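(* Let $U,V$ be complex vector spaces with $\dim U=3$ and $\dim V=n$, and let $r\ge1$. As a representation of $\mathrm{GL}(U)\times\mathrm{GL}(V)$, the space of generators of $I_{\kappa_1\le 2r}\subseteq S^\bullet(U\otimes S^2V)$ has the decomposition into irreducible representations $$(I_{\kappa_1\le2r})_{r+1}=\bigoplus_{|\pi|=r+1}S_\pi U\otimes S_{(3)^{r+1}-\pi'}V,$$ where $\pi$ ranges over partitions of $r+1$ and $\pi'$ is the conjugate partition to $\pi$. In order for the summand indexed by $\pi$ to be non-zero, $\pi$ must have at most $3$ parts, and $\pi_3$ must be at least $r+1-n$ (if the latter is positive).
   Context: Write an element of $U^*\otimes S^2V^*$ as $x=e_1\otimes A_1+e_2\otimes A_2+e_3\otimes A_3$ with $e_1,e_2,e_3$ a basis of $U^*$ and $A_i$ symmetric $n\times n$ matrices; $S^\bullet(U\otimes S^2V)$ is the polynomial ring on $U^*\otimes S^2V^*$. Let $\psi_{1,x}$ be the $3n\times3n$ skew-symmetric matrix of linear forms $$\psi_{1,x}=\begin{pmatrix} 0 & A_3 & -A_2 \\ -A_3 & 0 & A_1 \\ A_2 & -A_1 & 0 \end{pmatrix}.$$ $I_{\kappa_1\le2r}$ is the ideal generated by the $(2r+2)\times(2r+2)$ principal Pfaffians of $\psi_{1,x}$, and $(I_{\kappa_1\le2r})_{r+1}$ is its degree $r+1$ part, i.e. the span of these Pfaffians. $S_\pi$ denotes the Schur functor; $S_\pi A=0$ when $\pi$ has more than $\dim A$ parts. For $\pi$ with at most $3$ parts, $(3)^{r+1}-\pi'$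 denotes the partition $(3-\pi'_{r+1},\dots,3-\pi'_1)$, with $\pi'$ padded by zeros to length $r+1$. Partitions $\pi$ with more than $3$ parts contribute a zero summand because $S_\pi U=0$. *)

theory Defs
  imports
    Complex_Main
    "HOL-Library.Function_Algebras"
    "HOL-Combinatorics.Permutations"
    "HOL-Algebra.Group"
begin

section \<open>Bases and general linear groups\<close>

definition is_basis :: "(complex \<Rightarrow> 'a::ab_group_add \<Rightarrow> 'a) \<Rightarrow> 'a list \<Rightarrow> bool" where
  "is_basis s bs \<longleftrightarrow>
     distinct bs \<and> \<not> module.dependent s (set bs) \<and> module.span s (set bs) = UNIV"

definition GL :: "(complex \<Rightarrow> 'a::ab_group_add \<Rightarrow> 'a) \<Rightarrow> ('a \<Rightarrow> 'a) monoid" where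
  "GL s = \<lparr>carrier = {g. Vector_Spaces.linear s s g \<and> bij g}, mult = (\<circ>), one = id\<rparr>"


section \<open>Representations on spaces of complex-valued functions\<close>

text \<open>
  All representations below are spaces of functions on some set, extended by zero outside
  that set, so they are complex subspaces of \<^typ>\<open>'x \<Rightarrow> complex\<close>.
\<close>

definition cscale :: "complex \<Rightarrow> ('x \<Rightarrow> complex) \<Rightarrow> 'x \<Rightarrow> complex" where
  "cscale c f = (\<lambda>x. c * f x)"

interpretation fun_space: vector_space cscale
  by unfold_locales (auto simp: cscale_def fun_eq_iff algebra_simps)

definition linear_on ::
  "('x \<Rightarrow> complex) set \<Rightarrow> (('x \<Rightarrow> complex) \<Rightarrow> 'y \<Rightarrow> complex) \<Rightarrow> bool" where
  "linear_on W \<Phi> \<longleftrightarrow>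
     (\<forall>f\<in>W. \<forall>g\<in>W. \<Phi> (f + g) = \<Phi> f + \<Phi> g) \<and>
     (\<forall>c. \<forall>f\<in>W. \<Phi> (cscale c f) = cscale c (\<Phi> f))"

definition representation ::
  "('g, 'm) monoid_scheme \<Rightarrow> ('g \<Rightarrow> ('x \<Rightarrow> complex) \<Rightarrow> 'x \<Rightarrow> complex) \<Rightarrow>
   ('x \<Rightarrow> complex) set \<Rightarrow> bool" where
  "representation G \<rho> W \<longleftrightarrow>
     group G \<and> fun_space.subspace W \<and>
     (\<forall>g\<in>carrier G. linear_on W (\<rho> g) \<and> \<rho> g ` W \<subseteq> W) \<and>
     (\<forall>f\<in>W. \<rho> \<one>\<^bsub>G\<^esub> f = f) \<and>
     (\<forall>g\<in>carrier G. \<forall>h\<in>carrier G. \<forall>f\<in>W. \<rho> (g \<otimes>\<^bsub>G\<^esub> h) f = \<rho> g (\<rho> h f))"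

definition irreducible_rep ::
  "('g, 'm) monoid_scheme \<Rightarrow> ('g \<Rightarrow> ('x \<Rightarrow> complex) \<Rightarrow> 'x \<Rightarrow> complex) \<Rightarrow>
   ('x \<Rightarrow> complex) set \<Rightarrow> bool" where
  "irreducible_rep G \<rho> W \<longleftrightarrow>
     representation G \<rho> W \<and> W \<noteq> {0} \<and>
     (\<forall>W'. W' \<subseteq> W \<longrightarrow> representation G \<rho> W' \<longrightarrow> W' = {0} \<or> W' = W)"

definition isomorphic_reps ::
  "('g, 'm) monoid_scheme \<Rightarrow>
   ('g \<Rightarrow> ('x \<Rightarrow> complex) \<Rightarrow> 'x \<Rightarrow> complex) \<Rightarrow> ('x \<Rightarrow> complex) set \<Rightarrow>
   ('g \<Rightarrow> ('y \<Rightarrow> complex) \<Rightarrow> 'y \<Rightarrow> complex) \<Rightarrow> ('y \<Rightarrow> complex) set \<Rightarrow> bool" where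
  "isomorphic_reps G \<rho> W \<rho>' W' \<longleftrightarrow>
     representation G \<rho> W \<and> representation G \<rho>' W' \<and>
     (\<exists>\<Phi>. linear_on W \<Phi> \<and> bij_betw \<Phi> W W' \<and>
          (\<forall>g\<in>carrier G. \<forall>f\<in>W. \<Phi> (\<rho> g f) = \<rho>' g (\<Phi> f)))"

text \<open>
  The external direct sum of the \<open>M i\<close> with \<open>i \<in> I\<close>, for finite \<open>I\<close>: a family of functions is
  stored as one function of the index and the argument.
\<close>

definition direct_sum :: "'i set \<Rightarrow> ('i \<Rightarrow> ('x \<Rightarrow> complex) set) \<Rightarrow> ('i \<times> 'x \<Rightarrow> complex) set" where
  "direct_sum I M =
     {F. (\<forall>i\<in>I. (\<lambda>x. F (i, x)) \<in> M i) \<and> (\<forall>i x. i \<notin> I \<longrightarrow> F (i, x) = 0)}"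

definition direct_sum_act ::
  "('g \<Rightarrow> ('x \<Rightarrow> complex) \<Rightarrow> 'x \<Rightarrow> complex) \<Rightarrow> 'g \<Rightarrow> ('i \<times> 'x \<Rightarrow> complex) \<Rightarrow> 'i \<times> 'x \<Rightarrow> complex" where
  "direct_sum_act \<rho> g F = (\<lambda>(i, x). \<rho> g (\<lambda>y. F (i, y)) x)"


section \<open>Partitions\<close>

definition is_partition :: "nat \<Rightarrow> nat list \<Rightarrow> bool" where
  "is_partition d \<pi> \<longleftrightarrow> sorted_wrt (\<ge>) \<pi> \<and> 0 \<notin> set \<pi> \<and> sum_list \<pi> = d"

text \<open>Parts are numbered from 0 and padded by zeros: \<open>part \<pi> i\<close> is \<open>\<pi>\<^sub>i\<^sub>+\<^sub>1\<close> and \<open>conj_part \<pi> j\<close> is \<open>\<pi>'\<^sub>j\<^sub>+\<^sub>1\<close>.\<close>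

definition part :: "nat list \<Rightarrow> nat \<Rightarrow> nat" where
  "part \<pi> i = (if i < length \<pi> then \<pi> ! i else 0)"

definition conj_part :: "nat list \<Rightarrow> nat \<Rightarrow> nat" where
  "conj_part \<pi> j = card {i. j < part \<pi> i}"

text \<open>
  The partition \<open>(3)\<^sup>m - \<pi>'\<close>, i.e. the list \<open>3 - \<pi>'\<^sub>m, \<dots>, 3 - \<pi>'\<^sub>1\<close>, which may end in zeros. Only its
  values for \<open>\<pi>\<close> with at most 3 parts matter; otherwise the subtraction truncates.
\<close>

definition complement3 :: "nat \<Rightarrow> nat list \<Rightarrow> nat list" where
  "complement3 m \<pi> = rev (map (\<lambda>j. 3 - conj_part \<pi> j) [0..<m])"


section \<open>Tensor powers and Schur functors\<close>

text \<open>
  For a finite-dimensional space \<open>A\<close>, the tensor power of order \<open>d\<close> is realised inside the functions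
  of \<open>d\<close> linear functionals on \<open>A\<close>: the tensor of \<open>a\<^sub>1, \<dots>, a\<^sub>d\<close> is the function
  sending \<open>\<phi>\<^sub>1, \<dots>, \<phi>\<^sub>d\<close> to the product of the \<open>\<phi>\<^sub>i(a\<^sub>i)\<close>.
\<close>

definition covectors :: "(complex \<Rightarrow> 'a::ab_group_add \<Rightarrow> 'a) \<Rightarrow> nat \<Rightarrow> ('a \<Rightarrow> complex) list set" where
  "covectors s d = {\<phi>s. length \<phi>s = d \<and> (\<forall>\<phi>\<in>set \<phi>s. Vector_Spaces.linear s (*) \<phi>)}"

definition pure_tensor ::
  "(complex \<Rightarrow> 'a::ab_group_add \<Rightarrow> 'a) \<Rightarrow> 'a list \<Rightarrow> ('a \<Rightarrow> complex) list \<Rightarrow> complex" where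
  "pure_tensor s as =
     (\<lambda>\<phi>s. if \<phi>s \<in> covectors s (length as) then \<Prod>i<length as. (\<phi>s ! i) (as ! i) else 0)"

definition tensor_power ::
  "(complex \<Rightarrow> 'a::ab_group_add \<Rightarrow> 'a) \<Rightarrow> nat \<Rightarrow> (('a \<Rightarrow> complex) list \<Rightarrow> complex) set" where
  "tensor_power s d = fun_space.span {pure_tensor s as | as. length as = d}"

text \<open>
  The boxes of the Young diagram (row, column), listed row by row; tensor position \<open>p\<close> carries the
  \<open>p\<close>-th box.
\<close>

definition boxes :: "nat list \<Rightarrow> (nat \<times> nat) list" where
  "boxes \<pi> = concat (map (\<lambda>i. map (Pair i) [0..<\<pi> ! i]) [0..<length \<pi>])"

definition row_group :: "nat list \<Rightarrow> (nat \<Rightarrow> nat) set" where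
  "row_group \<pi> = {\<sigma>. \<sigma> permutes {..<sum_list \<pi>} \<and>
     (\<forall>p<sum_list \<pi>. fst (boxes \<pi> ! \<sigma> p) = fst (boxes \<pi> ! p))}"

definition column_group :: "nat list \<Rightarrow> (nat \<Rightarrow> nat) set" where
  "column_group \<pi> = {\<tau>. \<tau> permutes {..<sum_list \<pi>} \<and>
     (\<forall>p<sum_list \<pi>. snd (boxes \<pi> ! \<tau> p) = snd (boxes \<pi> ! p))}"

text \<open>
  A permutation \<open>\<sigma>\<close> acts on tensors from the left by sending \<open>T\<close> to \<open>\<phi>s \<mapsto> T (permute_list \<sigma> \<phi>s)\<close>.
  The Young symmetrizer is the sum of \<open>sgn(\<tau>) \<sigma>\<tau>\<close> over row permutations \<open>\<sigma>\<close> and column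
  permutations \<open>\<tau>\<close>. Rows are symmetrized, so that one-row partitions give symmetric powers and
  one-column partitions exterior powers.
\<close>

definition young_symmetrizer ::
  "nat list \<Rightarrow> ('b list \<Rightarrow> complex) \<Rightarrow> 'b list \<Rightarrow> complex" where
  "young_symmetrizer \<pi> T =
     (\<lambda>\<phi>s. \<Sum>\<sigma>\<in>row_group \<pi>. \<Sum>\<tau>\<in>column_group \<pi>.
        of_int (sign \<tau>) * T (permute_list (\<sigma> \<circ> \<tau>) \<phi>s))"

definition schur_functor ::
  "(complex \<Rightarrow> 'a::ab_group_add \<Rightarrow> 'a) \<Rightarrow> nat list \<Rightarrow> (('a \<Rightarrow> complex) list \<Rightarrow> complex) set" where
  "schur_functor s \<pi> = young_symmetrizer \<pi> ` tensor_power s (sum_list \<pi>)"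

text \<open>
  The tensor product of two function spaces, as functions on the product: functions of separate
  variables span a copy of the tensor product.
\<close>

definition tensor_prod ::
  "('x \<Rightarrow> complex) set \<Rightarrow> ('y \<Rightarrow> complex) set \<Rightarrow> ('x \<times> 'y \<Rightarrow> complex) set" where
  "tensor_prod A B = fun_space.span {(\<lambda>(x, y). a x * b y) | a b. a \<in> A \<and> b \<in> B}"

text \<open>
  The action of \<open>(g, h)\<close> applies \<open>g\<close> to every factor from \<open>U\<close> and \<open>h\<close> to every factor from \<open>V\<close>.
\<close>

definition tensor_act ::
  "('u \<Rightarrow> 'u) \<times> ('v \<Rightarrow> 'v) \<Rightarrow>
   (('u \<Rightarrow> complex) list \<times> ('v \<Rightarrow> complex) list \<Rightarrow> complex) \<Rightarrow>
   ('u \<Rightarrow> complex) list \<times> ('v \<Rightarrow> complex) list \<Rightarrow> complex" where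
  "tensor_act = (\<lambda>(g, h) T (\<phi>s, \<psi>s). T (map (\<lambda>\<phi>. \<phi> \<circ> g) \<phi>s, map (\<lambda>\<psi>. \<psi> \<circ> h) \<psi>s))"


section \<open>The polynomial ring\<close>

text \<open>
  An element of \<open>U\<^sup>* \<otimes> S\<^sup>2V\<^sup>*\<close> is a trilinear form \<open>x u v w\<close> on \<open>U \<times> V \<times> V\<close> that is symmetric in \<open>v\<close>
  and \<open>w\<close>. Elements of the polynomial ring on this space are polynomial functions on it; the
  generator \<open>u \<otimes> vw\<close> of \<open>S\<^sup>\<bullet>(U \<otimes> S\<^sup>2V)\<close> is the function sending \<open>x\<close> to \<open>x u v w\<close>.
\<close>

definition form_space ::
  "(complex \<Rightarrow> 'u::ab_group_add \<Rightarrow> 'u) \<Rightarrow> (complex \<Rightarrow> 'v::ab_group_add \<Rightarrow> 'v) \<Rightarrow>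
   ('u \<Rightarrow> 'v \<Rightarrow> 'v \<Rightarrow> complex) set" where
  "form_space sU sV = {x.
     (\<forall>v w. Vector_Spaces.linear sU (*) (\<lambda>u. x u v w)) \<and>
     (\<forall>u w. Vector_Spaces.linear sV (*) (\<lambda>v. x u v w)) \<and>
     (\<forall>u v w. x u v w = x u w v)}"

definition poly_part ::
  "(complex \<Rightarrow> 'u::ab_group_add \<Rightarrow> 'u) \<Rightarrow> (complex \<Rightarrow> 'v::ab_group_add \<Rightarrow> 'v) \<Rightarrow> nat \<Rightarrow>
   (('u \<Rightarrow> 'v \<Rightarrow> 'v \<Rightarrow> complex) \<Rightarrow> complex) set" where
  "poly_part sU sV d = fun_space.span
     {(\<lambda>x. if x \<in> form_space sU sV then \<Prod>(u, v, w)\<leftarrow>ts. x u v w else 0) | ts. length ts = d}"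

definition poly_ring ::
  "(complex \<Rightarrow> 'u::ab_group_add \<Rightarrow> 'u) \<Rightarrow> (complex \<Rightarrow> 'v::ab_group_add \<Rightarrow> 'v) \<Rightarrow>
   (('u \<Rightarrow> 'v \<Rightarrow> 'v \<Rightarrow> complex) \<Rightarrow> complex) set" where
  "poly_ring sU sV = fun_space.span (\<Union>d. poly_part sU sV d)"

text \<open>
  The action sends the generator \<open>u \<otimes> vw\<close> to \<open>g u \<otimes> (h v)(h w)\<close>; on functions this is \<open>f\<close>
  composed with the action of \<open>(g, h)\<^sup>-\<^sup>1\<close> on \<open>U\<^sup>* \<otimes> S\<^sup>2V\<^sup>*\<close>.
\<close>

definition poly_act ::
  "('u \<Rightarrow> 'u) \<times> ('v \<Rightarrow> 'v) \<Rightarrow> (('u \<Rightarrow> 'v \<Rightarrow> 'v \<Rightarrow> complex) \<Rightarrow> complex) \<Rightarrow>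
   ('u \<Rightarrow> 'v \<Rightarrow> 'v \<Rightarrow> complex) \<Rightarrow> complex" where
  "poly_act = (\<lambda>(g, h) f x. f (\<lambda>u v w. x (g u) (h v) (h w)))"


section \<open>The Pfaffian ideal\<close>

text \<open>The Pfaffian of a skew-symmetric matrix of size \<open>2 * m\<close> with indices starting at 0.\<close>

definition pfaffian :: "nat \<Rightarrow> (nat \<Rightarrow> nat \<Rightarrow> complex) \<Rightarrow> complex" where
  "pfaffian m A =
     (\<Sum>\<sigma> | \<sigma> permutes {..<2 * m}. of_int (sign \<sigma>) * (\<Prod>i<m. A (\<sigma> (2 * i)) (\<sigma> (2 * i + 1))))
       / (2 ^ m * fact m)"

text \<open>
  With \<open>e\<^sub>1, e\<^sub>2, e\<^sub>3\<close> the basis of \<open>U\<^sup>*\<close> dual to \<open>us\<close>, the matrix \<open>A\<^sub>k\<close> of \<open>x\<close> has the entries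
  \<open>x u\<^sub>k v\<^sub>i v\<^sub>j\<close>; since lists are indexed from 0, \<open>A 0, A 1, A 2\<close> below are entries of
  \<open>A\<^sub>1, A\<^sub>2, A\<^sub>3\<close>. Row \<open>a\<close> of \<open>\<psi>\<close> is row \<open>a mod n\<close> in block row \<open>a div n\<close>, where \<open>n = length vs\<close>.
\<close>

definition psi_matrix ::
  "'u list \<Rightarrow> 'v list \<Rightarrow> ('u \<Rightarrow> 'v \<Rightarrow> 'v \<Rightarrow> complex) \<Rightarrow> nat \<Rightarrow> nat \<Rightarrow> complex" where
  "psi_matrix us vs x a b =
     (let n = length vs;
          A = (\<lambda>k. x (us ! k) (vs ! (a mod n)) (vs ! (b mod n)))
      in [[    0,   A 2, - A 1],
          [- A 2,     0,   A 0],
          [  A 1, - A 0,     0]] ! (a div n) ! (b div n))"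

definition principal_pfaffian :: "nat \<Rightarrow> (nat \<Rightarrow> nat \<Rightarrow> complex) \<Rightarrow> nat set \<Rightarrow> complex" where
  "principal_pfaffian m A J =
     pfaffian m (\<lambda>i j. A (sorted_list_of_set J ! i) (sorted_list_of_set J ! j))"

definition psi_pfaffians ::
  "(complex \<Rightarrow> 'u::ab_group_add \<Rightarrow> 'u) \<Rightarrow> (complex \<Rightarrow> 'v::ab_group_add \<Rightarrow> 'v) \<Rightarrow>
   'u list \<Rightarrow> 'v list \<Rightarrow> nat \<Rightarrow> (('u \<Rightarrow> 'v \<Rightarrow> 'v \<Rightarrow> complex) \<Rightarrow> complex) set" where
  "psi_pfaffians sU sV us vs m =
     {(\<lambda>x. if x \<in> form_space sU sV then principal_pfaffian m (psi_matrix us vs x) J else 0) | J.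
        J \<subseteq> {..<3 * length vs} \<and> card J = 2 * m}"

text \<open>The ideal of \<open>\<kappa>\<^sub>1 \<le> 2r\<close>, generated by the Pfaffians of size \<open>2r + 2\<close>.\<close>

definition kappa_ideal ::
  "(complex \<Rightarrow> 'u::ab_group_add \<Rightarrow> 'u) \<Rightarrow> (complex \<Rightarrow> 'v::ab_group_add \<Rightarrow> 'v) \<Rightarrow>
   'u list \<Rightarrow> 'v list \<Rightarrow> nat \<Rightarrow> (('u \<Rightarrow> 'v \<Rightarrow> 'v \<Rightarrow> complex) \<Rightarrow> complex) set" where
  "kappa_ideal sU sV us vs r = fun_space.span
     {p * q | p q. p \<in> poly_ring sU sV \<and> q \<in> psi_pfaffians sU sV us vs (r + 1)}"

definition summand ::
  "(complex \<Rightarrow> 'u::ab_group_add \<Rightarrow> 'u) \<Rightarrow> (complex \<Rightarrow> 'v::ab_group_add \<Rightarrow> 'v) \<Rightarrow> nat \<Rightarrow> nat list \<Rightarrow>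
   (('u \<Rightarrow> complex) list \<times> ('v \<Rightarrow> complex) list \<Rightarrow> complex) set" where
  "summand sU sV r \<pi> =
     tensor_prod (schur_functor sU \<pi>) (schur_functor sV (complement3 (r + 1) \<pi>))"

end

theory Submission
  imports Defs "HOL-Library.FuncSet"
begin

text \<open>
  Both sides are quotients of spaces of functions on words, i.e. of tensor powers of
  \<open>\<complex>\<^sup>3 \<oplus> \<complex>\<^sup>n\<close> with the action of the block matrices in \<open>GL\<^sub>3 \<times> GL\<^sub>n\<close>: a word is mapped to a Young
  symmetrized tensor, respectively to a Pfaffian of \<open>\<psi>\<close> whose rows are listed by the word. The
  Hermitian form on words makes these representations completely reducible, so they are controlled by
  their highest weight vectors. On each quotient the Casimir operators, which are sums of
  transpositions of letters, act by scalars; for the Pfaffians this holds for their sum over the two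
  factors. Their eigenvalues are strictly monotone in the dominance order, which leaves only the
  words given by row lengths of a diagram as possible highest weight vectors. For the Pfaffians these
  diagrams have the rows \<open>m - \<pi>\<^sub>3, m - \<pi>\<^sub>2, m - \<pi>\<^sub>1\<close>, because \<open>\<psi>\<close> involves the second exterior power of the
  first space. Finally, the matrix coefficients of highest weight vectors are invariant under
  unipotent matrices and hence determined by the weights, and equal matrix coefficients yield the
  isomorphism.
\<close>

section \<open>Functions supported on a finite set\<close>

text \<open>With \<open>m = r + 1\<close>, a Pfaffian in the ideal is alternating in
  \<open>2m\<close> rows of \<open>\<psi>\<close>, and a row is a block together with an index;
  hence words of length \<open>4m\<close>. Substituting \<open>g\<close> in the entries of
  \<open>\<psi>\<close> amounts, up to one factor \<open>det g\<close> for each entry, to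
  substituting the cofactors of \<open>g\<close> in the blocks (\<open>thm3\<close>). The resulting
  twist by \<open>det ^ m\<close> is what turns a weight \<open>\<pi>\<close> into row lengths
  \<open>m - \<pi>\<^sub>i\<close>.

  Exchanging two rows changes the sign, so exchanging their blocks is minus exchanging their
  indices, and the two Casimir eigenvalues add up to 0. Neither is known by itself; but a block
  weight \<open>L\<close> fixes the first and thereby the second, and dominance then leaves only the
  conjugate of \<open>L\<close> as index weight. The bound \<open>L ! i \<le> m\<close> is forced by
  the zero diagonal blocks of \<open>\<psi>\<close>. That it suffices needs a form for which exactly
  one perfect matching of the rows has nonzero weight.

  The word spaces behind the two sides have different lengths and cannot be mapped to each other
  directly. Matrix coefficients are functions of the group element alone, so they can be
  compared.\<close>

definition supp_on :: "'w set \<Rightarrow> ('w \<Rightarrow> complex) set" where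
  "supp_on A = {x. \<forall>w. w \<notin> A \<longrightarrow> x w = 0}"

definition ip :: "'w set \<Rightarrow> ('w \<Rightarrow> complex) \<Rightarrow> ('w \<Rightarrow> complex) \<Rightarrow> complex" where
  "ip A x y = (\<Sum>w\<in>A. x w * cnj (y w))"

definition unitv :: "'w \<Rightarrow> 'w \<Rightarrow> complex" where
  "unitv w = (\<lambda>v. if v = w then 1 else 0)"

definition orthc :: "'w set \<Rightarrow> ('w \<Rightarrow> complex) set \<Rightarrow> ('w \<Rightarrow> complex) set" where
  "orthc A W = {y \<in> supp_on A. \<forall>x\<in>W. ip A x y = 0}"

lemma fun_apply_simps:
  "(x + y) w = x w + y w" "(x - y) w = x w - y w" "(- x) w = - x w" "(0 :: 'w \<Rightarrow> complex) w = 0"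
  "cscale c x w = c * x w" for x y :: "'w \<Rightarrow> complex"
  by (auto simp: cscale_def)

lemma sum_fun_apply: "(\<Sum>i\<in>I. f i) w = (\<Sum>i\<in>I. f i w)" for f :: "'i \<Rightarrow> 'w \<Rightarrow> complex"
  by (induction I rule: infinite_finite_induct) auto

lemma subspace_supp_on: "fun_space.subspace (supp_on A)"
  by (auto simp: fun_space.subspace_def supp_on_def cscale_def)

lemma supp_on_expand:
  assumes "finite A" "x \<in> supp_on A"
  shows "x = (\<Sum>w\<in>A. cscale (x w) (unitv w))"
proof
  fix v
  have "(\<Sum>w\<in>A. x w * unitv w v) = (\<Sum>w\<in>A. if w = v then x w else 0)"
    by (intro sum.cong) (auto simp: unitv_def)
  also have "\<dots> = x v"
    using assms by (auto simp: supp_on_def)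
  finally show "x v = (\<Sum>w\<in>A. cscale (x w) (unitv w)) v"
    by (simp add: sum_fun_apply fun_apply_simps)
qed

lemma unitv_supp: "w \<in> A \<Longrightarrow> unitv w \<in> supp_on A"
  by (auto simp: unitv_def supp_on_def)

lemma supp_on_span: "finite A \<Longrightarrow> supp_on A \<subseteq> fun_space.span (unitv ` A)"
  using supp_on_expand
  by (metis (no_types, lifting) fun_space.span_base fun_space.span_scale fun_space.span_sum imageI subsetI)

lemma finite_spanning:
  assumes "finite A" "fun_space.subspace W" "W \<subseteq> supp_on A"
  obtains B where "finite B" "B \<subseteq> W" "fun_space.span B = W"
proof -
  obtain B where B: "B \<subseteq> W" "\<not> fun_space.dependent B" "W \<subseteq> fun_space.span B"
    using fun_space.basis_exists[of W] by metis
  have "B \<subseteq> fun_space.span (unitv ` A)"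
    using B(1) assms(3) supp_on_span[OF assms(1)] by blast
  then have "finite B"
    using fun_space.independent_span_bound[of "unitv ` A" B] assms(1) B(2) by auto
  moreover have "fun_space.span B = W"
    using B assms(2) by (simp add: fun_space.span_minimal subset_antisym)
  ultimately show ?thesis using that B(1) by blast
qed

section \<open>The Hermitian form and orthogonal complements\<close>

lemma ip_add_left: "ip A (x + y) z = ip A x z + ip A y z"
  and ip_diff_left: "ip A (x - y) z = ip A x z - ip A y z"
  and ip_scale_left: "ip A (cscale c x) z = c * ip A x z"
  and ip_add_right: "ip A z (x + y) = ip A z x + ip A z y"
  and ip_diff_right: "ip A z (x - y) = ip A z x - ip A z y"
  and ip_scale_right: "ip A z (cscale c x) = cnj c * ip A z x"
  and ip_zero_left: "ip A 0 z = 0"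
  and ip_zero_right: "ip A z 0 = 0"
  and ip_add_left': "ip A (\<lambda>w. x w + y w) z = ip A x z + ip A y z"
  and ip_add_right': "ip A z (\<lambda>w. x w + y w) = ip A z x + ip A z y"
  and ip_zero_left': "ip A (\<lambda>w. 0) z = 0"
  and ip_zero_right': "ip A z (\<lambda>w. 0) = 0"
  by (auto simp: ip_def fun_apply_simps algebra_simps sum.distrib sum_subtractf sum_distrib_left)

lemmas ip_simps = ip_add_left ip_diff_left ip_scale_left ip_add_right ip_diff_right ip_scale_right
  ip_zero_left ip_zero_right ip_add_left' ip_add_right' ip_zero_left' ip_zero_right'

lemma ip_commute: "ip A y x = cnj (ip A x y)"
  by (simp add: ip_def mult.commute)

lemma ip_self: "ip A x x = complex_of_real (\<Sum>w\<in>A. (cmod (x w))\<^sup>2)"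
  unfolding ip_def of_real_sum by (intro sum.cong refl complex_norm_square[symmetric])

lemma ip_self_eq_0:
  assumes "finite A" "x \<in> supp_on A" "ip A x x = 0"
  shows "x = 0"
proof
  fix w
  have "(\<Sum>w\<in>A. (cmod (x w))\<^sup>2) = 0"
    using assms(3) unfolding ip_self of_real_eq_0_iff .
  then have "\<forall>w\<in>A. (cmod (x w))\<^sup>2 = 0"
    using assms(1) by (subst (asm) sum_nonneg_eq_0_iff) auto
  then show "x w = 0 w"
    using assms(2) by (cases "w \<in> A") (auto simp: supp_on_def)
qed

text \<open>Gram-Schmidt, one vector at a time: \<open>b'\<close> is the part of \<open>b\<close>
  orthogonal to the span of \<open>B\<close>, and the new projection adds the component along
  \<open>b'\<close> to the projection onto the span of \<open>B\<close>.\<close>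

lemma orth_projection_span:
  assumes "finite A" "finite B" "B \<subseteq> supp_on A"
  shows "\<exists>y\<in>fun_space.span B. \<forall>v\<in>fun_space.span B. ip A (x - y) v = 0"
  using assms(2,3)
proof (induction B arbitrary: x rule: finite_induct)
  case empty
  show ?case by (simp add: ip_simps)
next
  case (insert b B)
  have reduce: "\<forall>v\<in>fun_space.span C. ip A u v = 0" if "\<forall>v\<in>C. ip A u v = 0" for u C
  proof
    fix v assume "v \<in> fun_space.span C"
    then show "ip A u v = 0"
      by (induction rule: fun_space.span_induct_alt) (auto simp: ip_simps that)
  qed
  obtain yb where yb: "yb \<in> fun_space.span B" "\<forall>v\<in>fun_space.span B. ip A (b - yb) v = 0"
    using insert by blast
  obtain yx where yx: "yx \<in> fun_space.span B" "\<forall>v\<in>fun_space.span B. ip A (x - yx) v = 0"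
    using insert by blast
  define b' where "b' = b - yb"
  have sub: "fun_space.span B \<subseteq> fun_space.span (insert b B)"
    by (rule fun_space.span_mono) auto
  have "fun_space.span B \<subseteq> supp_on A"
    using insert by (intro fun_space.span_minimal subspace_supp_on) auto
  then have b's: "b' \<in> supp_on A"
    using yb insert.prems unfolding b'_def
    by (metis fun_space.subspace_diff insert_subset subsetD subspace_supp_on)
  have b'i: "b' \<in> fun_space.span (insert b B)"
    unfolding b'_def using yb sub by (meson fun_space.span_base fun_space.span_diff insertI1 subsetD)
  \<comment> \<open>If \<open>b' = 0\<close>, the quotient is 0 by the convention for division, so
    this definition covers that case as well.\<close>
  define y where "y = yx + cscale (ip A (x - yx) b' / ip A b' b') b'"
  have y: "y \<in> fun_space.span (insert b B)"
    unfolding y_def using b'i yx sub by (meson fun_space.span_add fun_space.span_scale subsetD)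
  have b: "b = b' + yb" by (simp add: b'_def)
  have ortho: "ip A b' v = 0" if "v \<in> fun_space.span B" for v
    using yb that b'_def by auto
  have yorth: "ip A (x - y) b' = 0"
  proof (cases "ip A b' b' = 0")
    case True
    then have "b' = 0" using ip_self_eq_0 assms(1) b's by blast
    then show ?thesis by (simp add: ip_simps)
  next
    case False
    then show ?thesis by (simp add: y_def ip_simps)
  qed
  have yB: "ip A (x - y) v = 0" if "v \<in> fun_space.span B" for v
  proof -
    have "ip A (x - y) v = ip A (x - yx) v - (ip A (x - yx) b' / ip A b' b') * ip A b' v"
      by (simp add: y_def ip_simps)
    then show ?thesis using yx that ortho by auto
  qed
  have "\<forall>v\<in>insert b B. ip A (x - y) v = 0"
    using yB yorth yb(1) b by (auto simp: ip_simps fun_space.span_base)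
  then show ?case using reduce y by blast
qed

lemma orth_projection:
  assumes "finite A" "fun_space.subspace W" "W \<subseteq> supp_on A"
  obtains y where "y \<in> W" "\<And>v. v \<in> W \<Longrightarrow> ip A (x - y) v = 0"
  using orth_projection_span finite_spanning assms by (metis order_trans)

lemma subspace_orthc: "fun_space.subspace (orthc A W)"
  using subspace_supp_on[of A]
  by (auto simp: orthc_def fun_space.subspace_def ip_simps)

lemma orthc_supp: "orthc A W \<subseteq> supp_on A"
  by (auto simp: orthc_def)

lemma orth_decomp:
  assumes "finite A" "fun_space.subspace W" "W \<subseteq> supp_on A" "x \<in> supp_on A"
  obtains y z where "y \<in> W" "z \<in> orthc A W" "x = y + z"
proof -
  obtain y where y: "y \<in> W" "\<And>v. v \<in> W \<Longrightarrow> ip A (x - y) v = 0"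
    using orth_projection assms by blast
  have "x - y \<in> supp_on A"
    using assms y by (meson fun_space.subspace_diff subsetD subspace_supp_on)
  then have "x - y \<in> orthc A W"
    using y(2) by (auto simp: orthc_def) (metis complex_cnj_zero ip_commute)
  then show ?thesis using that y(1) by force
qed

lemma orthc_Int:
  assumes "finite A" "x \<in> W" "x \<in> orthc A W"
  shows "x = 0"
  using assms ip_self_eq_0[of A x] by (auto simp: orthc_def)

text \<open>\<open>W\<close> contains its double complement. Membership in \<open>W\<close> thereby
  becomes the vanishing of scalar products, to which derivatives and polynomial identities can be
  applied.\<close>

lemma in_subspace_if_orth:
  assumes "finite A" "fun_space.subspace W" "W \<subseteq> supp_on A" "x \<in> supp_on A"
    and "\<And>v. v \<in> orthc A W \<Longrightarrow> ip A x v = 0"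
  shows "x \<in> W"
proof -
  obtain y z where yz: "y \<in> W" "z \<in> orthc A W" "x = y + z"
    using orth_decomp assms by blast
  have "ip A y z = 0" using yz by (auto simp: orthc_def)
  then have "ip A z z = 0" using assms(5)[OF yz(2)] yz(3) by (simp add: ip_simps)
  then have "z = 0" using ip_self_eq_0 assms(1) yz(2) orthc_supp by blast
  then show ?thesis using yz by simp
qed

lemma orthc_trivial_imp:
  assumes "finite A" "fun_space.subspace W" "W \<subseteq> supp_on A" "orthc A W \<subseteq> {0}"
  shows "W = supp_on A"
proof -
  have "x \<in> W" if "x \<in> supp_on A" for x
    by (rule in_subspace_if_orth[OF assms(1-3) that]) (use assms(4) in \<open>auto simp: ip_simps\<close>)
  then show ?thesis using assms(3) by blast
qed

lemma subspace_eq_if_no_complement: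
  assumes "finite A" "fun_space.subspace W" "W \<subseteq> supp_on A" "fun_space.subspace K" "K \<subseteq> W"
    and "W \<inter> orthc A K \<subseteq> {0}"
  shows "W = K"
proof -
  have "x \<in> K" if x: "x \<in> W" for x
  proof -
    obtain y z where yz: "y \<in> K" "z \<in> orthc A K" "x = y + z"
      using orth_decomp[of A K x] assms x by blast
    have "z \<in> W" using yz x assms
      by (metis add_diff_cancel_left' fun_space.subspace_diff subsetD)
    then have "z = 0" using yz assms by blast
    then show ?thesis using yz by simp
  qed
  then show ?thesis using assms(5) by blast
qed

section \<open>Words and the action of matrices\<close>

text \<open>Words are extensional, so two of them are equal once they agree on the \<open>d\<close>
  positions. Functions on words are the coordinates of a \<open>d\<close>-fold tensor power, and
  \<open>act\<close> below is the tensor power of a matrix.\<close>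

definition words :: "nat \<Rightarrow> nat \<Rightarrow> (nat \<Rightarrow> nat) set" where
  "words d N = ({..<d} \<rightarrow>\<^sub>E {..<N})"

definition act :: "nat \<Rightarrow> nat \<Rightarrow> (nat \<Rightarrow> nat \<Rightarrow> complex) \<Rightarrow> ((nat \<Rightarrow> nat) \<Rightarrow> complex) \<Rightarrow> (nat \<Rightarrow> nat) \<Rightarrow> complex" where
  "act d N g x = (\<lambda>w. if w \<in> words d N then \<Sum>v\<in>words d N. (\<Prod>p<d. g (w p) (v p)) * x v else 0)"

definition mm :: "nat \<Rightarrow> (nat \<Rightarrow> nat \<Rightarrow> complex) \<Rightarrow> (nat \<Rightarrow> nat \<Rightarrow> complex) \<Rightarrow> nat \<Rightarrow> nat \<Rightarrow> complex" where
  "mm N g h = (\<lambda>i j. \<Sum>k<N. g i k * h k j)"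

definition adjm :: "(nat \<Rightarrow> nat \<Rightarrow> complex) \<Rightarrow> nat \<Rightarrow> nat \<Rightarrow> complex" where
  "adjm g = (\<lambda>i j. cnj (g j i))"

text \<open>The elementary matrix \<open>1 + z E\<^sub>i\<^sub>j\<close>, invertible unless
  \<open>i = j\<close> and \<open>z = - 1\<close>.\<close>

definition el :: "complex \<Rightarrow> nat \<Rightarrow> nat \<Rightarrow> nat \<Rightarrow> nat \<Rightarrow> complex" where
  "el z i j = (\<lambda>a b. (if a = b then 1 else 0) + (if a = i \<and> b = j then z else 0))"

definition blk :: "nat \<Rightarrow> nat \<Rightarrow> nat \<Rightarrow> bool" where
  "blk K i j \<longleftrightarrow> (i < K \<longleftrightarrow> j < K)"

definition cnt :: "nat \<Rightarrow> (nat \<Rightarrow> nat) \<Rightarrow> nat \<Rightarrow> nat" where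
  "cnt d w i = card {p \<in> {..<d}. w p = i}"

text \<open>Invariance is asked only of the invertible elementary matrices inside the two diagonal
  blocks, which are separated at \<open>K\<close>. They generate the block diagonal group, and their
  adjoints are of the same kind.\<close>

definition inv_sub :: "nat \<Rightarrow> nat \<Rightarrow> nat \<Rightarrow> ((nat \<Rightarrow> nat) \<Rightarrow> complex) set \<Rightarrow> bool" where
  "inv_sub d N K W \<longleftrightarrow> fun_space.subspace W \<and> W \<subseteq> supp_on (words d N) \<and>
     (\<forall>i<N. \<forall>j<N. \<forall>z. blk K i j \<longrightarrow> i \<noteq> j \<or> z \<noteq> - 1 \<longrightarrow> (\<forall>x\<in>W. act d N (el z i j) x \<in> W))"

text \<open>For \<open>i \<noteq> j\<close> this is the action of the matrix unit
  \<open>E\<^sub>i\<^sub>j\<close> in the Lie algebra, the derivative at 0 that is computed in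
  \<open>act_el_deriv\<close>.\<close>

definition Dop :: "nat \<Rightarrow> nat \<Rightarrow> nat \<Rightarrow> nat \<Rightarrow> ((nat \<Rightarrow> nat) \<Rightarrow> complex) \<Rightarrow> (nat \<Rightarrow> nat) \<Rightarrow> complex" where
  "Dop d N i j x = (\<lambda>w. if w \<in> words d N then \<Sum>p\<in>{p \<in> {..<d}. w p = i}. x (w(p := j)) else 0)"

lemma finite_words [simp, intro]: "finite (words d N)"
  unfolding words_def by (intro finite_PiE) auto

lemma words_upd: "w \<in> words d N \<Longrightarrow> p < d \<Longrightarrow> j < N \<Longrightarrow> w(p := j) \<in> words d N"
  by (auto simp: words_def PiE_iff extensional_def)

lemma words_less: "w \<in> words d N \<Longrightarrow> p < d \<Longrightarrow> w p < N"
  by (auto simp: words_def)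

lemma words_eqI: "w \<in> words d N \<Longrightarrow> v \<in> words d N' \<Longrightarrow> (\<And>p. p < d \<Longrightarrow> w p = v p) \<Longrightarrow> w = v"
  unfolding words_def by (rule PiE_ext) auto

lemma act_supp: "act d N g x \<in> supp_on (words d N)"
  by (auto simp: act_def supp_on_def)

lemma act_scale: "act d N g (cscale c x) = cscale c (act d N g x)"
  by (auto simp: act_def fun_eq_iff cscale_def sum_distrib_left algebra_simps)

lemma act_diff: "act d N g (x - y) = act d N g x - act d N g y"
  by (auto simp: act_def fun_eq_iff sum_subtractf algebra_simps)

lemma act_cong:
  assumes "\<And>i j. i < N \<Longrightarrow> j < N \<Longrightarrow> g i j = h i j"
  shows "act d N g x = act d N h x"
proof
  fix w show "act d N g x w = act d N h x w"
    unfolding act_def using assms words_less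
    by (auto intro!: sum.cong arg_cong2[of _ _ _ _ "(*)"] prod.cong)
qed

lemma act_mm: "act d N (mm N g h) x = act d N g (act d N h x)"
proof
  fix w
  show "act d N (mm N g h) x w = act d N g (act d N h x) w"
  proof (cases "w \<in> words d N")
    case True
    have "(\<Prod>p<d. mm N g h (w p) (v p)) =
        (\<Sum>u\<in>words d N. (\<Prod>p<d. g (w p) (u p)) * (\<Prod>p<d. h (u p) (v p)))" for v
      unfolding mm_def words_def by (subst prod_sum_PiE) (auto simp: prod.distrib)
    then have "act d N (mm N g h) x w =
        (\<Sum>v\<in>words d N. \<Sum>u\<in>words d N. (\<Prod>p<d. g (w p) (u p)) * (\<Prod>p<d. h (u p) (v p)) * x v)"
      using True by (simp add: act_def sum_distrib_right)
    also have "\<dots> = (\<Sum>u\<in>words d N. \<Sum>v\<in>words d N. (\<Prod>p<d. g (w p) (u p)) * (\<Prod>p<d. h (u p) (v p)) * x v)"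
      by (rule sum.swap)
    also have "\<dots> = act d N g (act d N h x) w"
      using True by (simp add: act_def sum_distrib_left mult.assoc)
    finally show ?thesis .
  qed (simp add: act_def)
qed

lemma ip_act: "ip (words d N) (act d N g x) y = ip (words d N) x (act d N (adjm g) y)"
proof -
  have "ip (words d N) (act d N g x) y =
      (\<Sum>w\<in>words d N. \<Sum>v\<in>words d N. (\<Prod>p<d. g (w p) (v p)) * x v * cnj (y w))"
    by (simp add: ip_def act_def sum_distrib_right)
  also have "\<dots> = (\<Sum>v\<in>words d N. \<Sum>w\<in>words d N. (\<Prod>p<d. g (w p) (v p)) * x v * cnj (y w))"
    by (rule sum.swap)
  also have "\<dots> = ip (words d N) x (act d N (adjm g) y)"
    by (simp add: ip_def act_def sum_distrib_left adjm_def mult_ac)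
  finally show ?thesis .
qed

section \<open>Invariant subspaces: adjoints, derivatives and weight projections\<close>

lemma adjm_el: "adjm (el z i j) = el (cnj z) j i"
  by (auto simp: adjm_def el_def fun_eq_iff)

lemma inv_orthc:
  assumes "inv_sub d N K W"
  shows "inv_sub d N K (orthc (words d N) W)"
  unfolding inv_sub_def
proof (intro conjI allI impI ballI)
  fix i j :: nat and z :: complex and x
  assume *: "i < N" "j < N" "blk K i j" "i \<noteq> j \<or> z \<noteq> - 1" and x: "x \<in> orthc (words d N) W"
  have "ip (words d N) y (act d N (el z i j) x) = 0" if y: "y \<in> W" for y
  proof -
    have "j \<noteq> i \<or> cnj z \<noteq> - 1"
      using *(4) by (metis complex_cnj_cnj complex_cnj_minus complex_cnj_one)
    moreover have "blk K j i" using *(3) by (auto simp: blk_def)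
    ultimately have "act d N (el (cnj z) j i) y \<in> W"
      using assms * y unfolding inv_sub_def by blast
    then have "ip (words d N) (act d N (el (cnj z) j i) y) x = 0"
      using x by (auto simp: orthc_def)
    then show ?thesis by (simp add: ip_act adjm_el)
  qed
  then show "act d N (el z i j) x \<in> orthc (words d N) W"
    by (simp add: orthc_def act_supp)
qed (use subspace_orthc orthc_supp in blast)+

text \<open>By the product rule one factor is differentiated and the others are evaluated at the
  identity matrix; in the sum over \<open>v\<close> only \<open>v = w(p := j)\<close> with
  \<open>w p = i\<close> survives.\<close>

lemma act_el_deriv:
  assumes "w \<in> words d N" "j < N" "i \<noteq> j"
  shows "((\<lambda>z. act d N (el z i j) x w) has_field_derivative Dop d N i j x w) (at 0)"
proof -
  let ?e = "\<lambda>a b. if a = b then 1 else 0 :: complex"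
  let ?i = "\<lambda>p v. if w p = i \<and> v p = j then 1 else 0 :: complex"
  have 1: "((\<lambda>z::complex. el z i j a b) has_field_derivative (if a = i \<and> b = j then 1 else 0)) (at 0)" for a b
    unfolding el_def by (cases "a = i \<and> b = j") (auto intro!: derivative_eq_intros simp: if_distrib cong: if_cong)
  have el0: "el 0 i j a b = ?e a b" for a b by (simp add: el_def)
  have "((\<lambda>z. \<Sum>v\<in>words d N. (\<Prod>p<d. el z i j (w p) (v p)) * x v) has_field_derivative
      (\<Sum>v\<in>words d N. (\<Sum>p<d. ?i p v * (\<Prod>q\<in>{..<d}-{p}. el 0 i j (w q) (v q))) * x v)) (at 0)"
    by (intro DERIV_sum DERIV_cmult_right has_field_derivative_prod 1)
  also have "(\<Sum>v\<in>words d N. (\<Sum>p<d. ?i p v * (\<Prod>q\<in>{..<d}-{p}. el 0 i j (w q) (v q))) * x v)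
      = (\<Sum>p<d. \<Sum>v\<in>words d N. ?i p v * (\<Prod>q\<in>{..<d}-{p}. ?e (w q) (v q)) * x v)"
    unfolding el0 sum_distrib_right by (subst sum.swap) (simp add: sum_distrib_right)
  also have "\<dots> = (\<Sum>p<d. if w p = i then x (w(p := j)) else 0)"
  proof (rule sum.cong[OF refl])
    fix p assume p: "p \<in> {..<d}"
    show "(\<Sum>v\<in>words d N. ?i p v * (\<Prod>q\<in>{..<d}-{p}. ?e (w q) (v q)) * x v)
        = (if w p = i then x (w(p := j)) else 0)"
    proof (cases "w p = i")
      case True
      have "?i p v * (\<Prod>q\<in>{..<d}-{p}. ?e (w q) (v q)) * x v = (if v = w(p := j) then x (w(p := j)) else 0)"
        if v: "v \<in> words d N" for v
      proof (cases "v = w(p := j)")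
        case True
        then show ?thesis using \<open>w p = i\<close> by auto
      next
        case False
        then obtain q where q: "q < d" "v q \<noteq> (w(p := j)) q"
          using words_eqI[OF v words_upd[OF assms(1)]] p assms(2) by auto
        show ?thesis
        proof (cases "q = p")
          case True
          then show ?thesis using q False by auto
        next
          case False
          then have "(\<Prod>q\<in>{..<d}-{p}. ?e (w q) (v q)) = 0"
            using q by (intro prod_zero) (auto intro!: bexI[of _ q])
          then show ?thesis using \<open>v \<noteq> w(p := j)\<close> by simp
        qed
      qed
      then have "(\<Sum>v\<in>words d N. ?i p v * (\<Prod>q\<in>{..<d}-{p}. ?e (w q) (v q)) * x v)
          = (\<Sum>v\<in>words d N. if v = w(p := j) then x (w(p := j)) else 0)"
        by (intro sum.cong) auto
      then show ?thesis using True words_upd[OF assms(1)] p assms(2) by auto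
    qed auto
  qed
  also have "\<dots> = Dop d N i j x w"
    using assms(1) by (auto simp: Dop_def sum.If_cases Int_def intro!: sum.cong)
  finally show ?thesis
    using assms(1) by (simp add: act_def)
qed

lemma Dop_supp: "Dop d N i j x \<in> supp_on (words d N)"
  by (auto simp: Dop_def supp_on_def)

text \<open>Against a vector of the complement, the curve \<open>act d N (el z i j) x\<close> has
  scalar product 0 for every \<open>z\<close>, hence so has its derivative at 0.\<close>

lemma inv_Dop:
  assumes "inv_sub d N K W" "x \<in> W" "i < N" "j < N" "i \<noteq> j" "blk K i j"
  shows "Dop d N i j x \<in> W"
proof (rule in_subspace_if_orth)
  fix v assume v: "v \<in> orthc (words d N) W"
  have "((\<lambda>z. ip (words d N) (act d N (el z i j) x) v) has_field_derivative
     ip (words d N) (Dop d N i j x) v) (at 0)"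
    unfolding ip_def using assms by (intro DERIV_sum DERIV_cmult_right act_el_deriv)
  moreover have "ip (words d N) (act d N (el z i j) x) v = 0" for z
    using assms v unfolding inv_sub_def orthc_def by blast
  ultimately have "((\<lambda>z::complex. 0) has_field_derivative ip (words d N) (Dop d N i j x) v) (at 0)"
    by simp
  then show "ip (words d N) (Dop d N i j x) v = 0"
    using DERIV_unique DERIV_const by blast
qed (use assms in \<open>auto simp: inv_sub_def Dop_supp\<close>)

lemma act_el_diag:
  assumes "w \<in> words d N" 
  shows "act d N (el z i i) x w = ((1 + z) :: complex) ^ cnt d w i * x w"
proof -
  have "(\<Prod>p<d. el z i i (w p) (v p)) * x v = (if v = w then (1 + z) ^ cnt d w i * x w else 0)"
    if v: "v \<in> words d N" for v
  proof (cases "v = w")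
    case True
    have "(\<Prod>p<d. el z i i (w p) (w p)) = (\<Prod>p<d. if w p = i then 1 + z else 1)"
      by (intro prod.cong) (auto simp: el_def)
    also have "\<dots> = (1 + z) ^ cnt d w i"
      by (subst prod.If_cases) (auto simp: cnt_def Int_def)
    finally show ?thesis using True by simp
  next
    case False
    then obtain p where p: "p < d" "v p \<noteq> w p"
      using words_eqI[OF v assms] by auto
    then have "el z i i (w p) (v p) = 0" by (auto simp: el_def)
    then have "(\<Prod>p<d. el z i i (w p) (v p)) = 0"
      using p by (intro prod_zero) auto
    then show ?thesis using False by simp
  qed
  then have "act d N (el z i i) x w = (\<Sum>v\<in>words d N. if v = w then (1 + z) ^ cnt d w i * x w else 0)"
    using assms unfolding act_def by (simp cong: sum.cong)
  then show ?thesis using assms by simp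
qed

lemma cnt_le: "cnt d w i \<le> d"
proof -
  have "card {p \<in> {..<d}. w p = i} \<le> card {..<d}" by (rule card_mono) auto
  then show ?thesis by (simp add: cnt_def)
qed

text \<open>The torus element with entry \<open>t\<close> at the letter \<open>i\<close> multiplies
  the part of \<open>x\<close> with \<open>k\<close> letters \<open>i\<close> by
  \<open>t ^ k\<close>. Its scalar product with a vector of the complement is a polynomial in
  \<open>t\<close> that vanishes for \<open>t \<noteq> 0\<close>, so every coefficient is 0.\<close>

lemma inv_cnt_projection:
  assumes "inv_sub d N K W" "x \<in> W" "i < N"
  shows "(\<lambda>w. if cnt d w i = k then x w else 0) \<in> W"
proof (rule in_subspace_if_orth)
  fix v assume v: "v \<in> orthc (words d N) W"
  define s where "s = (\<lambda>k. \<Sum>w\<in>{w\<in>words d N. cnt d w i = k}. x w * cnj (v w))"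
  have z: "(\<Sum>k\<le>d. s k * t ^ k) = 0" if "t \<noteq> 0" for t
  proof -
    have "blk K i i" "t - 1 \<noteq> - 1" using that by (auto simp: blk_def)
    then have "act d N (el (t - 1) i i) x \<in> W"
      using assms unfolding inv_sub_def by blast
    then have "0 = ip (words d N) (act d N (el (t - 1) i i) x) v"
      using v by (auto simp: orthc_def)
    also have "\<dots> = (\<Sum>w\<in>words d N. t ^ cnt d w i * (x w * cnj (v w)))"
      unfolding ip_def by (intro sum.cong) (auto simp: act_el_diag)
    also have "\<dots> = (\<Sum>k\<le>d. \<Sum>w\<in>{w\<in>words d N. cnt d w i = k}. t ^ cnt d w i * (x w * cnj (v w)))"
      by (rule sum.group[symmetric]) (auto simp: cnt_le)
    also have "\<dots> = (\<Sum>k\<le>d. s k * t ^ k)"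
      unfolding s_def sum_distrib_right by (intro sum.cong) (auto simp: mult_ac)
    finally show ?thesis by simp
  qed
  have "s k = 0" if "k \<le> d" for k
  proof (rule ccontr)
    assume "s k \<noteq> 0"
    then have "finite {z. (\<Sum>k\<le>d. s k * z ^ k) = 0}"
      using that polyfun_roots_finite by blast
    moreover have "UNIV - {0} \<subseteq> {z. (\<Sum>k\<le>d. s k * z ^ k) = 0}" using z by auto
    ultimately have "finite (UNIV - {0::complex})" using finite_subset by blast
    then show False by (simp add: infinite_UNIV_char_0)
  qed
  moreover have "s k = 0" if "\<not> k \<le> d"
    using that cnt_le unfolding s_def by (intro sum.neutral) auto
  ultimately have "s k = 0" by blast
  then show "ip (words d N) (\<lambda>w. if cnt d w i = k then x w else 0) v = 0"
    unfolding s_def ip_def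
    by (subst sum.mono_neutral_right[of _ "{w\<in>words d N. cnt d w i = k}"]) auto
qed (use assms in \<open>auto simp: inv_sub_def supp_on_def\<close>)

section \<open>Highest weight vectors\<close>

text \<open>\<open>Dop d N i j\<close> with \<open>i < j\<close> raises weights: the words in its
  result have one more \<open>i\<close> and one fewer \<open>j\<close>. Only raising operators
  inside a block have to give 0.\<close>

definition hwv :: "nat \<Rightarrow> nat \<Rightarrow> nat \<Rightarrow> (nat \<Rightarrow> nat) \<Rightarrow> ((nat \<Rightarrow> nat) \<Rightarrow> complex) \<Rightarrow> bool" where
  "hwv d N K c x \<longleftrightarrow> x \<in> supp_on (words d N) \<and> x \<noteq> 0 \<and>
     (\<forall>w. x w \<noteq> 0 \<longrightarrow> (\<forall>i<N. cnt d w i = c i)) \<and>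
     (\<forall>i j. i < j \<longrightarrow> j < N \<longrightarrow> blk K i j \<longrightarrow> Dop d N i j x = 0)"

text \<open>
  Up to a scalar depending only on the number of letters in \<open>B\<close>, \<open>Sw\<close> is the Casimir operator of the
  general linear group of the letters in \<open>B\<close>; \<open>kap\<close> is its eigenvalue at the highest weight \<open>c\<close>.
\<close>

definition Sw :: "nat \<Rightarrow> nat \<Rightarrow> nat set \<Rightarrow> ((nat \<Rightarrow> nat) \<Rightarrow> complex) \<Rightarrow> (nat \<Rightarrow> nat) \<Rightarrow> complex" where
  "Sw d N B x = (\<lambda>w. if w \<in> words d N then
     \<Sum>p<d. \<Sum>q<d. if p \<noteq> q \<and> w p \<in> B \<and> w q \<in> B then x (w \<circ> transpose p q) else 0 else 0)"

definition kap :: "nat set \<Rightarrow> (nat \<Rightarrow> nat) \<Rightarrow> int" where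
  "kap B c = (\<Sum>i\<in>B. int (c i) * (int (c i) - 1)) - (\<Sum>i\<in>B. \<Sum>j\<in>B-{i}. int (c (max i j)))"

lemma cnt_upd:
  assumes "p < d" "w p = i" "i \<noteq> j"
  shows "cnt d (w(p := j)) k = (if k = i then cnt d w i - 1 else if k = j then cnt d w j + 1 else cnt d w k)"
    and "cnt d w i > 0"
proof -
  have 1: "{q \<in> {..<d}. (w(p := j)) q = i} = {q \<in> {..<d}. w q = i} - {p}" using assms by auto
  have 2: "{q \<in> {..<d}. (w(p := j)) q = j} = insert p {q \<in> {..<d}. w q = j}" using assms by auto
  have 3: "{q \<in> {..<d}. (w(p := j)) q = k} = {q \<in> {..<d}. w q = k}" if "k \<noteq> i" "k \<noteq> j" using assms that by auto
  have p: "p \<in> {q \<in> {..<d}. w q = i}" "p \<notin> {q \<in> {..<d}. w q = j}" using assms by auto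
  show "cnt d w i > 0" using p(1) by (auto simp: cnt_def card_gt_0_iff)
  show "cnt d (w(p := j)) k = (if k = i then cnt d w i - 1 else if k = j then cnt d w j + 1 else cnt d w k)"
    unfolding cnt_def using 1 2 3 p by (auto simp: card_Diff_singleton)
qed

lemma words_comp:
  assumes "w \<in> words d N" "\<sigma> permutes {..<d}"
  shows "w \<circ> \<sigma> \<in> words d N"
proof -
  have "w (\<sigma> p) < N" if "p < d" for p
    using assms that permutes_in_image[OF assms(2), of p] words_less[OF assms(1)] by auto
  moreover have "w (\<sigma> p) = undefined" if "\<not> p < d" for p
    using assms that permutes_not_in[OF assms(2), of p] by (auto simp: words_def PiE_iff extensional_def)
  ultimately show ?thesis by (auto simp: words_def PiE_iff extensional_def)
qed

lemma transpose_permutes: "p < d \<Longrightarrow> q < d \<Longrightarrow> transpose p q permutes {..<d}"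
  by (intro permutes_swap_id) auto

lemma sum_letters:
  fixes f :: "nat \<Rightarrow> 'a :: comm_semiring_1"
  assumes "w \<in> words d N"
  shows "(\<Sum>p<d. f (w p)) = (\<Sum>i<N. of_nat (cnt d w i) * f i)"
proof -
  have "(\<Sum>p<d. f (w p)) = (\<Sum>i<N. \<Sum>p\<in>{p\<in>{..<d}. w p = i}. f (w p))"
    by (rule sum.group[symmetric]) (use assms in \<open>auto simp: words_def\<close>)
  also have "\<dots> = (\<Sum>i<N. of_nat (cnt d w i) * f i)"
    by (intro sum.cong) (auto simp: cnt_def)
  finally show ?thesis .
qed

text \<open>Among the finitely many weights of vectors of \<open>W\<close> one of greatest height
  \<open>ht\<close> is chosen. A raising operator preserves \<open>W\<close> and strictly increases
  the height, so it kills a vector of that weight.\<close>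

lemma hwv_exists:
  assumes W: "inv_sub d N K W" and x: "x \<in> W" "x \<noteq> 0"
  shows "\<exists>y c. y \<in> W \<and> hwv d N K c y"
proof -
  define ht where "ht = (\<lambda>w. \<Sum>i<N. cnt d w i * (N - i))"
  have ht: "ht w = (\<Sum>p<d. N - w p)" if "w \<in> words d N" for w
    using sum_letters[OF that, of "\<lambda>i. N - i"] by (simp add: ht_def)
  define H where "H = {w \<in> words d N. \<exists>x\<in>W. x w \<noteq> 0 \<and> (\<forall>v. x v \<noteq> 0 \<longrightarrow> (\<forall>i<N. cnt d v i = cnt d w i))}"
  obtain w1 where w1: "x w1 \<noteq> 0" using x(2) by (auto simp: fun_eq_iff)
  have supp: "W \<subseteq> supp_on (words d N)" using W unfolding inv_sub_def by blast
  have w1w: "w1 \<in> words d N" using w1 x(1) supp unfolding supp_on_def by blast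
  \<comment> \<open>Projecting onto the right count of one letter after another yields a weight
    vector of \<open>W\<close> that is still nonzero at \<open>w1\<close>.\<close>
  have "\<exists>y\<in>W. y w1 \<noteq> 0 \<and> (\<forall>v. y v \<noteq> 0 \<longrightarrow> (\<forall>i<k. cnt d v i = cnt d w1 i))" if "k \<le> N" for k
    using that
  proof (induction k)
    case 0
    show ?case by (intro bexI[of _ x]) (simp_all add: x w1)
  next
    case (Suc k)
    then obtain y where y: "y \<in> W" "y w1 \<noteq> 0" "\<forall>v. y v \<noteq> 0 \<longrightarrow> (\<forall>i<k. cnt d v i = cnt d w1 i)"
      using Suc.IH[OF Suc_leD[OF Suc.prems]] by blast
    define y' where "y' = (\<lambda>w. if cnt d w k = cnt d w1 k then y w else 0)"
    have "y' \<in> W"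
      unfolding y'_def using inv_cnt_projection[OF W y(1)] Suc.prems Suc_le_lessD by blast
    moreover have "y' w1 \<noteq> 0" using y(2) by (simp add: y'_def)
    moreover have "cnt d v i = cnt d w1 i" if "y' v \<noteq> 0" "i < Suc k" for v i
    proof -
      have "y v \<noteq> 0" "cnt d v k = cnt d w1 k" using that(1) by (auto simp: y'_def split: if_splits)
      then show ?thesis using y(3) that(2) by (cases "i = k") auto
    qed
    ultimately show ?case by blast
  qed
  from this[OF order_refl] have "w1 \<in> H" unfolding H_def using w1w by blast
  moreover have "finite H" by (simp add: H_def)
  ultimately have "Max (ht ` H) \<in> ht ` H" "\<And>w. w \<in> H \<Longrightarrow> ht w \<le> Max (ht ` H)"
    by (auto intro!: Max_in)
  then obtain w0 where w0: "w0 \<in> H" and max: "\<And>w. w \<in> H \<Longrightarrow> ht w \<le> ht w0" by (metis imageE)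
  from w0 obtain y where y: "y \<in> W" "y w0 \<noteq> 0" "\<And>v i. y v \<noteq> 0 \<Longrightarrow> i < N \<Longrightarrow> cnt d v i = cnt d w0 i"
    unfolding H_def by blast
  have "Dop d N i j y = 0" if ij: "i < j" "j < N" "blk K i j" for i j
  proof (rule ccontr)
    assume "Dop d N i j y \<noteq> 0"
    then obtain v where v: "Dop d N i j y v \<noteq> 0" by (auto simp: fun_eq_iff)
    have D: "Dop d N i j y \<in> W" using inv_Dop[OF W y(1)] ij by auto
    have *: "\<exists>p<d. u p = i \<and> y (u(p := j)) \<noteq> 0 \<and> u \<in> words d N" if "Dop d N i j y u \<noteq> 0" for u
      using that unfolding Dop_def by (auto split: if_splits elim!: sum.not_neutral_contains_not_neutral)
    have cu: "cnt d u k = (if k = i then cnt d w0 i + 1 else if k = j then cnt d w0 j - 1 else cnt d w0 k)"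
      if u: "Dop d N i j y u \<noteq> 0" and k: "k < N" for u k
    proof -
      obtain p where p: "p < d" "u p = i" "y (u(p := j)) \<noteq> 0" using *[OF u] by blast
      have "cnt d (u(p := j)) k = cnt d w0 k" "cnt d (u(p := j)) i = cnt d w0 i" "cnt d (u(p := j)) j = cnt d w0 j"
        using y(3)[OF p(3)] k ij by auto
      moreover note cnt_upd(1)[of p d u i j k, OF p(1,2)] cnt_upd(2)[of p d u i j, OF p(1,2)] cnt_upd(1)[of p d u i j i, OF p(1,2)]
        cnt_upd(1)[of p d u i j j, OF p(1,2)]
      ultimately show ?thesis using ij(1) by (cases "k = i"; cases "k = j") auto
    qed
    have "\<forall>u. Dop d N i j y u \<noteq> 0 \<longrightarrow> (\<forall>k<N. cnt d u k = cnt d v k)" using cu v by simp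
    then have "v \<in> H" unfolding H_def using D v *[OF v] by blast
    then have "ht v \<le> ht w0" using max by blast
    obtain p where p: "p < d" "v p = i" "y (v(p := j)) \<noteq> 0" "v \<in> words d N" using *[OF v] by blast
    have "ht (v(p := j)) = ht w0" unfolding ht_def using y(3)[OF p(3)] by simp
    moreover have "(\<Sum>q<d. N - (v(p := j)) q) < (\<Sum>q<d. N - v q)"
      using p ij by (intro sum_strict_mono_ex1) (auto intro!: bexI[of _ p])
    then have "ht (v(p := j)) < ht v" using ht[OF p(4)] ht[OF words_upd[OF p(4,1) ij(2)]] by simp
    ultimately show False using \<open>ht v \<le> ht w0\<close> by simp
  qed
  moreover have "y \<noteq> 0" using y(2) by auto
  ultimately have "hwv d N K (cnt d w0) y" unfolding hwv_def using y supp by blast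
  then show ?thesis using y(1) by blast
qed

text \<open>A letter \<open>i\<close> at \<open>p\<close> becomes \<open>j\<close>, and a letter
  \<open>j\<close> at \<open>q\<close> becomes \<open>i\<close>. For \<open>q = p\<close> the word
  is restored; for \<open>q \<noteq> p\<close> two letters have been exchanged.\<close>

lemma Dop_Dop:
  assumes "w \<in> words d N" "i < N" "j < N" "i \<noteq> j"
  shows "Dop d N i j (Dop d N j i x) w = of_nat (cnt d w i) * x w +
    (\<Sum>p\<in>{p\<in>{..<d}. w p = i}. \<Sum>q\<in>{q\<in>{..<d}. w q = j}. x (w \<circ> transpose p q))"
proof -
  have "Dop d N j i x (w(p := j)) = x w + (\<Sum>q\<in>{q\<in>{..<d}. w q = j}. x (w \<circ> transpose p q))"
    if p: "p < d" "w p = i" for p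
  proof -
    have "{q \<in> {..<d}. (w(p := j)) q = j} = insert p {q\<in>{..<d}. w q = j}" using p by auto
    moreover have "p \<notin> {q\<in>{..<d}. w q = j}" using p assms by auto
    moreover have "w(p := i) = w" using p by auto
    moreover have "w(p := j, q := i) = w \<circ> transpose p q" if "w q = j" for q
      using p that assms by (auto simp: fun_eq_iff transpose_def)
    ultimately show ?thesis
      using words_upd[OF assms(1) p(1) assms(3)] by (simp add: Dop_def)
  qed
  then have "Dop d N i j (Dop d N j i x) w =
      (\<Sum>p\<in>{p\<in>{..<d}. w p = i}. x w + (\<Sum>q\<in>{q\<in>{..<d}. w q = j}. x (w \<circ> transpose p q)))"
    using assms(1) by (simp add: Dop_def[of _ _ i j])
  then show ?thesis by (simp add: sum.distrib cnt_def)
qed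

lemma Dop_zero: "Dop d N i j 0 = 0"
  by (auto simp: Dop_def fun_eq_iff)

text \<open>\<open>Dop_Dop\<close> applied to \<open>Dop d N j i (Dop d N i j x) = 0\<close> can be
  solved for the sum of the exchanges, and this sum is the same for both orders of the two
  letters.\<close>

lemma hwv_swap:
  assumes "hwv d N K c x" "w \<in> words d N" "i < j" "j < N" "blk K i j" "x w \<noteq> 0 \<Longrightarrow> cnt d w j = c j"
  shows "(\<Sum>p\<in>{p\<in>{..<d}. w p = i}. \<Sum>q\<in>{q\<in>{..<d}. w q = j}. x (w \<circ> transpose p q)) = - of_nat (c j) * x w"
    and "(\<Sum>p\<in>{p\<in>{..<d}. w p = j}. \<Sum>q\<in>{q\<in>{..<d}. w q = i}. x (w \<circ> transpose p q)) = - of_nat (c j) * x w"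
proof -
  have "Dop d N i j x = 0" using assms by (auto simp: hwv_def)
  then have "0 = Dop d N j i (Dop d N i j x) w" by (simp add: Dop_zero)
  also have "\<dots> = of_nat (cnt d w j) * x w +
    (\<Sum>p\<in>{p\<in>{..<d}. w p = j}. \<Sum>q\<in>{q\<in>{..<d}. w q = i}. x (w \<circ> transpose p q))"
    using assms by (intro Dop_Dop) auto
  finally show *: "(\<Sum>p\<in>{p\<in>{..<d}. w p = j}. \<Sum>q\<in>{q\<in>{..<d}. w q = i}. x (w \<circ> transpose p q)) = - of_nat (c j) * x w"
    using assms(6) by (cases "x w = 0") (auto simp: add_eq_0_iff)
  have "(\<Sum>p\<in>{p\<in>{..<d}. w p = i}. \<Sum>q\<in>{q\<in>{..<d}. w q = j}. x (w \<circ> transpose p q)) =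
     (\<Sum>q\<in>{q\<in>{..<d}. w q = j}. \<Sum>p\<in>{p\<in>{..<d}. w p = i}. x (w \<circ> transpose q p))"
    by (subst sum.swap) (simp add: transpose_commute)
  then show "(\<Sum>p\<in>{p\<in>{..<d}. w p = i}. \<Sum>q\<in>{q\<in>{..<d}. w q = j}. x (w \<circ> transpose p q)) = - of_nat (c j) * x w"
    using * by simp
qed

lemma ip_Dop:
  assumes "i < N" "j < N"
  shows "ip (words d N) (Dop d N i j x) y = ip (words d N) x (Dop d N j i y)"
proof -
  have "ip (words d N) (Dop d N i j x) y =
      (\<Sum>(w, p)\<in>Sigma (words d N) (\<lambda>w. {p\<in>{..<d}. w p = i}). x (w(p := j)) * cnj (y w))"
    by (simp add: ip_def Dop_def sum_distrib_right sum.Sigma)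
  also have "\<dots> = (\<Sum>(w, p)\<in>Sigma (words d N) (\<lambda>w. {p\<in>{..<d}. w p = j}). x w * cnj (y (w(p := i))))"
    by (rule sum.reindex_bij_witness[of _ "\<lambda>(w, p). (w(p := i), p)" "\<lambda>(w, p). (w(p := j), p)"])
      (use assms in \<open>auto simp: words_upd\<close>)
  also have "\<dots> = ip (words d N) x (Dop d N j i y)"
    by (simp add: ip_def Dop_def sum_distrib_left sum.Sigma)
  finally show ?thesis .
qed

text \<open>By adjointness the square norm of the lowered vector \<open>Dop d N j i x\<close> is
  \<open>c i - c j\<close> times that of \<open>x\<close>, and a square norm is nonnegative.\<close>

lemma hwv_decreasing:
  assumes "hwv d N K c x" "i < j" "j < N" "blk K i j"
  shows "c j \<le> c i"
proof -
  let ?W = "words d N"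
  have sx: "x \<in> supp_on ?W" "x \<noteq> 0" using assms(1) by (auto simp: hwv_def)
  have "Dop d N i j (Dop d N j i x) w = (of_nat (c i) - of_nat (c j)) * x w" if w: "w \<in> ?W" for w
  proof (cases "x w = 0")
    case True
    then show ?thesis using Dop_Dop[OF w, of i j x] hwv_swap(1)[OF assms(1) w] assms by auto
  next
    case False
    then have "cnt d w i = c i" "cnt d w j = c j" using assms by (auto simp: hwv_def)
    then show ?thesis using Dop_Dop[OF w, of i j x] hwv_swap(1)[OF assms(1) w] assms by (auto simp: algebra_simps)
  qed
  then have "ip ?W (Dop d N i j (Dop d N j i x)) x = (of_nat (c i) - of_nat (c j)) * ip ?W x x"
    by (simp add: ip_def sum_distrib_left mult.assoc)
  then have "ip ?W (Dop d N j i x) (Dop d N j i x) = (of_nat (c i) - of_nat (c j)) * ip ?W x x"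
    using assms by (simp add: ip_Dop)
  then have "complex_of_real (\<Sum>w\<in>?W. (cmod (Dop d N j i x w))\<^sup>2) =
      complex_of_real ((real (c i) - real (c j)) * (\<Sum>w\<in>?W. (cmod (x w))\<^sup>2))"
    by (simp add: ip_self)
  then have "(\<Sum>w\<in>?W. (cmod (Dop d N j i x w))\<^sup>2) = (real (c i) - real (c j)) * (\<Sum>w\<in>?W. (cmod (x w))\<^sup>2)"
    using of_real_eq_iff by blast
  moreover have "(\<Sum>w\<in>?W. (cmod (Dop d N j i x w))\<^sup>2) \<ge> 0" by (intro sum_nonneg) auto
  moreover have "(\<Sum>w\<in>?W. (cmod (x w))\<^sup>2) \<ge> 0" by (intro sum_nonneg) auto
  moreover have "(\<Sum>w\<in>?W. (cmod (x w))\<^sup>2) \<noteq> 0"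
    using ip_self_eq_0[of ?W x] sx unfolding ip_self by (metis finite_words of_real_0)
  ultimately show ?thesis by (auto simp: zero_le_mult_iff)
qed

text \<open>Exchanges of equal letters fix the word and are counted by
  \<open>c i * (c i - 1)\<close>. For different letters \<open>i\<close> and \<open>j\<close>,
  \<open>hwv_swap\<close> contributes \<open>- c (max i j)\<close>.\<close>

lemma hwv_Sw:
  assumes x: "hwv d N K c x" and B: "B \<subseteq> {..<N}" "\<And>i j. i \<in> B \<Longrightarrow> j \<in> B \<Longrightarrow> blk K i j"
  shows "Sw d N B x = cscale (of_int (kap B c)) x"
proof
  fix w
  show "Sw d N B x w = cscale (of_int (kap B c)) x w"
  proof (cases "w \<in> words d N")
    case False
    then have "x w = 0" using x by (auto simp: hwv_def supp_on_def)
    then show ?thesis using False by (simp add: Sw_def cscale_def)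
  next
    case w: True
    have fB: "finite B" using B(1) finite_subset by blast
    define P where "P = (\<lambda>i. {p\<in>{..<d}. w p = i})"
    have cw: "x w \<noteq> 0 \<Longrightarrow> i < N \<Longrightarrow> cnt d w i = c i" for i using x by (auto simp: hwv_def)
    have grp: "(\<Sum>p<d. if w p \<in> B then h p else 0) = (\<Sum>i\<in>B. \<Sum>p\<in>P i. h p)" for h :: "nat \<Rightarrow> complex"
    proof -
      have "(\<Sum>p<d. if w p \<in> B then h p else 0) = (\<Sum>p\<in>{p\<in>{..<d}. w p \<in> B}. h p)"
        by (simp add: sum.If_cases Int_def)
      also have "\<dots> = (\<Sum>i\<in>B. \<Sum>p\<in>{q\<in>{p\<in>{..<d}. w p \<in> B}. w q = i}. h p)"
        by (rule sum.group[symmetric]) (use fB in auto)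
      also have "\<dots> = (\<Sum>i\<in>B. \<Sum>p\<in>P i. h p)"
        by (intro sum.cong) (auto simp: P_def)
      finally show ?thesis .
    qed
    have "Sw d N B x w = (\<Sum>p<d. if w p \<in> B then \<Sum>q<d. if w q \<in> B then (if p \<noteq> q then x (w \<circ> transpose p q) else 0) else 0 else 0)"
      using w unfolding Sw_def by (auto intro!: sum.cong)
    also have "\<dots> = (\<Sum>i\<in>B. \<Sum>p\<in>P i. \<Sum>j\<in>B. \<Sum>q\<in>P j. if p \<noteq> q then x (w \<circ> transpose p q) else 0)"
      by (simp add: grp)
    also have "\<dots> = (\<Sum>i\<in>B. \<Sum>j\<in>B. \<Sum>p\<in>P i. \<Sum>q\<in>P j. if p \<noteq> q then x (w \<circ> transpose p q) else 0)"
      by (intro sum.cong refl sum.swap)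
    also have "\<dots> = (\<Sum>i\<in>B. (\<Sum>p\<in>P i. \<Sum>q\<in>P i. if p \<noteq> q then x (w \<circ> transpose p q) else 0) +
        (\<Sum>j\<in>B-{i}. \<Sum>p\<in>P i. \<Sum>q\<in>P j. if p \<noteq> q then x (w \<circ> transpose p q) else 0))"
      using fB by (intro sum.cong refl sum.remove) auto
    also have "\<dots> = (\<Sum>i\<in>B. of_int (int (c i) * (int (c i) - 1)) * x w + (\<Sum>j\<in>B-{i}. - of_int (int (c (max i j))) * x w))"
    proof (intro sum.cong[OF refl] arg_cong2[of _ _ _ _ "(+)"])
      fix i assume i: "i \<in> B"
      have "(\<Sum>p\<in>P i. \<Sum>q\<in>P i. if p \<noteq> q then x (w \<circ> transpose p q) else 0) =
          (\<Sum>p\<in>P i. \<Sum>q\<in>P i - {p}. x w)"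
      proof (rule sum.cong[OF refl])
        fix p assume p: "p \<in> P i"
        have "x (w \<circ> transpose p q) = x w" if "q \<in> P i" for q
        proof -
          have "w \<circ> transpose p q = w" using p that by (auto simp: P_def fun_eq_iff transpose_def)
          then show ?thesis by simp
        qed
        then have "(\<Sum>q\<in>P i. if p \<noteq> q then x (w \<circ> transpose p q) else 0) = (\<Sum>q\<in>P i. if p \<noteq> q then x w else 0)"
          by (intro sum.cong) auto
        also have "\<dots> = (\<Sum>q\<in>P i - {p}. x w)"
          by (rule sum.mono_neutral_cong_right) (auto simp: P_def)
        finally show "(\<Sum>q\<in>P i. if p \<noteq> q then x (w \<circ> transpose p q) else 0) = (\<Sum>q\<in>P i - {p}. x w)" .
      qed
      also have "\<dots> = of_nat (card (P i)) * of_nat (card (P i) - 1) * x w"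
        by (simp add: card_Diff_singleton)
      also have "\<dots> = of_int (int (c i) * (int (c i) - 1)) * x w"
        using cw[of i] i B(1) by (cases "x w = 0"; cases "c i") (auto simp: cnt_def P_def)
      finally show "(\<Sum>p\<in>P i. \<Sum>q\<in>P i. if p \<noteq> q then x (w \<circ> transpose p q) else 0) =
         of_int (int (c i) * (int (c i) - 1)) * x w" .
      fix j assume j: "j \<in> B - {i}"
      have "(\<Sum>p\<in>P i. \<Sum>q\<in>P j. if p \<noteq> q then x (w \<circ> transpose p q) else 0) =
          (\<Sum>p\<in>P i. \<Sum>q\<in>P j. x (w \<circ> transpose p q))"
        using j by (intro sum.cong refl) (auto simp: P_def)
      also have "\<dots> = - of_int (int (c (max i j))) * x w"
      proof (cases "i < j")
        case True
        then show ?thesis using hwv_swap(1)[OF x w True] i j B cw[of j] unfolding P_def by (auto simp: max_def)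
      next
        case False
        then have "j < i" using j by auto
        then show ?thesis using hwv_swap(2)[OF x w \<open>j < i\<close>] i j B cw[of i] unfolding P_def by (auto simp: max_def)
      qed
      finally show "(\<Sum>p\<in>P i. \<Sum>q\<in>P j. if p \<noteq> q then x (w \<circ> transpose p q) else 0) = - of_int (int (c (max i j))) * x w" .
    qed
    also have "\<dots> = of_int (kap B c) * x w"
      by (simp add: kap_def sum.distrib sum_subtractf sum_negf left_diff_distrib sum_distrib_right)
    finally show ?thesis by (simp add: cscale_def)
  qed
qed

text \<open>Abel summation. The eigenvalues differ by the sum of \<open>a i * e i\<close> with
  \<open>a i = p i - c i\<close> and \<open>e i = p i + c i - 1 - 2 * i\<close>. The partial sums of
  \<open>a\<close> are nonnegative with total 0, and \<open>e\<close> is strictly decreasing, so all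
  these partial sums vanish.\<close>

lemma casimir_dominance:
  fixes c p :: "nat \<Rightarrow> int"
  assumes dec: "\<And>i. Suc i < n \<Longrightarrow> c (Suc i) \<le> c i" "\<And>i. Suc i < n \<Longrightarrow> p (Suc i) \<le> p i"
    and part: "\<And>k. k \<le> n \<Longrightarrow> (\<Sum>i<k. c i) \<le> (\<Sum>i<k. p i)" and tot: "(\<Sum>i<n. c i) = (\<Sum>i<n. p i)"
    and eq: "(\<Sum>i<n. c i * (c i - 1) - 2 * int i * c i) = (\<Sum>i<n. p i * (p i - 1) - 2 * int i * p i)"
    and "i < n"
  shows "c i = p i"
proof -
  obtain k where n: "n = Suc k" using \<open>i < n\<close> by (cases n) auto
  define a where "a = (\<lambda>i. p i - c i)"
  define e where "e = (\<lambda>i. p i + c i - 1 - 2 * int i)"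
  define S where "S = (\<lambda>k. \<Sum>i<k. a i)"
  have abel: "(\<Sum>i<Suc k. a i * e i) = S (Suc k) * e k + (\<Sum>i<k. S (Suc i) * (e i - e (Suc i)))" for k
    by (induction k) (auto simp: S_def algebra_simps)
  have S0: "S (Suc k) = 0" using tot n by (simp add: S_def a_def sum_subtractf)
  have Spos: "S j \<ge> 0" if "j \<le> n" for j using part[OF that] by (simp add: S_def a_def sum_subtractf)
  have epos: "e i - e (Suc i) > 0" if "i < k" for i using dec[of i] that n by (auto simp: e_def)
  have "(\<Sum>i<n. a i * e i) = (\<Sum>i<n. p i * (p i - 1) - 2 * int i * p i) - (\<Sum>i<n. c i * (c i - 1) - 2 * int i * c i)"
    unfolding sum_subtractf[symmetric] by (intro sum.cong) (auto simp: a_def e_def algebra_simps)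
  then have "(\<Sum>i<k. S (Suc i) * (e i - e (Suc i))) = 0"
    using eq abel[of k] S0 n by simp
  moreover have "S (Suc i) * (e i - e (Suc i)) \<ge> 0" if "i \<in> {..<k}" for i
    using Spos[of "Suc i"] epos[of i] that n by (intro mult_nonneg_nonneg) auto
  ultimately have "\<forall>i\<in>{..<k}. S (Suc i) * (e i - e (Suc i)) = 0"
    by (subst (asm) sum_nonneg_eq_0_iff) auto
  then have S: "S (Suc i) = 0" if "i < k" for i using epos[OF that] that by force
  then have "S j = 0" if "j \<le> n" for j
    using S0 n that by (cases j; cases "j = n") (auto simp: S_def)
  then have "S (Suc i) - S i = 0" using \<open>i < n\<close> by simp
  then show ?thesis by (simp add: S_def a_def)
qed

text \<open>An index is the maximum in two ordered pairs with each smaller index.\<close>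

lemma sum_max_pairs: "(\<Sum>i<n. \<Sum>j\<in>{..<n}-{i}. c (max i j)) = (\<Sum>i<n. 2 * int i * c i)"
  for c :: "nat \<Rightarrow> int"
proof (induction n)
  case (Suc n)
  have "(\<Sum>j\<in>{..<Suc n}-{i}. c (max i j)) = (\<Sum>j\<in>{..<n}-{i}. c (max i j)) + c n" if "i < n" for i
  proof -
    have "{..<Suc n}-{i} = insert n ({..<n}-{i})" using that by auto
    then show ?thesis using that by (simp add: max_def)
  qed
  moreover have "(\<Sum>j\<in>{..<Suc n}-{n}. c (max n j)) = int n * c n"
  proof -
    have "{..<Suc n}-{n} = {..<n}" by auto
    then show ?thesis by (simp add: max_def)
  qed
  ultimately show ?case using Suc by (simp add: sum.distrib)
qed auto

lemma kap_shift: "kap {K..<K + n} c = kap {..<n} (\<lambda>i. c (K + i))"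
proof -
  have im: "{K..<K + n} = (\<lambda>i. K + i) ` {..<n}" using image_add_atLeastLessThan[of K 0 n] by (simp add: lessThan_atLeast0 add.commute)
  have "{K..<K+n} - {K + i} = (\<lambda>i. K + i) ` ({..<n} - {i})" for i unfolding im by auto
  moreover have "inj_on (\<lambda>i. K + i) A" for A :: "nat set" by auto
  moreover have "max (K + i) (K + j) = K + max i j" for i j by simp
  ultimately show ?thesis unfolding kap_def
    by (subst im, subst im, subst sum.reindex, simp, subst sum.reindex, simp) (simp add: sum.reindex)
qed

lemma kap_lessThan:
  "kap {..<n} c = (\<Sum>i<n. int (c i) * (int (c i) - 1) - 2 * int i * int (c i))"
  using sum_max_pairs[of "\<lambda>i. int (c i)" n] by (simp add: kap_def sum_subtractf)

section \<open>Quotients of the word representation\<close>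

definition lin :: "'w set \<Rightarrow> ('w \<Rightarrow> 'x \<Rightarrow> complex) \<Rightarrow> ('w \<Rightarrow> complex) \<Rightarrow> 'x \<Rightarrow> complex" where
  "lin A Q x = (\<lambda>z. \<Sum>w\<in>A. x w * Q w z)"

definition ker :: "'w set \<Rightarrow> ('w \<Rightarrow> 'x \<Rightarrow> complex) \<Rightarrow> ('w \<Rightarrow> complex) set" where
  "ker A Q = {x \<in> supp_on A. lin A Q x = 0}"

lemma lin_add: "lin A Q (x + y) = lin A Q x + lin A Q y"
  and lin_diff: "lin A Q (x - y) = lin A Q x - lin A Q y"
  and lin_scale: "lin A Q (cscale c x) = cscale c (lin A Q x)"
  and lin_zero: "lin A Q 0 = 0"
  by (auto simp: lin_def fun_eq_iff sum.distrib sum_subtractf algebra_simps sum_distrib_left cscale_def)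

lemma lin_unitv:
  assumes "finite A" "w \<in> A"
  shows "lin A Q (unitv w) = Q w"
proof
  fix z
  have "lin A Q (unitv w) z = (\<Sum>v\<in>A. if v = w then Q w z else 0)"
    unfolding lin_def by (intro sum.cong) (auto simp: unitv_def)
  then show "lin A Q (unitv w) z = Q w z" using assms by simp
qed

lemma subspace_ker: "fun_space.subspace (ker A Q)"
  using subspace_supp_on[of A]
  by (auto simp: ker_def fun_space.subspace_def lin_add lin_scale lin_zero)

lemma ker_supp: "ker A Q \<subseteq> supp_on A"
  by (auto simp: ker_def)

lemma inv_sub_subspace: "inv_sub d N K W \<Longrightarrow> fun_space.subspace W"
  and inv_sub_supp: "inv_sub d N K W \<Longrightarrow> W \<subseteq> supp_on (words d N)"
  and inv_sub_el: "inv_sub d N K W \<Longrightarrow> i < N \<Longrightarrow> j < N \<Longrightarrow> blk K i j \<Longrightarrow> i \<noteq> j \<or> z \<noteq> - 1 \<Longrightarrow> x \<in> W \<Longrightarrow>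
    act d N (el z i j) x \<in> W"
  unfolding inv_sub_def by blast+

lemma inv_sub_Int:
  assumes "inv_sub d N K V" "inv_sub d N K W"
  shows "inv_sub d N K (V \<inter> W)"
  unfolding inv_sub_def
  using assms inv_sub_el[OF assms(1)] inv_sub_el[OF assms(2)] inv_sub_supp[OF assms(1)]
    fun_space.subspace_inter[OF assms[THEN inv_sub_subspace]]
  by blast

lemma orthc_antimono: "V \<subseteq> W \<Longrightarrow> orthc A W \<subseteq> orthc A V"
  by (auto simp: orthc_def)

lemma lin_act_unitv:
  assumes "t \<in> words d N"
  shows "lin (words d N) Q (act d N X (unitv t)) = (\<lambda>z. \<Sum>w\<in>words d N. (\<Prod>p<d. X (w p) (t p)) * Q w z)"
proof
  fix z
  have "act d N X (unitv t) w = (\<Prod>p<d. X (w p) (t p))" if "w \<in> words d N" for w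
  proof -
    have "(\<Sum>v\<in>words d N. (\<Prod>p<d. X (w p) (v p)) * unitv t v) =
        (\<Sum>v\<in>words d N. if v = t then (\<Prod>p<d. X (w p) (t p)) else 0)"
      by (rule sum.cong[OF refl]) (simp add: unitv_def)
    then show ?thesis using that assms by (simp add: act_def)
  qed
  then show "lin (words d N) Q (act d N X (unitv t)) z = (\<Sum>w\<in>words d N. (\<Prod>p<d. X (w p) (t p)) * Q w z)"
    by (simp add: lin_def)
qed

text \<open>The image of \<open>unitv t\<close> combines the words that arise from \<open>t\<close>
  by turning some letters \<open>j\<close> into \<open>i\<close>, and \<open>t\<close> itself has
  coefficient 1. If \<open>Q\<close> vanishes on all the others, only \<open>Q t\<close>
  remains.\<close>

lemma lin_act_el_top:
  assumes t: "t \<in> words d N" and "i \<noteq> j"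
    and zero: "\<And>w. w \<in> words d N \<Longrightarrow> w \<noteq> t \<Longrightarrow> (\<And>p. p < d \<Longrightarrow> w p = t p \<or> w p = i \<and> t p = j) \<Longrightarrow> Q w = 0"
  shows "lin (words d N) Q (act d N (el z i j) (unitv t)) = Q t"
proof
  fix y
  have "(\<Prod>p<d. el z i j (w p) (t p)) * Q w y = (if w = t then Q t y else 0)" if w: "w \<in> words d N" for w
  proof (cases "w = t")
    case True
    have "(\<Prod>p<d. el z i j (t p) (t p)) = 1" using \<open>i \<noteq> j\<close> by (intro prod.neutral) (auto simp: el_def)
    then show ?thesis using True by simp
  next
    case False
    show ?thesis
    proof (cases "\<forall>p<d. w p = t p \<or> w p = i \<and> t p = j")
      case True
      then have "Q w = 0" using zero w False by blast
      then show ?thesis using False by simp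
    next
      case False
      then obtain p where "p < d" "el z i j (w p) (t p) = 0" by (auto simp: el_def)
      then have "(\<Prod>p<d. el z i j (w p) (t p)) = 0" by (intro prod_zero) auto
      then show ?thesis using \<open>w \<noteq> t\<close> by simp
    qed
  qed
  then show "lin (words d N) Q (act d N (el z i j) (unitv t)) y = Q t y"
    unfolding lin_act_unitv[OF t] using t by (simp cong: sum.cong)
qed

lemma sum_rotate3: "(\<Sum>a\<in>A. \<Sum>b\<in>B. \<Sum>c\<in>C. F a b c) = (\<Sum>b\<in>B. \<Sum>c\<in>C. \<Sum>a\<in>A. F a b c)"
proof -
  have "(\<Sum>a\<in>A. \<Sum>b\<in>B. \<Sum>c\<in>C. F a b c) = (\<Sum>b\<in>B. \<Sum>a\<in>A. \<Sum>c\<in>C. F a b c)"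
    by (rule sum.swap)
  also have "\<dots> = (\<Sum>b\<in>B. \<Sum>c\<in>C. \<Sum>a\<in>A. F a b c)"
    by (rule sum.cong[OF refl], rule sum.swap)
  finally show ?thesis .
qed

text \<open>Exchanging two positions is an involution on words that keeps the condition on the
  letters, so the exchange passes from \<open>x\<close> to \<open>Q\<close>.\<close>

lemma lin_Sw:
  "lin (words d N) Q (Sw d N B x) z = (\<Sum>w\<in>words d N. x w *
     (\<Sum>p<d. \<Sum>q<d. if p \<noteq> q \<and> w p \<in> B \<and> w q \<in> B then Q (w \<circ> transpose p q) z else 0))"
proof -
  have tr: "w \<circ> transpose p q \<in> words d N" if "w \<in> words d N" "p < d" "q < d" for w p q
    using words_comp[OF that(1) transpose_permutes] that by blast
  have "lin (words d N) Q (Sw d N B x) z =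
     (\<Sum>w\<in>words d N. \<Sum>p<d. \<Sum>q<d. (if p \<noteq> q \<and> w p \<in> B \<and> w q \<in> B then x (w \<circ> transpose p q) else 0) * Q w z)"
    by (simp add: lin_def Sw_def sum_distrib_right)
  also have "\<dots> = (\<Sum>p<d. \<Sum>q<d. \<Sum>w\<in>words d N. (if p \<noteq> q \<and> w p \<in> B \<and> w q \<in> B then x (w \<circ> transpose p q) else 0) * Q w z)"
    by (rule sum_rotate3)
  also have "\<dots> = (\<Sum>p<d. \<Sum>q<d. \<Sum>w\<in>words d N. x w * (if p \<noteq> q \<and> w p \<in> B \<and> w q \<in> B then Q (w \<circ> transpose p q) z else 0))"
  proof (rule sum.cong[OF refl], rule sum.cong[OF refl])
    fix p q assume pq: "p \<in> {..<d}" "q \<in> {..<d}"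
    show "(\<Sum>w\<in>words d N. (if p \<noteq> q \<and> w p \<in> B \<and> w q \<in> B then x (w \<circ> transpose p q) else 0) * Q w z) =
      (\<Sum>w\<in>words d N. x w * (if p \<noteq> q \<and> w p \<in> B \<and> w q \<in> B then Q (w \<circ> transpose p q) z else 0))"
    proof (rule sum.reindex_bij_witness[of _ "\<lambda>w. w \<circ> transpose p q" "\<lambda>w. w \<circ> transpose p q"])
      fix w assume w: "w \<in> words d N"
      show inv: "w \<circ> transpose p q \<circ> transpose p q = w" by (simp add: fun_eq_iff)
      then show "w \<circ> transpose p q \<circ> transpose p q = w" .
      show "w \<circ> transpose p q \<in> words d N" using tr w pq by blast
      then show "w \<circ> transpose p q \<in> words d N" .
      show "x (w \<circ> transpose p q) * (if p \<noteq> q \<and> (w \<circ> transpose p q) p \<in> B \<and> (w \<circ> transpose p q) q \<in> B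
          then Q (w \<circ> transpose p q \<circ> transpose p q) z else 0) =
          (if p \<noteq> q \<and> w p \<in> B \<and> w q \<in> B then x (w \<circ> transpose p q) else 0) * Q w z"
        unfolding inv by auto
    qed
  qed
  also have "\<dots> = (\<Sum>w\<in>words d N. \<Sum>p<d. \<Sum>q<d. x w * (if p \<noteq> q \<and> w p \<in> B \<and> w q \<in> B then Q (w \<circ> transpose p q) z else 0))"
    by (rule sum_rotate3[symmetric])
  finally show ?thesis by (simp add: sum_distrib_left)
qed

text \<open>The image of \<open>lin\<close> is the space of words modulo \<open>ker\<close>, and
  \<open>T\<close> lists words whose images are highest weight vectors. The classification of all
  highest weight vectors is left to \<open>quotient_rep\<close>, because its proofs use the lifts
  constructed here.\<close>

locale pre_quotient_rep =
  fixes d N K :: nat and Q :: "(nat \<Rightarrow> nat) \<Rightarrow> 'x \<Rightarrow> complex" and T :: "(nat \<Rightarrow> nat) set"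
  assumes ker_inv: "\<And>i j z x. i < N \<Longrightarrow> j < N \<Longrightarrow> blk K i j \<Longrightarrow> i \<noteq> j \<or> z \<noteq> - 1 \<Longrightarrow> x \<in> ker (words d N) Q \<Longrightarrow>
      lin (words d N) Q (act d N (el z i j) x) = 0"
    and top_words: "T \<subseteq> words d N"
    and top_nonzero: "\<And>t. t \<in> T \<Longrightarrow> Q t \<noteq> 0"
    and top_fixed: "\<And>t i j z. t \<in> T \<Longrightarrow> i < j \<Longrightarrow> j < N \<Longrightarrow> blk K i j \<Longrightarrow>
      lin (words d N) Q (act d N (el z i j) (unitv t)) = Q t"
begin

abbreviation "W \<equiv> words d N"

lemma inv_ker: "inv_sub d N K (ker W Q)"
  unfolding inv_sub_def using ker_inv subspace_ker ker_supp
  by (auto simp: act_supp ker_def)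

text \<open>The lift is the component of \<open>unitv t\<close> orthogonal to the kernel. On that
  complement \<open>lin W Q\<close> is injective, so invariance and weight of the lift can be
  checked on its image.\<close>

lemma top_lift:
  assumes t: "t \<in> T"
  obtains p where "p \<in> orthc W (ker W Q)" "lin W Q p = Q t" "ip W p p \<noteq> 0"
    "\<And>i j z. i < j \<Longrightarrow> j < N \<Longrightarrow> blk K i j \<Longrightarrow> act d N (el z i j) p = p"
    "\<And>w i. p w \<noteq> 0 \<Longrightarrow> i < N \<Longrightarrow> cnt d w i = cnt d t i"
proof -
  let ?O = "orthc W (ker W Q)"
  have tW: "t \<in> W" using t top_words by blast
  obtain k p where kp: "k \<in> ker W Q" "p \<in> ?O" "unitv t = k + p"
    using orth_decomp[of W "ker W Q" "unitv t"] unitv_supp[OF tW] subspace_ker ker_supp by (metis finite_words)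
  have k0: "lin W Q k = 0" using kp(1) by (simp add: ker_def)
  have p: "p = unitv t - k" using kp(3) by simp
  have qp: "lin W Q p = Q t" unfolding p lin_diff k0 by (simp add: lin_unitv tW)
  have uniq: "y = p" if "y \<in> ?O" "lin W Q y = Q t" for y
  proof -
    have "y - p \<in> ?O" using fun_space.subspace_diff[OF subspace_orthc that(1) kp(2)] .
    moreover have "y - p \<in> ker W Q" using calculation that qp orthc_supp unfolding ker_def by (auto simp: lin_diff)
    ultimately have "y - p = 0" using orthc_Int by blast
    then show ?thesis by simp
  qed
  have fixed: "act d N (el z i j) p = p" if ij: "i < j" "j < N" "blk K i j" for i j z
  proof (rule uniq)
    show "act d N (el z i j) p \<in> ?O" using inv_sub_el[OF inv_orthc[OF inv_ker] _ _ ij(3)] ij kp(2) by auto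
    have "lin W Q (act d N (el z i j) k) = 0" using ker_inv[OF _ _ ij(3)] ij kp(1) by auto
    then show "lin W Q (act d N (el z i j) p) = Q t"
      unfolding p act_diff lin_diff using top_fixed[OF t ij] by simp
  qed
  have wt: "cnt d w i = cnt d t i" if "p w \<noteq> 0" "i < N" for w i
  proof -
    let ?P = "\<lambda>x :: (nat \<Rightarrow> nat) \<Rightarrow> complex. \<lambda>w. if cnt d w i = cnt d t i then x w else 0"
    have "?P p = p"
    proof (rule uniq)
      show "?P p \<in> ?O" using inv_cnt_projection[OF inv_orthc[OF inv_ker] kp(2) \<open>i < N\<close>] .
      have "?P k \<in> ker W Q" using inv_cnt_projection[OF inv_ker kp(1) \<open>i < N\<close>] .
      then have "lin W Q (?P k) = 0" by (simp add: ker_def)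
      moreover have "?P p = unitv t - ?P k" unfolding p by (rule ext) (simp add: unitv_def)
      ultimately show "lin W Q (?P p) = Q t" by (simp add: lin_diff lin_unitv tW)
    qed
    from fun_cong[OF this, of w] show ?thesis using that(1) by (simp split: if_splits)
  qed
  have "ip W p p \<noteq> 0"
  proof
    assume "ip W p p = 0"
    then have "p = 0" using ip_self_eq_0 kp(2) orthc_supp by (metis finite_words subsetD)
    then show False using qp top_nonzero[OF t] by (simp add: lin_zero)
  qed
  then show ?thesis using that kp(2) qp fixed wt by blast
qed

text \<open>The lift is fixed for every \<open>z\<close>, so the derivative, which is
  \<open>Dop\<close>, vanishes.\<close>

lemma top_lift_hwv:
  assumes t: "t \<in> T"
  obtains p where "p \<in> orthc W (ker W Q)" "lin W Q p = Q t" "hwv d N K (cnt d t) p"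
proof -
  obtain p where p: "p \<in> orthc W (ker W Q)" "lin W Q p = Q t" "ip W p p \<noteq> 0"
    "\<And>i j z. i < j \<Longrightarrow> j < N \<Longrightarrow> blk K i j \<Longrightarrow> act d N (el z i j) p = p"
    "\<And>w i. p w \<noteq> 0 \<Longrightarrow> i < N \<Longrightarrow> cnt d w i = cnt d t i"
    using top_lift[OF t] by blast
  have "Dop d N i j p = 0" if ij: "i < j" "j < N" "blk K i j" for i j
  proof
    fix w
    show "Dop d N i j p w = 0 w"
    proof (cases "w \<in> W")
      case True
      have "((\<lambda>z. act d N (el z i j) p w) has_field_derivative Dop d N i j p w) (at 0)"
        using act_el_deriv True ij by simp
      then have "((\<lambda>z::complex. p w) has_field_derivative Dop d N i j p w) (at 0)"
        using p(4)[OF ij] by simp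
      from DERIV_unique[OF this DERIV_const] show ?thesis by simp
    qed (simp add: Dop_def)
  qed
  moreover have "p \<noteq> 0" using p(3) by (auto simp: ip_zero_left)
  moreover have "p \<in> supp_on W" using p(1) orthc_supp by blast
  ultimately have "hwv d N K (cnt d t) p" using p(5) unfolding hwv_def by blast
  then show ?thesis using that p(1,2) by blast
qed

end

locale quotient_rep = pre_quotient_rep d N K Q T
  for d N K :: nat and Q :: "(nat \<Rightarrow> nat) \<Rightarrow> 'x \<Rightarrow> complex" and T :: "(nat \<Rightarrow> nat) set" +
  assumes hwv_top: "\<And>c x. hwv d N K c x \<Longrightarrow> x \<in> orthc (words d N) (ker (words d N) Q) \<Longrightarrow>
      \<exists>t\<in>T. \<exists>k. lin (words d N) Q x = cscale k (Q t)"
begin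

lemma hwv_orthc_ker:
  assumes "hwv d N K c x" "x \<in> orthc W (ker W Q)"
  obtains t k where "t \<in> T" "k \<noteq> 0" "x - cscale k (unitv t) \<in> ker W Q" "lin W Q x = cscale k (Q t)"
proof -
  obtain t k where t: "t \<in> T" "lin W Q x = cscale k (Q t)" using hwv_top assms by blast
  have x: "x \<in> supp_on W" "x \<noteq> 0" using assms(1) unfolding hwv_def by blast+
  have "lin W Q x \<noteq> 0" using x assms(2) orthc_Int[of W x "ker W Q"] by (auto simp: ker_def)
  then have "k \<noteq> 0" using t(2) by (auto simp: cscale_def fun_eq_iff)
  moreover have "cscale k (unitv t) \<in> supp_on W"
    using t(1) top_words unitv_supp subspace_supp_on by (metis fun_space.subspace_scale subsetD)
  then have "x - cscale k (unitv t) \<in> ker W Q"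
    using x t top_words unfolding ker_def
    by (auto simp: lin_diff lin_scale lin_unitv subsetD fun_space.subspace_diff[OF subspace_supp_on])
  ultimately show ?thesis using that t by blast
qed

text \<open>Otherwise the complement of \<open>V\<close> contains a highest weight vector. Modulo
  the kernel it is a multiple of some \<open>unitv t\<close>, hence it also lies in
  \<open>V\<close>, which is impossible.\<close>

lemma generated_by_tops:
  assumes "inv_sub d N K V" "ker W Q \<subseteq> V" "\<And>t. t \<in> T \<Longrightarrow> unitv t \<in> V"
  shows "V = supp_on W"
proof (rule orthc_trivial_imp)
  show "orthc W V \<subseteq> {0}"
  proof (rule ccontr)
    assume "\<not> orthc W V \<subseteq> {0}"
    then obtain x where "x \<in> orthc W V" "x \<noteq> 0" by blast
    then obtain y c where y: "y \<in> orthc W V" "hwv d N K c y"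
      using hwv_exists inv_orthc[OF assms(1)] by blast
    then have "y \<in> orthc W (ker W Q)" using orthc_antimono[OF assms(2)] by blast
    then obtain t k where t: "t \<in> T" "y - cscale k (unitv t) \<in> ker W Q" using hwv_orthc_ker y(2) by metis
    have sV: "fun_space.subspace V" using inv_sub_subspace assms(1) by blast
    then have "(y - cscale k (unitv t)) + cscale k (unitv t) \<in> V"
      using t assms by (meson fun_space.subspace_add fun_space.subspace_scale subsetD)
    then have "y \<in> V" by simp
    then have "y = 0" using orthc_Int y(1) by blast
    then show False using y(2) unfolding hwv_def by blast
  qed
qed (use inv_sub_subspace inv_sub_supp assms(1) in auto)

text \<open>If \<open>V\<close> is larger than the kernel, it has a highest weight vector orthogonal
  to the kernel. With a single top this puts \<open>unitv t\<close> into \<open>V\<close>, and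
  \<open>generated_by_tops\<close> applies.\<close>

lemma irreducible_if_one_top:
  assumes "inv_sub d N K V" "ker W Q \<subseteq> V" "T = {t}"
  shows "V = ker W Q \<or> V = supp_on W"
proof (cases "V \<inter> orthc W (ker W Q) \<subseteq> {0}")
  case True
  then show ?thesis
    using subspace_eq_if_no_complement[of W V "ker W Q"] inv_sub_subspace inv_sub_supp assms subspace_ker by blast
next
  case False
  then obtain x where "x \<in> V \<inter> orthc W (ker W Q)" "x \<noteq> 0" by blast
  then obtain y c where y: "y \<in> V" "y \<in> orthc W (ker W Q)" "hwv d N K c y"
    using hwv_exists inv_sub_Int[OF assms(1) inv_orthc[OF inv_ker]] by blast
  then obtain k where k: "k \<noteq> 0" "y - cscale k (unitv t) \<in> ker W Q" using hwv_orthc_ker assms(3) by blast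
  have sV: "fun_space.subspace V" using inv_sub_subspace assms(1) by blast
  have "cscale (1 / k) (y - (y - cscale k (unitv t))) \<in> V"
    using k y(1) assms(2) sV by (meson fun_space.subspace_diff fun_space.subspace_scale subsetD)
  moreover have "cscale (1 / k) (y - (y - cscale k (unitv t))) = unitv t"
    using k(1) by (auto simp: cscale_def fun_eq_iff)
  ultimately have "unitv t \<in> V" by simp
  then show ?thesis using generated_by_tops assms by blast
qed

end

section \<open>Vanishing of functions on block matrices\<close>

text \<open>Matrices with an LDU decomposition are dense.\<close>

definition block_matrix :: "nat \<Rightarrow> nat \<Rightarrow> (nat \<Rightarrow> nat \<Rightarrow> complex) \<Rightarrow> bool" where
  "block_matrix N K g \<longleftrightarrow> (\<forall>i<N. \<forall>j<N. \<not> blk K i j \<longrightarrow> g i j = 0)"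

lemma mm_el_left:
  assumes "a < N" "j < N"
  shows "mm N (el z i j) g a b = g a b + (if a = i then z * g j b else 0)"
proof -
  have "mm N (el z i j) g a b = (\<Sum>k<N. if k = a then g a b else 0) + (\<Sum>k<N. if k = j then (if a = i then z * g j b else 0) else 0)"
    unfolding mm_def el_def sum.distrib[symmetric] by (intro sum.cong) (auto simp: algebra_simps)
  then show ?thesis using assms by simp
qed

lemma mm_el_right:
  assumes "b < N" "i < N"
  shows "mm N g (el z i j) a b = g a b + (if b = j then g a i * z else 0)"
proof -
  have "mm N g (el z i j) a b = (\<Sum>k<N. if k = b then g a b else 0) + (\<Sum>k<N. if k = i then (if b = j then g a i * z else 0) else 0)"
    unfolding mm_def el_def sum.distrib[symmetric] by (intro sum.cong) (auto simp: algebra_simps)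
  then show ?thesis using assms by simp
qed

text \<open>Gaussian elimination. Lower row operations from the left and upper column operations
  from the right do not change \<open>f\<close>; with nonzero pivots they reduce \<open>g\<close> to
  a diagonal matrix. Continuity in the diagonal entries takes care of pivots that are 0.\<close>

lemma block_function_vanishes:
  fixes f :: "(nat \<Rightarrow> nat \<Rightarrow> complex) \<Rightarrow> complex"
  assumes ext: "\<And>g h. (\<And>i j. i < N \<Longrightarrow> j < N \<Longrightarrow> g i j = h i j) \<Longrightarrow> f g = f h"
    and low: "\<And>g i j z. block_matrix N K g \<Longrightarrow> j < i \<Longrightarrow> i < N \<Longrightarrow> blk K i j \<Longrightarrow> f (mm N (el z i j) g) = f g"
    and up: "\<And>g i j z. block_matrix N K g \<Longrightarrow> i < j \<Longrightarrow> j < N \<Longrightarrow> blk K i j \<Longrightarrow> f (mm N g (el z i j)) = f g"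
    and cont: "\<And>g k. block_matrix N K g \<Longrightarrow> k < N \<Longrightarrow> isCont (\<lambda>z. f (\<lambda>i j. g i j + (if i = k \<and> j = k then z else 0))) 0"
    and diag: "\<And>g. (\<And>i j. i < N \<Longrightarrow> j < N \<Longrightarrow> i \<noteq> j \<Longrightarrow> g i j = 0) \<Longrightarrow> f g = 0"
    and g: "block_matrix N K g"
  shows "f g = 0"
proof -
  \<comment> \<open>The state of the elimination: \<open>cl k g\<close> means that everything off
    the diagonal is cleared in the rows and columns before \<open>k\<close>, and
    \<open>bad k g\<close> collects what is left to clear in row and column
    \<open>k\<close>.\<close>
  define cl where "cl = (\<lambda>k g. \<forall>i<N. \<forall>j<N. i \<noteq> j \<longrightarrow> min i j < k \<longrightarrow> g i j = (0::complex))"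
  define bad where "bad = (\<lambda>k g. {(i, j). i < N \<and> j < N \<and> i \<noteq> j \<and> min i j = k \<and> g i j \<noteq> (0::complex)})"
  have fin: "finite (bad k g)" for k g
    by (rule finite_subset[of _ "{..<N} \<times> {..<N}"]) (auto simp: bad_def)
  have main: "f g = 0" if "block_matrix N K g" "cl k g" "k \<le> N" for k g
    using that
  proof (induction "N - k" arbitrary: k g)
    case 0
    then have "k = N" by simp
    then show ?case using 0 by (intro diag) (auto simp: cl_def)
  next
    case (Suc n)
    then have kN: "k < N" by simp
    have next_step: "f h = 0" if "block_matrix N K h" "cl k h" "bad k h = {}" for h
    proof (rule Suc.hyps(1))
      show "n = N - Suc k" using Suc.hyps(2) by simp
      show "cl (Suc k) h" using that(2,3) unfolding cl_def bad_def by (auto simp: less_Suc_eq)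
    qed (use that kN in auto)
    have pivot: "f h = 0" if "block_matrix N K h" "cl k h" "h k k \<noteq> 0" for h
      using that
    proof (induction "card (bad k h)" arbitrary: h rule: less_induct)
      case less
      show ?case
      proof (cases "bad k h = {}")
        case True
        then show ?thesis using next_step less by blast
      next
        case False
        then obtain i j where ij: "(i, j) \<in> bad k h" by auto
        then have hij: "i < N" "j < N" "i \<noteq> j" "min i j = k" "h i j \<noteq> 0" by (auto simp: bad_def)
        then have bij: "blk K i j" using less.prems(1) by (auto simp: block_matrix_def)
        show ?thesis
        proof (cases "j < i")
          case True
          then have jk: "j = k" using hij by auto
          define z where "z = - h i k / h k k"
          define h' where "h' = mm N (el z i j) h"
          have e: "h' a b = h a b + (if a = i then z * h k b else 0)" if "a < N" for a b
            using mm_el_left[OF that hij(2)] jk by (simp add: h'_def)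
          have z0: "h i k + z * h k k = 0" using less.prems(3) by (simp add: z_def)
          have ck: "h k b = 0" if "b < k" for b using less.prems(2) that kN by (auto simp: cl_def)
          have bm: "block_matrix N K h'"
            using less.prems(1) bij kN jk by (auto simp: block_matrix_def e blk_def)
          have c: "cl k h'"
            using less.prems(2) True jk by (auto simp: cl_def e ck min_def split: if_splits)
          have p: "h' k k \<noteq> 0" using less.prems(3) True jk kN by (simp add: e)
          have "bad k h' \<subseteq> bad k h - {(i, j)}"
            using True jk z0 by (auto simp: bad_def e min_def split: if_splits)
          then have "bad k h' \<subset> bad k h" using ij by auto
          then have "f h' = 0" using less.hyps[OF psubset_card_mono[OF fin] bm c p] by blast
          then show ?thesis using low[OF less.prems(1) True hij(1) bij] by (simp add: h'_def)
        next
          case False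
          then have ik: "i < j" "i = k" using hij by auto
          define z where "z = - h k j / h k k"
          define h' where "h' = mm N h (el z i j)"
          have e: "h' a b = h a b + (if b = j then h a k * z else 0)" if "b < N" for a b
            using mm_el_right[OF that hij(1)] ik by (simp add: h'_def)
          have z0: "h k j + h k k * z = 0" using less.prems(3) by (simp add: z_def)
          have ck: "h a k = 0" if "a < k" for a using less.prems(2) that kN by (auto simp: cl_def)
          have bm: "block_matrix N K h'"
            using less.prems(1) bij kN ik by (auto simp: block_matrix_def e blk_def)
          have c: "cl k h'"
            using less.prems(2) ik by (auto simp: cl_def e ck min_def split: if_splits)
          have p: "h' k k \<noteq> 0" using less.prems(3) ik kN by (simp add: e)
          have "bad k h' \<subseteq> bad k h - {(i, j)}"
            using ik z0 by (auto simp: bad_def e min_def split: if_splits)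
          then have "bad k h' \<subset> bad k h" using ij by auto
          then have "f h' = 0" using less.hyps[OF psubset_card_mono[OF fin] bm c p] by blast
          then show ?thesis using up[OF less.prems(1) ik(1) hij(2) bij] by (simp add: h'_def)
        qed
      qed
    qed
    show ?case
    proof (cases "g k k = 0")
      case False
      then show ?thesis using pivot Suc.prems by blast
    next
      case True
      \<comment> \<open>A zero pivot is perturbed by \<open>z\<close>. The pivot case gives the
        value 0 for \<open>z \<noteq> 0\<close>, and continuity gives it at 0.\<close>
      let ?g = "\<lambda>z i j. g i j + (if i = k \<and> j = k then z else 0)"
      have "f (?g z) = 0" if "z \<noteq> 0" for z
      proof (rule pivot)
        show "block_matrix N K (?g z)" using Suc.prems(1) by (auto simp: block_matrix_def blk_def)
        show "cl k (?g z)" using Suc.prems(2) by (auto simp: cl_def)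
      qed (use True that in simp)
      then have "((\<lambda>z. f (?g z)) \<longlongrightarrow> 0) (at 0)"
        by (intro tendsto_eventually) (auto simp: eventually_at_filter)
      moreover have "((\<lambda>z. f (?g z)) \<longlongrightarrow> f (?g 0)) (at 0)"
        using cont[OF Suc.prems(1) kN] by (simp add: isCont_def)
      ultimately have "f (?g 0) = 0" using LIM_unique by blast
      moreover have "?g 0 = g" by (auto simp: fun_eq_iff)
      ultimately show ?thesis by simp
    qed
  qed
  show ?thesis using main[of g 0] g by (auto simp: cl_def)
qed

section \<open>Fillings\<close>

lemma downset_eq_lessThan:
  fixes S :: "nat set"
  assumes "finite S" "\<And>i j. j \<in> S \<Longrightarrow> i < j \<Longrightarrow> i \<in> S"
  shows "S = {..<card S}"
proof (cases "S = {}")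
  case False
  have "S = {..Max S}"
  proof
    show "S \<subseteq> {..Max S}" using assms(1) by auto
    show "{..Max S} \<subseteq> S"
    proof
      fix i assume "i \<in> {..Max S}"
      then show "i \<in> S" using assms(2)[OF Max_in[OF assms(1) False], of i] Max_in[OF assms(1) False]
        by (cases "i = Max S") auto
    qed
  qed
  then have "card S = Suc (Max S)" by (metis card_atMost)
  then show ?thesis using \<open>S = {..Max S}\<close> lessThan_Suc_atMost by metis
qed simp

text \<open>In each fibre over \<open>x\<close> the set \<open>D\<close> occupies the least second
  coordinates, so below \<open>k\<close> it has the minimum of \<open>k\<close> and the fibre size,
  which bounds what \<open>J\<close> can have. Equality for all \<open>k\<close> makes every fibre
  of \<open>J\<close> an initial segment too.\<close>

lemma fill_dominance:
  fixes J D :: "('a \<times> nat) set"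
  assumes fin: "finite J" "finite D"
    and fib: "\<And>x. card {j. (x, j) \<in> J} = card {j. (x, j) \<in> D}"
    and left: "\<And>x i j. (x, j) \<in> D \<Longrightarrow> i < j \<Longrightarrow> (x, i) \<in> D"
  shows "card {z\<in>J. snd z < k} \<le> card {z\<in>D. snd z < k}"
    and "(\<And>k. card {z\<in>J. snd z < k} = card {z\<in>D. snd z < k}) \<Longrightarrow> J = D"
proof -
  define X where "X = fst ` (J \<union> D)"
  define FJ where "FJ = (\<lambda>x. {j. (x, j) \<in> J})"
  define FD where "FD = (\<lambda>x. {j. (x, j) \<in> D})"
  have finX: "finite X" using fin by (simp add: X_def)
  have finF: "finite (FJ x)" "finite (FD x)" for x
    using finite_subset[of "FJ x" "snd ` J"] finite_subset[of "FD x" "snd ` D"] fin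
    by (force simp: FJ_def FD_def)+
  have FD: "FD x = {..<card (FJ x)}" for x
    using downset_eq_lessThan[OF finF(2)[of x]] left fib[of x] unfolding FJ_def FD_def by auto
  have cJ: "card {z\<in>J. snd z < k} = (\<Sum>x\<in>X. card (FJ x \<inter> {..<k}))" for k
  proof -
    have "{z\<in>J. snd z < k} = Sigma X (\<lambda>x. FJ x \<inter> {..<k})" by (force simp: X_def FJ_def)
    then show ?thesis using finX finF by simp
  qed
  have cD: "card {z\<in>D. snd z < k} = (\<Sum>x\<in>X. card (FD x \<inter> {..<k}))" for k
  proof -
    have "{z\<in>D. snd z < k} = Sigma X (\<lambda>x. FD x \<inter> {..<k})" by (force simp: X_def FD_def)
    then show ?thesis using finX finF by simp
  qed
  have le: "card (FJ x \<inter> {..<k}) \<le> card (FD x \<inter> {..<k})" for x k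
  proof -
    have "card (FJ x \<inter> {..<k}) \<le> card (FJ x)" "card (FJ x \<inter> {..<k}) \<le> card {..<k}"
      using card_mono[OF finF(1) Int_lower1] card_mono[OF finite_lessThan Int_lower2] by blast+
    moreover have "FD x \<inter> {..<k} = {..<min (card (FJ x)) k}" unfolding FD by auto
    ultimately show ?thesis by simp
  qed
  show "card {z\<in>J. snd z < k} \<le> card {z\<in>D. snd z < k}"
    unfolding cJ cD by (intro sum_mono le)
  assume eq: "\<And>k. card {z\<in>J. snd z < k} = card {z\<in>D. snd z < k}"
  have eqx: "card (FJ x \<inter> {..<k}) = card (FD x \<inter> {..<k})" if "x \<in> X" for x k
  proof (rule ccontr)
    assume "card (FJ x \<inter> {..<k}) \<noteq> card (FD x \<inter> {..<k})"
    then have "card (FJ x \<inter> {..<k}) < card (FD x \<inter> {..<k})" using le[of x k] by simp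
    then have "card {z\<in>J. snd z < k} < card {z\<in>D. snd z < k}"
      unfolding cJ cD using that le finX by (intro sum_strict_mono_ex1) auto
    then show False using eq by simp
  qed
  have "FJ x = FD x" if "x \<in> X" for x
  proof -
    let ?l = "card (FJ x)"
    have "card (FJ x \<inter> {..<?l}) = card (FJ x)" using eqx[OF that, of ?l] FD[of x] by simp
    then have "FJ x \<inter> {..<?l} = FJ x" using finF by (intro card_subset_eq) auto
    moreover have "FJ x \<subseteq> {..<?l} \<Longrightarrow> FJ x = {..<?l}" by (intro card_subset_eq) auto
    ultimately show ?thesis using FD[of x] by auto
  qed
  then show "J = D" by (force simp: X_def FJ_def FD_def)
qed

lemma permutes_match:
  assumes F: "inj_on F {..<d}" and G: "inj_on G {..<d}" and FG: "F ` {..<d} = G ` {..<d :: nat}"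
  obtains \<tau> where "\<tau> permutes {..<d}" "\<And>p. p < d \<Longrightarrow> G (\<tau> p) = F p"
proof -
  define \<tau> where "\<tau> = (\<lambda>p. if p < d then inv_into {..<d} G (F p) else p)"
  have *: "\<tau> p < d" "G (\<tau> p) = F p" if "p < d" for p
  proof -
    have "F p \<in> G ` {..<d}" using that FG by blast
    then show "\<tau> p < d" "G (\<tau> p) = F p"
      using inv_into_into[of "F p" G "{..<d}"] f_inv_into_f[of "F p" G "{..<d}"] that
      by (simp_all add: \<tau>_def)
  qed
  have "inj_on \<tau> {..<d}" using * F by (metis (no_types, lifting) inj_on_def lessThan_iff)
  moreover have "\<tau> ` {..<d} \<subseteq> {..<d}" using * by auto
  ultimately have "bij_betw \<tau> {..<d} {..<d}"
    by (simp add: bij_betw_def endo_inj_surj)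
  then have "\<tau> permutes {..<d}" by (intro bij_imp_permutes) (auto simp: \<tau>_def)
  then show ?thesis using that * by blast
qed

text \<open>Used with the columns of boxes for \<open>a\<close>, their rows for \<open>g\<close> and
  the letters of a word for \<open>f\<close>. A filling without repetition in a column has a weight
  dominated by the row lengths, and one of that very weight is a column permutation of the filling
  by row numbers.\<close>

lemma filling_dominance:
  fixes a f g :: "nat \<Rightarrow> nat"
  assumes f: "inj_on (\<lambda>p. (a p, f p)) {..<d}" and g: "inj_on (\<lambda>p. (a p, g p)) {..<d}"
    and left: "\<And>q j. q < d \<Longrightarrow> j < g q \<Longrightarrow> \<exists>r<d. a r = a q \<and> g r = j"
  shows "card {p\<in>{..<d}. f p < k} \<le> card {p\<in>{..<d}. g p < k}"
    and "(\<And>k. card {p\<in>{..<d}. f p < k} = card {p\<in>{..<d}. g p < k}) \<Longrightarrow>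
      \<exists>\<tau>. \<tau> permutes {..<d} \<and> (\<forall>p<d. a (\<tau> p) = a p \<and> g (\<tau> p) = f p)"
proof -
  define im where "im = (\<lambda>h. (\<lambda>p. (a p, h p :: nat)) ` {..<d})"
  have fib: "card {j. (x, j) \<in> im h} = card {p\<in>{..<d}. a p = x}" if h: "inj_on (\<lambda>p. (a p, h p)) {..<d}" for h x
  proof -
    have "{j. (x, j) \<in> im h} = h ` {p\<in>{..<d}. a p = x}" by (auto simp: im_def)
    moreover have "inj_on h {p\<in>{..<d}. a p = x}" using h unfolding inj_on_def by auto
    ultimately show ?thesis by (simp add: card_image)
  qed
  have cn: "card {z\<in>im h. snd z < k} = card {p\<in>{..<d}. h p < k}" if h: "inj_on (\<lambda>p. (a p, h p)) {..<d}" for h k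
  proof -
    have "{z\<in>im h. snd z < k} = (\<lambda>p. (a p, h p)) ` {p\<in>{..<d}. h p < k}" by (auto simp: im_def)
    moreover have "inj_on (\<lambda>p. (a p, h p)) {p\<in>{..<d}. h p < k}" using h unfolding inj_on_def by auto
    ultimately show ?thesis by (simp add: card_image)
  qed
  have fin: "finite (im f)" "finite (im g)" by (auto simp: im_def)
  have fibs: "card {j. (x, j) \<in> im f} = card {j. (x, j) \<in> im g}" for x using fib f g by simp
  have lf: "(x, i) \<in> im g" if prem: "(x, j) \<in> im g" "i < j" for x i j
  proof -
    obtain q where "q < d" "x = a q" "j = g q" using prem(1) unfolding im_def by auto
    then obtain r where "r < d" "a r = x" "g r = i" using left prem(2) by blast
    then show ?thesis unfolding im_def by blast
  qed
  show "card {p\<in>{..<d}. f p < k} \<le> card {p\<in>{..<d}. g p < k}"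
    using fill_dominance(1)[OF fin fibs lf] cn[OF f] cn[OF g] by simp
  assume "\<And>k. card {p\<in>{..<d}. f p < k} = card {p\<in>{..<d}. g p < k}"
  then have "im f = im g" using fill_dominance(2)[OF fin fibs lf] cn[OF f] cn[OF g] by simp
  then show "\<exists>\<tau>. \<tau> permutes {..<d} \<and> (\<forall>p<d. a (\<tau> p) = a p \<and> g (\<tau> p) = f p)"
    using permutes_match[OF f g] unfolding im_def by (metis prod.inject)
qed

lemma sum_cnt: "(\<Sum>i<k. cnt d w i) = card {p\<in>{..<d}. w p < k}"
proof -
  have "(\<Sum>i<k. cnt d w i) = (\<Sum>i<k. card {p\<in>{..<d}. w p = i})" by (simp add: cnt_def)
  also have "\<dots> = card (\<Union>i\<in>{..<k}. {p\<in>{..<d}. w p = i})" by (rule card_UN_disjoint[symmetric]) auto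
  also have "(\<Union>i\<in>{..<k}. {p\<in>{..<d}. w p = i}) = {p\<in>{..<d}. w p < k}" by auto
  finally show ?thesis .
qed

section \<open>Young symmetrizers\<close>

definition fixg :: "nat \<Rightarrow> (nat \<Rightarrow> nat) \<Rightarrow> (nat \<Rightarrow> nat) set" where
  "fixg d f = {\<sigma>. \<sigma> permutes {..<d} \<and> (\<forall>p<d. f (\<sigma> p) = f p)}"

text \<open>The Young symmetrizer acting on the positions of a word, arranged such that the column
  permutation meets \<open>w\<close> directly; this is what makes \<open>ysum_column\<close>
  hold.\<close>

definition ysum :: "nat \<Rightarrow> (nat \<Rightarrow> nat) \<Rightarrow> (nat \<Rightarrow> nat) \<Rightarrow> ((nat \<Rightarrow> nat) \<Rightarrow> complex) \<Rightarrow> (nat \<Rightarrow> nat) \<Rightarrow> complex" where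
  "ysum d row col P w = (\<Sum>\<sigma>\<in>fixg d row. \<Sum>\<tau>\<in>fixg d col. of_int (sign \<tau>) * P (w \<circ> \<tau> \<circ> \<sigma>))"

lemma finite_fixg: "finite (fixg d f)"
  unfolding fixg_def by (rule finite_subset[OF _ finite_permutations[of "{..<d}"]]) auto

lemma fixg_permutes: "\<sigma> \<in> fixg d f \<Longrightarrow> \<sigma> permutes {..<d}"
  by (simp add: fixg_def)

lemma fixg_comp:
  assumes "\<sigma> \<in> fixg d f" "\<tau> \<in> fixg d f"
  shows "\<sigma> \<circ> \<tau> \<in> fixg d f"
proof -
  have "\<tau> p < d" if "p < d" for p using that permutes_in_image[of \<tau> "{..<d}" p] assms(2) by (auto simp: fixg_def)
  then show ?thesis using assms by (auto simp: fixg_def permutes_compose)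
qed

lemma fixg_inv:
  assumes "\<sigma> \<in> fixg d f"
  shows "inv_into UNIV \<sigma> \<in> fixg d f"
proof -
  have \<sigma>: "\<sigma> permutes {..<d}" using assms by (simp add: fixg_def)
  have "f (inv_into UNIV \<sigma> p) = f p" if "p < d" for p
  proof -
    have "inv_into UNIV \<sigma> p < d"
      using that permutes_in_image[OF permutes_inv[OF \<sigma>], of p] by auto
    then have "f (\<sigma> (inv_into UNIV \<sigma> p)) = f (inv_into UNIV \<sigma> p)" using assms by (auto simp: fixg_def)
    then show ?thesis by (simp add: permutes_inverses[OF \<sigma>])
  qed
  then show ?thesis using permutes_inv[OF \<sigma>] by (simp add: fixg_def)
qed

lemma fixg_transpose:
  assumes "p < d" "q < d" "f p = f q"
  shows "transpose p q \<in> fixg d f"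
  using assms transpose_permutes[of p d q] by (auto simp: fixg_def transpose_def)

lemma fixg_sum_left:
  fixes h :: "(nat \<Rightarrow> nat) \<Rightarrow> complex"
  assumes "\<rho> \<in> fixg d f"
  shows "(\<Sum>\<sigma>\<in>fixg d f. h (\<rho> \<circ> \<sigma>)) = (\<Sum>\<sigma>\<in>fixg d f. h \<sigma>)"
proof -
  have \<rho>: "\<rho> permutes {..<d}" using assms by (simp add: fixg_def)
  show ?thesis
  proof (rule sum.reindex_bij_witness[of _ "\<lambda>\<sigma>. inv_into UNIV \<rho> \<circ> \<sigma>" "\<lambda>\<sigma>. \<rho> \<circ> \<sigma>"])
    fix \<sigma> assume s: "\<sigma> \<in> fixg d f"
    show "\<rho> \<circ> \<sigma> \<in> fixg d f" "inv_into UNIV \<rho> \<circ> \<sigma> \<in> fixg d f"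
      using fixg_comp fixg_inv assms s by blast+
    show "inv_into UNIV \<rho> \<circ> (\<rho> \<circ> \<sigma>) = \<sigma>" "\<rho> \<circ> (inv_into UNIV \<rho> \<circ> \<sigma>) = \<sigma>"
      by (simp_all add: fun_eq_iff permutes_inverses[OF \<rho>])
  qed simp
qed

lemma fixg_sum_right:
  fixes h :: "(nat \<Rightarrow> nat) \<Rightarrow> complex"
  assumes "\<rho> \<in> fixg d f"
  shows "(\<Sum>\<sigma>\<in>fixg d f. h (\<sigma> \<circ> \<rho>)) = (\<Sum>\<sigma>\<in>fixg d f. h \<sigma>)"
proof -
  have \<rho>: "\<rho> permutes {..<d}" using assms by (simp add: fixg_def)
  show ?thesis
  proof (rule sum.reindex_bij_witness[of _ "\<lambda>\<sigma>. \<sigma> \<circ> inv_into UNIV \<rho>" "\<lambda>\<sigma>. \<sigma> \<circ> \<rho>"])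
    fix \<sigma> assume s: "\<sigma> \<in> fixg d f"
    show "\<sigma> \<circ> \<rho> \<in> fixg d f" "\<sigma> \<circ> inv_into UNIV \<rho> \<in> fixg d f"
      using fixg_comp fixg_inv assms s by blast+
    show "\<sigma> \<circ> \<rho> \<circ> inv_into UNIV \<rho> = \<sigma>" "\<sigma> \<circ> inv_into UNIV \<rho> \<circ> \<rho> = \<sigma>"
      by (simp_all add: fun_eq_iff permutes_inverses[OF \<rho>])
  qed simp
qed

lemma sign_comp:
  assumes "\<sigma> permutes {..<d :: nat}" "\<tau> permutes {..<d}"
  shows "sign (\<sigma> \<circ> \<tau>) = sign \<sigma> * sign \<tau>"
  using assms by (intro sign_compose) (auto simp: permutation_permutes)

lemma transpose_conj:
  assumes "inj \<tau>"
  shows "transpose (\<tau> p) (\<tau> q) \<circ> \<tau> = \<tau> \<circ> transpose p q"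
  using assms by (auto simp: fun_eq_iff transpose_def inj_def)

lemma sign_of_int_sq: "of_int (sign \<tau>) * (of_int (sign \<tau>) * x) = (x :: complex)"
  by (simp add: sign_def)

text \<open>\<open>corner\<close> is the property of Young diagrams behind the eigenvalue in
  \<open>ysum_swaps\<close>: of the rectangle spanned by two boxes at least one further corner
  belongs to the diagram.\<close>

locale young_shape =
  fixes d :: nat and row col :: "nat \<Rightarrow> nat"
  assumes box_inj: "inj_on (\<lambda>p. (row p, col p)) {..<d}"
    and corner: "\<And>p q. p < d \<Longrightarrow> q < d \<Longrightarrow> row p \<noteq> row q \<Longrightarrow> col p \<noteq> col q \<Longrightarrow>
      \<exists>r<d. (row r = row p \<and> col r = col q) \<or> (row r = row q \<and> col r = col p)"
begin

abbreviation "R \<equiv> fixg d row"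
abbreviation "C \<equiv> fixg d col"

lemma ysum_column:
  assumes "\<rho> \<in> C"
  shows "ysum d row col P (w \<circ> \<rho>) = of_int (sign \<rho>) * ysum d row col P w"
proof -
  have "(\<Sum>\<tau>\<in>C. of_int (sign \<tau>) * P (w \<circ> \<rho> \<circ> \<tau> \<circ> \<sigma>)) =
      (\<Sum>\<tau>\<in>C. of_int (sign \<rho>) * (of_int (sign \<tau>) * P (w \<circ> \<tau> \<circ> \<sigma>)))" for \<sigma>
  proof -
    have "(\<Sum>\<tau>\<in>C. of_int (sign \<tau>) * P (w \<circ> \<rho> \<circ> \<tau> \<circ> \<sigma>)) =
        (\<Sum>\<tau>\<in>C. of_int (sign \<rho>) * (of_int (sign (\<rho> \<circ> \<tau>)) * P (w \<circ> (\<rho> \<circ> \<tau>) \<circ> \<sigma>)))"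
    proof (rule sum.cong[OF refl])
      fix \<tau> assume "\<tau> \<in> C"
      then have "sign (\<rho> \<circ> \<tau>) = sign \<rho> * sign \<tau>" using assms sign_comp fixg_permutes by blast
      then show "of_int (sign \<tau>) * P (w \<circ> \<rho> \<circ> \<tau> \<circ> \<sigma>) =
          of_int (sign \<rho>) * (of_int (sign (\<rho> \<circ> \<tau>)) * P (w \<circ> (\<rho> \<circ> \<tau>) \<circ> \<sigma>))"
        by (simp add: mult.assoc sign_of_int_sq comp_assoc)
    qed
    also have "\<dots> = (\<Sum>\<tau>\<in>C. of_int (sign \<rho>) * (of_int (sign \<tau>) * P (w \<circ> \<tau> \<circ> \<sigma>)))"
      by (rule fixg_sum_left[OF assms])
    finally show ?thesis .
  qed
  then show ?thesis by (simp add: ysum_def sum_distrib_left)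
qed

lemma ysum_duplicate:
  assumes "p < d" "q < d" "p \<noteq> q" "col p = col q" "w p = w q"
  shows "ysum d row col P w = 0"
proof -
  have "w \<circ> transpose p q = w" using assms(5) by (auto simp: fun_eq_iff transpose_def)
  then have "ysum d row col P w = of_int (sign (transpose p q)) * ysum d row col P w"
    using ysum_column[OF fixg_transpose[OF assms(1,2,4)], of P w] by simp
  then show ?thesis using assms(3) by (simp add: sign_swap_id)
qed

text \<open>The sum of all transpositions is central, so it can be moved between the column and the
  row permutations. There a pair in one row is absorbed with sign 1, a pair in one column with sign
  - 1, and any other pair contributes 0. For a Young diagram the eigenvalue is twice the sum of the
  contents.\<close>

lemma ysum_swaps:
  "(\<Sum>p<d. \<Sum>q<d. if p \<noteq> q then ysum d row col P (w \<circ> transpose p q) else 0) =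
   (\<Sum>p<d. \<Sum>q<d. if p \<noteq> q then (if row p = row q then 1 else if col p = col q then - 1 else 0) else 0) *
     ysum d row col P w"
proof -
  define Z where "Z = (\<lambda>p q. \<Sum>\<sigma>\<in>R. \<Sum>\<tau>\<in>C. of_int (sign \<tau>) * P (w \<circ> \<tau> \<circ> transpose p q \<circ> \<sigma>))"
  let ?F = "\<lambda>p q \<sigma> \<tau>. if p \<noteq> q then of_int (sign \<tau>) * P (w \<circ> transpose p q \<circ> \<tau> \<circ> \<sigma>) else 0"
  let ?G = "\<lambda>p q \<sigma> \<tau>. if p \<noteq> q then of_int (sign \<tau>) * P (w \<circ> \<tau> \<circ> transpose p q \<circ> \<sigma>) else 0"
  have 1: "(\<Sum>p<d. \<Sum>q<d. ?F p q \<sigma> \<tau>) = (\<Sum>p<d. \<Sum>q<d. ?G p q \<sigma> \<tau>)" if "\<tau> \<in> C" for \<sigma> \<tau>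
  proof -
    have \<tau>: "\<tau> permutes {..<d}" using that fixg_permutes by blast
    have inj: "inj \<tau>" using permutes_inj[OF \<tau>] .
    have "(\<Sum>p<d. \<Sum>q<d. ?F p q \<sigma> \<tau>) = (\<Sum>p<d. \<Sum>q<d. ?F (\<tau> p) (\<tau> q) \<sigma> \<tau>)"
      using sum.permute[OF \<tau>, of "\<lambda>p. \<Sum>q<d. ?F p q \<sigma> \<tau>"] sum.permute[OF \<tau>, of "\<lambda>q. ?F (\<tau> p) q \<sigma> \<tau>" for p]
      by (simp add: comp_def)
    also have "\<dots> = (\<Sum>p<d. \<Sum>q<d. ?G p q \<sigma> \<tau>)"
    proof (rule sum.cong[OF refl], rule sum.cong[OF refl])
      fix p q
      have "w \<circ> transpose (\<tau> p) (\<tau> q) \<circ> \<tau> \<circ> \<sigma> = w \<circ> \<tau> \<circ> transpose p q \<circ> \<sigma>"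
        using transpose_conj[OF inj, of p q] by (simp add: comp_assoc)
      moreover have "\<tau> p \<noteq> \<tau> q \<longleftrightarrow> p \<noteq> q" using inj by (auto simp: inj_def)
      ultimately show "?F (\<tau> p) (\<tau> q) \<sigma> \<tau> = ?G p q \<sigma> \<tau>" by simp
    qed
    finally show ?thesis .
  qed
  have sw: "(\<Sum>p<d. \<Sum>q<d. \<Sum>\<sigma>\<in>R. \<Sum>\<tau>\<in>C. H p q \<sigma> \<tau>) = (\<Sum>\<sigma>\<in>R. \<Sum>\<tau>\<in>C. \<Sum>p<d. \<Sum>q<d. H p q \<sigma> \<tau>)"
    for H :: "nat \<Rightarrow> nat \<Rightarrow> (nat \<Rightarrow> nat) \<Rightarrow> (nat \<Rightarrow> nat) \<Rightarrow> complex"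
  proof -
    have "(\<Sum>p<d. \<Sum>q<d. \<Sum>\<sigma>\<in>R. \<Sum>\<tau>\<in>C. H p q \<sigma> \<tau>) = (\<Sum>p<d. \<Sum>\<sigma>\<in>R. \<Sum>\<tau>\<in>C. \<Sum>q<d. H p q \<sigma> \<tau>)"
      by (rule sum.cong[OF refl], rule sum_rotate3)
    also have "\<dots> = (\<Sum>\<sigma>\<in>R. \<Sum>\<tau>\<in>C. \<Sum>p<d. \<Sum>q<d. H p q \<sigma> \<tau>)" by (rule sum_rotate3)
    finally show ?thesis .
  qed
  have "(\<Sum>p<d. \<Sum>q<d. if p \<noteq> q then ysum d row col P (w \<circ> transpose p q) else 0) =
      (\<Sum>p<d. \<Sum>q<d. \<Sum>\<sigma>\<in>R. \<Sum>\<tau>\<in>C. ?F p q \<sigma> \<tau>)"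
    by (intro sum.cong[OF refl]) (auto simp: ysum_def)
  also have "\<dots> = (\<Sum>p<d. \<Sum>q<d. \<Sum>\<sigma>\<in>R. \<Sum>\<tau>\<in>C. ?G p q \<sigma> \<tau>)"
    unfolding sw by (intro sum.cong[OF refl] 1)
  also have "\<dots> = (\<Sum>p<d. \<Sum>q<d. if p \<noteq> q then Z p q else 0)"
    by (intro sum.cong[OF refl]) (auto simp: Z_def)
  also have "\<dots> = (\<Sum>p<d. \<Sum>q<d. (if p \<noteq> q then (if row p = row q then 1 else if col p = col q then - 1 else 0) else 0) *
      ysum d row col P w)"
  proof (rule sum.cong[OF refl], rule sum.cong[OF refl])
    fix p q assume "p \<in> {..<d}" "q \<in> {..<d}"
    then have pq: "p < d" "q < d" by auto
    have same_row: "Z p q = ysum d row col P w" if "row p = row q"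
      unfolding Z_def ysum_def
      using fixg_sum_left[OF fixg_transpose[OF pq, of row, OF that],
          of "\<lambda>\<sigma>. \<Sum>\<tau>\<in>C. of_int (sign \<tau>) * P (w \<circ> \<tau> \<circ> \<sigma>)"]
      by (simp add: comp_assoc)
    have same_col: "Z p q = - ysum d row col P w" if "col p = col q" "p \<noteq> q"
    proof -
      have tr: "transpose p q \<in> C" using fixg_transpose pq that by blast
      have "(\<Sum>\<tau>\<in>C. of_int (sign \<tau>) * P (w \<circ> \<tau> \<circ> transpose p q \<circ> \<sigma>)) =
          - (\<Sum>\<tau>\<in>C. of_int (sign \<tau>) * P (w \<circ> \<tau> \<circ> \<sigma>))" for \<sigma>
      proof -
        have "(\<Sum>\<tau>\<in>C. of_int (sign \<tau>) * P (w \<circ> \<tau> \<circ> \<sigma>)) =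
          (\<Sum>\<tau>\<in>C. of_int (sign (\<tau> \<circ> transpose p q)) * P (w \<circ> (\<tau> \<circ> transpose p q) \<circ> \<sigma>))"
          by (rule fixg_sum_right[OF tr, symmetric])
        also have "\<dots> = (\<Sum>\<tau>\<in>C. - (of_int (sign \<tau>) * P (w \<circ> \<tau> \<circ> transpose p q \<circ> \<sigma>)))"
        proof (rule sum.cong[OF refl])
          fix \<tau> assume "\<tau> \<in> C"
          then have "sign (\<tau> \<circ> transpose p q) = sign \<tau> * sign (transpose p q)"
            using sign_comp fixg_permutes tr by blast
          then show "of_int (sign (\<tau> \<circ> transpose p q)) * P (w \<circ> (\<tau> \<circ> transpose p q) \<circ> \<sigma>) =
            - (of_int (sign \<tau>) * P (w \<circ> \<tau> \<circ> transpose p q \<circ> \<sigma>))"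
            using that(2) by (simp add: sign_swap_id comp_assoc)
        qed
        finally show ?thesis by (simp add: sum_negf)
      qed
      then show ?thesis by (simp add: Z_def ysum_def sum_negf)
    qed
    have corner_zero: "Z p' q' = 0"
      if pq': "p' < d" "q' < d" "row p' \<noteq> row q'" "col p' \<noteq> col q'" and r: "r < d" "row r = row p'" "col r = col q'" for p' q' r
    proof -
      have dist: "r \<noteq> p'" "r \<noteq> q'" "p' \<noteq> q'" using that by auto
      have tC: "transpose q' r \<in> C" and tR: "transpose p' r \<in> R"
        using fixg_transpose pq' r by auto
      \<comment> \<open>\<open>transpose q' r\<close> is a column permutation and
        \<open>transpose p' r\<close> a row permutation. Absorbing both reverses the sign, while by
        this identity the transposition in the middle is unchanged.\<close>
      have braid: "transpose q' r \<circ> transpose p' q' \<circ> transpose p' r = transpose p' q'"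
        using dist by (auto simp: fun_eq_iff transpose_def)
      have "Z p' q' = (\<Sum>\<sigma>\<in>R. \<Sum>\<tau>\<in>C. of_int (sign \<tau>) * P (w \<circ> \<tau> \<circ> transpose p' q' \<circ> (transpose p' r \<circ> \<sigma>)))"
        unfolding Z_def by (rule fixg_sum_left[OF tR, symmetric])
      also have "\<dots> = (\<Sum>\<sigma>\<in>R. \<Sum>\<tau>\<in>C. of_int (sign (\<tau> \<circ> transpose q' r)) *
          P (w \<circ> (\<tau> \<circ> transpose q' r) \<circ> transpose p' q' \<circ> (transpose p' r \<circ> \<sigma>)))"
        by (intro sum.cong[OF refl] fixg_sum_right[OF tC, symmetric])
      also have "\<dots> = (\<Sum>\<sigma>\<in>R. \<Sum>\<tau>\<in>C. - (of_int (sign \<tau>) * P (w \<circ> \<tau> \<circ> transpose p' q' \<circ> \<sigma>)))"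
      proof (rule sum.cong[OF refl], rule sum.cong[OF refl])
        fix \<sigma> \<tau> :: "nat \<Rightarrow> nat" assume "\<tau> \<in> C"
        then have s: "sign (\<tau> \<circ> transpose q' r) = - sign \<tau>"
          using sign_comp[OF fixg_permutes fixg_permutes, OF _ tC] dist by (simp add: sign_swap_id)
        have "w \<circ> (\<tau> \<circ> transpose q' r) \<circ> transpose p' q' \<circ> (transpose p' r \<circ> \<sigma>) =
          w \<circ> \<tau> \<circ> (transpose q' r \<circ> transpose p' q' \<circ> transpose p' r) \<circ> \<sigma>" by (simp only: comp_assoc)
        then show "of_int (sign (\<tau> \<circ> transpose q' r)) *
          P (w \<circ> (\<tau> \<circ> transpose q' r) \<circ> transpose p' q' \<circ> (transpose p' r \<circ> \<sigma>)) =
          - (of_int (sign \<tau>) * P (w \<circ> \<tau> \<circ> transpose p' q' \<circ> \<sigma>))"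
          unfolding braid s by simp
      qed
      also have "\<dots> = - Z p' q'" by (simp add: Z_def sum_negf)
      finally show ?thesis by simp
    qed
    have off: "Z p q = 0" if prem: "row p \<noteq> row q" "col p \<noteq> col q"
    proof -
      obtain r where r: "r < d" "(row r = row p \<and> col r = col q) \<or> (row r = row q \<and> col r = col p)"
        using corner[OF pq prem] by blast
      have "Z p q = Z q p" unfolding Z_def by (simp add: transpose_commute)
      then show ?thesis using r corner_zero[OF pq prem r(1)] corner_zero[OF pq(2,1) prem[symmetric] r(1)] by metis
    qed
    show "(if p \<noteq> q then Z p q else 0) =
      (if p \<noteq> q then (if row p = row q then 1 else if col p = col q then - 1 else 0) else 0) * ysum d row col P w"
      using same_row same_col off by auto
  qed
  finally show ?thesis by (simp add: sum_distrib_right)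
qed

text \<open>A product of a column and a row permutation preserves the rows of all positions only if
  its column part is the identity. No cancellation occurs, and the sum is the order of the row
  group.\<close>

lemma ysum_row_nonzero:
  assumes v: "\<And>p. p < d \<Longrightarrow> v p = row p"
  shows "ysum d row col (\<lambda>w. if \<forall>p<d. w p = row p then 1 else 0) v \<noteq> 0"
proof -
  have "(if \<forall>p<d. (v \<circ> \<tau> \<circ> \<sigma>) p = row p then 1 else 0) = (if \<tau> = id then 1 else 0 :: complex)"
    if "\<sigma> \<in> R" "\<tau> \<in> C" for \<sigma> \<tau>
  proof -
    have \<sigma>: "\<sigma> permutes {..<d}" "\<And>p. p < d \<Longrightarrow> row (\<sigma> p) = row p" and
      \<tau>: "\<tau> permutes {..<d}" "\<And>p. p < d \<Longrightarrow> col (\<tau> p) = col p" using that by (auto simp: fixg_def)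
    have lt: "\<sigma> p < d" "\<tau> p < d" if "p < d" for p
      using permutes_in_image[OF \<sigma>(1), of p] permutes_in_image[OF \<tau>(1), of p] that by auto
    have "(\<forall>p<d. (v \<circ> \<tau> \<circ> \<sigma>) p = row p) \<longleftrightarrow> \<tau> = id"
    proof
      assume L: "\<forall>p<d. (v \<circ> \<tau> \<circ> \<sigma>) p = row p"
      have "\<tau> q = q" for q
      proof (cases "q < d")
        case True
        define p where "p = inv_into UNIV \<sigma> q"
        have p: "p < d" "\<sigma> p = q"
          using permutes_in_image[OF permutes_inv[OF \<sigma>(1)], of q] True permutes_inverses[OF \<sigma>(1)] by (auto simp: p_def)
        then have "row (\<tau> q) = row q" using L v lt \<sigma>(2)[OF p(1)] by (metis comp_apply)
        then show ?thesis using box_inj \<tau>(2) True lt(2)[OF True] unfolding inj_on_def by (metis lessThan_iff)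
      next
        case False
        then show ?thesis using \<tau>(1) permutes_not_in by fastforce
      qed
      then show "\<tau> = id" by auto
    next
      assume "\<tau> = id"
      then show "\<forall>p<d. (v \<circ> \<tau> \<circ> \<sigma>) p = row p" using v lt \<sigma>(2) by simp
    qed
    then show ?thesis by simp
  qed
  then have "ysum d row col (\<lambda>w. if \<forall>p<d. w p = row p then 1 else 0) v =
      (\<Sum>\<sigma>\<in>R. \<Sum>\<tau>\<in>C. of_int (sign \<tau>) * (if \<tau> = id then 1 else 0))"
    unfolding ysum_def by (intro sum.cong[OF refl]) simp
  also have "\<dots> = (\<Sum>\<sigma>\<in>R. \<Sum>\<tau>\<in>C. if \<tau> = id then 1 else 0)"
    by (intro sum.cong[OF refl]) auto
  also have "\<dots> = of_nat (card R)"
  proof -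
    have "id \<in> C" by (simp add: fixg_def permutes_id)
    then show ?thesis using finite_fixg[of d col] by simp
  qed
  moreover have "card R \<noteq> 0"
  proof -
    have "id \<in> R" by (simp add: fixg_def permutes_id)
    then show ?thesis using finite_fixg[of d row] by auto
  qed
  ultimately show ?thesis by simp
qed

end

section \<open>The boxes of a diagram as positions\<close>

lemma boxes_properties:
  "length (boxes \<pi>) = sum_list \<pi>" "distinct (boxes \<pi>)"
  "set (boxes \<pi>) = {(i, j). i < length \<pi> \<and> j < \<pi> ! i}"
proof -
  have "sum_list (map (\<lambda>i. \<pi> ! i) [0..<length \<pi>]) = sum_list \<pi>" by (simp add: map_nth)
  then show "length (boxes \<pi>) = sum_list \<pi>" by (simp add: boxes_def length_concat comp_def)
  show "set (boxes \<pi>) = {(i, j). i < length \<pi> \<and> j < \<pi> ! i}" by (auto simp: boxes_def)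
  have "distinct (concat (map (\<lambda>i. map (Pair i) [0..<\<pi> ! i]) xs))" if "distinct xs" for xs
    using that by (induction xs) (auto simp: distinct_map inj_on_def)
  then show "distinct (boxes \<pi>)" by (simp add: boxes_def)
qed

definition brow :: "nat list \<Rightarrow> nat \<Rightarrow> nat" where "brow \<pi> p = fst (boxes \<pi> ! p)"
definition bcol :: "nat list \<Rightarrow> nat \<Rightarrow> nat" where "bcol \<pi> p = snd (boxes \<pi> ! p)"

lemma box_position:
  assumes "i < length \<pi>" "j < \<pi> ! i"
  obtains p where "p < sum_list \<pi>" "brow \<pi> p = i" "bcol \<pi> p = j"
proof -
  have "(i, j) \<in> set (boxes \<pi>)" using assms by (simp add: boxes_properties)
  then obtain p where "p < length (boxes \<pi>)" "boxes \<pi> ! p = (i, j)" by (meson in_set_conv_nth)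
  then show ?thesis using that by (simp add: boxes_properties brow_def bcol_def)
qed

lemma position_box:
  assumes "p < sum_list \<pi>"
  shows "brow \<pi> p < length \<pi>" "bcol \<pi> p < \<pi> ! brow \<pi> p"
proof -
  have "boxes \<pi> ! p \<in> set (boxes \<pi>)" using assms by (simp add: boxes_properties(1))
  then show "brow \<pi> p < length \<pi>" "bcol \<pi> p < \<pi> ! brow \<pi> p"
    unfolding boxes_properties(3) brow_def bcol_def by auto
qed

lemma box_inj_on: "inj_on (\<lambda>p. (brow \<pi> p, bcol \<pi> p)) {..<sum_list \<pi>}"
proof (rule inj_onI)
  fix p q assume "p \<in> {..<sum_list \<pi>}" "q \<in> {..<sum_list \<pi>}" "(brow \<pi> p, bcol \<pi> p) = (brow \<pi> q, bcol \<pi> q)"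
  then show "p = q"
    using nth_eq_iff_index_eq[OF boxes_properties(2)[of \<pi>], of p q] boxes_properties(1)[of \<pi>]
    by (simp add: brow_def bcol_def prod_eq_iff)
qed

text \<open>Of two boxes in different rows, the upper one lies in a row at least as long as that of
  the lower one; so the upper row reaches the column of the lower box.\<close>

lemma young_shape_boxes:
  assumes "sorted_wrt (\<ge>) \<pi>"
  shows "young_shape (sum_list \<pi>) (brow \<pi>) (bcol \<pi>)"
proof
  show "inj_on (\<lambda>p. (brow \<pi> p, bcol \<pi> p)) {..<sum_list \<pi>}" by (rule box_inj_on)
  fix p q assume pq: "p < sum_list \<pi>" "q < sum_list \<pi>" "brow \<pi> p \<noteq> brow \<pi> q"
  have *: "\<exists>r<sum_list \<pi>. brow \<pi> r = brow \<pi> p' \<and> bcol \<pi> r = bcol \<pi> q'"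
    if "p' < sum_list \<pi>" "q' < sum_list \<pi>" "brow \<pi> p' < brow \<pi> q'" for p' q'
  proof -
    have "\<pi> ! brow \<pi> q' \<le> \<pi> ! brow \<pi> p'"
      using assms that position_box(1)[OF that(2)] by (simp add: sorted_wrt_iff_nth_less)
    then have "bcol \<pi> q' < \<pi> ! brow \<pi> p'" using position_box(2)[OF that(2)] by simp
    then show ?thesis using box_position position_box(1)[OF that(1)] by metis
  qed
  show "\<exists>r<sum_list \<pi>. (brow \<pi> r = brow \<pi> p \<and> bcol \<pi> r = bcol \<pi> q) \<or> (brow \<pi> r = brow \<pi> q \<and> bcol \<pi> r = bcol \<pi> p)"
    using *[OF pq(1,2)] *[OF pq(2,1)] pq(3) by (meson linorder_neqE_nat)
qed

lemma box_column_left: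
  assumes "sorted_wrt (\<ge>) \<pi>" "q < sum_list \<pi>" "i < brow \<pi> q"
  shows "\<exists>r<sum_list \<pi>. bcol \<pi> r = bcol \<pi> q \<and> brow \<pi> r = i"
proof -
  have "\<pi> ! brow \<pi> q \<le> \<pi> ! i"
    using assms position_box(1)[OF assms(2)] by (simp add: sorted_wrt_iff_nth_less)
  then have "bcol \<pi> q < \<pi> ! i" using position_box(2)[OF assms(2)] by simp
  then show ?thesis using box_position position_box(1)[OF assms(2)] assms(3) by (metis order.strict_trans)
qed

lemma cnt_brow: "cnt (sum_list \<pi>) (brow \<pi>) i = part \<pi> i"
proof -
  have "bij_betw (\<lambda>p. boxes \<pi> ! p) {p\<in>{..<sum_list \<pi>}. brow \<pi> p = i} {b \<in> set (boxes \<pi>). fst b = i}"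
    unfolding bij_betw_def
  proof
    show "inj_on (\<lambda>p. boxes \<pi> ! p) {p\<in>{..<sum_list \<pi>}. brow \<pi> p = i}"
      using box_inj_on[of \<pi>] by (auto simp: inj_on_def brow_def bcol_def)
    show "(\<lambda>p. boxes \<pi> ! p) ` {p\<in>{..<sum_list \<pi>}. brow \<pi> p = i} = {b \<in> set (boxes \<pi>). fst b = i}"
      using boxes_properties(1)[of \<pi>] by (auto simp: brow_def set_conv_nth)
  qed
  then have "cnt (sum_list \<pi>) (brow \<pi>) i = card {b \<in> set (boxes \<pi>). fst b = i}"
    unfolding cnt_def by (rule bij_betw_same_card)
  also have "{b \<in> set (boxes \<pi>). fst b = i} = (if i < length \<pi> then Pair i ` {..<\<pi> ! i} else {})"
    unfolding boxes_properties(3) by auto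
  also have "card \<dots> = part \<pi> i" by (auto simp: part_def card_image inj_on_def)
  finally show ?thesis .
qed

section \<open>Coordinates\<close>

lemma additive_sum:
  fixes f :: "'a::ab_group_add \<Rightarrow> 'b::ab_group_add"
  assumes "\<And>x y. f (x + y) = f x + f y"
  shows "f (\<Sum>i\<in>I. g i) = (\<Sum>i\<in>I. f (g i))"
proof -
  have "f 0 = 0" using assms[of 0 0] by simp
  then show ?thesis by (induction I rule: infinite_finite_induct) (simp_all add: assms)
qed

lemma linear_add: "Vector_Spaces.linear s s' f \<Longrightarrow> f (x + y) = f x + f y"
  and linear_scale: "Vector_Spaces.linear s s' f \<Longrightarrow> f (s c x) = s' c (f x)"
  by (simp_all add: Vector_Spaces.linear_iff)

lemma linear_sum: "Vector_Spaces.linear s s' f \<Longrightarrow> f (\<Sum>i\<in>I. g i) = (\<Sum>i\<in>I. f (g i))"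
  by (rule additive_sum) (rule linear_add)

lemma vector_space_complex: "vector_space ((*) :: complex \<Rightarrow> complex \<Rightarrow> complex)"
  by unfold_locales (simp_all add: algebra_simps)

lemma carrier_GL: "g \<in> carrier (GL s) \<longleftrightarrow> Vector_Spaces.linear s s g \<and> bij g"
  by (simp add: GL_def)

lemma group_GL:
  assumes "vector_space s"
  shows "group (GL s)"
proof (rule groupI)
  interpret vector_space s by fact
  show "\<one>\<^bsub>GL s\<^esub> \<in> carrier (GL s)"
    using assms by (simp add: GL_def Vector_Spaces.linear_iff)
  fix x y z assume x: "x \<in> carrier (GL s)" and y: "y \<in> carrier (GL s)" and "z \<in> carrier (GL s)"
  show "x \<otimes>\<^bsub>GL s\<^esub> y \<in> carrier (GL s)"
    using x y Vector_Spaces.linear_compose[of s s y s x] by (simp add: GL_def bij_comp)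
  show "x \<otimes>\<^bsub>GL s\<^esub> y \<otimes>\<^bsub>GL s\<^esub> z = x \<otimes>\<^bsub>GL s\<^esub> (y \<otimes>\<^bsub>GL s\<^esub> z)"
    by (simp add: GL_def comp_assoc)
next
  fix x assume x: "x \<in> carrier (GL s)"
  show "\<one>\<^bsub>GL s\<^esub> \<otimes>\<^bsub>GL s\<^esub> x = x" by (simp add: GL_def)
  have b: "bij x" and l: "Vector_Spaces.linear s s x" using x by (simp_all add: carrier_GL)
  have "Vector_Spaces.linear s s (inv_into UNIV x)"
    unfolding Vector_Spaces.linear_iff
  proof (intro conjI allI)
    fix c a a'
    have inj: "inj x" using b by (rule bij_is_inj)
    have xi: "x (inv_into UNIV x a) = a" for a using b by (simp add: bij_is_surj surj_f_inv_f)
    show "inv_into UNIV x (a + a') = inv_into UNIV x a + inv_into UNIV x a'"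
      by (rule injD[OF inj]) (simp add: xi linear_add[OF l])
    show "inv_into UNIV x (s c a) = s c (inv_into UNIV x a)"
      by (rule injD[OF inj]) (simp add: xi linear_scale[OF l])
  qed (rule assms)+
  moreover have "bij (inv_into UNIV x)" using b by (rule bij_imp_bij_inv)
  ultimately have "inv_into UNIV x \<in> carrier (GL s)" by (simp add: carrier_GL)
  moreover have "inv_into UNIV x \<otimes>\<^bsub>GL s\<^esub> x = \<one>\<^bsub>GL s\<^esub>"
    using b by (simp add: GL_def bij_is_inj)
  ultimately show "\<exists>y\<in>carrier (GL s). y \<otimes>\<^bsub>GL s\<^esub> x = \<one>\<^bsub>GL s\<^esub>" by blast
qed

definition ptw :: "(complex \<Rightarrow> 'a::ab_group_add \<Rightarrow> 'a) \<Rightarrow> 'a list \<Rightarrow> nat \<Rightarrow> (nat \<Rightarrow> nat) \<Rightarrow> ('a \<Rightarrow> complex) list \<Rightarrow> complex" where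
  "ptw s bs d w = pure_tensor s (map (\<lambda>p. bs ! w p) [0..<d])"

definition YS :: "(complex \<Rightarrow> 'a::ab_group_add \<Rightarrow> 'a) \<Rightarrow> 'a list \<Rightarrow> nat list \<Rightarrow> (nat \<Rightarrow> nat) \<Rightarrow> ('a \<Rightarrow> complex) list \<Rightarrow> complex" where
  "YS s bs \<pi> w \<phi>s = ysum (sum_list \<pi>) (brow \<pi>) (bcol \<pi>) (\<lambda>v. ptw s bs (sum_list \<pi>) v \<phi>s) w"

lemma ptw_eq: "ptw s bs d w \<phi>s = (if \<phi>s \<in> covectors s d then \<Prod>p<d. (\<phi>s ! p) (bs ! w p) else 0)"
  by (simp add: ptw_def pure_tensor_def)

lemma ptw_cong: "(\<And>p. p < d \<Longrightarrow> w p = v p) \<Longrightarrow> ptw s bs d w = ptw s bs d v"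
  unfolding ptw_def by (intro arg_cong[of _ _ "pure_tensor s"] map_cong) auto

lemma YS_cong:
  assumes "\<And>p. p < sum_list \<pi> \<Longrightarrow> w p = v p"
  shows "YS s bs \<pi> w = YS s bs \<pi> v"
proof
  fix \<phi>s
  have "ptw s bs (sum_list \<pi>) (w \<circ> \<tau> \<circ> \<sigma>) = ptw s bs (sum_list \<pi>) (v \<circ> \<tau> \<circ> \<sigma>)"
    if "\<sigma> \<in> fixg (sum_list \<pi>) f" "\<tau> \<in> fixg (sum_list \<pi>) g" for \<sigma> \<tau> f g
  proof (rule ptw_cong)
    fix p assume "p < sum_list \<pi>"
    then have "\<tau> (\<sigma> p) < sum_list \<pi>"
      using permutes_in_image[OF fixg_permutes[OF that(1)]] permutes_in_image[OF fixg_permutes[OF that(2)]] by simp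
    then show "(w \<circ> \<tau> \<circ> \<sigma>) p = (v \<circ> \<tau> \<circ> \<sigma>) p" using assms by simp
  qed
  then show "YS s bs \<pi> w \<phi>s = YS s bs \<pi> v \<phi>s"
    unfolding YS_def ysum_def by (intro sum.cong[OF refl]) simp
qed

lemma ptw_permute:
  assumes "\<rho> permutes {..<d}"
  shows "ptw s bs d w (permute_list \<rho> \<phi>s) = ptw s bs d (w \<circ> inv_into UNIV \<rho>) \<phi>s"
proof (cases "length \<phi>s = d")
  case False
  then show ?thesis by (simp add: ptw_eq covectors_def)
next
  case True
  have "set (permute_list \<rho> \<phi>s) = set \<phi>s" using assms True by simp
  then have "permute_list \<rho> \<phi>s \<in> covectors s d \<longleftrightarrow> \<phi>s \<in> covectors s d" by (simp add: covectors_def)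
  moreover have "(\<Prod>p<d. (permute_list \<rho> \<phi>s ! p) (bs ! w p)) = (\<Prod>p<d. (\<phi>s ! p) (bs ! w (inv_into UNIV \<rho> p)))"
  proof -
    have "(\<Prod>p<d. (\<phi>s ! p) (bs ! w (inv_into UNIV \<rho> p))) = (\<Prod>p<d. (\<phi>s ! \<rho> p) (bs ! w (inv_into UNIV \<rho> (\<rho> p))))"
      using prod.permute[OF assms, of "\<lambda>p. (\<phi>s ! p) (bs ! w (inv_into UNIV \<rho> p))"] by (simp add: comp_def)
    also have "\<dots> = (\<Prod>p<d. (permute_list \<rho> \<phi>s ! p) (bs ! w p))"
      using assms True by (intro prod.cong) (simp_all add: permute_list_nth permutes_inverses)
    finally show ?thesis by simp
  qed
  ultimately show ?thesis by (simp add: ptw_eq)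
qed

lemma row_group_eq: "row_group \<pi> = fixg (sum_list \<pi>) (brow \<pi>)"
  and column_group_eq: "column_group \<pi> = fixg (sum_list \<pi>) (bcol \<pi>)"
  by (simp_all add: row_group_def column_group_def fixg_def brow_def bcol_def)

lemma fixg_sum_inv:
  fixes h :: "(nat \<Rightarrow> nat) \<Rightarrow> complex"
  shows "(\<Sum>\<sigma>\<in>fixg d f. h (inv_into UNIV \<sigma>)) = (\<Sum>\<sigma>\<in>fixg d f. h \<sigma>)"
  by (rule sum.reindex_bij_witness[of _ "inv_into UNIV" "inv_into UNIV"])
    (auto simp: fixg_inv inv_inv_eq permutes_bij[OF fixg_permutes])

text \<open>Permuting the functionals amounts to the inverse permutation of the word. Replacing
  \<open>\<sigma>\<close> and \<open>\<tau>\<close> by their inverses, which keeps the signs, turns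
  the order \<open>\<sigma> \<circ> \<tau>\<close> into the order in \<open>ysum\<close>.\<close>

lemma young_symmetrizer_ptw: "young_symmetrizer \<pi> (ptw s bs (sum_list \<pi>) w) = YS s bs \<pi> w"
proof
  fix \<phi>s
  let ?R = "fixg (sum_list \<pi>) (brow \<pi>)" and ?C = "fixg (sum_list \<pi>) (bcol \<pi>)"
  let ?P = "\<lambda>v. ptw s bs (sum_list \<pi>) v \<phi>s"
  have "young_symmetrizer \<pi> (ptw s bs (sum_list \<pi>) w) \<phi>s =
     (\<Sum>\<sigma>\<in>?R. \<Sum>\<tau>\<in>?C. of_int (sign (inv_into UNIV \<tau>)) * ?P (w \<circ> inv_into UNIV \<tau> \<circ> inv_into UNIV \<sigma>))"
    unfolding young_symmetrizer_def row_group_eq column_group_eq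
  proof (rule sum.cong[OF refl], rule sum.cong[OF refl])
    fix \<sigma> \<tau> assume "\<sigma> \<in> ?R" "\<tau> \<in> ?C"
    then have p: "\<sigma> permutes {..<sum_list \<pi>}" "\<tau> permutes {..<sum_list \<pi>}" using fixg_permutes by blast+
    have "inv_into UNIV (\<sigma> \<circ> \<tau>) = inv_into UNIV \<tau> \<circ> inv_into UNIV \<sigma>"
      using permutes_bij p by (intro o_inv_distrib) auto
    moreover have "sign (inv_into UNIV \<tau>) = sign \<tau>"
      using p(2) by (intro sign_inverse) (auto simp: permutation_permutes)
    ultimately show "of_int (sign \<tau>) * ptw s bs (sum_list \<pi>) w (permute_list (\<sigma> \<circ> \<tau>) \<phi>s) =
       of_int (sign (inv_into UNIV \<tau>)) * ?P (w \<circ> inv_into UNIV \<tau> \<circ> inv_into UNIV \<sigma>)"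
      using ptw_permute[OF permutes_compose[OF p(2,1)], of s bs w \<phi>s] by (simp add: comp_assoc)
  qed
  also have "\<dots> = (\<Sum>\<sigma>\<in>?R. \<Sum>\<tau>\<in>?C. of_int (sign \<tau>) * ?P (w \<circ> \<tau> \<circ> inv_into UNIV \<sigma>))"
    by (rule sum.cong[OF refl]) (rule fixg_sum_inv)
  also have "\<dots> = (\<Sum>\<sigma>\<in>?R. \<Sum>\<tau>\<in>?C. of_int (sign \<tau>) * ?P (w \<circ> \<tau> \<circ> \<sigma>))"
    by (rule fixg_sum_inv)
  finally show "young_symmetrizer \<pi> (ptw s bs (sum_list \<pi>) w) \<phi>s = YS s bs \<pi> w \<phi>s"
    by (simp add: YS_def ysum_def)
qed

lemma vector_space_cscale: "vector_space cscale"
  by (rule fun_space.vector_space_axioms)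

lemma linear_young_symmetrizer: "Vector_Spaces.linear cscale cscale (young_symmetrizer \<pi>)"
  unfolding Vector_Spaces.linear_iff
  by (auto simp: vector_space_cscale young_symmetrizer_def cscale_def fun_eq_iff sum.distrib algebra_simps sum_distrib_left)

lemma span_image_fun:
  assumes "Vector_Spaces.linear cscale cscale f"
  shows "fun_space.span (f ` S) = f ` fun_space.span S"
  using module_hom.span_image[of cscale cscale f S] assms unfolding module_hom_iff_linear by blast

lemma range_lin:
  assumes "finite A"
  shows "lin A Q ` supp_on A = fun_space.span (Q ` A)"
proof -
  have "fun_space.span (unitv ` A) = supp_on A"
  proof
    show "fun_space.span (unitv ` A) \<subseteq> supp_on A"
      by (rule fun_space.span_minimal) (auto simp: unitv_supp subspace_supp_on)
  qed (rule supp_on_span[OF assms])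
  moreover have "Vector_Spaces.linear cscale cscale (lin A Q)"
    by (simp add: Vector_Spaces.linear_iff vector_space_cscale lin_add lin_scale)
  moreover have "lin A Q ` unitv ` A = Q ` A"
    unfolding image_image by (rule image_cong[OF refl lin_unitv[OF assms]])
  ultimately show ?thesis by (metis span_image_fun)
qed

lemma tensor_prod_span:
  "tensor_prod (fun_space.span X) (fun_space.span Y) = fun_space.span {(\<lambda>(x, y). a x * b y) | a b. a \<in> X \<and> b \<in> Y}"
    (is "_ = fun_space.span ?S")
proof
  have 1: "(\<lambda>(x, y). a x * b y) \<in> fun_space.span ?S" if "a \<in> fun_space.span X" "b \<in> Y" for a b
    using that(1)
  proof (induction rule: fun_space.span_induct_alt)
    case base
    have "(\<lambda>(x, y). (0 :: 'a \<Rightarrow> complex) x * b y) = 0" by auto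
    then show ?case by (simp only: fun_space.span_zero)
  next
    case (step c x z)
    have eq: "(\<lambda>(u, y). (cscale c x + z) u * b y) = cscale c (\<lambda>(u, y). x u * b y) + (\<lambda>(u, y). z u * b y)"
      by (auto simp: fun_eq_iff cscale_def algebra_simps)
    have "(\<lambda>(u, y). x u * b y) \<in> fun_space.span ?S"
      using step that(2) by (intro fun_space.span_base) blast
    then show ?case unfolding eq using step(2) by (intro fun_space.span_add fun_space.span_scale)
  qed
  have 2: "(\<lambda>(x, y). a x * b y) \<in> fun_space.span ?S" if "a \<in> fun_space.span X" "b \<in> fun_space.span Y" for a b
    using that(2)
  proof (induction rule: fun_space.span_induct_alt)
    case base
    have "(\<lambda>(x, y). a x * (0 :: 'b \<Rightarrow> complex) y) = 0" by auto
    then show ?case by (simp only: fun_space.span_zero)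
  next
    case (step c x z)
    have eq: "(\<lambda>(u, y). a u * (cscale c x + z) y) = cscale c (\<lambda>(u, y). a u * x y) + (\<lambda>(u, y). a u * z y)"
      by (auto simp: fun_eq_iff cscale_def algebra_simps)
    have "(\<lambda>(u, y). a u * x y) \<in> fun_space.span ?S" using 1[OF that(1) step(1)] .
    then show ?case unfolding eq using step(2) by (intro fun_space.span_add fun_space.span_scale)
  qed
  show "tensor_prod (fun_space.span X) (fun_space.span Y) \<subseteq> fun_space.span ?S"
    unfolding tensor_prod_def 
  proof (rule fun_space.span_minimal[OF _ fun_space.subspace_span], rule subsetI)
    fix f assume "f \<in> {(\<lambda>(x, y). a x * b y) | a b. a \<in> fun_space.span X \<and> b \<in> fun_space.span Y}"
    then obtain a b where "a \<in> fun_space.span X" "b \<in> fun_space.span Y" "f = (\<lambda>(x, y). a x * b y)" by blast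
    then show "f \<in> fun_space.span ?S" using 2 by simp
  qed
  show "fun_space.span ?S \<subseteq> tensor_prod (fun_space.span X) (fun_space.span Y)"
    unfolding tensor_prod_def
  proof (rule fun_space.span_mono, rule subsetI)
    fix f assume "f \<in> ?S"
    then obtain a b where ab: "a \<in> X" "b \<in> Y" "f = (\<lambda>(x, y). a x * b y)" by blast
    have "a \<in> fun_space.span X" "b \<in> fun_space.span Y" using ab fun_space.span_base by auto
    then show "f \<in> {(\<lambda>(x, y). a x * b y) | a b. a \<in> fun_space.span X \<and> b \<in> fun_space.span Y}"
      using ab(3) by blast
  qed
qed

section \<open>Tensor powers and Schur functors in a basis\<close>

locale based_space = vector_space s for s :: "complex \<Rightarrow> 'a::ab_group_add \<Rightarrow> 'a" +
  fixes bs :: "'a list"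
  assumes basis: "is_basis s bs"
begin

definition crd :: "nat \<Rightarrow> 'a \<Rightarrow> complex" where
  "crd l a = representation (set bs) a (bs ! l)"

lemma indep: "independent (set bs)" and spanning: "a \<in> span (set bs)" and distinct_basis: "distinct bs"
  using basis by (auto simp: is_basis_def)

lemma crd_basis: "k < length bs \<Longrightarrow> l < length bs \<Longrightarrow> crd l (bs ! k) = (if k = l then 1 else 0)"
  using representation_basis[OF indep, of "bs ! k"] distinct_basis
  by (simp add: crd_def nth_eq_iff_index_eq)

lemma linear_crd: "Vector_Spaces.linear s (*) (crd l)"
  unfolding Vector_Spaces.linear_iff crd_def
  using representation_add[OF indep spanning spanning] representation_scale[OF indep spanning]
  by (simp add: vector_space_complex vector_space_axioms)

lemma expand: "a = (\<Sum>l<length bs. s (crd l a) (bs ! l))"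
proof -
  have "(\<Sum>b\<in>set bs. s (representation (set bs) a b) b) = a"
    by (rule sum_representation_eq[OF indep spanning]) auto
  moreover have "(\<Sum>l<length bs. s (crd l a) (bs ! l)) = (\<Sum>b\<in>set bs. s (representation (set bs) a b) b)"
    unfolding crd_def by (rule sum.reindex_bij_betw[OF bij_betw_nth[OF distinct_basis refl refl]])
  ultimately show ?thesis by simp
qed

lemma functional_expand:
  assumes "Vector_Spaces.linear s (*) \<phi>"
  shows "\<phi> a = (\<Sum>l<length bs. crd l a * \<phi> (bs ! l))"
  by (subst expand[of a]) (simp add: linear_sum[OF assms] linear_scale[OF assms])

lemma map_expand:
  assumes "Vector_Spaces.linear s s g"
  shows "g a = (\<Sum>l<length bs. s (crd l a) (g (bs ! l)))"
  by (subst expand[of a]) (simp add: linear_sum[OF assms] linear_scale[OF assms])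

definition mat :: "('a \<Rightarrow> 'a) \<Rightarrow> nat \<Rightarrow> nat \<Rightarrow> complex" where
  "mat g k l = crd k (g (bs ! l))"

lemma mat_comp:
  assumes "Vector_Spaces.linear s s g"
  shows "mat (g \<circ> h) k l = mm (length bs) (mat g) (mat h) k l"
proof -
  have "crd k (g (h (bs ! l))) = (\<Sum>j<length bs. crd j (h (bs ! l)) * crd k (g (bs ! j)))"
    by (subst map_expand[OF assms]) (simp add: linear_sum[OF linear_crd] linear_scale[OF linear_crd])
  then show ?thesis by (simp add: mat_def mm_def mult.commute)
qed

lemma el_in_GL:
  assumes "i < length bs" "j < length bs" "i \<noteq> j \<or> z \<noteq> - 1"
  shows "\<exists>g\<in>carrier (GL s). \<forall>k<length bs. \<forall>l<length bs. mat g k l = el z i j k l"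
proof -
  define e where "e = (\<lambda>z a. a + s (z * crd j a) (bs ! i))"
  have lin: "Vector_Spaces.linear s s (e z)" for z
    unfolding Vector_Spaces.linear_iff e_def
    by (auto simp: vector_space_axioms linear_add[OF linear_crd] linear_scale[OF linear_crd] scale_left_distrib
      scale_right_distrib distrib_left mult_ac)
  have ee: "e y (e z a) = e (y + z + y * z * crd j (bs ! i)) a" for y z a
  proof -
    have c: "crd j (e z a) = crd j a + z * crd j a * crd j (bs ! i)"
      unfolding e_def linear_add[OF linear_crd] linear_scale[OF linear_crd] ..
    have eq: "z * crd j a + y * crd j (e z a) = (y + z + y * z * crd j (bs ! i)) * crd j a"
      unfolding c by (simp add: ring_distribs)
    have "e y (e z a) = a + (s (z * crd j a) (bs ! i) + s (y * crd j (e z a)) (bs ! i))"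
      unfolding e_def by (simp only: add.assoc)
    also have "\<dots> = a + s (z * crd j a + y * crd j (e z a)) (bs ! i)"
      by (simp only: scale_left_distrib)
    also have "\<dots> = e (y + z + y * z * crd j (bs ! i)) a"
      unfolding eq unfolding e_def ..
    finally show ?thesis .
  qed
  have e0: "e 0 a = a" for a by (simp add: e_def)
  \<comment> \<open>\<open>ee\<close> composes \<open>e y\<close> and \<open>e z\<close> to an
    \<open>e\<close> with parameter \<open>y + z + y * z * crd j (bs ! i)\<close>. This
    \<open>y\<close> makes the parameter 0, so \<open>e y\<close> is the inverse of
    \<open>e z\<close>.\<close>
  define y where "y = (if i = j then - z / (1 + z) else - z)"
  have "y + z + y * z * crd j (bs ! i) = 0"
  proof (cases "i = j")
    case True
    then have nz: "1 + z \<noteq> 0" using assms(3) by (metis add.inverse_inverse add_eq_0_iff)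
    have "y * (1 + z) = - z" using nz True by (simp add: y_def)
    moreover have "y + z + y * z = y * (1 + z) + z" by (simp add: distrib_left)
    moreover have "crd j (bs ! i) = 1" using True assms crd_basis by simp
    ultimately show ?thesis by simp
  next
    case False
    then show ?thesis using assms crd_basis[of i j] by (simp add: y_def)
  qed
  moreover have "z + y + z * y * crd j (bs ! i) = y + z + y * z * crd j (bs ! i)" by (simp add: mult.commute)
  ultimately have "e y (e z a) = a" "e z (e y a) = a" for a by (simp_all only: ee e0)
  then have "bij (e z)" by (metis bijI')
  then have "e z \<in> carrier (GL s)" using lin by (simp add: carrier_GL)
  moreover have "mat (e z) k l = el z i j k l" if "k < length bs" "l < length bs" for k l
    using that assms by (simp add: mat_def e_def linear_add[OF linear_crd] linear_scale[OF linear_crd] crd_basis el_def)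
  ultimately show ?thesis by blast
qed

lemma pure_tensor_expand:
  assumes "length as = d"
  shows "pure_tensor s as \<phi>s = (\<Sum>w\<in>words d (length bs). (\<Prod>p<d. crd (w p) (as ! p)) * ptw s bs d w \<phi>s)"
proof (cases "\<phi>s \<in> covectors s d")
  case True
  then have lin: "Vector_Spaces.linear s (*) (\<phi>s ! p)" if "p < d" for p
    using that by (auto simp: covectors_def)
  have "pure_tensor s as \<phi>s = (\<Prod>p<d. \<Sum>l<length bs. crd l (as ! p) * (\<phi>s ! p) (bs ! l))"
    using True assms functional_expand[OF lin] by (auto simp: pure_tensor_def intro!: prod.cong)
  also have "\<dots> = (\<Sum>w\<in>words d (length bs). \<Prod>p<d. crd (w p) (as ! p) * (\<phi>s ! p) (bs ! w p))"
    unfolding words_def by (rule prod_sum_PiE) auto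
  finally show ?thesis using True by (simp add: prod.distrib ptw_eq)
qed (use assms in \<open>simp add: pure_tensor_def ptw_eq\<close>)

lemma tensor_power_span: "tensor_power s d = fun_space.span (ptw s bs d ` words d (length bs))"
proof
  show "tensor_power s d \<subseteq> fun_space.span (ptw s bs d ` words d (length bs))"
    unfolding tensor_power_def
  proof (rule fun_space.span_minimal)
    show "{pure_tensor s as |as. length as = d} \<subseteq> fun_space.span (ptw s bs d ` words d (length bs))"
    proof
      fix T assume "T \<in> {pure_tensor s as |as. length as = d}"
      then obtain as where as: "length as = d" "T = pure_tensor s as" by blast
      have "T = (\<Sum>w\<in>words d (length bs). cscale (\<Prod>p<d. crd (w p) (as ! p)) (ptw s bs d w))"
        using pure_tensor_expand[OF as(1)] as(2) by (simp add: fun_eq_iff sum_fun_apply cscale_def)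
      then show "T \<in> fun_space.span (ptw s bs d ` words d (length bs))"
        by (simp only:) (intro fun_space.span_sum fun_space.span_scale fun_space.span_base imageI)
    qed
  qed (rule fun_space.subspace_span)
  show "fun_space.span (ptw s bs d ` words d (length bs)) \<subseteq> tensor_power s d"
    unfolding tensor_power_def
  proof (rule fun_space.span_mono, rule image_subsetI)
    fix w assume "w \<in> words d (length bs)"
    show "ptw s bs d w \<in> {pure_tensor s as |as. length as = d}"
      unfolding ptw_def by (rule CollectI, rule exI, rule conjI[OF refl]) simp
  qed
qed

lemma schur_functor_span:
  "schur_functor s \<pi> = fun_space.span (YS s bs \<pi> ` words (sum_list \<pi>) (length bs))"
  unfolding schur_functor_def tensor_power_span span_image_fun[OF linear_young_symmetrizer, symmetric]
  by (simp add: image_image young_symmetrizer_ptw)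

text \<open>Tensors are 0 outside \<open>covectors\<close>. The action respects this convention
  because \<open>g\<close> is bijective, so that linearity of \<open>\<phi> \<circ> g\<close>
  carries over to \<open>\<phi>\<close>.\<close>

lemma covectors_comp:
  assumes "g \<in> carrier (GL s)"
  shows "map (\<lambda>\<phi>. \<phi> \<circ> g) \<phi>s \<in> covectors s d \<longleftrightarrow> \<phi>s \<in> covectors s d"
proof -
  have l: "Vector_Spaces.linear s s g" and b: "bij g" using assms by (simp_all add: carrier_GL)
  have "Vector_Spaces.linear s (*) (\<phi> \<circ> g) \<longleftrightarrow> Vector_Spaces.linear s (*) \<phi>" for \<phi> :: "'a \<Rightarrow> complex"
  proof
    assume L: "Vector_Spaces.linear s (*) (\<phi> \<circ> g)"
    have gi: "g (inv_into UNIV g a) = a" for a using b by (simp add: bij_is_surj surj_f_inv_f)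
    show "Vector_Spaces.linear s (*) \<phi>"
      unfolding Vector_Spaces.linear_iff
    proof (intro conjI allI vector_space_axioms vector_space_complex)
      fix a a' c
      show "\<phi> (a + a') = \<phi> a + \<phi> a'"
        using linear_add[OF L, of "inv_into UNIV g a" "inv_into UNIV g a'"] by (simp add: linear_add[OF l] gi)
      show "\<phi> (s c a) = c * \<phi> a"
        using linear_scale[OF L, of c "inv_into UNIV g a"] by (simp add: linear_scale[OF l] gi)
    qed
  qed (rule Vector_Spaces.linear_compose[OF l])
  then show ?thesis by (auto simp: covectors_def)
qed

lemma ptw_act:
  assumes g: "g \<in> carrier (GL s)"
  shows "ptw s bs d w (map (\<lambda>\<phi>. \<phi> \<circ> g) \<phi>s) =
    (\<Sum>v\<in>words d (length bs). (\<Prod>p<d. mat g (v p) (w p)) * ptw s bs d v \<phi>s)"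
proof -
  let ?as = "map (\<lambda>p. g (bs ! w p)) [0..<d]"
  have "ptw s bs d w (map (\<lambda>\<phi>. \<phi> \<circ> g) \<phi>s) = pure_tensor s ?as \<phi>s"
    unfolding ptw_eq covectors_comp[OF g] pure_tensor_def by (auto simp: covectors_def intro!: prod.cong)
  then show ?thesis using pure_tensor_expand[of ?as d \<phi>s] by (simp add: mat_def)
qed

text \<open>Permuting positions commutes with applying the same matrix at every position.\<close>

lemma YS_act:
  assumes g: "g \<in> carrier (GL s)"
  shows "YS s bs \<pi> w (map (\<lambda>\<phi>. \<phi> \<circ> g) \<phi>s) =
    (\<Sum>v\<in>words (sum_list \<pi>) (length bs). (\<Prod>p<sum_list \<pi>. mat g (v p) (w p)) * YS s bs \<pi> v \<phi>s)"
proof -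
  let ?d = "sum_list \<pi>"
  let ?R = "fixg ?d (brow \<pi>)" and ?C = "fixg ?d (bcol \<pi>)" and ?W = "words ?d (length bs)"
  have 1: "ptw s bs ?d (w \<circ> \<tau> \<circ> \<sigma>) (map (\<lambda>\<phi>. \<phi> \<circ> g) \<phi>s) =
      (\<Sum>v\<in>?W. (\<Prod>p<?d. mat g (v p) (w p)) * ptw s bs ?d (v \<circ> \<tau> \<circ> \<sigma>) \<phi>s)"
    if "\<sigma> \<in> ?R" "\<tau> \<in> ?C" for \<sigma> \<tau>
  proof -
    define \<rho> where "\<rho> = \<tau> \<circ> \<sigma>"
    have \<rho>: "\<rho> permutes {..<?d}" using that fixg_permutes permutes_compose unfolding \<rho>_def by blast
    have "ptw s bs ?d (w \<circ> \<rho>) (map (\<lambda>\<phi>. \<phi> \<circ> g) \<phi>s) =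
        (\<Sum>v\<in>?W. (\<Prod>p<?d. mat g (v p) ((w \<circ> \<rho>) p)) * ptw s bs ?d v \<phi>s)" by (rule ptw_act[OF g])
    also have "\<dots> = (\<Sum>v\<in>?W. (\<Prod>p<?d. mat g (v p) (w p)) * ptw s bs ?d (v \<circ> \<rho>) \<phi>s)"
    proof (rule sum.reindex_bij_witness[of _ "\<lambda>v. v \<circ> \<rho>" "\<lambda>v. v \<circ> inv_into UNIV \<rho>"])
      fix v assume v: "v \<in> ?W"
      show "v \<circ> inv_into UNIV \<rho> \<circ> \<rho> = v" "v \<circ> \<rho> \<circ> inv_into UNIV \<rho> = v"
        by (simp_all add: fun_eq_iff permutes_inverses[OF \<rho>])
      show "v \<circ> \<rho> \<in> ?W" "v \<circ> inv_into UNIV \<rho> \<in> ?W"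
        using words_comp[OF v] \<rho> permutes_inv[OF \<rho>] by blast+
      have "(\<Prod>p<?d. mat g ((v \<circ> inv_into UNIV \<rho>) p) (w p)) = (\<Prod>p<?d. mat g (v p) ((w \<circ> \<rho>) p))"
        using prod.permute[OF \<rho>, of "\<lambda>p. mat g ((v \<circ> inv_into UNIV \<rho>) p) (w p)"]
        by (simp add: comp_def permutes_inverses[OF \<rho>])
      then show "(\<Prod>p<?d. mat g ((v \<circ> inv_into UNIV \<rho>) p) (w p)) * ptw s bs ?d (v \<circ> inv_into UNIV \<rho> \<circ> \<rho>) \<phi>s =
          (\<Prod>p<?d. mat g (v p) ((w \<circ> \<rho>) p)) * ptw s bs ?d v \<phi>s"
        by (simp add: comp_assoc permutes_inv_o[OF \<rho>])
    qed
    finally show ?thesis by (simp add: \<rho>_def comp_assoc)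
  qed
  have "YS s bs \<pi> w (map (\<lambda>\<phi>. \<phi> \<circ> g) \<phi>s) = (\<Sum>\<sigma>\<in>?R. \<Sum>\<tau>\<in>?C. of_int (sign \<tau>) *
      (\<Sum>v\<in>?W. (\<Prod>p<?d. mat g (v p) (w p)) * ptw s bs ?d (v \<circ> \<tau> \<circ> \<sigma>) \<phi>s))"
    unfolding YS_def ysum_def by (intro sum.cong[OF refl]) (simp add: 1)
  also have "\<dots> = (\<Sum>\<sigma>\<in>?R. \<Sum>\<tau>\<in>?C. \<Sum>v\<in>?W. (\<Prod>p<?d. mat g (v p) (w p)) * (of_int (sign \<tau>) * ptw s bs ?d (v \<circ> \<tau> \<circ> \<sigma>) \<phi>s))"
    by (simp add: sum_distrib_left mult_ac)
  also have "\<dots> = (\<Sum>v\<in>?W. \<Sum>\<sigma>\<in>?R. \<Sum>\<tau>\<in>?C. (\<Prod>p<?d. mat g (v p) (w p)) * (of_int (sign \<tau>) * ptw s bs ?d (v \<circ> \<tau> \<circ> \<sigma>) \<phi>s))"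
    by (rule sum_rotate3[symmetric])
  finally show ?thesis by (simp add: YS_def ysum_def sum_distrib_left)
qed

text \<open>Evaluation at the coordinate functionals named by the rows picks out the words that
  agree with \<open>brow \<pi>\<close>, which reduces the claim to
  \<open>ysum_row_nonzero\<close>.\<close>

lemma YS_row_nonzero:
  assumes "sorted_wrt (\<ge>) \<pi>" "\<And>p. p < sum_list \<pi> \<Longrightarrow> brow \<pi> p < length bs"
    and v: "\<And>p. p < sum_list \<pi> \<Longrightarrow> v p = brow \<pi> p"
  shows "YS s bs \<pi> v (map (\<lambda>p. crd (brow \<pi> p)) [0..<sum_list \<pi>]) \<noteq> 0"
proof -
  let ?d = "sum_list \<pi>" and ?\<phi> = "map (\<lambda>p. crd (brow \<pi> p)) [0..<sum_list \<pi>]"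
  interpret young_shape ?d "brow \<pi>" "bcol \<pi>" using young_shape_boxes assms(1) .
  have cov: "?\<phi> \<in> covectors s ?d" by (auto simp: covectors_def linear_crd)
  have "ptw s bs ?d w ?\<phi> = (if \<forall>p<?d. w p = brow \<pi> p then 1 else 0)"
    if w: "\<And>p. p < ?d \<Longrightarrow> w p < length bs" for w
  proof -
    have "ptw s bs ?d w ?\<phi> = (\<Prod>p<?d. if w p = brow \<pi> p then 1 else 0)"
      using cov unfolding ptw_eq by (auto intro!: prod.cong simp: crd_basis w assms(2))
    then show ?thesis by (auto intro!: prod.neutral prod_zero)
  qed
  moreover have "(v \<circ> \<tau> \<circ> \<sigma>) p < length bs" if "\<sigma> \<in> R" "\<tau> \<in> C" "p < ?d" for \<sigma> \<tau> p
  proof -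
    have "\<tau> (\<sigma> p) < ?d"
      using that permutes_in_image[OF fixg_permutes[OF that(1)]] permutes_in_image[OF fixg_permutes[OF that(2)]] by simp
    then show ?thesis using v assms(2) by simp
  qed
  ultimately have "YS s bs \<pi> v ?\<phi> = ysum ?d (brow \<pi>) (bcol \<pi>) (\<lambda>w. if \<forall>p<?d. w p = brow \<pi> p then 1 else 0) v"
    unfolding YS_def ysum_def by (intro sum.cong[OF refl]) simp
  then show ?thesis using ysum_row_nonzero[OF v] by simp
qed

text \<open>The first column has more boxes than there are letters, so every word repeats a letter
  in it and is antisymmetrized to 0.\<close>

lemma schur_functor_zero:
  assumes "sorted_wrt (\<ge>) \<pi>" "length bs < length \<pi>" "\<pi> ! length bs > 0"
  shows "schur_functor s \<pi> = {0}"
proof -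
  let ?d = "sum_list \<pi>"
  interpret young_shape ?d "brow \<pi>" "bcol \<pi>" using young_shape_boxes assms(1) .
  have "YS s bs \<pi> w = 0" if w: "w \<in> words ?d (length bs)" for w
  proof (rule ccontr)
    assume "YS s bs \<pi> w \<noteq> 0"
    then obtain \<phi> where \<phi>: "YS s bs \<pi> w \<phi> \<noteq> 0" by (auto simp: fun_eq_iff)
    define S where "S = {p\<in>{..<?d}. bcol \<pi> p = 0}"
    have "inj_on w S"
      by (rule inj_onI, rule ccontr) (use ysum_duplicate \<phi> in \<open>auto simp: S_def YS_def\<close>)
    then have "card S \<le> length bs"
      using card_inj_on_le[of w S "{..<length bs}"] words_less[OF w] by (auto simp: S_def)
    obtain q where q: "q < ?d" "brow \<pi> q = length bs" "bcol \<pi> q = 0"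
      using box_position assms by metis
    have "{..length bs} \<subseteq> brow \<pi> ` S"
    proof
      fix i assume "i \<in> {..length bs}"
      then show "i \<in> brow \<pi> ` S"
        using q box_column_left[OF assms(1) q(1), of i] by (cases "i = length bs") (auto simp: S_def image_iff)
    qed
    then have "card {..length bs} \<le> card S"
      by (rule surj_card_le[rotated]) (simp add: S_def)
    then show False using \<open>card S \<le> length bs\<close> by simp
  qed
  then have "YS s bs \<pi> ` words ?d (length bs) \<subseteq> {0}" by auto
  then have "schur_functor s \<pi> \<subseteq> {0}"
    unfolding schur_functor_span by (intro fun_space.span_minimal) (auto simp: fun_space.subspace_def cscale_def fun_eq_iff)
  moreover have "0 \<in> schur_functor s \<pi>" unfolding schur_functor_span by (rule fun_space.span_zero)
  ultimately show ?thesis by blast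
qed

end

section \<open>Words in the letters of two spaces\<close>

text \<open>The letters below \<open>K\<close> belong to the first space, the letter \<open>K + i\<close> is letter \<open>i\<close> of the second.\<close>

definition pat :: "nat \<Rightarrow> nat \<Rightarrow> nat \<Rightarrow> (nat \<Rightarrow> nat) \<Rightarrow> bool" where
  "pat m l K w \<longleftrightarrow> (\<forall>p<m. w p < K) \<and> (\<forall>p<l. K \<le> w (m + p))"

definition rgt :: "nat \<Rightarrow> nat \<Rightarrow> (nat \<Rightarrow> nat) \<Rightarrow> nat \<Rightarrow> nat" where
  "rgt m K w = (\<lambda>p. w (m + p) - K)"

definition joinw :: "nat \<Rightarrow> nat \<Rightarrow> nat \<Rightarrow> (nat \<Rightarrow> nat) \<Rightarrow> (nat \<Rightarrow> nat) \<Rightarrow> nat \<Rightarrow> nat" where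
  "joinw m l K u v = (\<lambda>p. if p < m then u p else if p < m + l then K + v (p - m) else undefined)"

definition bmat :: "nat \<Rightarrow> (nat \<Rightarrow> nat \<Rightarrow> complex) \<Rightarrow> (nat \<Rightarrow> nat \<Rightarrow> complex) \<Rightarrow> nat \<Rightarrow> nat \<Rightarrow> complex" where
  "bmat K A B i j = (if i < K \<and> j < K then A i j else if K \<le> i \<and> K \<le> j then B (i - K) (j - K) else 0)"

lemma prod_split: "(\<Prod>p<m + l. f p) = (\<Prod>p<m. f p) * (\<Prod>p<l. f (m + p))" for f :: "nat \<Rightarrow> 'a::comm_monoid_mult"
  by (induction l) (simp_all add: mult.assoc)

lemma joinw_words:
  assumes "\<And>p. p < m \<Longrightarrow> u p < K" "\<And>p. p < l \<Longrightarrow> v p < n"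
  shows "joinw m l K u v \<in> words (m + l) (K + n)"
proof -
  have "joinw m l K u v p < K + n" if "p < m + l" for p
    using assms(1)[of p] assms(2)[of "p - m"] that by (auto simp: joinw_def)
  then show ?thesis by (auto simp: words_def PiE_iff extensional_def joinw_def)
qed

lemma pat_joinw: "(\<And>p. p < m \<Longrightarrow> u p < K) \<Longrightarrow> pat m l K (joinw m l K u v)"
  by (simp add: pat_def joinw_def)

lemma rgt_joinw: "p < l \<Longrightarrow> rgt m K (joinw m l K u v) p = v p"
  by (simp add: rgt_def joinw_def)

lemma rgt_less:
  assumes "w \<in> words (m + l) (K + n)" "pat m l K w" "p < l"
  shows "rgt m K w p < n"
proof -
  have "w (m + p) < K + n" using words_less[OF assms(1)] assms(3) by simp
  moreover have "K \<le> w (m + p)" using assms(2,3) by (simp add: pat_def)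
  ultimately show ?thesis by (simp add: rgt_def)
qed

lemma sum_pat:
  fixes F :: "(nat \<Rightarrow> nat) \<Rightarrow> complex"
  shows "(\<Sum>w\<in>words (m + l) (K + n). if pat m l K w then F w else 0) =
    (\<Sum>u\<in>words m K. \<Sum>v\<in>words l n. F (joinw m l K u v))"
proof -
  have "(\<Sum>w\<in>words (m + l) (K + n). if pat m l K w then F w else 0) =
      (\<Sum>w\<in>{w\<in>words (m + l) (K + n). pat m l K w}. F w)"
    by (simp add: sum.If_cases Int_def)
  also have "\<dots> = (\<Sum>(u, v)\<in>words m K \<times> words l n. F (joinw m l K u v))"
  proof (rule sum.reindex_bij_witness[of _ "\<lambda>(u, v). joinw m l K u v"
        "\<lambda>w. (restrict w {..<m}, restrict (rgt m K w) {..<l})"])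
    fix w assume "w \<in> {w\<in>words (m + l) (K + n). pat m l K w}"
    then have w: "w \<in> words (m + l) (K + n)" "pat m l K w" by auto
    have "joinw m l K (restrict w {..<m}) (restrict (rgt m K w) {..<l}) p = w p" for p
    proof -
      consider "p < m" | q where "p = m + q" "q < l" | "\<not> p < m + l"
        by (metis add_diff_inverse_nat nat_add_left_cancel_less)
      then show ?thesis
      proof cases
        case 2
        then show ?thesis using w(2) by (simp add: joinw_def rgt_def pat_def)
      next
        case 3
        then have "w p = undefined" using w(1) by (auto simp: words_def PiE_iff extensional_def)
        then show ?thesis using 3 by (simp add: joinw_def)
      qed (simp add: joinw_def)
    qed
    then have eq: "joinw m l K (restrict w {..<m}) (restrict (rgt m K w) {..<l}) = w" by auto
    then show "(case (restrict w {..<m}, restrict (rgt m K w) {..<l}) of (u, v) \<Rightarrow> joinw m l K u v) = w" by simp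
    show "(restrict w {..<m}, restrict (rgt m K w) {..<l}) \<in> words m K \<times> words l n"
      using w rgt_less[OF w] by (auto simp: words_def pat_def)
    show "(case (restrict w {..<m}, restrict (rgt m K w) {..<l}) of (u, v) \<Rightarrow> F (joinw m l K u v)) = F w"
      using eq by simp
  next
    fix b assume b: "b \<in> words m K \<times> words l n"
    obtain u v where uv: "b = (u, v)" by (cases b)
    have u: "u \<in> words m K" and v: "v \<in> words l n" using b uv by auto
    have ul: "\<And>p. p < m \<Longrightarrow> u p < K" and vl: "\<And>p. p < l \<Longrightarrow> v p < n"
      using words_less u v by auto
    show "(case b of (u, v) \<Rightarrow> joinw m l K u v) \<in> {w\<in>words (m + l) (K + n). pat m l K w}"
      using joinw_words[of m u K l v n] pat_joinw[of m u K l v] ul vl uv by simp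
    have "restrict (joinw m l K u v) {..<m} = u"
      using u by (auto simp: words_def PiE_iff extensional_def joinw_def restrict_def)
    moreover have "restrict (rgt m K (joinw m l K u v)) {..<l} = v"
      using v by (auto simp: words_def PiE_iff extensional_def rgt_joinw restrict_def)
    ultimately show "(restrict (case b of (u, v) \<Rightarrow> joinw m l K u v) {..<m},
        restrict (rgt m K (case b of (u, v) \<Rightarrow> joinw m l K u v)) {..<l}) = b"
      using uv by simp
  qed
  finally show ?thesis by (simp add: sum.cartesian_product)
qed

lemma cnt_pat:
  assumes "pat m l K w"
  shows "i < K \<Longrightarrow> cnt (m + l) w i = cnt m w i" "cnt (m + l) w (K + i) = cnt l (rgt m K w) i"
proof -
  have "K \<le> w p" if "m \<le> p" "p < m + l" for p
    using assms that unfolding pat_def by (metis le_add_diff_inverse nat_add_left_cancel_less)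
  then have "{p\<in>{..<m + l}. w p = i} = {p\<in>{..<m}. w p = i}" if "i < K" for i
    using that by (auto simp: not_le[symmetric])
  then show "i < K \<Longrightarrow> cnt (m + l) w i = cnt m w i" by (simp add: cnt_def)
  have "{p\<in>{..<m + l}. w p = K + i} = (\<lambda>p. m + p) ` {p\<in>{..<l}. rgt m K w p = i}"
  proof
    show "(\<lambda>p. m + p) ` {p\<in>{..<l}. rgt m K w p = i} \<subseteq> {p\<in>{..<m + l}. w p = K + i}"
      using assms by (auto simp: rgt_def pat_def)
    show "{p\<in>{..<m + l}. w p = K + i} \<subseteq> (\<lambda>p. m + p) ` {p\<in>{..<l}. rgt m K w p = i}"
    proof
      fix p assume p: "p \<in> {p\<in>{..<m + l}. w p = K + i}"
      then have "\<not> p < m" using assms by (force simp: pat_def)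
      then have "p - m \<in> {p\<in>{..<l}. rgt m K w p = i}" "p = m + (p - m)" using p by (auto simp: rgt_def)
      then show "p \<in> (\<lambda>p. m + p) ` {p\<in>{..<l}. rgt m K w p = i}" by blast
    qed
  qed
  then show "cnt (m + l) w (K + i) = cnt l (rgt m K w) i"
    by (simp add: cnt_def card_image)
qed

lemma sum_block: "(\<Sum>p<m + l. f p) = (\<Sum>p<m. f p) + (\<Sum>p<l. f (m + p))" for f :: "nat \<Rightarrow> 'a::comm_monoid_add"
  by (induction l) (simp_all add: add.assoc)

lemma blk_sym: "blk K i j \<Longrightarrow> blk K j i"
  by (simp add: blk_def)

lemma pat_swap:
  assumes "p < m + l" "q < m + l" "w p < K \<longleftrightarrow> w q < K"
  shows "pat m l K (w \<circ> transpose p q) \<longleftrightarrow> pat m l K w"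
proof -
  have "(w \<circ> transpose p q) r < K \<longleftrightarrow> w r < K" for r
    using assms(3) by (auto simp: transpose_def)
  then show ?thesis unfolding pat_def not_less[symmetric] by simp
qed

lemma lin_act:
  "lin (words d N) Q (act d N X x) z =
     (\<Sum>w\<in>words d N. x w * (\<Sum>v\<in>words d N. (\<Prod>p<d. X (v p) (w p)) * Q v z))"
proof -
  have "lin (words d N) Q (act d N X x) z = (\<Sum>v\<in>words d N. \<Sum>w\<in>words d N. (\<Prod>p<d. X (v p) (w p)) * x w * Q v z)"
    by (simp add: lin_def act_def sum_distrib_right)
  also have "\<dots> = (\<Sum>w\<in>words d N. \<Sum>v\<in>words d N. (\<Prod>p<d. X (v p) (w p)) * x w * Q v z)"
    by (rule sum.swap)
  finally show ?thesis by (simp add: sum_distrib_left mult_ac)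
qed

lemma lin_swaps_eigen:
  assumes "\<And>w z. w \<in> words d N \<Longrightarrow>
    (\<Sum>p<d. \<Sum>q<d. if p \<noteq> q \<and> w p \<in> B \<and> w q \<in> B then Q (w \<circ> transpose p q) z else 0) = \<kappa> * Q w z"
  shows "lin (words d N) Q (Sw d N B x) = cscale \<kappa> (lin (words d N) Q x)"
proof
  fix z
  have "lin (words d N) Q (Sw d N B x) z = (\<Sum>w\<in>words d N. x w * (\<kappa> * Q w z))"
    unfolding lin_Sw using assms by (intro sum.cong[OF refl]) simp
  then show "lin (words d N) Q (Sw d N B x) z = cscale \<kappa> (lin (words d N) Q x) z"
    by (simp add: lin_def cscale_def sum_distrib_left mult_ac)
qed

lemma casimir_weights:
  fixes c p :: "nat \<Rightarrow> nat"
  assumes "\<And>i. Suc i < n \<Longrightarrow> c (Suc i) \<le> c i" "\<And>i. Suc i < n \<Longrightarrow> p (Suc i) \<le> p i"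
    and part: "\<And>k. k \<le> n \<Longrightarrow> (\<Sum>i<k. c i) \<le> (\<Sum>i<k. p i)" and tot: "(\<Sum>i<n. c i) = (\<Sum>i<n. p i)"
    and eq: "kap {..<n} c = kap {..<n} p" and "i < n"
  shows "c i = p i"
proof -
  have "int (c i) = int (p i)"
  proof (rule casimir_dominance[of n "\<lambda>i. int (c i)" "\<lambda>i. int (p i)", OF _ _ _ _ _ \<open>i < n\<close>])
    fix k assume "k \<le> n"
    then show "(\<Sum>i<k. int (c i)) \<le> (\<Sum>i<k. int (p i))"
      using part unfolding of_nat_sum[symmetric] of_nat_le_iff by blast
  next
    show "(\<Sum>i<n. int (c i)) = (\<Sum>i<n. int (p i))" using tot unfolding of_nat_sum[symmetric] of_nat_eq_iff .
  qed (use assms(1,2) eq in \<open>simp_all add: kap_lessThan\<close>)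
  then show ?thesis by simp
qed

section \<open>Products of Schur functors\<close>

locale two_spaces = U: based_space sU us + V: based_space sV vs
  for sU :: "complex \<Rightarrow> 'u::ab_group_add \<Rightarrow> 'u" and us and sV :: "complex \<Rightarrow> 'v::ab_group_add \<Rightarrow> 'v" and vs
begin

abbreviation "K \<equiv> length us"
abbreviation "n \<equiv> length vs"

definition gmat :: "('u \<Rightarrow> 'u) \<times> ('v \<Rightarrow> 'v) \<Rightarrow> nat \<Rightarrow> nat \<Rightarrow> complex" where
  "gmat gh = bmat K (U.mat (fst gh)) (V.mat (snd gh))"

lemma id_GL: "id \<in> carrier (GL sU)" "id \<in> carrier (GL sV)"
  using U.vector_space_axioms V.vector_space_axioms by (simp_all add: carrier_GL Vector_Spaces.linear_iff)

lemma mat_id: "i < K \<Longrightarrow> j < K \<Longrightarrow> U.mat id i j = (if i = j then 1 else 0)"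
  "i < n \<Longrightarrow> j < n \<Longrightarrow> V.mat id i j = (if i = j then 1 else 0)"
  by (auto simp: U.mat_def V.mat_def U.crd_basis V.crd_basis)

lemma el_gmat:
  assumes "i < K + n" "j < K + n" "blk K i j" "i \<noteq> j \<or> z \<noteq> - 1"
  obtains gh where "gh \<in> carrier (GL sU \<times>\<times> GL sV)"
    "\<And>a b. a < K + n \<Longrightarrow> b < K + n \<Longrightarrow> gmat gh a b = el z i j a b"
proof (cases "i < K")
  case True
  then have "j < K" using assms(3) by (simp add: blk_def)
  obtain g where g: "g \<in> carrier (GL sU)" "\<And>k l. k < K \<Longrightarrow> l < K \<Longrightarrow> U.mat g k l = el z i j k l"
    using U.el_in_GL[OF True \<open>j < K\<close> assms(4)] by blast
  have "gmat (g, id) a b = el z i j a b" if "a < K + n" "b < K + n" for a b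
    using that True \<open>j < K\<close> by (auto simp: gmat_def bmat_def g(2) mat_id el_def)
  then show ?thesis using that[of "(g, id)"] g(1) id_GL by simp
next
  case False
  then have jK: "\<not> j < K" using assms(3) by (simp add: blk_def)
  have c: "i - K < n" "j - K < n" "i - K \<noteq> j - K \<or> z \<noteq> - 1" using False jK assms by auto
  obtain h where h: "h \<in> carrier (GL sV)" "\<And>k l. k < n \<Longrightarrow> l < n \<Longrightarrow> V.mat h k l = el z (i - K) (j - K) k l"
    using V.el_in_GL[OF c] by blast
  have "gmat (id, h) a b = el z i j a b" if ab: "a < K + n" "b < K + n" for a b
  proof (cases "K \<le> a \<and> K \<le> b")
    case True
    then have "a - K < n" "b - K < n" and eq: "a - K = b - K \<longleftrightarrow> a = b" "a - K = i - K \<longleftrightarrow> a = i" "b - K = j - K \<longleftrightarrow> b = j"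
      using ab False jK by auto
    then have "V.mat h (a - K) (b - K) = el z i j a b" unfolding h(2)[OF \<open>a - K < n\<close> \<open>b - K < n\<close>] el_def eq by simp
    then show ?thesis using True by (simp add: gmat_def bmat_def)
  next
    case F: False
    then have "\<not> (a = i \<and> b = j)" using False jK by auto
    then have "el z i j a b = (if a = b then 1 else 0)" by (auto simp: el_def)
    moreover have "gmat (id, h) a b = (if a = b then 1 else 0)" using F by (auto simp: gmat_def bmat_def mat_id)
    ultimately show ?thesis by simp
  qed
  then show ?thesis using that[of "(id, h)"] h(1) id_GL by simp
qed

end

text \<open>The assumption \<open>rows\<close> makes row numbers available as letters; the highest
  weight word \<open>stop\<close> needs a letter for every row of each diagram.\<close>

locale schur_pair = two_spaces sU us sV vs
  for sU :: "complex \<Rightarrow> 'u::ab_group_add \<Rightarrow> 'u" and us and sV :: "complex \<Rightarrow> 'v::ab_group_add \<Rightarrow> 'v" and vs +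
  fixes \<pi> \<mu> :: "nat list"
  assumes sorted: "sorted_wrt (\<ge>) \<pi>" "sorted_wrt (\<ge>) \<mu>"
    and rows: "\<And>p. p < sum_list \<pi> \<Longrightarrow> brow \<pi> p < length us" "\<And>p. p < sum_list \<mu> \<Longrightarrow> brow \<mu> p < length vs"
begin

abbreviation "m \<equiv> sum_list \<pi>"
abbreviation "l \<equiv> sum_list \<mu>"

text \<open>Words off the pattern are sent to 0. Block diagonal matrices respect the pattern, so
  both factors are handled by one action on words of length \<open>m + l\<close>.\<close>

definition SQ :: "(nat \<Rightarrow> nat) \<Rightarrow> ('u \<Rightarrow> complex) list \<times> ('v \<Rightarrow> complex) list \<Rightarrow> complex" where
  "SQ w = (\<lambda>(\<phi>, \<psi>). if pat m l K w then YS sU us \<pi> w \<phi> * YS sV vs \<mu> (rgt m K w) \<psi> else 0)"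

text \<open>Every box carries its own row number; in either factor this is the word of highest
  weight.\<close>

definition stop :: "nat \<Rightarrow> nat" where
  "stop = joinw m l K (brow \<pi>) (brow \<mu>)"

sublocale YU: young_shape m "brow \<pi>" "bcol \<pi>" by (rule young_shape_boxes[OF sorted(1)])
sublocale YV: young_shape l "brow \<mu>" "bcol \<mu>" by (rule young_shape_boxes[OF sorted(2)])

lemma stop_words: "stop \<in> words (m + l) (K + n)"
  unfolding stop_def by (rule joinw_words) (simp_all add: rows)

lemma stop_pat: "pat m l K stop"
  unfolding stop_def by (rule pat_joinw) (rule rows)

lemma SQ_range: "lin (words (m + l) (K + n)) SQ ` supp_on (words (m + l) (K + n)) =
    tensor_prod (schur_functor sU \<pi>) (schur_functor sV \<mu>)"
proof -
  let ?W = "words (m + l) (K + n)"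
  let ?S = "{(\<lambda>(x, y). a x * b y) | a b. a \<in> YS sU us \<pi> ` words m K \<and> b \<in> YS sV vs \<mu> ` words l n}"
  have SQj: "SQ (joinw m l K u v) = (\<lambda>(x, y). YS sU us \<pi> u x * YS sV vs \<mu> v y)" if "\<And>p. p < m \<Longrightarrow> u p < K" for u v
  proof -
    have "YS sU us \<pi> (joinw m l K u v) = YS sU us \<pi> u" by (rule YS_cong) (simp add: joinw_def)
    moreover have "YS sV vs \<mu> (rgt m K (joinw m l K u v)) = YS sV vs \<mu> v" by (rule YS_cong) (simp add: rgt_joinw)
    ultimately show ?thesis using pat_joinw[of m u K l v] that by (simp add: SQ_def)
  qed
  have "fun_space.span (SQ ` ?W) = fun_space.span ?S"
  proof
    show "fun_space.span (SQ ` ?W) \<subseteq> fun_space.span ?S"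
    proof (rule fun_space.span_minimal[OF _ fun_space.subspace_span], rule image_subsetI)
      fix w assume w: "w \<in> ?W"
      show "SQ w \<in> fun_space.span ?S"
      proof (cases "pat m l K w")
        case True
        let ?u = "restrict w {..<m}" and ?v = "restrict (rgt m K w) {..<l}"
        have "YS sU us \<pi> w = YS sU us \<pi> ?u" by (rule YS_cong) simp
        moreover have "YS sV vs \<mu> (rgt m K w) = YS sV vs \<mu> ?v" by (rule YS_cong) simp
        ultimately have "SQ w = (\<lambda>(x, y). YS sU us \<pi> ?u x * YS sV vs \<mu> ?v y)" using True by (simp add: SQ_def)
        moreover have "?u \<in> words m K" "?v \<in> words l n"
          using True rgt_less[OF w True] by (auto simp: words_def pat_def)
        ultimately show ?thesis by (intro fun_space.span_base) blast
      next
        case False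
        then have "SQ w = 0" by (auto simp: SQ_def)
        then show ?thesis by (simp only: fun_space.span_zero)
      qed
    qed
    show "fun_space.span ?S \<subseteq> fun_space.span (SQ ` ?W)"
    proof (rule fun_space.span_mono, rule subsetI)
      fix f assume "f \<in> ?S"
      then obtain u v where uv: "u \<in> words m K" "v \<in> words l n" "f = (\<lambda>(x, y). YS sU us \<pi> u x * YS sV vs \<mu> v y)" by auto
      have "f = SQ (joinw m l K u v)" using SQj words_less[OF uv(1)] uv(3) by simp
      moreover have "joinw m l K u v \<in> ?W" using words_less[OF uv(1)] words_less[OF uv(2)] by (intro joinw_words) auto
      ultimately show "f \<in> SQ ` ?W" by blast
    qed
  qed
  then show ?thesis
    unfolding range_lin[OF finite_words] U.schur_functor_span V.schur_functor_span tensor_prod_span by simp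
qed

lemma SQ_act:
  assumes gh: "gh \<in> carrier (GL sU \<times>\<times> GL sV)"
  shows "tensor_act gh (lin (words (m + l) (K + n)) SQ x) = lin (words (m + l) (K + n)) SQ (act (m + l) (K + n) (gmat gh) x)"
proof
  fix z :: "('u \<Rightarrow> complex) list \<times> ('v \<Rightarrow> complex) list"
  obtain g h where g: "gh = (g, h)" "g \<in> carrier (GL sU)" "h \<in> carrier (GL sV)" using gh by (cases gh) auto
  obtain \<phi> \<psi> where z: "z = (\<phi>, \<psi>)" by (cases z)
  let ?W = "words (m + l) (K + n)"
  let ?\<phi> = "map (\<lambda>\<phi>. \<phi> \<circ> g) \<phi>" and ?\<psi> = "map (\<lambda>\<psi>. \<psi> \<circ> h) \<psi>"
  have "SQ w (?\<phi>, ?\<psi>) = (\<Sum>v\<in>?W. (\<Prod>p<m + l. gmat gh (v p) (w p)) * SQ v (\<phi>, \<psi>))" if w: "w \<in> ?W" for w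
  proof -
    have "(\<Sum>v\<in>?W. (\<Prod>p<m + l. gmat gh (v p) (w p)) * SQ v (\<phi>, \<psi>)) =
        (\<Sum>v\<in>?W. if pat m l K v then (\<Prod>p<m + l. gmat gh (v p) (w p)) * (YS sU us \<pi> v \<phi> * YS sV vs \<mu> (rgt m K v) \<psi>) else 0)"
      by (intro sum.cong) (auto simp: SQ_def)
    also have "\<dots> = (\<Sum>u\<in>words m K. \<Sum>v\<in>words l n. (\<Prod>p<m + l. gmat gh (joinw m l K u v p) (w p)) *
        (YS sU us \<pi> (joinw m l K u v) \<phi> * YS sV vs \<mu> (rgt m K (joinw m l K u v)) \<psi>))" by (rule sum_pat)
    also have "\<dots> = (\<Sum>u\<in>words m K. \<Sum>v\<in>words l n. if pat m l K w then
        ((\<Prod>p<m. U.mat g (u p) (w p)) * YS sU us \<pi> u \<phi>) * ((\<Prod>p<l. V.mat h (v p) (rgt m K w p)) * YS sV vs \<mu> v \<psi>) else 0)"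
    proof (rule sum.cong[OF refl], rule sum.cong[OF refl])
      fix u v assume u: "u \<in> words m K" and v: "v \<in> words l n"
      have 1: "YS sU us \<pi> (joinw m l K u v) = YS sU us \<pi> u" by (rule YS_cong) (simp add: joinw_def)
      have 2: "YS sV vs \<mu> (rgt m K (joinw m l K u v)) = YS sV vs \<mu> v" by (rule YS_cong) (simp add: rgt_joinw)
      have 3: "(\<Prod>p<m + l. gmat gh (joinw m l K u v p) (w p)) =
          (if pat m l K w then (\<Prod>p<m. U.mat g (u p) (w p)) * (\<Prod>p<l. V.mat h (v p) (rgt m K w p)) else 0)"
      proof (cases "pat m l K w")
        case True
        have "(\<Prod>p<m. gmat gh (joinw m l K u v p) (w p)) = (\<Prod>p<m. U.mat g (u p) (w p))"
          using True words_less[OF u] g(1) by (intro prod.cong) (auto simp: joinw_def gmat_def bmat_def pat_def)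
        moreover have "(\<Prod>p<l. gmat gh (joinw m l K u v (m + p)) (w (m + p))) = (\<Prod>p<l. V.mat h (v p) (rgt m K w p))"
          using True g(1) by (intro prod.cong) (auto simp: joinw_def gmat_def bmat_def pat_def rgt_def)
        ultimately show ?thesis using True by (simp add: prod_split)
      next
        case False
        \<comment> \<open>Off the pattern some letter of \<open>w\<close> belongs to the wrong
          space, where the block diagonal matrix has the entry 0.\<close>
        then consider p where "p < m" "K \<le> w p" | p where "p < l" "w (m + p) < K" by (auto simp: pat_def not_le)
        then have "\<exists>p<m + l. gmat gh (joinw m l K u v p) (w p) = 0"
        proof cases
          case 1
          then show ?thesis using words_less[OF u, of p] by (intro exI[of _ p]) (simp add: gmat_def bmat_def joinw_def)
        next
          case 2
          then show ?thesis by (intro exI[of _ "m + p"]) (auto simp: gmat_def bmat_def joinw_def)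
        qed
        then show ?thesis using False by (auto intro!: prod_zero)
      qed
      show "(\<Prod>p<m + l. gmat gh (joinw m l K u v p) (w p)) *
        (YS sU us \<pi> (joinw m l K u v) \<phi> * YS sV vs \<mu> (rgt m K (joinw m l K u v)) \<psi>) =
        (if pat m l K w then ((\<Prod>p<m. U.mat g (u p) (w p)) * YS sU us \<pi> u \<phi>) *
          ((\<Prod>p<l. V.mat h (v p) (rgt m K w p)) * YS sV vs \<mu> v \<psi>) else 0)"
        unfolding 1 2 3 by simp
    qed
    also have "\<dots> = SQ w (?\<phi>, ?\<psi>)"
      by (simp add: SQ_def U.YS_act[OF g(2)] V.YS_act[OF g(3)] sum_product)
    finally show ?thesis by simp
  qed
  then have "tensor_act gh (lin ?W SQ x) z = (\<Sum>w\<in>?W. x w * (\<Sum>v\<in>?W. (\<Prod>p<m + l. gmat gh (v p) (w p)) * SQ v (\<phi>, \<psi>)))"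
    unfolding tensor_act_def g(1) z by (simp add: lin_def cong: sum.cong)
  then show "tensor_act gh (lin ?W SQ x) z = lin ?W SQ (act (m + l) (K + n) (gmat gh) x) z"
    by (simp add: lin_act z)
qed

lemma SQ_nonzero_inj:
  assumes "SQ w \<noteq> 0"
  shows "pat m l K w" "inj_on (\<lambda>p. (bcol \<pi> p, w p)) {..<m}" "inj_on (\<lambda>p. (bcol \<mu> p, rgt m K w p)) {..<l}"
proof -
  obtain z where "SQ w z \<noteq> 0" using assms by (auto simp: fun_eq_iff)
  then obtain \<phi> \<psi> where nz: "pat m l K w" "YS sU us \<pi> w \<phi> \<noteq> 0" "YS sV vs \<mu> (rgt m K w) \<psi> \<noteq> 0"
    by (cases z) (auto simp: SQ_def split: if_splits)
  show "pat m l K w" by (rule nz)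
  show "inj_on (\<lambda>p. (bcol \<pi> p, w p)) {..<m}"
  proof (rule inj_onI, rule ccontr)
    fix p q assume "p \<in> {..<m}" "q \<in> {..<m}" "(bcol \<pi> p, w p) = (bcol \<pi> q, w q)" "p \<noteq> q"
    then show False using YU.ysum_duplicate[of p q w "\<lambda>v. ptw sU us m v \<phi>"] nz(2) by (simp add: YS_def)
  qed
  show "inj_on (\<lambda>p. (bcol \<mu> p, rgt m K w p)) {..<l}"
  proof (rule inj_onI, rule ccontr)
    fix p q assume "p \<in> {..<l}" "q \<in> {..<l}" "(bcol \<mu> p, rgt m K w p) = (bcol \<mu> q, rgt m K w q)" "p \<noteq> q"
    then show False using YV.ysum_duplicate[of p q "rgt m K w" "\<lambda>v. ptw sV vs l v \<psi>"] nz(3) by (simp add: YS_def)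
  qed
qed

lemma SQ_stop_nonzero: "SQ stop \<noteq> 0"
proof -
  have "YS sU us \<pi> stop (map (\<lambda>p. U.crd (brow \<pi> p)) [0..<m]) \<noteq> 0"
    by (rule U.YS_row_nonzero[OF sorted(1) rows(1)]) (simp_all add: stop_def joinw_def)
  moreover have "YS sV vs \<mu> (rgt m K stop) (map (\<lambda>p. V.crd (brow \<mu> p)) [0..<l]) \<noteq> 0"
    by (rule V.YS_row_nonzero[OF sorted(2) rows(2)]) (simp_all add: stop_def rgt_joinw)
  ultimately have "SQ stop (map (\<lambda>p. U.crd (brow \<pi> p)) [0..<m], map (\<lambda>p. V.crd (brow \<mu> p)) [0..<l]) \<noteq> 0"
    using stop_pat by (simp add: SQ_def)
  then show ?thesis by auto
qed

text \<open>On the pattern, letters below \<open>K\<close> occur exactly in the first factor, so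
  this is the transposition sum of its Young symmetrizer. Off the pattern both sides are 0.\<close>

lemma SQ_swapsU:
  "\<exists>\<kappa>. \<forall>w\<in>words (m + l) (K + n). \<forall>z. (\<Sum>p<m + l. \<Sum>q<m + l.
     if p \<noteq> q \<and> w p \<in> {..<K} \<and> w q \<in> {..<K} then SQ (w \<circ> transpose p q) z else 0) = \<kappa> * SQ w z"
proof -
  let ?k = "(\<Sum>p<m. \<Sum>q<m. if p \<noteq> q then (if brow \<pi> p = brow \<pi> q then 1 else if bcol \<pi> p = bcol \<pi> q then - 1 else 0) else 0) :: complex"
  have "(\<Sum>p<m + l. \<Sum>q<m + l. if p \<noteq> q \<and> w p \<in> {..<K} \<and> w q \<in> {..<K} then SQ (w \<circ> transpose p q) z else 0) = ?k * SQ w z"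
    if w: "w \<in> words (m + l) (K + n)" for w z
  proof (cases "pat m l K w")
    case False
    have "(\<Sum>p<m + l. \<Sum>q<m + l. if p \<noteq> q \<and> w p \<in> {..<K} \<and> w q \<in> {..<K} then SQ (w \<circ> transpose p q) z else 0) = 0"
    proof (intro sum.neutral ballI)
      fix p q assume "p \<in> {..<m + l}" "q \<in> {..<m + l}"
      then show "(if p \<noteq> q \<and> w p \<in> {..<K} \<and> w q \<in> {..<K} then SQ (w \<circ> transpose p q) z else 0) = 0"
        using False pat_swap[of p m l q w K] by (auto simp: SQ_def)
    qed
    then show ?thesis using False by (cases z) (simp add: SQ_def)
  next
    case True
    obtain \<phi> \<psi> where z: "z = (\<phi>, \<psi>)" by (cases z)
    have wl: "w p < K \<longleftrightarrow> p < m" if "p < m + l" for p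
      using True that unfolding pat_def by (metis add_diff_inverse_nat linorder_not_le nat_add_left_cancel_less)
    have "(\<Sum>p<m + l. \<Sum>q<m + l. if p \<noteq> q \<and> w p \<in> {..<K} \<and> w q \<in> {..<K} then SQ (w \<circ> transpose p q) z else 0) =
       (\<Sum>p<m. \<Sum>q<m. if p \<noteq> q then SQ (w \<circ> transpose p q) z else 0)"
      unfolding sum_block[of _ m l] by (simp add: wl)
    also have "\<dots> = (\<Sum>p<m. \<Sum>q<m. (if p \<noteq> q then YS sU us \<pi> (w \<circ> transpose p q) \<phi> else 0) * YS sV vs \<mu> (rgt m K w) \<psi>)"
    proof (rule sum.cong[OF refl], rule sum.cong[OF refl])
      fix p q assume pq: "p \<in> {..<m}" "q \<in> {..<m}"
      then have "pat m l K (w \<circ> transpose p q)" using pat_swap[of p m l q w K] True wl[of p] wl[of q] by simp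
      moreover have "rgt m K (w \<circ> transpose p q) = rgt m K w" using pq by (auto simp: rgt_def transpose_def)
      ultimately show "(if p \<noteq> q then SQ (w \<circ> transpose p q) z else 0) =
        (if p \<noteq> q then YS sU us \<pi> (w \<circ> transpose p q) \<phi> else 0) * YS sV vs \<mu> (rgt m K w) \<psi>"
        by (simp add: SQ_def z)
    qed
    also have "\<dots> = ?k * SQ w z"
      unfolding sum_distrib_right[symmetric] using True
        YU.ysum_swaps[of "\<lambda>v. ptw sU us m v \<phi>" w, folded YS_def] by (simp add: SQ_def z)
    finally show ?thesis .
  qed
  then show ?thesis by blast
qed

lemma SQ_swapsV:
  "\<exists>\<kappa>. \<forall>w\<in>words (m + l) (K + n). \<forall>z. (\<Sum>p<m + l. \<Sum>q<m + l.
     if p \<noteq> q \<and> w p \<in> {K..<K + n} \<and> w q \<in> {K..<K + n} then SQ (w \<circ> transpose p q) z else 0) = \<kappa> * SQ w z"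
proof -
  let ?k = "(\<Sum>p<l. \<Sum>q<l. if p \<noteq> q then (if brow \<mu> p = brow \<mu> q then 1 else if bcol \<mu> p = bcol \<mu> q then - 1 else 0) else 0) :: complex"
  have "(\<Sum>p<m + l. \<Sum>q<m + l. if p \<noteq> q \<and> w p \<in> {K..<K + n} \<and> w q \<in> {K..<K + n} then SQ (w \<circ> transpose p q) z else 0) = ?k * SQ w z"
    if w: "w \<in> words (m + l) (K + n)" for w z
  proof (cases "pat m l K w")
    case False
    have "(\<Sum>p<m + l. \<Sum>q<m + l. if p \<noteq> q \<and> w p \<in> {K..<K + n} \<and> w q \<in> {K..<K + n} then SQ (w \<circ> transpose p q) z else 0) = 0"
    proof (intro sum.neutral ballI)
      fix p q assume "p \<in> {..<m + l}" "q \<in> {..<m + l}"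
      then show "(if p \<noteq> q \<and> w p \<in> {K..<K + n} \<and> w q \<in> {K..<K + n} then SQ (w \<circ> transpose p q) z else 0) = 0"
        using False pat_swap[of p m l q w K] by (auto simp: SQ_def)
    qed
    then show ?thesis using False by (cases z) (simp add: SQ_def)
  next
    case True
    obtain \<phi> \<psi> where z: "z = (\<phi>, \<psi>)" by (cases z)
    have wl: "w p \<in> {K..<K + n} \<longleftrightarrow> m \<le> p" if "p < m + l" for p
    proof -
      have "w p < K + n" using words_less[OF w that] .
      moreover have "K \<le> w p \<longleftrightarrow> m \<le> p"
        using True that unfolding pat_def by (metis le_add_diff_inverse linorder_not_le nat_add_left_cancel_less)
      ultimately show ?thesis by simp
    qed
    have "(\<Sum>p<m + l. \<Sum>q<m + l. if p \<noteq> q \<and> w p \<in> {K..<K + n} \<and> w q \<in> {K..<K + n} then SQ (w \<circ> transpose p q) z else 0) =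
       (\<Sum>p<m + l. \<Sum>q<m + l. if p \<noteq> q \<and> m \<le> p \<and> m \<le> q then SQ (w \<circ> transpose p q) z else 0)"
      by (intro sum.cong refl if_cong) (simp_all add: wl del: atLeastLessThan_iff)
    also have "\<dots> = (\<Sum>p<l. \<Sum>q<l. if p \<noteq> q then SQ (w \<circ> transpose (m + p) (m + q)) z else 0)"
      unfolding sum_block[of _ m l] by simp
    also have "\<dots> = (\<Sum>p<l. \<Sum>q<l. (if p \<noteq> q then YS sV vs \<mu> (rgt m K w \<circ> transpose p q) \<psi> else 0) * YS sU us \<pi> w \<phi>)"
    proof (rule sum.cong[OF refl], rule sum.cong[OF refl])
      fix p q assume pq: "p \<in> {..<l}" "q \<in> {..<l}"
      then have "w (m + p) \<in> {K..<K + n}" "w (m + q) \<in> {K..<K + n}" using wl[of "m + p"] wl[of "m + q"] by auto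
      then have "pat m l K (w \<circ> transpose (m + p) (m + q))"
        using pat_swap[of "m + p" m l "m + q" w K] True pq by simp
      moreover have "rgt m K (w \<circ> transpose (m + p) (m + q)) = rgt m K w \<circ> transpose p q"
        by (auto simp: rgt_def transpose_def fun_eq_iff)
      moreover have "YS sU us \<pi> (w \<circ> transpose (m + p) (m + q)) = YS sU us \<pi> w"
        by (rule YS_cong) (simp add: transpose_def)
      ultimately show "(if p \<noteq> q then SQ (w \<circ> transpose (m + p) (m + q)) z else 0) =
        (if p \<noteq> q then YS sV vs \<mu> (rgt m K w \<circ> transpose p q) \<psi> else 0) * YS sU us \<pi> w \<phi>"
        by (simp add: SQ_def z)
    qed
    also have "\<dots> = ?k * SQ w z"
      unfolding sum_distrib_right[symmetric] using True
        YV.ysum_swaps[of "\<lambda>v. ptw sV vs l v \<psi>" "rgt m K w", folded YS_def] by (simp add: SQ_def z)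
    finally show ?thesis .
  qed
  then show ?thesis by blast
qed

sublocale pre: pre_quotient_rep "m + l" "K + n" K SQ "{stop}"
proof
  fix i j :: nat and z :: complex and x assume *: "i < K + n" "j < K + n" "blk K i j" "i \<noteq> j \<or> z \<noteq> - 1" and x: "x \<in> ker (words (m + l) (K + n)) SQ"
  obtain gh where gh: "gh \<in> carrier (GL sU \<times>\<times> GL sV)" "\<And>a b. a < K + n \<Longrightarrow> b < K + n \<Longrightarrow> gmat gh a b = el z i j a b"
    using el_gmat[OF *] by blast
  have "act (m + l) (K + n) (el z i j) x = act (m + l) (K + n) (gmat gh) x" using gh(2) by (intro act_cong) simp
  then have "lin (words (m + l) (K + n)) SQ (act (m + l) (K + n) (el z i j) x) = tensor_act gh (lin (words (m + l) (K + n)) SQ x)"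
    by (simp add: SQ_act[OF gh(1)])
  also have "lin (words (m + l) (K + n)) SQ x = 0" using x by (simp add: ker_def)
  finally show "lin (words (m + l) (K + n)) SQ (act (m + l) (K + n) (el z i j) x) = 0"
    by (auto simp: tensor_act_def fun_eq_iff split: prod.splits)
next
  show "{stop} \<subseteq> words (m + l) (K + n)" using stop_words by simp
  show "\<And>t. t \<in> {stop} \<Longrightarrow> SQ t \<noteq> 0" using SQ_stop_nonzero by simp
next
  fix t and i j :: nat and z :: complex assume t: "t \<in> {stop}" and ij: "i < j" "j < K + n" "blk K i j"
  have "lin (words (m + l) (K + n)) SQ (act (m + l) (K + n) (el z i j) (unitv stop)) = SQ stop"
  proof (rule lin_act_el_top[OF stop_words])
    show "i \<noteq> j" using ij by simp
    fix w assume w: "w \<in> words (m + l) (K + n)" "w \<noteq> stop"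
      and step: "\<And>p. p < m + l \<Longrightarrow> w p = stop p \<or> w p = i \<and> stop p = j"
    obtain p where p: "p < m + l" "w p \<noteq> stop p" using words_eqI[OF w(1) stop_words] w(2) by blast
    then have wp: "w p = i" "stop p = j" using step by blast+
    show "SQ w = 0"
    proof (rule ccontr)
      assume nz: "SQ w \<noteq> 0"
      show False
      proof (cases "p < m")
        case True
        then have "j = brow \<pi> p" using wp(2) by (simp add: stop_def joinw_def)
        \<comment> \<open>The box of row \<open>i\<close> in the same column already carries
          \<open>i\<close>; a second \<open>i\<close> in this column makes \<open>SQ w\<close>
          vanish.\<close>
        then obtain r where r: "r < m" "bcol \<pi> r = bcol \<pi> p" "brow \<pi> r = i"
          using box_column_left[OF sorted(1) True, of i] ij(1) by auto
        have "stop r = i" using r by (simp add: stop_def joinw_def)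
        then have "w r = i" using step[of r] r(1) by auto
        then have "r = p" using SQ_nonzero_inj(2)[OF nz] r True wp(1) unfolding inj_on_def by simp
        then show False using r(3) \<open>j = brow \<pi> p\<close> ij(1) by simp
      next
        case False
        define q where "q = p - m"
        have q: "q < l" "p = m + q" using False p(1) by (auto simp: q_def)
        have j: "j = K + brow \<mu> q" using wp(2) q by (simp add: stop_def joinw_def)
        then have iK: "K \<le> i" using ij(3) by (simp add: blk_def)
        then have "i - K < brow \<mu> q" using ij(1) j by simp
        then obtain r where r: "r < l" "bcol \<mu> r = bcol \<mu> q" "brow \<mu> r = i - K"
          using box_column_left[OF sorted(2) q(1), of "i - K"] by blast
        have "stop (m + r) = i" using r iK by (simp add: stop_def joinw_def)
        then have "w (m + r) = i" using step[of "m + r"] r(1) by auto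
        then have "r = q" using SQ_nonzero_inj(3)[OF nz] r q wp(1) unfolding inj_on_def by (simp add: rgt_def)
        then show False using r(3) j ij(1) iK by simp
      qed
    qed
  qed
  then show "lin (words (m + l) (K + n)) SQ (act (m + l) (K + n) (el z i j) (unitv t)) = SQ t" using t by simp
qed

lemma kap_eigen:
  assumes "B \<subseteq> {..<K + n}" "\<And>i j. i \<in> B \<Longrightarrow> j \<in> B \<Longrightarrow> blk K i j"
    and \<kappa>: "\<forall>w\<in>words (m + l) (K + n). \<forall>z. (\<Sum>p<m + l. \<Sum>q<m + l.
      if p \<noteq> q \<and> w p \<in> B \<and> w q \<in> B then SQ (w \<circ> transpose p q) z else 0) = \<kappa> * SQ w z"
    and x: "hwv (m + l) (K + n) K c x" "lin (words (m + l) (K + n)) SQ x \<noteq> 0"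
  shows "of_int (kap B c) = \<kappa>"
proof -
  let ?q = "lin (words (m + l) (K + n)) SQ"
  have "?q (Sw (m + l) (K + n) B x) = cscale \<kappa> (?q x)" using \<kappa> by (intro lin_swaps_eigen) blast
  moreover have "Sw (m + l) (K + n) B x = cscale (of_int (kap B c)) x" using hwv_Sw[OF x(1) assms(1,2)] .
  ultimately have "cscale (of_int (kap B c)) (?q x) = cscale \<kappa> (?q x)" by (simp add: lin_scale)
  moreover obtain z where "?q x z \<noteq> 0" using x(2) by (auto simp: fun_eq_iff)
  ultimately show ?thesis by (metis cscale_def mult_right_cancel)
qed

text \<open>The Casimir eigenvalue on each factor does not depend on the vector, so \<open>c\<close>
  and the weight of \<open>stop\<close> share it. A word in the support of \<open>x\<close> with
  \<open>SQ w \<noteq> 0\<close> repeats no letter in a column, so \<open>c\<close> is dominated by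
  the row lengths; equal eigenvalues exclude strict dominance.\<close>

lemma hwv_weight:
  assumes x: "hwv (m + l) (K + n) K c x" "lin (words (m + l) (K + n)) SQ x \<noteq> 0" and i: "i < K + n"
  shows "c i = cnt (m + l) stop i"
proof -
  let ?W = "words (m + l) (K + n)"
  let ?t = "cnt (m + l) stop"
  obtain p where p: "lin ?W SQ p = SQ stop" "hwv (m + l) (K + n) K ?t p" using pre.top_lift_hwv by blast
  have p0: "lin ?W SQ p \<noteq> 0" using p(1) SQ_stop_nonzero by simp
  have kapU: "kap {..<K} c = kap {..<K} ?t"
  proof -
    obtain \<kappa> where k: "\<forall>w\<in>words (m + l) (K + n). \<forall>z. (\<Sum>p<m + l. \<Sum>q<m + l.
      if p \<noteq> q \<and> w p \<in> {..<K} \<and> w q \<in> {..<K} then SQ (w \<circ> transpose p q) z else 0) = \<kappa> * SQ w z" using SQ_swapsU by blast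
    have "of_int (kap {..<K} c) = \<kappa>"
      by (rule kap_eigen[OF _ _ k x]) (auto simp: blk_def)
    moreover have "of_int (kap {..<K} ?t) = \<kappa>"
      by (rule kap_eigen[OF _ _ k p(2) p0]) (auto simp: blk_def)
    ultimately show ?thesis by (metis of_int_eq_iff)
  qed
  have kapV: "kap {..<n} (\<lambda>i. c (K + i)) = kap {..<n} (\<lambda>i. ?t (K + i))"
  proof -
    obtain \<kappa> where k: "\<forall>w\<in>words (m + l) (K + n). \<forall>z. (\<Sum>p<m + l. \<Sum>q<m + l.
      if p \<noteq> q \<and> w p \<in> {K..<K + n} \<and> w q \<in> {K..<K + n} then SQ (w \<circ> transpose p q) z else 0) = \<kappa> * SQ w z" using SQ_swapsV by blast
    have "of_int (kap {K..<K + n} c) = \<kappa>"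
      by (rule kap_eigen[OF _ _ k x]) (auto simp: blk_def)
    moreover have "of_int (kap {K..<K + n} ?t) = \<kappa>"
      by (rule kap_eigen[OF _ _ k p(2) p0]) (auto simp: blk_def)
    ultimately have "kap {K..<K + n} c = kap {K..<K + n} ?t" by (metis of_int_eq_iff)
    then show ?thesis by (simp only: kap_shift)
  qed
  obtain w where w: "w \<in> ?W" "x w \<noteq> 0" "SQ w \<noteq> 0"
  proof -
    obtain z where "lin ?W SQ x z \<noteq> 0" using x(2) by (auto simp: fun_eq_iff)
    then obtain w where "w \<in> ?W" "x w * SQ w z \<noteq> 0"
      unfolding lin_def by (rule sum.not_neutral_contains_not_neutral)
    moreover from this have "SQ w \<noteq> 0" "x w \<noteq> 0" by auto
    ultimately show ?thesis using that by blast
  qed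
  have cw: "cnt (m + l) w i = c i" if "i < K + n" for i using x(1) w(2) that unfolding hwv_def by blast
  note inj = SQ_nonzero_inj[OF w(3)]
  have cU: "c i = cnt m w i" "?t i = cnt m (brow \<pi>) i" if "i < K" for i
  proof -
    show "c i = cnt m w i" using cw[of i] cnt_pat(1)[OF inj(1) that] that by simp
    have "cnt m stop i = cnt m (brow \<pi>) i" unfolding cnt_def stop_def joinw_def by (metis (mono_tags, lifting) lessThan_iff)
    then show "?t i = cnt m (brow \<pi>) i" using cnt_pat(1)[OF stop_pat that] by simp
  qed
  have cV: "c (K + i) = cnt l (rgt m K w) i" "?t (K + i) = cnt l (brow \<mu>) i" if "i < n" for i
  proof -
    show "c (K + i) = cnt l (rgt m K w) i" using cw[of "K + i"] cnt_pat(2)[OF inj(1)] that by simp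
    have "{p\<in>{..<l}. rgt m K stop p = i} = {p\<in>{..<l}. brow \<mu> p = i}" by (auto simp: stop_def rgt_joinw)
    then show "?t (K + i) = cnt l (brow \<mu>) i" using cnt_pat(2)[OF stop_pat] by (simp add: cnt_def)
  qed
  have decU: "d (Suc i) \<le> d i" if "hwv (m + l) (K + n) K d y" "Suc i < K" for d y i
    using hwv_decreasing[OF that(1), of i "Suc i"] that(2) by (simp add: blk_def)
  have decV: "d (K + Suc i) \<le> d (K + i)" if "hwv (m + l) (K + n) K d y" "Suc i < n" for d y i
    using hwv_decreasing[OF that(1), of "K + i" "K + Suc i"] that(2) by (simp add: blk_def)
  have bU: "inj_on (\<lambda>p. (bcol \<pi> p, brow \<pi> p)) {..<m}" and bV: "inj_on (\<lambda>p. (bcol \<mu> p, brow \<mu> p)) {..<l}"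
    using box_inj_on[of \<pi>] box_inj_on[of \<mu>] unfolding inj_on_def by blast+
  have U: "c i = ?t i" if "i < K" for i
  proof (rule casimir_weights[of K c ?t, OF decU[OF x(1)] decU[OF p(2)] _ _ kapU that])
    fix k assume "k \<le> K"
    then have "(\<Sum>i<k. c i) = card {p\<in>{..<m}. w p < k}" "(\<Sum>i<k. ?t i) = card {p\<in>{..<m}. brow \<pi> p < k}"
      unfolding sum_cnt[symmetric] using cU by (auto intro!: sum.cong)
    then show "(\<Sum>i<k. c i) \<le> (\<Sum>i<k. ?t i)"
      using filling_dominance(1)[OF inj(2) bU box_column_left[OF sorted(1)]] by simp
  next
    have "(\<Sum>i<K. c i) = card {p\<in>{..<m}. w p < K}" "(\<Sum>i<K. ?t i) = card {p\<in>{..<m}. brow \<pi> p < K}"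
      unfolding sum_cnt[symmetric] using cU by auto
    moreover have "{p\<in>{..<m}. w p < K} = {..<m}" "{p\<in>{..<m}. brow \<pi> p < K} = {..<m}"
      using inj(1) rows(1) by (auto simp: pat_def)
    ultimately show "(\<Sum>i<K. c i) = (\<Sum>i<K. ?t i)" by simp
  qed
  have V: "c (K + i) = ?t (K + i)" if "i < n" for i
  proof (rule casimir_weights[of n "\<lambda>i. c (K + i)" "\<lambda>i. ?t (K + i)", OF decV[OF x(1)] decV[OF p(2)] _ _ kapV that])
    fix k assume "k \<le> n"
    then have "(\<Sum>i<k. c (K + i)) = card {p\<in>{..<l}. rgt m K w p < k}" "(\<Sum>i<k. ?t (K + i)) = card {p\<in>{..<l}. brow \<mu> p < k}"
      unfolding sum_cnt[symmetric] using cV by (auto intro!: sum.cong)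
    then show "(\<Sum>i<k. c (K + i)) \<le> (\<Sum>i<k. ?t (K + i))"
      using filling_dominance(1)[OF inj(3) bV box_column_left[OF sorted(2)]] by simp
  next
    have "(\<Sum>i<n. c (K + i)) = card {p\<in>{..<l}. rgt m K w p < n}" "(\<Sum>i<n. ?t (K + i)) = card {p\<in>{..<l}. brow \<mu> p < n}"
      unfolding sum_cnt[symmetric] using cV by auto
    moreover have "{p\<in>{..<l}. rgt m K w p < n} = {..<l}" "{p\<in>{..<l}. brow \<mu> p < n} = {..<l}"
      using rgt_less[OF w(1) inj(1)] rows(2) by auto
    ultimately show "(\<Sum>i<n. c (K + i)) = (\<Sum>i<n. ?t (K + i))" by simp
  qed
  show ?thesis using U[of i] V[of "i - K"] i by (cases "i < K") auto
qed

text \<open>The equality case of \<open>filling_dominance\<close>: in both factors \<open>w\<close>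
  arises from \<open>stop\<close> by a column permutation, which contributes only a sign.\<close>

lemma SQ_same_weight:
  assumes w: "w \<in> words (m + l) (K + n)" and cw: "\<And>i. i < K + n \<Longrightarrow> cnt (m + l) w i = cnt (m + l) stop i"
  shows "\<exists>k. SQ w = cscale k (SQ stop)"
proof (cases "SQ w = 0")
  case True
  then show ?thesis by (intro exI[of _ 0]) (auto simp: cscale_def fun_eq_iff)
next
  case False
  note inj = SQ_nonzero_inj[OF False]
  have bU: "inj_on (\<lambda>p. (bcol \<pi> p, brow \<pi> p)) {..<m}" and bV: "inj_on (\<lambda>p. (bcol \<mu> p, brow \<mu> p)) {..<l}"
    using box_inj_on[of \<pi>] box_inj_on[of \<mu>] unfolding inj_on_def by blast+
  have eqU: "card {p\<in>{..<m}. w p < k} = card {p\<in>{..<m}. brow \<pi> p < k}" for k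
  proof -
    have "cnt m w i = cnt m (brow \<pi>) i" for i
    proof (cases "i < K")
      case True
      have "cnt m stop i = cnt m (brow \<pi>) i" unfolding cnt_def stop_def joinw_def by (metis (mono_tags, lifting) lessThan_iff)
      then show ?thesis using cw[of i] cnt_pat(1)[OF inj(1) True] cnt_pat(1)[OF stop_pat True] True by simp
    next
      case False
      then have "{p\<in>{..<m}. w p = i} = {}" "{p\<in>{..<m}. brow \<pi> p = i} = {}" using inj(1) rows(1) by (auto simp: pat_def)
      then show ?thesis unfolding cnt_def by (simp only:)
    qed
    then show ?thesis unfolding sum_cnt[symmetric] by simp
  qed
  have eqV: "card {p\<in>{..<l}. rgt m K w p < k} = card {p\<in>{..<l}. brow \<mu> p < k}" for k
  proof -
    have "cnt l (rgt m K w) i = cnt l (brow \<mu>) i" for i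
    proof (cases "i < n")
      case True
      have "{p\<in>{..<l}. rgt m K stop p = i} = {p\<in>{..<l}. brow \<mu> p = i}" by (auto simp: stop_def rgt_joinw)
      then have "cnt l (rgt m K stop) i = cnt l (brow \<mu>) i" by (simp add: cnt_def)
      then show ?thesis using cw[of "K + i"] cnt_pat(2)[OF inj(1)] cnt_pat(2)[OF stop_pat] True by simp
    next
      case False
      then have "{p\<in>{..<l}. rgt m K w p = i} = {}" "{p\<in>{..<l}. brow \<mu> p = i} = {}"
        using rgt_less[OF w inj(1)] rows(2) by auto
      then show ?thesis unfolding cnt_def by (simp only:)
    qed
    then show ?thesis unfolding sum_cnt[symmetric] by simp
  qed
  obtain \<sigma> where s: "\<sigma> permutes {..<m}" "\<forall>p<m. bcol \<pi> (\<sigma> p) = bcol \<pi> p \<and> brow \<pi> (\<sigma> p) = w p"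
    using filling_dominance(2)[OF inj(2) bU box_column_left[OF sorted(1)] eqU] by blast
  obtain \<tau> where t: "\<tau> permutes {..<l}" "\<forall>p<l. bcol \<mu> (\<tau> p) = bcol \<mu> p \<and> brow \<mu> (\<tau> p) = rgt m K w p"
    using filling_dominance(2)[OF inj(3) bV box_column_left[OF sorted(2)] eqV] by blast
  have sp: "\<sigma> p < m" if "p < m" for p using permutes_in_image[OF s(1)] that by simp
  have tp: "\<tau> p < l" if "p < l" for p using permutes_in_image[OF t(1)] that by simp
  have sC: "\<sigma> \<in> YU.C" and tC: "\<tau> \<in> YV.C" using s t by (auto simp: fixg_def)
  have "YS sU us \<pi> w = YS sU us \<pi> (stop \<circ> \<sigma>)"
    using s(2) sp by (intro YS_cong) (simp add: stop_def joinw_def)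
  then have 1: "YS sU us \<pi> w \<phi> = of_int (sign \<sigma>) * YS sU us \<pi> stop \<phi>" for \<phi>
    using YU.ysum_column[OF sC] by (simp add: YS_def)
  have "YS sV vs \<mu> (rgt m K w) = YS sV vs \<mu> (rgt m K stop \<circ> \<tau>)"
    using t(2) tp by (intro YS_cong) (simp add: stop_def rgt_joinw)
  then have 2: "YS sV vs \<mu> (rgt m K w) \<psi> = of_int (sign \<tau>) * YS sV vs \<mu> (rgt m K stop) \<psi>" for \<psi>
    using YV.ysum_column[OF tC] by (simp add: YS_def)
  have "SQ w = cscale (of_int (sign \<sigma>) * of_int (sign \<tau>)) (SQ stop)"
    using inj(1) stop_pat by (auto simp: SQ_def cscale_def fun_eq_iff 1 2)
  then show ?thesis by blast
qed

sublocale quotient_rep "m + l" "K + n" K SQ "{stop}"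
proof
  fix c x assume x: "hwv (m + l) (K + n) K c x" "x \<in> orthc (words (m + l) (K + n)) (ker (words (m + l) (K + n)) SQ)"
  let ?W = "words (m + l) (K + n)"
  have "\<exists>k. lin ?W SQ x = cscale k (SQ stop)"
  proof (cases "lin ?W SQ x = 0")
    case True
    then show ?thesis by (intro exI[of _ 0]) (auto simp: cscale_def fun_eq_iff)
  next
    case False
    have "\<exists>k. SQ w = cscale k (SQ stop)" if "w \<in> ?W" "x w \<noteq> 0" for w
    proof (rule SQ_same_weight[OF that(1)])
      fix i assume "i < K + n"
      then show "cnt (m + l) w i = cnt (m + l) stop i"
        using hwv_weight[OF x(1) False] x(1) that(2) unfolding hwv_def by metis
    qed
    then obtain k where k: "\<And>w. w \<in> ?W \<Longrightarrow> x w \<noteq> 0 \<Longrightarrow> SQ w = cscale (k w) (SQ stop)" by metis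
    have "lin ?W SQ x = cscale (\<Sum>w\<in>?W. x w * k w) (SQ stop)"
    proof
      fix z
      have "x w * SQ w z = x w * k w * SQ stop z" if "w \<in> ?W" for w
        using k[OF that] by (cases "x w = 0") (simp_all add: cscale_def)
      then have "lin ?W SQ x z = (\<Sum>w\<in>?W. x w * k w * SQ stop z)"
        unfolding lin_def by (rule sum.cong[OF refl])
      then show "lin ?W SQ x z = cscale (\<Sum>w\<in>?W. x w * k w) (SQ stop) z"
        by (simp add: cscale_def sum_distrib_right)
    qed
    then show ?thesis by blast
  qed
  then show "\<exists>t\<in>{stop}. \<exists>k. lin ?W SQ x = cscale k (SQ t)" by simp
qed

end

section \<open>Pfaffians as functions of words\<close>

lemma multilinear_expand:
  fixes F :: "(nat \<Rightarrow> nat \<Rightarrow> complex) \<Rightarrow> complex"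
  assumes "finite S" and lin: "\<And>p a. p \<in> S \<Longrightarrow> F a = (\<Sum>k<N. a p k * F (a(p := unitv k)))"
  shows "F a = (\<Sum>w\<in>S \<rightarrow>\<^sub>E {..<N}. (\<Prod>p\<in>S. a p (w p)) * F (\<lambda>p. if p \<in> S then unitv (w p) else a p))"
  using assms
proof (induction S arbitrary: a rule: finite_induct)
  case empty
  show ?case by simp
next
  case (insert q S)
  let ?o = "\<lambda>S w p. if p \<in> S then unitv (w p) else a p"
  have "F a = (\<Sum>w\<in>S \<rightarrow>\<^sub>E {..<N}. (\<Prod>p\<in>S. a p (w p)) * F (?o S w))"
    by (rule insert.IH) (use insert.prems in auto)
  also have "\<dots> = (\<Sum>w\<in>S \<rightarrow>\<^sub>E {..<N}. \<Sum>k<N. (\<Prod>p\<in>S. a p (w p)) * (a q k * F ((?o S w)(q := unitv k))))"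
  proof (rule sum.cong[OF refl])
    fix w
    have "F (?o S w) = (\<Sum>k<N. ?o S w q k * F ((?o S w)(q := unitv k)))"
      by (rule insert.prems) simp
    then show "(\<Prod>p\<in>S. a p (w p)) * F (?o S w) =
      (\<Sum>k<N. (\<Prod>p\<in>S. a p (w p)) * (a q k * F ((?o S w)(q := unitv k))))"
      using insert.hyps(2) by (simp add: sum_distrib_left)
  qed
  also have "\<dots> = (\<Sum>(w, k)\<in>(S \<rightarrow>\<^sub>E {..<N}) \<times> {..<N}. (\<Prod>p\<in>S. a p (w p)) * (a q k * F ((?o S w)(q := unitv k))))"
    by (rule sum.cartesian_product)
  also have "\<dots> = (\<Sum>w\<in>insert q S \<rightarrow>\<^sub>E {..<N}. (\<Prod>p\<in>insert q S. a p (w p)) * F (?o (insert q S) w))"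
  proof (rule sum.reindex_bij_witness[of _ "\<lambda>w. (w(q := undefined), w q)" "\<lambda>(w, k). w(q := k)"])
    fix b assume b: "b \<in> (S \<rightarrow>\<^sub>E {..<N}) \<times> {..<N}"
    obtain w k where wk: "b = (w, k)" by (cases b)
    have w: "w \<in> S \<rightarrow>\<^sub>E {..<N}" and k: "k < N" using b wk by auto
    have "w q = undefined" using w insert.hyps(2) by (auto simp: PiE_iff extensional_def)
    then show "((case b of (w, k) \<Rightarrow> w(q := k))(q := undefined), (case b of (w, k) \<Rightarrow> w(q := k)) q) = b"
      using wk by auto
    show "(case b of (w, k) \<Rightarrow> w(q := k)) \<in> insert q S \<rightarrow>\<^sub>E {..<N}"
      using w k wk by (auto simp: PiE_iff extensional_def)
    have 1: "?o (insert q S) (w(q := k)) = (?o S w)(q := unitv k)"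
      using insert.hyps(2) by auto
    have 2: "(\<Prod>p\<in>S. a p ((w(q := k)) p)) = (\<Prod>p\<in>S. a p (w p))"
      using insert.hyps(2) by (intro prod.cong) auto
    show "(\<Prod>p\<in>insert q S. a p ((case b of (w, k) \<Rightarrow> w(q := k)) p)) *
        F (?o (insert q S) (case b of (w, k) \<Rightarrow> w(q := k))) =
      (case b of (w, k) \<Rightarrow> (\<Prod>p\<in>S. a p (w p)) * (a q k * F ((?o S w)(q := unitv k))))"
      unfolding wk prod.case 1 prod.insert[OF insert.hyps] 2 by simp
  next
    fix w assume w: "w \<in> insert q S \<rightarrow>\<^sub>E {..<N}"
    show "(case (w(q := undefined), w q) of (w, k) \<Rightarrow> w(q := k)) = w" by simp
    show "(w(q := undefined), w q) \<in> (S \<rightarrow>\<^sub>E {..<N}) \<times> {..<N}"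
      using w insert.hyps(2) by (auto simp: PiE_iff extensional_def)
  qed
  finally show ?case .
qed

text \<open>
  A row of the skew-symmetric matrix is indexed by a block and an index in the block; row \<open>p\<close> of the
  submatrix described by \<open>w\<close> has the block \<open>w p\<close> and the index \<open>w (2 * m + p)\<close>.
\<close>

definition pfw :: "nat \<Rightarrow> (nat \<Rightarrow> nat \<Rightarrow> nat \<Rightarrow> nat \<Rightarrow> complex) \<Rightarrow> (nat \<Rightarrow> nat) \<Rightarrow> complex" where
  "pfw m Om w = (\<Sum>\<sigma> | \<sigma> permutes {..<2 * m}. of_int (sign \<sigma>) *
     (\<Prod>i<m. Om (w (\<sigma> (2 * i))) (w (2 * m + \<sigma> (2 * i))) (w (\<sigma> (2 * i + 1))) (w (2 * m + \<sigma> (2 * i + 1)))))"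

text \<open>A permutation of the \<open>2m\<close> rows moves block and index together, hence acts
  on both halves of the word.\<close>

definition lift2 :: "nat \<Rightarrow> (nat \<Rightarrow> nat) \<Rightarrow> nat \<Rightarrow> nat" where
  "lift2 m \<tau> p = (if p < 2 * m then \<tau> p else if p < 4 * m then 2 * m + \<tau> (p - 2 * m) else p)"

lemma sum_permutations_left:
  assumes "\<tau> permutes (S :: 'a set)" "finite S"
  shows "(\<Sum>\<sigma> | \<sigma> permutes S. h (\<tau> \<circ> \<sigma>)) = (\<Sum>\<sigma> | \<sigma> permutes S. h \<sigma>)"
  using assms by (intro sum.reindex_bij_witness[of _ "\<lambda>\<sigma>. inv_into UNIV \<tau> \<circ> \<sigma>" "\<lambda>\<sigma>. \<tau> \<circ> \<sigma>"])
    (auto intro: permutes_compose permutes_inv simp: fun_eq_iff permutes_inverses)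

lemma pfw_alternating:
  assumes \<tau>: "\<tau> permutes {..<2 * m}" and v: "\<And>p. p < 2 * m \<Longrightarrow> v p = w (\<tau> p) \<and> v (2 * m + p) = w (2 * m + \<tau> p)"
  shows "pfw m Om v = of_int (sign \<tau>) * pfw m Om w"
proof -
  let ?t = "\<lambda>w \<sigma>. (\<Prod>i<m. Om (w (\<sigma> (2 * i))) (w (2 * m + \<sigma> (2 * i))) (w (\<sigma> (2 * i + 1))) (w (2 * m + \<sigma> (2 * i + 1))))"
  have "pfw m Om v = (\<Sum>\<sigma> | \<sigma> permutes {..<2 * m}. of_int (sign \<tau>) * (of_int (sign (\<tau> \<circ> \<sigma>)) * ?t w (\<tau> \<circ> \<sigma>)))"
    unfolding pfw_def
  proof (rule sum.cong[OF refl])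
    fix \<sigma> assume "\<sigma> \<in> {\<sigma>. \<sigma> permutes {..<2 * m}}"
    then have \<sigma>: "\<sigma> permutes {..<2 * m}" by simp
    have lt: "\<sigma> p < 2 * m" if "p < 2 * m" for p using permutes_in_image[OF \<sigma>] that by simp
    have "?t v \<sigma> = ?t w (\<tau> \<circ> \<sigma>)"
      using v[OF lt] by (intro prod.cong) auto
    moreover have "sign (\<tau> \<circ> \<sigma>) = sign \<tau> * sign \<sigma>" using \<sigma> \<tau> sign_comp by blast
    ultimately show "of_int (sign \<sigma>) * ?t v \<sigma> = of_int (sign \<tau>) * (of_int (sign (\<tau> \<circ> \<sigma>)) * ?t w (\<tau> \<circ> \<sigma>))"
      by (simp add: mult.assoc sign_of_int_sq)
  qed
  also have "\<dots> = (\<Sum>\<sigma> | \<sigma> permutes {..<2 * m}. of_int (sign \<tau>) * (of_int (sign \<sigma>) * ?t w \<sigma>))"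
    by (rule sum_permutations_left[OF \<tau>]) simp
  finally show ?thesis by (simp add: pfw_def sum_distrib_left)
qed

lemma pfw_duplicate:
  assumes "p < 2 * m" "q < 2 * m" "p \<noteq> q" "w p = w q" "w (2 * m + p) = w (2 * m + q)"
  shows "pfw m Om w = 0"
proof -
  have "pfw m Om w = of_int (sign (transpose p q)) * pfw m Om w"
    by (rule pfw_alternating[OF transpose_permutes]) (use assms in \<open>auto simp: transpose_def\<close>)
  then show ?thesis using assms(3) by (simp add: sign_swap_id)
qed

text \<open>Exchanging the blocks and the indices of two rows together exchanges the rows, which
  changes the sign; so one of the exchanges alone is minus the other. This ties the Casimir
  operators of the two spaces to each other.\<close>

lemma pfw_swaps:
  assumes "p < 2 * m" "q < 2 * m" "p \<noteq> q"
  shows "pfw m Om (w \<circ> transpose p q) = - pfw m Om (w \<circ> transpose (2 * m + p) (2 * m + q))"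
proof -
  have "pfw m Om (w \<circ> transpose p q) = of_int (sign (transpose p q)) * pfw m Om (w \<circ> transpose (2 * m + p) (2 * m + q))"
    by (rule pfw_alternating[OF transpose_permutes]) (use assms in \<open>auto simp: transpose_def\<close>)
  then show ?thesis using assms(3) by (simp add: sign_swap_id)
qed

text \<open>If more than \<open>m\<close> of the rows lie in block \<open>a\<close>, every perfect
  matching has a pair inside this block by the pigeonhole principle, and its entry is 0.\<close>

lemma pfw_zero_block:
  assumes zero: "\<And>b b'. Om a b a b' = 0" and big: "m < card {p\<in>{..<2 * m}. w p = a}"
  shows "pfw m Om w = 0"
  unfolding pfw_def
proof (rule sum.neutral, rule ballI)
  fix \<sigma> assume "\<sigma> \<in> {\<sigma>. \<sigma> permutes {..<2 * m}}"
  then have \<sigma>: "\<sigma> permutes {..<2 * m}" by simp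
  have "\<exists>i<m. w (\<sigma> (2 * i)) = a \<and> w (\<sigma> (2 * i + 1)) = a"
  proof (rule ccontr)
    assume no: "\<not> (\<exists>i<m. w (\<sigma> (2 * i)) = a \<and> w (\<sigma> (2 * i + 1)) = a)"
    let ?S = "{p\<in>{..<2 * m}. w p = a}"
    define f where "f = (\<lambda>p. inv_into UNIV \<sigma> p div 2)"
    have inv: "inv_into UNIV \<sigma> p < 2 * m" if "p < 2 * m" for p
      using permutes_in_image[OF permutes_inv[OF \<sigma>]] that by simp
    have fm: "f p < m" if "p < 2 * m" for p using inv[OF that] by (auto simp: f_def)
    have "inj_on f ?S"
    proof (rule inj_onI, rule ccontr)
      fix p q assume pq: "p \<in> ?S" "q \<in> ?S" "f p = f q" "p \<noteq> q"
      have pe: "\<sigma> (inv_into UNIV \<sigma> p) = p" "\<sigma> (inv_into UNIV \<sigma> q) = q"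
        by (simp_all add: permutes_inverses[OF \<sigma>])
      then have "inv_into UNIV \<sigma> p \<noteq> inv_into UNIV \<sigma> q" using pq(4) by metis
      then have "{inv_into UNIV \<sigma> p, inv_into UNIV \<sigma> q} = {2 * f p, 2 * f p + 1}"
        using pq(3) unfolding f_def by (metis doubleton_eq_iff add_0_right mod2_eq_if mult_div_mod_eq)
      then have "{p, q} = {\<sigma> (2 * f p), \<sigma> (2 * f p + 1)}"
        using pe by (metis image_empty image_insert)
      then have "w (\<sigma> (2 * f p)) = a \<and> w (\<sigma> (2 * f p + 1)) = a"
        using pq(1,2) by (auto simp: doubleton_eq_iff)
      moreover have "f p < m" using fm pq(1) by simp
      ultimately show False using no by blast
    qed
    then have "card ?S \<le> card {..<m}" using fm by (intro card_inj_on_le[of f]) auto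
    then show False using big by simp
  qed
  then obtain i where "i < m" "w (\<sigma> (2 * i)) = a" "w (\<sigma> (2 * i + 1)) = a" by blast
  then have "(\<Prod>i<m. Om (w (\<sigma> (2 * i))) (w (2 * m + \<sigma> (2 * i))) (w (\<sigma> (2 * i + 1))) (w (2 * m + \<sigma> (2 * i + 1)))) = 0"
    using zero by (intro prod_zero) (auto intro!: bexI[of _ i])
  then show "of_int (sign \<sigma>) * (\<Prod>i<m. Om (w (\<sigma> (2 * i))) (w (2 * m + \<sigma> (2 * i))) (w (\<sigma> (2 * i + 1))) (w (2 * m + \<sigma> (2 * i + 1)))) = 0"
    by simp
qed

text \<open>With \<open>s\<close> exchanging \<open>2i\<close> and \<open>2i + 1\<close> for each
  \<open>i\<close>, and \<open>E\<close> moving the even numbers as \<open>\<rho>\<close> does,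
  \<open>\<rho>\<close> is the product \<open>E s E s\<close>, in which each factor occurs
  twice.\<close>

lemma sign_block_permutation:
  fixes \<rho> :: "nat \<Rightarrow> nat"
  assumes \<rho>: "\<rho> permutes {..<2 * m}" and bl: "\<And>i. i < m \<Longrightarrow> even (\<rho> (2 * i)) \<and> \<rho> (2 * i + 1) = \<rho> (2 * i) + 1"
  shows "sign \<rho> = 1"
proof -
  define s where "s = (\<lambda>p. if p < 2 * m then (if even p then p + 1 else p - 1) else p)"
  define E where "E = (\<lambda>p. if even p then \<rho> p else p)"
  have ss: "s (s p) = p" for p by (auto simp: s_def elim!: evenE oddE)
  have lt: "\<rho> p < 2 * m" if "p < 2 * m" for p using permutes_in_image[OF \<rho>] that by simp
  have out: "\<rho> p = p" if "\<not> p < 2 * m" for p using permutes_not_in[OF \<rho>] that by simp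
  have ev: "even (\<rho> p)" if "even p" for p using bl[of "p div 2"] out[of p] that by (cases "p < 2 * m") auto
  have od: "\<rho> p = \<rho> (p - 1) + 1" if "odd p" "p < 2 * m" for p
    using bl[of "p div 2"] that by (auto elim!: oddE)
  have injE: "inj E"
  proof (rule injI)
    fix p q assume "E p = E q"
    then show "p = q" using ev permutes_inj[OF \<rho>] unfolding E_def by (metis injD)
  qed
  have s: "s permutes {..<2 * m}"
  proof (rule bij_imp_permutes)
    show "bij_betw s {..<2 * m} {..<2 * m}"
      by (rule bij_betw_byWitness[where f' = s]) (auto simp: ss s_def elim!: evenE oddE)
  qed (simp add: s_def)
  have E: "E permutes {..<2 * m}"
  proof (rule bij_imp_permutes)
    have "E ` {..<2 * m} \<subseteq> {..<2 * m}" using lt by (auto simp: E_def)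
    then show "bij_betw E {..<2 * m} {..<2 * m}"
      using injE by (simp add: bij_betw_def endo_inj_surj inj_on_subset[of _ UNIV])
  qed (simp add: E_def out)
  have "\<rho> = E \<circ> (s \<circ> (E \<circ> s))"
  proof
    fix p
    show "\<rho> p = (E \<circ> (s \<circ> (E \<circ> s))) p"
    proof (cases "p < 2 * m")
      case False
      then show ?thesis using out[of p] by (simp add: s_def E_def)
    next
      case True
      show ?thesis
      proof (cases "even p")
        case True
        then have "s p = p + 1" "s (p + 1) = p" using \<open>p < 2 * m\<close> by (auto simp: s_def elim!: evenE)
        then show ?thesis using True by (simp add: E_def)
      next
        case False
        then have "s p = p - 1" "even (p - 1)" using True by (auto simp: s_def)
        moreover have "\<rho> (p - 1) < 2 * m" using lt True by simp
        ultimately have "(s \<circ> (E \<circ> s)) p = \<rho> (p - 1) + 1" using ev[of "p - 1"] by (simp add: E_def s_def)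
        then show ?thesis using od[OF False True] ev[of "p - 1"] \<open>even (p - 1)\<close> by (simp add: E_def)
      qed
    qed
  qed
  then have "sign \<rho> = sign E * (sign s * (sign E * sign s))"
    using E s by (simp add: sign_comp permutes_compose)
  then show ?thesis by (auto simp: sign_def)
qed

text \<open>The only matching of nonzero weight pairs \<open>2i\<close> with \<open>2i + 1\<close>.
  All permutations describing it contribute the same term: permuting whole pairs is even, and a flip
  inside a pair changes both the sign and the entry.\<close>

lemma pair_sum_nonzero:
  fixes A :: "nat \<Rightarrow> nat \<Rightarrow> complex"
  assumes skew: "\<And>p q. p < 2 * m \<Longrightarrow> q < 2 * m \<Longrightarrow> A p q = - A q p"
    and nz: "\<And>i. i < m \<Longrightarrow> A (2 * i) (2 * i + 1) \<noteq> 0"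
    and only: "\<And>i q. i < m \<Longrightarrow> q < 2 * m \<Longrightarrow> A (2 * i) q \<noteq> 0 \<Longrightarrow> q = 2 * i + 1"
  shows "(\<Sum>\<sigma> | \<sigma> permutes {..<2 * m}. of_int (sign \<sigma>) * (\<Prod>i<m. A (\<sigma> (2 * i)) (\<sigma> (2 * i + 1)))) \<noteq> 0"
proof -
  let ?t = "\<lambda>\<sigma>. of_int (sign \<sigma>) * (\<Prod>i<m. A (\<sigma> (2 * i)) (\<sigma> (2 * i + 1)))"
  let ?b = "\<Prod>i<m. A (2 * i) (2 * i + 1)"
  have clean: "?t \<rho> = ?b" if \<rho>: "\<rho> permutes {..<2 * m}" and bl: "\<And>i. i < m \<Longrightarrow> even (\<rho> (2 * i)) \<and> \<rho> (2 * i + 1) = \<rho> (2 * i) + 1" for \<rho>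
  proof -
    define k where "k = (\<lambda>i. \<rho> (2 * i) div 2)"
    have k: "\<rho> (2 * i) = 2 * k i" if "i < m" for i using bl[OF that] by (auto simp: k_def)
    have "inj_on k {..<m}"
    proof (rule inj_onI)
      fix i j assume "i \<in> {..<m}" "j \<in> {..<m}" "k i = k j"
      then have "\<rho> (2 * i) = \<rho> (2 * j)" using k by simp
      then show "i = j" using permutes_inj[OF \<rho>] by (metis injD mult_left_cancel zero_neq_numeral)
    qed
    moreover have "k ` {..<m} \<subseteq> {..<m}"
    proof (rule image_subsetI)
      fix i assume "i \<in> {..<m}"
      then have "\<rho> (2 * i) < 2 * m" "\<rho> (2 * i) = 2 * k i" using k permutes_in_image[OF \<rho>, of "2 * i"] by auto
      then show "k i \<in> {..<m}" by simp
    qed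
    ultimately have bij: "bij_betw k {..<m} {..<m}" by (simp add: bij_betw_def endo_inj_surj)
    have "(\<Prod>i<m. A (\<rho> (2 * i)) (\<rho> (2 * i + 1))) = (\<Prod>i<m. A (2 * k i) (2 * k i + 1))"
      using k bl by (intro prod.cong) auto
    also have "\<dots> = ?b" by (rule prod.reindex_bij_betw[OF bij])
    finally show ?thesis using sign_block_permutation[OF \<rho> bl] by simp
  qed
  have good: "?t \<rho> = ?b"
    if "\<rho> permutes {..<2 * m}"
      "\<And>i. i < m \<Longrightarrow> \<exists>k<m. \<rho> (2 * i) = 2 * k \<and> \<rho> (2 * i + 1) = 2 * k + 1 \<or> \<rho> (2 * i) = 2 * k + 1 \<and> \<rho> (2 * i + 1) = 2 * k" for \<rho>
    using that
  \<comment> \<open>Induction on the number of flipped pairs.\<close>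
  proof (induction "card {i\<in>{..<m}. odd (\<rho> (2 * i))}" arbitrary: \<rho> rule: less_induct)
    case less
    show ?case
    proof (cases "\<exists>i<m. odd (\<rho> (2 * i))")
      case False
      have "even (\<rho> (2 * i)) \<and> \<rho> (2 * i + 1) = \<rho> (2 * i) + 1" if "i < m" for i
        using less.prems(2)[OF that] False that by auto
      then show ?thesis using clean less.prems(1) by blast
    next
      case True
      then obtain j where j: "j < m" "odd (\<rho> (2 * j))" by blast
      let ?tr = "transpose (2 * j) (2 * j + 1)"
      define \<rho>' where "\<rho>' = \<rho> \<circ> ?tr"
      have tr: "?tr permutes {..<2 * m}" using j(1) by (intro transpose_permutes) auto
      have \<rho>': "\<rho>' permutes {..<2 * m}" unfolding \<rho>'_def by (rule permutes_compose[OF tr less.prems(1)])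
      have at_j: "\<rho>' (2 * j) = \<rho> (2 * j + 1)" "\<rho>' (2 * j + 1) = \<rho> (2 * j)" by (auto simp: \<rho>'_def)
      have off_j: "\<rho>' (2 * i) = \<rho> (2 * i)" "\<rho>' (2 * i + 1) = \<rho> (2 * i + 1)" if "i \<noteq> j" for i
        using that by (auto simp: \<rho>'_def transpose_def)
      obtain k where k: "k < m" "\<rho> (2 * j) = 2 * k + 1" "\<rho> (2 * j + 1) = 2 * k"
        using less.prems(2)[OF j(1)] j(2) by auto
      have "{i\<in>{..<m}. odd (\<rho>' (2 * i))} \<subset> {i\<in>{..<m}. odd (\<rho> (2 * i))}"
      proof (rule psubsetI)
        show "{i\<in>{..<m}. odd (\<rho>' (2 * i))} \<subseteq> {i\<in>{..<m}. odd (\<rho> (2 * i))}"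
        proof
          fix i assume i: "i \<in> {i\<in>{..<m}. odd (\<rho>' (2 * i))}"
          then have "i \<noteq> j" using at_j(1) k(3) by auto
          then show "i \<in> {i\<in>{..<m}. odd (\<rho> (2 * i))}" using i off_j(1) by simp
        qed
        have "j \<in> {i\<in>{..<m}. odd (\<rho> (2 * i))}" "j \<notin> {i\<in>{..<m}. odd (\<rho>' (2 * i))}" using j k at_j by auto
        then show "{i\<in>{..<m}. odd (\<rho>' (2 * i))} \<noteq> {i\<in>{..<m}. odd (\<rho> (2 * i))}" by blast
      qed
      then have "card {i\<in>{..<m}. odd (\<rho>' (2 * i))} < card {i\<in>{..<m}. odd (\<rho> (2 * i))}"
        by (intro psubset_card_mono) auto
      moreover have "\<exists>k<m. \<rho>' (2 * i) = 2 * k \<and> \<rho>' (2 * i + 1) = 2 * k + 1 \<or> \<rho>' (2 * i) = 2 * k + 1 \<and> \<rho>' (2 * i + 1) = 2 * k"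
        if "i < m" for i
        using less.prems(2)[OF that] at_j off_j[of i] k by (cases "i = j") auto
      ultimately have IH: "?t \<rho>' = ?b" using less.hyps \<rho>' by blast
      have "sign \<rho>' = - sign \<rho>"
        unfolding \<rho>'_def sign_comp[OF less.prems(1) tr] by (simp add: sign_swap_id)
      moreover have "(\<Prod>i<m. A (\<rho>' (2 * i)) (\<rho>' (2 * i + 1))) = - (\<Prod>i<m. A (\<rho> (2 * i)) (\<rho> (2 * i + 1)))"
      proof -
        have "(\<Prod>i\<in>{..<m} - {j}. A (\<rho>' (2 * i)) (\<rho>' (2 * i + 1))) = (\<Prod>i\<in>{..<m} - {j}. A (\<rho> (2 * i)) (\<rho> (2 * i + 1)))"
          using off_j by (intro prod.cong) auto
        moreover have "A (\<rho>' (2 * j)) (\<rho>' (2 * j + 1)) = - A (\<rho> (2 * j)) (\<rho> (2 * j + 1))"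
          using skew[of "2 * k" "2 * k + 1"] at_j k by simp
        moreover note prod.remove[of "{..<m}" j "\<lambda>i. A (\<rho>' (2 * i)) (\<rho>' (2 * i + 1))"]
          prod.remove[of "{..<m}" j "\<lambda>i. A (\<rho> (2 * i)) (\<rho> (2 * i + 1))"]
        ultimately show ?thesis using j(1) by simp
      qed
      ultimately show ?thesis using IH by simp
    qed
  qed
  have "?t \<rho> = 0 \<or> ?t \<rho> = ?b" if \<rho>: "\<rho> permutes {..<2 * m}" for \<rho>
  proof (cases "?t \<rho> = 0")
    case False
    then have f: "A (\<rho> (2 * i)) (\<rho> (2 * i + 1)) \<noteq> 0" if "i < m" for i
      using that by (auto intro: prod_zero)
    have lt: "\<rho> p < 2 * m" if "p < 2 * m" for p using permutes_in_image[OF \<rho>] that by simp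
    have "\<exists>k<m. \<rho> (2 * i) = 2 * k \<and> \<rho> (2 * i + 1) = 2 * k + 1 \<or> \<rho> (2 * i) = 2 * k + 1 \<and> \<rho> (2 * i + 1) = 2 * k"
      if i: "i < m" for i
    proof -
      have li: "\<rho> (2 * i) < 2 * m" "\<rho> (2 * i + 1) < 2 * m" using lt[of "2 * i"] lt[of "2 * i + 1"] i by auto
      define k where "k = \<rho> (2 * i) div 2"
      have km: "k < m" using li by (auto simp: k_def)
      show ?thesis
      proof (cases "even (\<rho> (2 * i))")
        case True
        then have "\<rho> (2 * i) = 2 * k" by (simp add: k_def)
        then show ?thesis using only[OF km li(2)] f[OF i] km by auto
      next
        case False
        then have k1: "\<rho> (2 * i) = 2 * k + 1" by (simp add: k_def)
        \<comment> \<open>\<open>only\<close> says nothing about the partners of the odd number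
          \<open>2k + 1\<close>. So the pair that contains \<open>2k\<close> is located; its other
          member must be \<open>2k + 1\<close>, hence it is the pair \<open>i\<close>.\<close>
        define t where "t = inv_into UNIV \<rho> (2 * k)"
        have t: "\<rho> t = 2 * k" by (simp add: t_def permutes_inverses[OF \<rho>])
        have tm: "t < 2 * m" using t km permutes_in_image[OF \<rho>, of t] by simp
        define j where "j = t div 2"
        have jm: "j < m" using tm by (auto simp: j_def)
        have lj: "\<rho> (2 * j) < 2 * m" "\<rho> (2 * j + 1) < 2 * m" using lt[of "2 * j"] lt[of "2 * j + 1"] jm by auto
        have "t = 2 * j \<or> t = 2 * j + 1" by (auto simp: j_def)
        then show ?thesis
        proof
          assume t0: "t = 2 * j"
          then have "\<rho> (2 * j + 1) = 2 * k + 1" using only[OF km lj(2)] f[OF jm] t by auto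
          then have "2 * j + 1 = 2 * i" using k1 permutes_inj[OF \<rho>] by (metis injD)
          then show ?thesis by presburger
        next
          assume t1: "t = 2 * j + 1"
          have "A (2 * k) (\<rho> (2 * j)) \<noteq> 0" using f[OF jm] t t1 skew[OF lj] by auto
          then have "\<rho> (2 * j) = 2 * k + 1" using only[OF km lj(1)] by blast
          then have "2 * j = 2 * i" using k1 permutes_inj[OF \<rho>] by (metis injD)
          then show ?thesis using k1 t t1 km by auto
        qed
      qed
    qed
    then show ?thesis using good[OF \<rho>] by blast
  qed simp
  then have split: "(\<Sum>\<sigma> | \<sigma> permutes {..<2 * m}. ?t \<sigma>) = (\<Sum>\<sigma> | \<sigma> permutes {..<2 * m} \<and> ?t \<sigma> = ?b. ?b)"
    by (intro sum.mono_neutral_cong_right) (auto simp: finite_permutations)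
  have id_in: "id \<in> {\<sigma>. \<sigma> permutes {..<2 * m} \<and> ?t \<sigma> = ?b}" by (simp add: permutes_id)
  have "finite {\<sigma>. \<sigma> permutes {..<2 * m} \<and> ?t \<sigma> = ?b}"
    by (rule finite_subset[OF _ finite_permutations[of "{..<2 * m}"]]) auto
  then have "card {\<sigma>. \<sigma> permutes {..<2 * m} \<and> ?t \<sigma> = ?b} \<noteq> 0"
    using id_in by (metis (no_types, lifting) card_eq_0_iff empty_iff)
  moreover have "?b \<noteq> 0" using nz by simp
  ultimately show ?thesis unfolding split by simp
qed

text \<open>Every product of \<open>m\<close> entries is linear in each of the \<open>4m\<close>
  columns of \<open>X\<close> that \<open>w\<close> selects, and expanding all of them gives the sum
  over words. Evaluating factor by factor with \<open>sub\<close> instead produces one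
  \<open>D\<close> for each pair.\<close>

lemma pfw_substitute:
  assumes sub: "\<And>a b a' b'. a < N \<Longrightarrow> b < N \<Longrightarrow> a' < N \<Longrightarrow> b' < N \<Longrightarrow>
      (\<Sum>k<N. \<Sum>l<N. \<Sum>k'<N. \<Sum>l'<N. X k a * X l b * X k' a' * X l' b' * Om k l k' l') = D * Om' a b a' b'"
    and w: "w \<in> words (4 * m) N"
  shows "(\<Sum>v\<in>words (4 * m) N. (\<Prod>p<4 * m. X (v p) (w p)) * pfw m Om v) = D ^ m * pfw m Om' w"
proof -
  \<comment> \<open>\<open>Om\<close> extended to a form in four vectors; \<open>slot1\<close> to
    \<open>slot4\<close> express its linearity in each of them.\<close>
  define G where "G = (\<lambda>\<alpha> \<beta> \<alpha>' \<beta>'. \<Sum>k<N. \<alpha> k * (\<Sum>l<N. \<beta> l * (\<Sum>k'<N. \<alpha>' k' * (\<Sum>l'<N. \<beta>' l' * Om k l k' l'))))"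
  have swap: "(\<Sum>k<N. \<alpha> k * (\<Sum>l<N. \<beta> l * H k l)) = (\<Sum>l<N. \<beta> l * (\<Sum>k<N. \<alpha> k * H k l))"
    for \<alpha> \<beta> :: "nat \<Rightarrow> complex" and H
    unfolding sum_distrib_left by (subst sum.swap) (simp only: mult.left_commute)
  have unit: "(\<Sum>a<N. unitv k a * f a) = f k" if "k < N" for k and f :: "nat \<Rightarrow> complex"
  proof -
    have "(\<Sum>a<N. unitv k a * f a) = (\<Sum>a<N. if a = k then f k else 0)"
      by (intro sum.cong) (auto simp: unitv_def)
    then show ?thesis using that by simp
  qed
  have slot1: "G \<alpha> \<beta> \<alpha>' \<beta>' = (\<Sum>k<N. \<alpha> k * G (unitv k) \<beta> \<alpha>' \<beta>')" for \<alpha> \<beta> \<alpha>' \<beta>'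
    unfolding G_def by (intro sum.cong refl arg_cong2[of _ _ _ _ "(*)"] unit[symmetric]) simp
  have slot2: "G \<alpha> \<beta> \<alpha>' \<beta>' = (\<Sum>k<N. \<beta> k * G \<alpha> (unitv k) \<alpha>' \<beta>')" for \<alpha> \<beta> \<alpha>' \<beta>'
    unfolding G_def by (subst swap, rule sum.cong[OF refl]) (simp add: unit)
  have slot3: "G \<alpha> \<beta> \<alpha>' \<beta>' = (\<Sum>k<N. \<alpha>' k * G \<alpha> \<beta> (unitv k) \<beta>')" for \<alpha> \<beta> \<alpha>' \<beta>'
    unfolding G_def swap[of \<beta> \<alpha>'] by (subst swap, rule sum.cong[OF refl]) (simp add: unit)
  have slot4: "G \<alpha> \<beta> \<alpha>' \<beta>' = (\<Sum>k<N. \<beta>' k * G \<alpha> \<beta> \<alpha>' (unitv k))" for \<alpha> \<beta> \<alpha>' \<beta>'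
    unfolding G_def swap[of \<alpha>' \<beta>'] swap[of \<beta> \<beta>'] by (subst swap, rule sum.cong[OF refl]) (simp add: unit)
  have Gu: "G (unitv a) (unitv b) (unitv a') (unitv b') = Om a b a' b'" if "a < N" "b < N" "a' < N" "b' < N" for a b a' b'
    using that by (simp add: G_def unit)
  have Gsum: "G \<alpha> \<beta> \<alpha>' \<beta>' = (\<Sum>k<N. \<Sum>l<N. \<Sum>k'<N. \<Sum>l'<N. \<alpha> k * \<beta> l * \<alpha>' k' * \<beta>' l' * Om k l k' l')" for \<alpha> \<beta> \<alpha>' \<beta>'
    by (simp add: G_def sum_distrib_left mult.assoc)
  have key: "(\<Sum>v\<in>words (4 * m) N. (\<Prod>p<4 * m. X (v p) (w p)) *
      (\<Prod>i<m. Om (v (\<sigma> (2 * i))) (v (2 * m + \<sigma> (2 * i))) (v (\<sigma> (2 * i + 1))) (v (2 * m + \<sigma> (2 * i + 1))))) =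
      D ^ m * (\<Prod>i<m. Om' (w (\<sigma> (2 * i))) (w (2 * m + \<sigma> (2 * i))) (w (\<sigma> (2 * i + 1))) (w (2 * m + \<sigma> (2 * i + 1))))"
    if \<sigma>: "\<sigma> permutes {..<2 * m}" for \<sigma>
  proof -
    have lt: "\<sigma> p < 2 * m" if "p < 2 * m" for p using permutes_in_image[OF \<sigma>] that by simp
    have lt2: "\<sigma> (2 * i) < 2 * m" "\<sigma> (2 * i + 1) < 2 * m" if "i < m" for i
      using lt[of "2 * i"] lt[of "2 * i + 1"] that by auto
    have inj: "\<sigma> p = \<sigma> q \<longleftrightarrow> p = q" for p q using permutes_inj[OF \<sigma>] by (auto dest: injD)
    define g where "g = (\<lambda>i (a :: nat \<Rightarrow> nat \<Rightarrow> complex). G (a (\<sigma> (2 * i))) (a (2 * m + \<sigma> (2 * i))) (a (\<sigma> (2 * i + 1))) (a (2 * m + \<sigma> (2 * i + 1))))"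
    define F where "F = (\<lambda>a. \<Prod>i<m. g i a)"
    have lin: "F a = (\<Sum>k<N. a p k * F (a(p := unitv k)))" if p: "p \<in> {..<4 * m}" for p a
    proof -
      \<comment> \<open>The position \<open>p\<close> holds the block or the index of row
        \<open>\<sigma> q\<close>, and this row occurs only in the factor with number
        \<open>q div 2\<close>.\<close>
      define q where "q = inv_into UNIV \<sigma> (if p < 2 * m then p else p - 2 * m)"
      have \<sigma>q: "\<sigma> q = (if p < 2 * m then p else p - 2 * m)" by (simp add: q_def permutes_inverses[OF \<sigma>])
      have "\<sigma> q < 2 * m" unfolding \<sigma>q using p by auto
      then have qm: "q < 2 * m" using permutes_in_image[OF \<sigma>, of q] by simp
      define j where "j = q div 2"
      have jm: "j < m" using qm by (auto simp: j_def)
      have qj: "q = 2 * j \<or> q = 2 * j + 1" by (auto simp: j_def)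
      have pq: "p = \<sigma> q \<and> p < 2 * m \<or> p = 2 * m + \<sigma> q \<and> \<not> p < 2 * m" using \<sigma>q by auto
      have other: "g i (a(p := y)) = g i a" if "i < m" "i \<noteq> j" for i y
      proof -
        have "2 * i \<noteq> q" "2 * i + 1 \<noteq> q" using that(2) qj by presburger+
        then have "\<sigma> (2 * i) \<noteq> p" "\<sigma> (2 * i + 1) \<noteq> p" "2 * m + \<sigma> (2 * i) \<noteq> p" "2 * m + \<sigma> (2 * i + 1) \<noteq> p"
          using pq lt2[OF that(1)] inj by auto
        then show ?thesis by (simp add: g_def)
      qed
      have at: "g j a = (\<Sum>k<N. a p k * g j (a(p := unitv k)))"
        using qj
      proof
        assume q0: "q = 2 * j"
        have ne: "\<sigma> (2 * j + 1) \<noteq> \<sigma> (2 * j)" using inj by simp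
        show ?thesis
        proof (cases "p < 2 * m")
          case True
          then have p0: "p = \<sigma> (2 * j)" using pq q0 by auto
          show ?thesis unfolding g_def p0 using ne lt2[OF jm] by (subst slot1) simp
        next
          case False
          then have p0: "p = 2 * m + \<sigma> (2 * j)" using pq q0 by auto
          have "\<sigma> (2 * j) \<noteq> p" "\<sigma> (2 * j + 1) \<noteq> p" using lt2[OF jm] p0 by auto
          then show ?thesis unfolding g_def using ne p0 by (subst slot2) simp
        qed
      next
        assume q1: "q = 2 * j + 1"
        have ne: "\<sigma> (2 * j) \<noteq> \<sigma> (2 * j + 1)" using inj by simp
        show ?thesis
        proof (cases "p < 2 * m")
          case True
          then have p0: "p = \<sigma> (2 * j + 1)" using pq q1 by auto
          show ?thesis unfolding g_def p0 using ne lt2[OF jm] by (subst slot3) simp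
        next
          case False
          then have p0: "p = 2 * m + \<sigma> (2 * j + 1)" using pq q1 by auto
          have "\<sigma> (2 * j) \<noteq> p" "\<sigma> (2 * j + 1) \<noteq> p" using lt2[OF jm] p0 by auto
          then show ?thesis unfolding g_def using ne p0 by (subst slot4) simp
        qed
      qed
      have rest: "(\<Prod>i\<in>{..<m} - {j}. g i (a(p := y))) = (\<Prod>i\<in>{..<m} - {j}. g i a)" for y
        using other by (intro prod.cong) auto
      have Fj: "F b = g j b * (\<Prod>i\<in>{..<m} - {j}. g i b)" for b
        unfolding F_def using jm by (intro prod.remove) auto
      show ?thesis
        unfolding Fj rest by (subst at) (simp add: sum_distrib_right mult.assoc)
    qed
    let ?a = "\<lambda>p k. X k (w p)"
    have "(\<Prod>i<m. g i ?a) = F ?a" by (simp add: F_def)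
    also have "\<dots> = (\<Sum>v\<in>{..<4 * m} \<rightarrow>\<^sub>E {..<N}. (\<Prod>p<4 * m. X (v p) (w p)) * F (\<lambda>p. if p \<in> {..<4 * m} then unitv (v p) else ?a p))"
      by (rule multilinear_expand[OF _ lin]) auto
    also have "\<dots> = (\<Sum>v\<in>words (4 * m) N. (\<Prod>p<4 * m. X (v p) (w p)) *
      (\<Prod>i<m. Om (v (\<sigma> (2 * i))) (v (2 * m + \<sigma> (2 * i))) (v (\<sigma> (2 * i + 1))) (v (2 * m + \<sigma> (2 * i + 1)))))"
      unfolding words_def[symmetric]
    proof (rule sum.cong[OF refl])
      fix v assume v: "v \<in> words (4 * m) N"
      have "F (\<lambda>p. if p \<in> {..<4 * m} then unitv (v p) else ?a p) =
        (\<Prod>i<m. Om (v (\<sigma> (2 * i))) (v (2 * m + \<sigma> (2 * i))) (v (\<sigma> (2 * i + 1))) (v (2 * m + \<sigma> (2 * i + 1))))"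
        unfolding F_def
      proof (rule prod.cong[OF refl])
        fix i assume "i \<in> {..<m}"
        then have "\<sigma> (2 * i) < 2 * m" "\<sigma> (2 * i + 1) < 2 * m" using lt2 by auto
        then show "g i (\<lambda>p. if p \<in> {..<4 * m} then unitv (v p) else ?a p) =
          Om (v (\<sigma> (2 * i))) (v (2 * m + \<sigma> (2 * i))) (v (\<sigma> (2 * i + 1))) (v (2 * m + \<sigma> (2 * i + 1)))"
          unfolding g_def using words_less[OF v] by (simp add: Gu)
      qed
      then show "(\<Prod>p<4 * m. X (v p) (w p)) * F (\<lambda>p. if p \<in> {..<4 * m} then unitv (v p) else ?a p) =
        (\<Prod>p<4 * m. X (v p) (w p)) *
        (\<Prod>i<m. Om (v (\<sigma> (2 * i))) (v (2 * m + \<sigma> (2 * i))) (v (\<sigma> (2 * i + 1))) (v (2 * m + \<sigma> (2 * i + 1))))" by simp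
    qed
    moreover have "(\<Prod>i<m. g i ?a) = (\<Prod>i<m. D * Om' (w (\<sigma> (2 * i))) (w (2 * m + \<sigma> (2 * i))) (w (\<sigma> (2 * i + 1))) (w (2 * m + \<sigma> (2 * i + 1))))"
    proof (rule prod.cong[OF refl])
      fix i assume "i \<in> {..<m}"
      then have "\<sigma> (2 * i) < 2 * m" "\<sigma> (2 * i + 1) < 2 * m" using lt2 by auto
      then show "g i ?a = D * Om' (w (\<sigma> (2 * i))) (w (2 * m + \<sigma> (2 * i))) (w (\<sigma> (2 * i + 1))) (w (2 * m + \<sigma> (2 * i + 1)))"
        unfolding g_def Gsum using words_less[OF w] by (intro sub) auto
    qed
    ultimately show ?thesis by (simp add: prod.distrib)
  qed
  have "(\<Sum>v\<in>words (4 * m) N. (\<Prod>p<4 * m. X (v p) (w p)) * pfw m Om v) =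
     (\<Sum>v\<in>words (4 * m) N. \<Sum>\<sigma> | \<sigma> permutes {..<2 * m}. of_int (sign \<sigma>) * ((\<Prod>p<4 * m. X (v p) (w p)) *
      (\<Prod>i<m. Om (v (\<sigma> (2 * i))) (v (2 * m + \<sigma> (2 * i))) (v (\<sigma> (2 * i + 1))) (v (2 * m + \<sigma> (2 * i + 1))))))"
    unfolding pfw_def sum_distrib_left by (intro sum.cong refl) (simp only: mult.left_commute)
  also have "\<dots> = (\<Sum>\<sigma> | \<sigma> permutes {..<2 * m}. of_int (sign \<sigma>) * (\<Sum>v\<in>words (4 * m) N. (\<Prod>p<4 * m. X (v p) (w p)) *
      (\<Prod>i<m. Om (v (\<sigma> (2 * i))) (v (2 * m + \<sigma> (2 * i))) (v (\<sigma> (2 * i + 1))) (v (2 * m + \<sigma> (2 * i + 1))))))"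
    unfolding sum_distrib_left by (rule sum.swap)
  also have "\<dots> = D ^ m * pfw m Om' w"
  proof -
    have "of_int (sign \<sigma>) * (\<Sum>v\<in>words (4 * m) N. (\<Prod>p<4 * m. X (v p) (w p)) *
      (\<Prod>i<m. Om (v (\<sigma> (2 * i))) (v (2 * m + \<sigma> (2 * i))) (v (\<sigma> (2 * i + 1))) (v (2 * m + \<sigma> (2 * i + 1))))) =
      D ^ m * (of_int (sign \<sigma>) * (\<Prod>i<m. Om' (w (\<sigma> (2 * i))) (w (2 * m + \<sigma> (2 * i))) (w (\<sigma> (2 * i + 1))) (w (2 * m + \<sigma> (2 * i + 1)))))"
      if "\<sigma> \<in> {\<sigma>. \<sigma> permutes {..<2 * m}}" for \<sigma>
      using key[of \<sigma>] that by (simp only: mem_Collect_eq mult.left_commute)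
    then show ?thesis unfolding pfw_def sum_distrib_left[of "D ^ m"] by (rule sum.cong[OF refl])
  qed
  finally show ?thesis .
qed

section \<open>The Pfaffians of the matrix psi\<close>

text \<open>Minus the Levi-Civita symbol: the letters of the blocks are reversed below, and
  reversing three indices is an odd permutation.\<close>

definition lev :: "nat \<Rightarrow> nat \<Rightarrow> nat \<Rightarrow> complex" where
  "lev a b c = (if (a, b, c) \<in> {(0, 1, 2), (1, 2, 0), (2, 0, 1)} then - 1
     else if (a, b, c) \<in> {(1, 0, 2), (2, 1, 0), (0, 2, 1)} then 1 else 0)"

text \<open>Cyclic indices modulo 3 produce the signs of the cofactors.\<close>

definition cof3 :: "(nat \<Rightarrow> nat \<Rightarrow> complex) \<Rightarrow> nat \<Rightarrow> nat \<Rightarrow> complex" where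
  "cof3 R i j = R ((i + 1) mod 3) ((j + 1) mod 3) * R ((i + 2) mod 3) ((j + 2) mod 3)
     - R ((i + 1) mod 3) ((j + 2) mod 3) * R ((i + 2) mod 3) ((j + 1) mod 3)"

definition det3 :: "(nat \<Rightarrow> nat \<Rightarrow> complex) \<Rightarrow> complex" where
  "det3 R = R 0 0 * (R 1 1 * R 2 2 - R 1 2 * R 2 1) - R 0 1 * (R 1 0 * R 2 2 - R 1 2 * R 2 0)
     + R 0 2 * (R 1 0 * R 2 1 - R 1 1 * R 2 0)"

definition rev3 :: "(nat \<Rightarrow> nat \<Rightarrow> complex) \<Rightarrow> nat \<Rightarrow> nat \<Rightarrow> complex" where
  "rev3 M = (\<lambda>a c. M (2 - a) (2 - c))"

lemma sum3: "(\<Sum>k<3. f k) = f 0 + f 1 + f (2 :: nat)" for f :: "nat \<Rightarrow> 'a::comm_monoid_add"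
  by (simp add: eval_nat_numeral)

lemma less3: "a < 3 \<longleftrightarrow> a = 0 \<or> a = 1 \<or> a = (2 :: nat)"
  by auto

lemma cof3_entries:
  "cof3 R 0 0 = R 1 1 * R 2 2 - R 1 2 * R 2 1" "cof3 R 0 1 = R 1 2 * R 2 0 - R 1 0 * R 2 2"
  "cof3 R 0 2 = R 1 0 * R 2 1 - R 1 1 * R 2 0" "cof3 R 1 0 = R 2 1 * R 0 2 - R 2 2 * R 0 1"
  "cof3 R 1 1 = R 2 2 * R 0 0 - R 2 0 * R 0 2" "cof3 R 1 2 = R 2 0 * R 0 1 - R 2 1 * R 0 0"
  "cof3 R 2 0 = R 0 1 * R 1 2 - R 0 2 * R 1 1" "cof3 R 2 1 = R 0 2 * R 1 0 - R 0 0 * R 1 2"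
  "cof3 R 2 2 = R 0 0 * R 1 1 - R 0 1 * R 1 0"
  by (simp_all add: cof3_def flip: numeral_2_eq_2)

lemma cof3_mult:
  assumes "i < 3" "j < 3"
  shows "cof3 (mm 3 R S) i j = mm 3 (cof3 R) (cof3 S) i j"
  using assms unfolding less3
  by (elim disjE; simp only: cof3_entries mm_def sum3; simp add: algebra_simps)

lemma det3_mult: "det3 (mm 3 R S) = det3 R * det3 S"
  by (simp only: det3_def mm_def sum3) (simp add: algebra_simps)

lemma lev_values:
  "lev 0 0 0 = 0" "lev 0 0 1 = 0" "lev 0 0 2 = 0" "lev 0 1 0 = 0" "lev 0 1 1 = 0"
  "lev 0 1 2 = - 1" "lev 0 2 0 = 0" "lev 0 2 1 = 1" "lev 0 2 2 = 0" "lev 1 0 0 = 0"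
  "lev 1 0 1 = 0" "lev 1 0 2 = 1" "lev 1 1 0 = 0" "lev 1 1 1 = 0" "lev 1 1 2 = 0"
  "lev 1 2 0 = - 1" "lev 1 2 1 = 0" "lev 1 2 2 = 0" "lev 2 0 0 = 0" "lev 2 0 1 = - 1"
  "lev 2 0 2 = 0" "lev 2 1 0 = 1" "lev 2 1 1 = 0" "lev 2 1 2 = 0" "lev 2 2 0 = 0"
  "lev 2 2 1 = 0" "lev 2 2 2 = 0"
  by (simp_all add: lev_def)

text \<open>Cofactor matrices describe the induced map on cross products.\<close>

lemma cof3_cross:
  assumes "a < 3" "a' < 3" "c < 3"
  shows "(\<Sum>k<3. \<Sum>k'<3. cof3 R k a * cof3 R k' a' * lev k k' c) = det3 R * (\<Sum>c'<3. lev a a' c' * R c c')"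
  using assms unfolding less3
  by (elim disjE; simp only: sum3 lev_values mult_zero_right mult_zero_left mult_1_right add_0_left add_0_right
      mult_minus_right mult_minus_left mult_1_left cof3_entries det3_def; simp add: algebra_simps)

lemma lev_antisym: "lev b a c = - lev a b c"
  by (auto simp: lev_def)

lemma lev_same: "lev a a c = 0"
  by (auto simp: lev_def)

text \<open>The matrix psi as a form on letters: \<open>a\<close> and \<open>a'\<close> are block
  letters, \<open>b\<close> and \<open>b'\<close> are indices shifted by 3, and letters of the wrong
  kind give 0.\<close>

definition omy :: "(nat \<Rightarrow> nat \<Rightarrow> nat \<Rightarrow> complex) \<Rightarrow> nat \<Rightarrow> nat \<Rightarrow> nat \<Rightarrow> nat \<Rightarrow> complex" where
  "omy Y a b a' b' = (if a < 3 \<and> a' < 3 \<and> 3 \<le> b \<and> 3 \<le> b' then \<Sum>c<3. lev a a' c * Y c (b - 3) (b' - 3) else 0)"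

text \<open>Block letters transform by cofactors, as in the second exterior power of the first
  space, and index letters by the matrix itself. \<open>rev3\<close> accounts for the reversed block
  letters.\<close>

definition thm3 :: "(nat \<Rightarrow> nat \<Rightarrow> complex) \<Rightarrow> nat \<Rightarrow> nat \<Rightarrow> complex" where
  "thm3 g = bmat 3 (cof3 (rev3 g)) (\<lambda>i j. g (3 + i) (3 + j))"

lemma pfw_not_pat:
  assumes "\<not> pat (2 * m) (2 * m) 3 w"
  shows "pfw m (omy Y) w = 0"
  unfolding pfw_def
proof (rule sum.neutral, rule ballI)
  fix \<sigma> assume "\<sigma> \<in> {\<sigma>. \<sigma> permutes {..<2 * m}}"
  then have \<sigma>: "\<sigma> permutes {..<2 * m}" by simp
  obtain p where p: "p < 2 * m" "\<not> w p < 3 \<or> \<not> 3 \<le> w (2 * m + p)" using assms by (auto simp: pat_def)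
  define q where "q = inv_into UNIV \<sigma> p"
  have q: "\<sigma> q = p" "q < 2 * m"
    using permutes_inverses[OF \<sigma>] permutes_in_image[OF permutes_inv[OF \<sigma>]] p(1) by (auto simp: q_def)
  have "q = 2 * (q div 2) \<or> q = 2 * (q div 2) + 1" "q div 2 < m" using q(2) by auto
  then obtain i where i: "i < m" "q = 2 * i \<or> q = 2 * i + 1" by blast
  then have "omy Y (w (\<sigma> (2 * i))) (w (2 * m + \<sigma> (2 * i))) (w (\<sigma> (2 * i + 1))) (w (2 * m + \<sigma> (2 * i + 1))) = 0"
    using q(1) p(2) by (auto simp: omy_def)
  then have "(\<Prod>i<m. omy Y (w (\<sigma> (2 * i))) (w (2 * m + \<sigma> (2 * i))) (w (\<sigma> (2 * i + 1))) (w (2 * m + \<sigma> (2 * i + 1)))) = 0"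
    using i(1) by (intro prod_zero) (auto intro!: bexI[of _ i])
  then show "of_int (sign \<sigma>) * (\<Prod>i<m. omy Y (w (\<sigma> (2 * i))) (w (2 * m + \<sigma> (2 * i))) (w (\<sigma> (2 * i + 1))) (w (2 * m + \<sigma> (2 * i + 1)))) = 0"
    by simp
qed

text \<open>
  The letter \<open>a < 3\<close> stands for the block \<open>2 - a\<close> of the matrix: reversing the blocks makes the
  dual of the first space a representation with the usual order of its weights.
\<close>

locale pf_space = two_spaces sU us sV vs
  for sU :: "complex \<Rightarrow> 'u::ab_group_add \<Rightarrow> 'u" and us and sV :: "complex \<Rightarrow> 'v::ab_group_add \<Rightarrow> 'v" and vs +
  fixes m :: nat
  assumes K3: "length us = 3"
begin

definition Yf :: "('u \<Rightarrow> 'v \<Rightarrow> 'v \<Rightarrow> complex) \<Rightarrow> nat \<Rightarrow> nat \<Rightarrow> nat \<Rightarrow> complex" where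
  "Yf y c i j = y (us ! (2 - c)) (vs ! i) (vs ! j)"

definition PQ :: "(nat \<Rightarrow> nat) \<Rightarrow> ('u \<Rightarrow> 'v \<Rightarrow> 'v \<Rightarrow> complex) \<Rightarrow> complex" where
  "PQ w y = (if y \<in> form_space sU sV then pfw m (omy (Yf y)) w / (2 ^ m * fact m) else 0)"

abbreviation "Wd \<equiv> words (4 * m) (3 + n)"
abbreviation "patm \<equiv> pat (2 * m) (2 * m) 3"

lemma form_linear:
  assumes "y \<in> form_space sU sV"
  shows "Vector_Spaces.linear sU (*) (\<lambda>u. y u v w)" "Vector_Spaces.linear sV (*) (\<lambda>v. y u v w)"
    "Vector_Spaces.linear sV (*) (\<lambda>w. y u v w)" "y u v w = y u w v"
proof -
  show 1: "Vector_Spaces.linear sU (*) (\<lambda>u. y u v w)" "Vector_Spaces.linear sV (*) (\<lambda>v. y u v w)" "y u v w = y u w v" for u v w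
    using assms unfolding form_space_def by blast+
  have "(\<lambda>w. y u v w) = (\<lambda>w. y u w v)" using 1(3) by blast
  then show "Vector_Spaces.linear sV (*) (\<lambda>w. y u v w)" using 1(2)[of u v] by simp
qed

text \<open>The inverses of \<open>g\<close> and \<open>h\<close> give the backward direction. Hence
  functions extended by 0 outside \<open>form_space\<close> stay of this kind under the
  action.\<close>

lemma form_act:
  assumes gh: "g \<in> carrier (GL sU)" "h \<in> carrier (GL sV)"
  shows "(\<lambda>u v w. y (g u) (h v) (h w)) \<in> form_space sU sV \<longleftrightarrow> y \<in> form_space sU sV"
proof -
  have 1: "(\<lambda>u v w. y (g u) (h v) (h w)) \<in> form_space sU sV"
    if y: "y \<in> form_space sU sV" and g: "g \<in> carrier (GL sU)" and h: "h \<in> carrier (GL sV)" for y g h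
  proof -
    have g': "Vector_Spaces.linear sU sU g" and h': "Vector_Spaces.linear sV sV h" using g h by (auto simp: carrier_GL)
    have "Vector_Spaces.linear sU (*) (\<lambda>u. y (g u) (h v) (h w))" for v w
      using Vector_Spaces.linear_compose[OF g' form_linear(1)[OF y]] by (simp add: comp_def)
    moreover have "Vector_Spaces.linear sV (*) (\<lambda>v. y (g u) (h v) (h w))" for u w
      using Vector_Spaces.linear_compose[OF h' form_linear(2)[OF y]] by (simp add: comp_def)
    ultimately show ?thesis using form_linear(4)[OF y] unfolding form_space_def by blast
  qed
  have inv: "inv_into UNIV g \<in> carrier (GL sU)" "inv_into UNIV h \<in> carrier (GL sV)"
    "\<And>u. g (inv_into UNIV g u) = u" "\<And>v. h (inv_into UNIV h v) = v"
  proof -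
    have bg: "bij g" and bh: "bij h" using gh by (auto simp: carrier_GL)
    interpret GU: group "GL sU" by (rule group_GL[OF U.vector_space_axioms])
    interpret GV: group "GL sV" by (rule group_GL[OF V.vector_space_axioms])
    show gi: "\<And>u. g (inv_into UNIV g u) = u" "\<And>v. h (inv_into UNIV h v) = v"
      using bg bh by (auto simp: bij_is_surj surj_f_inv_f)
    have "\<exists>g'\<in>carrier (GL sU). g \<otimes>\<^bsub>GL sU\<^esub> g' = \<one>\<^bsub>GL sU\<^esub>" using GU.r_inv_ex[OF gh(1)] by blast
    then obtain g' where g': "g' \<in> carrier (GL sU)" "g \<circ> g' = id" by (auto simp: GL_def)
    have "inv_into UNIV g = g'" using g'(2) bg by (metis bij_is_inj comp_apply ext gi(1) id_apply injD)
    then show "inv_into UNIV g \<in> carrier (GL sU)" using g' by simp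
    have "\<exists>h'\<in>carrier (GL sV). h \<otimes>\<^bsub>GL sV\<^esub> h' = \<one>\<^bsub>GL sV\<^esub>" using GV.r_inv_ex[OF gh(2)] by blast
    then obtain h' where h': "h' \<in> carrier (GL sV)" "h \<circ> h' = id" by (auto simp: GL_def)
    have "inv_into UNIV h = h'" using h'(2) bh by (metis bij_is_inj comp_apply ext gi(2) id_apply injD)
    then show "inv_into UNIV h \<in> carrier (GL sV)" using h' by simp
  qed
  show ?thesis
  proof
    assume "(\<lambda>u v w. y (g u) (h v) (h w)) \<in> form_space sU sV"
    from 1[OF this inv(1,2)] show "y \<in> form_space sU sV" by (simp add: inv(3,4))
  qed (rule 1[OF _ gh])
qed

lemma Yf_act:
  assumes y: "y \<in> form_space sU sV" and "c' < 3" "j < n" "j' < n"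
  shows "Yf (\<lambda>u v w. y (g u) (h v) (h w)) c' j j' =
    (\<Sum>c<3. U.mat g (2 - c) (2 - c') * (\<Sum>l<n. \<Sum>l'<n. V.mat h l j * V.mat h l' j' * Yf y c l l'))"
proof -
  have 1: "y u (h (vs ! j)) (h (vs ! j')) = (\<Sum>l<n. \<Sum>l'<n. V.mat h l j * V.mat h l' j' * y u (vs ! l) (vs ! l'))" for u
  proof -
    have "y u (h (vs ! j)) (h (vs ! j')) = (\<Sum>l<n. V.mat h l j * y u (vs ! l) (h (vs ! j')))"
      using V.functional_expand[OF form_linear(2)[OF y, of u "h (vs ! j')"], of "h (vs ! j)"] by (simp add: V.mat_def)
    also have "\<dots> = (\<Sum>l<n. V.mat h l j * (\<Sum>l'<n. V.mat h l' j' * y u (vs ! l) (vs ! l')))"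
    proof (rule sum.cong[OF refl])
      fix l
      show "V.mat h l j * y u (vs ! l) (h (vs ! j')) = V.mat h l j * (\<Sum>l'<n. V.mat h l' j' * y u (vs ! l) (vs ! l'))"
        using V.functional_expand[OF form_linear(3)[OF y, of u "vs ! l"], of "h (vs ! j')"] by (simp add: V.mat_def)
    qed
    finally show ?thesis by (simp add: sum_distrib_left mult.assoc)
  qed
  have "Yf (\<lambda>u v w. y (g u) (h v) (h w)) c' j j' =
      (\<Sum>k<3. U.mat g k (2 - c') * y (us ! k) (h (vs ! j)) (h (vs ! j')))"
    using U.functional_expand[OF form_linear(1)[OF y, of "h (vs ! j)" "h (vs ! j')"], of "g (us ! (2 - c'))"]
    by (simp add: Yf_def U.mat_def K3)
  also have "\<dots> = (\<Sum>c<3. U.mat g (2 - c) (2 - c') * y (us ! (2 - c)) (h (vs ! j)) (h (vs ! j')))"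
    by (simp add: sum3)
  finally show ?thesis unfolding 1 Yf_def .
qed

text \<open>The substitution in \<open>y\<close> transforms the index \<open>c\<close> of its
  matrices; \<open>cof3_cross\<close> trades this for cofactors on the two block letters, at the
  price of one determinant.\<close>

lemma omy_act:
  fixes g :: "'u \<Rightarrow> 'u" and h :: "'v \<Rightarrow> 'v"
  assumes y: "y \<in> form_space sU sV"
    and ab: "a < 3 + n" "b < 3 + n" "a' < 3 + n" "b' < 3 + n"
  defines "X \<equiv> thm3 (gmat (g, h))"
  shows "(\<Sum>k<3 + n. \<Sum>l<3 + n. \<Sum>k'<3 + n. \<Sum>l'<3 + n. X k a * X l b * X k' a' * X l' b' * omy (Yf y) k l k' l') =
    det3 (rev3 (U.mat g)) * omy (Yf (\<lambda>u v w. y (g u) (h v) (h w))) a b a' b'"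
proof (cases "a < 3 \<and> a' < 3 \<and> 3 \<le> b \<and> 3 \<le> b'")
  case False
  have "X k a * X l b * X k' a' * X l' b' * omy (Yf y) k l k' l' = 0" for k l k' l'
  proof -
    have "X k a * X l b * X k' a' * X l' b' = 0 \<or> \<not> (k < 3 \<and> k' < 3 \<and> 3 \<le> l \<and> 3 \<le> l')"
      using False by (auto simp: X_def thm3_def bmat_def)
    then show ?thesis by (auto simp: omy_def)
  qed
  then have "(\<Sum>k<3 + n. \<Sum>l<3 + n. \<Sum>k'<3 + n. \<Sum>l'<3 + n. X k a * X l b * X k' a' * X l' b' * omy (Yf y) k l k' l') = 0"
    by (simp only: sum.neutral_const)
  then show ?thesis using False by (auto simp: omy_def)
next
  case True
  define j where "j = b - 3"
  define j' where "j' = b' - 3"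
  have b: "b = 3 + j" "b' = 3 + j'" "j < n" "j' < n" using True ab by (auto simp: j_def j'_def)
  let ?R = "rev3 (U.mat g)"
  let ?C = "cof3 ?R"
  let ?H = "V.mat h"
  have Xu: "X k a = (if k < 3 then ?C k a else 0)" "X k a' = (if k < 3 then ?C k a' else 0)" for k
  proof -
    have "cof3 (rev3 (gmat (g, h))) k a = ?C k a" if "a < 3" "k < 3" for a k
      using that unfolding less3
      by (elim disjE; simp only: cof3_entries rev3_def gmat_def bmat_def; simp add: K3)
    then show "X k a = (if k < 3 then ?C k a else 0)" "X k a' = (if k < 3 then ?C k a' else 0)"
      using True by (auto simp: X_def thm3_def bmat_def)
  qed
  have Xv: "X k b = (if k < 3 then 0 else ?H (k - 3) j)" "X k b' = (if k < 3 then 0 else ?H (k - 3) j')" for k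
    by (auto simp: X_def thm3_def bmat_def b gmat_def K3)
  define S where "S = (\<lambda>c. \<Sum>l<n. \<Sum>l'<n. ?H l j * ?H l' j' * Yf y c l l')"
  have om: "omy (Yf y) k (3 + l) k' (3 + l') = (\<Sum>c<3. lev k k' c * Yf y c l l')" if "k < 3" "k' < 3" for k k' l l'
    using that by (simp add: omy_def)
  have "(\<Sum>k<3 + n. \<Sum>l<3 + n. \<Sum>k'<3 + n. \<Sum>l'<3 + n. X k a * X l b * X k' a' * X l' b' * omy (Yf y) k l k' l') =
      (\<Sum>k<3. \<Sum>l<n. \<Sum>k'<3. \<Sum>l'<n. ?C k a * ?H l j * ?C k' a' * ?H l' j' * (\<Sum>c<3. lev k k' c * Yf y c l l'))"
    unfolding sum_block[of _ 3 n] by (simp add: Xu Xv om cong: sum.cong_simp)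
  also have "\<dots> = (\<Sum>k<3. \<Sum>k'<3. \<Sum>l<n. \<Sum>l'<n. ?C k a * ?H l j * ?C k' a' * ?H l' j' * (\<Sum>c<3. lev k k' c * Yf y c l l'))"
    by (rule sum.cong[OF refl], rule sum.swap)
  also have "\<dots> = (\<Sum>k<3. \<Sum>k'<3. \<Sum>c<3. (?C k a * ?C k' a' * lev k k' c) * S c)"
  proof (rule sum.cong[OF refl], rule sum.cong[OF refl])
    fix k k'
    have "(\<Sum>l<n. \<Sum>l'<n. ?C k a * ?H l j * ?C k' a' * ?H l' j' * (\<Sum>c<3. lev k k' c * Yf y c l l')) =
      (\<Sum>l<n. \<Sum>l'<n. \<Sum>c<3. (?C k a * ?C k' a' * lev k k' c) * (?H l j * ?H l' j' * Yf y c l l'))"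
      by (simp add: sum_distrib_left mult_ac)
    also have "\<dots> = (\<Sum>c<3. \<Sum>l<n. \<Sum>l'<n. (?C k a * ?C k' a' * lev k k' c) * (?H l j * ?H l' j' * Yf y c l l'))"
      by (rule sum_rotate3[symmetric])
    finally show "(\<Sum>l<n. \<Sum>l'<n. ?C k a * ?H l j * ?C k' a' * ?H l' j' * (\<Sum>c<3. lev k k' c * Yf y c l l')) =
      (\<Sum>c<3. (?C k a * ?C k' a' * lev k k' c) * S c)"
      by (simp add: S_def sum_distrib_left)
  qed
  also have "\<dots> = (\<Sum>c<3. (\<Sum>k<3. \<Sum>k'<3. ?C k a * ?C k' a' * lev k k' c) * S c)"
    unfolding sum_distrib_right by (rule sum_rotate3[symmetric])
  also have "\<dots> = (\<Sum>c<3. \<Sum>c'<3. det3 ?R * lev a a' c' * ?R c c' * S c)"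
  proof (rule sum.cong[OF refl])
    fix c assume "c \<in> {..<3 :: nat}"
    then have cc: "(\<Sum>k<3. \<Sum>k'<3. ?C k a * ?C k' a' * lev k k' c) = det3 ?R * (\<Sum>c'<3. lev a a' c' * ?R c c')"
      using True by (intro cof3_cross) auto
    show "(\<Sum>k<3. \<Sum>k'<3. ?C k a * ?C k' a' * lev k k' c) * S c = (\<Sum>c'<3. det3 ?R * lev a a' c' * ?R c c' * S c)"
      unfolding cc by (simp add: sum_distrib_left sum_distrib_right mult.assoc)
  qed
  also have "\<dots> = (\<Sum>c'<3. \<Sum>c<3. det3 ?R * lev a a' c' * ?R c c' * S c)"
    by (rule sum.swap)
  also have "\<dots> = det3 ?R * (\<Sum>c'<3. lev a a' c' * Yf (\<lambda>u v w. y (g u) (h v) (h w)) c' j j')"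
    using Yf_act[OF y _ b(3,4), of _ g h]
    by (simp add: sum_distrib_left S_def rev3_def mult.assoc cong: sum.cong_simp)
  also have "\<dots> = det3 ?R * omy (Yf (\<lambda>u v w. y (g u) (h v) (h w))) a b a' b'"
    using True by (simp add: omy_def b)
  finally show ?thesis .
qed

text \<open>Each of the \<open>m\<close> entries in a term of the Pfaffian contributes one
  determinant from \<open>omy_act\<close>.\<close>

lemma PQ_act:
  assumes gh: "g \<in> carrier (GL sU)" "h \<in> carrier (GL sV)"
  shows "cscale (det3 (rev3 (U.mat g)) ^ m) (poly_act (g, h) (lin Wd PQ x)) = lin Wd PQ (act (4 * m) (3 + n) (thm3 (gmat (g, h))) x)"
proof
  fix y :: "'u \<Rightarrow> 'v \<Rightarrow> 'v \<Rightarrow> complex"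
  let ?y = "\<lambda>u v w. y (g u) (h v) (h w)" and ?X = "thm3 (gmat (g, h))"
  let ?D = "det3 (rev3 (U.mat g)) ^ m"
  show "cscale ?D (poly_act (g, h) (lin Wd PQ x)) y = lin Wd PQ (act (4 * m) (3 + n) ?X x) y"
  proof (cases "y \<in> form_space sU sV")
    case False
    then show ?thesis using form_act[OF gh, of y] by (simp add: poly_act_def lin_def PQ_def cscale_def)
  next
    case True
    have y': "?y \<in> form_space sU sV" using form_act[OF gh, of y] True by simp
    have "(\<Sum>v\<in>Wd. (\<Prod>p<4 * m. ?X (v p) (w p)) * PQ v y) = ?D * PQ w ?y" if w: "w \<in> Wd" for w
    proof -
      have "(\<Sum>v\<in>Wd. (\<Prod>p<4 * m. ?X (v p) (w p)) * pfw m (omy (Yf y)) v) = ?D * pfw m (omy (Yf ?y)) w"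
        by (rule pfw_substitute[OF omy_act[OF True] w])
      then have "(\<Sum>v\<in>Wd. (\<Prod>p<4 * m. ?X (v p) (w p)) * pfw m (omy (Yf y)) v) / (2 ^ m * fact m) = ?D * pfw m (omy (Yf ?y)) w / (2 ^ m * fact m)"
        by simp
      then show ?thesis unfolding sum_divide_distrib PQ_def using True y' by simp
    qed
    then have "lin Wd PQ (act (4 * m) (3 + n) ?X x) y = (\<Sum>w\<in>Wd. x w * (?D * PQ w ?y))"
      unfolding lin_act by (intro sum.cong[OF refl]) simp
    then show ?thesis by (simp add: poly_act_def lin_def cscale_def sum_distrib_left mult_ac)
  qed
qed

lemma four: "2 * m + 2 * m = 4 * m" by simp

lemma PQ_pat: "PQ w \<noteq> 0 \<Longrightarrow> patm w"
  using pfw_not_pat[of m w] by (auto simp: PQ_def fun_eq_iff split: if_splits)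

lemma PQ_alternating:
  assumes "\<tau> permutes {..<2 * m}" "\<And>p. p < 2 * m \<Longrightarrow> v p = w (\<tau> p) \<and> v (2 * m + p) = w (2 * m + \<tau> p)"
  shows "PQ v = cscale (of_int (sign \<tau>)) (PQ w)"
  using pfw_alternating[OF assms(1), of v w] assms(2) by (auto simp: PQ_def cscale_def fun_eq_iff)

lemma PQ_inj:
  assumes "PQ w \<noteq> 0"
  shows "inj_on (\<lambda>p. (w p, rgt (2 * m) 3 w p)) {..<2 * m}"
proof (rule inj_onI, rule ccontr)
  fix p q assume pq: "p \<in> {..<2 * m}" "q \<in> {..<2 * m}" "(w p, rgt (2 * m) 3 w p) = (w q, rgt (2 * m) 3 w q)" "p \<noteq> q"
  have "3 \<le> w (2 * m + p)" "3 \<le> w (2 * m + q)" using pq(1,2) PQ_pat[OF assms] by (auto simp: pat_def)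
  then have "w (2 * m + p) = w (2 * m + q)" using pq(3) by (auto simp: rgt_def)
  then have "pfw m Om w = 0" for Om using pfw_duplicate[of p m q w Om] pq by simp
  then have "PQ w = 0" by (auto simp: PQ_def)
  then show False using assms by simp
qed

lemma PQ_block:
  assumes "PQ w \<noteq> 0"
  shows "cnt (2 * m) w a \<le> m"
proof (rule ccontr)
  assume "\<not> cnt (2 * m) w a \<le> m"
  then have "pfw m (omy Y) w = 0" for Y
    by (intro pfw_zero_block[of _ a]) (auto simp: omy_def lev_same cnt_def)
  then have "PQ w = 0" by (auto simp: PQ_def)
  then show False using assms by simp
qed

text \<open>On the pattern the first sum runs over exchanges of blocks and the second over exchanges
  of indices; they cancel pair by pair through \<open>pfw_swaps\<close>.\<close>

lemma PQ_swaps: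
  assumes w: "w \<in> Wd"
  shows "(\<Sum>p<4 * m. \<Sum>q<4 * m. if p \<noteq> q \<and> w p \<in> {..<3} \<and> w q \<in> {..<3} then PQ (w \<circ> transpose p q) y else 0) +
    (\<Sum>p<4 * m. \<Sum>q<4 * m. if p \<noteq> q \<and> w p \<in> {3..<3 + n} \<and> w q \<in> {3..<3 + n} then PQ (w \<circ> transpose p q) y else 0) = 0"
proof (cases "patm w")
  case False
  have z: "PQ (w \<circ> transpose p q) y = 0" if "p < 4 * m" "q < 4 * m" "w p < 3 \<longleftrightarrow> w q < 3" for p q
  proof -
    have "\<not> patm (w \<circ> transpose p q)" using pat_swap[of p "2 * m" "2 * m" q w 3] that False by simp
    then have "PQ (w \<circ> transpose p q) = 0" using PQ_pat by blast
    then show ?thesis by simp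
  qed
  show ?thesis by (simp add: z cong: sum.cong_simp if_cong)
next
  case True
  have lo: "w p < 3 \<longleftrightarrow> p < 2 * m" if "p < 4 * m" for p
  proof (cases "p < 2 * m")
    case False
    then have "p = 2 * m + (p - 2 * m)" "p - 2 * m < 2 * m" using that by auto
    then have "3 \<le> w p" using True unfolding pat_def by metis
    then show ?thesis using False by simp
  qed (use True in \<open>simp add: pat_def\<close>)
  have up: "w p < 3 + n" if "p < 4 * m" for p using words_less[OF w that] .
  have "(\<Sum>p<4 * m. \<Sum>q<4 * m. if p \<noteq> q \<and> w p \<in> {..<3} \<and> w q \<in> {..<3} then PQ (w \<circ> transpose p q) y else 0) =
      (\<Sum>p<4 * m. \<Sum>q<4 * m. if p \<noteq> q \<and> p < 2 * m \<and> q < 2 * m then PQ (w \<circ> transpose p q) y else 0)"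
    by (intro sum.cong refl if_cong) (simp_all add: lo)
  also have "\<dots> = (\<Sum>p<2 * m. \<Sum>q<2 * m. if p \<noteq> q then PQ (w \<circ> transpose p q) y else 0)"
    unfolding four[symmetric] sum_block[of _ "2 * m" "2 * m"] by simp
  finally have 1: "(\<Sum>p<4 * m. \<Sum>q<4 * m. if p \<noteq> q \<and> w p \<in> {..<3} \<and> w q \<in> {..<3} then PQ (w \<circ> transpose p q) y else 0) =
      (\<Sum>p<2 * m. \<Sum>q<2 * m. if p \<noteq> q then PQ (w \<circ> transpose p q) y else 0)" .
  have "(\<Sum>p<4 * m. \<Sum>q<4 * m. if p \<noteq> q \<and> w p \<in> {3..<3 + n} \<and> w q \<in> {3..<3 + n} then PQ (w \<circ> transpose p q) y else 0) =
      (\<Sum>p<4 * m. \<Sum>q<4 * m. if p \<noteq> q \<and> 2 * m \<le> p \<and> 2 * m \<le> q then PQ (w \<circ> transpose p q) y else 0)"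
    by (intro sum.cong refl if_cong) (use lo up in \<open>auto simp: not_less[symmetric]\<close>)
  also have "\<dots> = (\<Sum>p<2 * m. \<Sum>q<2 * m. if p \<noteq> q then PQ (w \<circ> transpose (2 * m + p) (2 * m + q)) y else 0)"
    unfolding four[symmetric] sum_block[of _ "2 * m" "2 * m"] by simp
  also have "\<dots> = (\<Sum>p<2 * m. \<Sum>q<2 * m. - (if p \<noteq> q then PQ (w \<circ> transpose p q) y else 0))"
    by (intro sum.cong refl) (simp add: PQ_def pfw_swaps)
  finally show ?thesis unfolding 1 by (simp add: sum_negf)
qed

lemma lin_PQ_Sw: "lin Wd PQ (Sw (4 * m) (3 + n) {..<3} x) + lin Wd PQ (Sw (4 * m) (3 + n) {3..<3 + n} x) = 0"
proof
  fix y
  let ?A = "\<lambda>B w. \<Sum>p<4 * m. \<Sum>q<4 * m. if p \<noteq> q \<and> w p \<in> B \<and> w q \<in> B then PQ (w \<circ> transpose p q) y else 0"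
  have "(lin Wd PQ (Sw (4 * m) (3 + n) {..<3} x) + lin Wd PQ (Sw (4 * m) (3 + n) {3..<3 + n} x)) y =
      (\<Sum>w\<in>Wd. x w * ?A {..<3} w) + (\<Sum>w\<in>Wd. x w * ?A {3..<3 + n} w)"
    by (simp only: plus_fun_apply lin_Sw)
  also have "\<dots> = (\<Sum>w\<in>Wd. x w * (?A {..<3} w + ?A {3..<3 + n} w))"
    by (simp only: sum.distrib distrib_left)
  also have "\<dots> = 0"
    by (rule sum.neutral, rule ballI, subst PQ_swaps) simp_all
  finally show "(lin Wd PQ (Sw (4 * m) (3 + n) {..<3} x) + lin Wd PQ (Sw (4 * m) (3 + n) {3..<3 + n} x)) y = 0 y"
    by simp
qed

end

text \<open>
  A symmetric triple of matrices whose psi has exactly one perfect matching on the rows of a Young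
  diagram with row lengths \<open>b + c\<close>, \<open>a + c\<close>, \<open>a + b\<close>, where \<open>a \<le> b \<le> c\<close>; the pair number \<open>i\<close> of the
  matching is \<open>pair1 i\<close>, \<open>pair2 i\<close>.
\<close>

definition pair1 :: "nat \<Rightarrow> nat \<Rightarrow> nat \<Rightarrow> nat \<times> nat" where
  "pair1 a b i = (if i < a + b then (2, i) else if i < a + b + b then (1, i - (a + b)) else (1, i - b))"

definition pair2 :: "nat \<Rightarrow> nat \<Rightarrow> nat \<Rightarrow> nat \<Rightarrow> nat \<times> nat" where
  "pair2 a b c i = (if i < b then (0, i) else if i < a + b then (1, i)
     else if i - (a + b) < a then (0, b + (i - (a + b)))
     else if i - (a + b) < b then (0, c + (i - (a + b))) else (0, i - b))"

definition Ymatch :: "nat \<Rightarrow> nat \<Rightarrow> nat \<Rightarrow> nat \<Rightarrow> nat \<Rightarrow> nat \<Rightarrow> complex" where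
  "Ymatch a b c k i j = of_bool (if k = 0 then i = j \<and> b \<le> i \<and> i < a + b
     else if k = 1 then i = j \<and> i < b
     else i = j \<and> a + b \<le> i \<and> i < a + c \<or>
       i < b \<and> j = (if i < a then b + i else c + i) \<or> j < b \<and> i = (if j < a then b + j else c + j))"

definition levY :: "(nat \<Rightarrow> nat \<Rightarrow> nat \<Rightarrow> complex) \<Rightarrow> nat \<times> nat \<Rightarrow> nat \<times> nat \<Rightarrow> complex" where
  "levY Y z z' = (\<Sum>k<3. lev (fst z) (fst z') k * Y k (snd z) (snd z'))"

lemma Ymatch_sym: "Ymatch a b c k i j = Ymatch a b c k j i"
  unfolding Ymatch_def by (rule arg_cong[of _ _ of_bool]) auto

lemma levY_values:
  "levY Y (2, i) (0, j) = - Y 1 i j" "levY Y (2, i) (1, j) = Y 0 i j" "levY Y (2, i) (2, j) = 0"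
  "levY Y (1, i) (0, j) = Y 2 i j" "levY Y (1, i) (1, j) = 0" "levY Y (1, i) (2, j) = - Y 0 i j"
  by (simp_all only: levY_def sum3 fst_conv snd_conv lev_values; simp)+

lemma matching_nonzero:
  assumes "a \<le> b" "b \<le> c" "i < a + b + c"
  shows "levY (Ymatch a b c) (pair1 a b i) (pair2 a b c i) \<noteq> 0"
proof -
  consider "i < b" | "b \<le> i" "i < a + b" | "a + b \<le> i" "i < a + b + b" | "a + b + b \<le> i" by linarith
  then show ?thesis
    using assms by cases (auto simp: pair1_def pair2_def levY_values[unfolded One_nat_def] levY_values Ymatch_def)
qed

text \<open>Symmetry forces mirror images of the off-diagonal entries for \<open>k = 2\<close>. They
  do not disturb: they leave from \<open>(1, b + i)\<close> with \<open>i < a\<close>, a second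
  member of a pair, or from \<open>(1, c + i)\<close> with \<open>a \<le> i\<close>, outside the row
  of length \<open>a + c\<close>.\<close>

lemma matching_unique:
  assumes "a \<le> b" "b \<le> c" "i < a + b + c" "k < 3" "levY (Ymatch a b c) (pair1 a b i) (k, j) \<noteq> 0"
  shows "(k, j) = pair2 a b c i"
proof -
  have k: "k = 0 \<or> k = 1 \<or> k = 2" using assms(4) by auto
  consider "i < b" | "b \<le> i" "i < a + b" | "a + b \<le> i" "i < a + b + b" | "a + b + b \<le> i" by linarith
  then show ?thesis
    using assms k by cases (auto simp: pair1_def pair2_def levY_values[unfolded One_nat_def] levY_values Ymatch_def split: if_splits)
qed

definition mpos :: "nat \<Rightarrow> nat \<Rightarrow> nat \<Rightarrow> nat \<Rightarrow> nat \<times> nat" where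
  "mpos a b c p = (if even p then pair1 a b (p div 2) else pair2 a b c (p div 2))"

lemma mpos_inj:
  assumes "a \<le> b" "b \<le> c"
  shows "inj_on (mpos a b c) {..<2 * (a + b + c)}"
proof -
  have 1: "i = j" if "pair1 a b i = pair1 a b j" "i < a + b + c" "j < a + b + c" for i j
    using that by (auto simp: pair1_def split: if_splits)
  have 2: "i = j" if "pair2 a b c i = pair2 a b c j" "i < a + b + c" "j < a + b + c" for i j
    using that assms by (auto simp: pair2_def split: if_splits)
  have 3: "pair1 a b i \<noteq> pair2 a b c j" if "i < a + b + c" "j < a + b + c" for i j
    using that assms by (auto simp: pair1_def pair2_def split: if_splits)
  show ?thesis
  proof (rule inj_onI)
    fix p q assume pq: "p \<in> {..<2 * (a + b + c)}" "q \<in> {..<2 * (a + b + c)}" "mpos a b c p = mpos a b c q"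
    have lt: "p div 2 < a + b + c" "q div 2 < a + b + c" using pq by auto
    have "p div 2 = q div 2 \<and> (even p \<longleftrightarrow> even q)"
      using pq(3) 1[OF _ lt] 2[OF _ lt] 3[OF lt] 3[OF lt(2,1)] by (auto simp: mpos_def split: if_splits)
    then show "p = q" by (metis even_two_times_div_two odd_two_times_div_two_succ)
  qed
qed

lemma mpos_diagram:
  assumes "a \<le> b" "b \<le> c" "p < 2 * (a + b + c)"
  shows "mpos a b c p \<in> {(k, j). k < 3 \<and> j < [b + c, a + c, a + b] ! k}"
proof -
  have lt: "p div 2 < a + b + c" using assms(3) by auto
  show ?thesis
    using assms(1,2) lt by (auto simp: mpos_def pair1_def pair2_def nth_Cons')
qed

lemma det3_cong: "(\<And>k l. k < 3 \<Longrightarrow> l < 3 \<Longrightarrow> R k l = S k l) \<Longrightarrow> det3 R = det3 S"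
  by (simp add: det3_def)

lemma cof3_cong: "(\<And>k l. k < 3 \<Longrightarrow> l < 3 \<Longrightarrow> R k l = S k l) \<Longrightarrow> cof3 R k l = cof3 S k l"
  by (simp add: cof3_def)

lemma det3_el:
  assumes "i < 3" "j < 3"
  shows "det3 (el z j i) = (if i = j then 1 + z else 1)"
  using assms unfolding less3 by (elim disjE; simp only: det3_def el_def; simp)

text \<open>Taking cofactors transposes and inverts, up to the determinant. Together with
  \<open>cof3_el_diag\<close> this shows that every invertible elementary matrix is a cofactor
  matrix up to a scalar.\<close>

lemma cof3_el_offdiag:
  assumes "i < 3" "j < 3" "i \<noteq> j" "k < 3" "l < 3"
  shows "cof3 (el (- z) j i) k l = el z i j k l"
  using assms unfolding less3 by (elim disjE; simp only: cof3_entries el_def; simp)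

lemma cof3_el_diag:
  assumes "i < 3" "k < 3" "l < 3" and w: "(1 + w) * (1 + z) = 1"
  shows "cof3 (el w i i) k l = (1 + w) * el z i i k l"
  using assms(1-3) unfolding less3 by (elim disjE; simp only: cof3_entries el_def; simp add: w)

section \<open>The highest weight words of the Pfaffians\<close>

context pf_space
begin

text \<open>Diagrams of three rows, zero rows allowed, whose boxes (block, index) serve as rows of
  psi. The bound \<open>m\<close> reflects the vanishing diagonal blocks of psi and the bound
  \<open>n\<close> the number of indices.\<close>

definition TL :: "nat list set" where
  "TL = {L. length L = 3 \<and> sorted_wrt (\<ge>) L \<and> sum_list L = 2 * m \<and> (\<forall>i<3. L ! i \<le> m \<and> L ! i \<le> n)}"

text \<open>A box becomes a row of the submatrix, with its row number as block letter and its column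
  number as index. The two weights are thus \<open>L\<close> and its conjugate.\<close>

definition ptop :: "nat list \<Rightarrow> nat \<Rightarrow> nat" where
  "ptop L = joinw (2 * m) (2 * m) 3 (brow L) (bcol L)"

definition zs :: "(nat \<Rightarrow> nat) \<Rightarrow> nat \<Rightarrow> nat \<times> nat" where
  "zs w p = (w p, rgt (2 * m) 3 w p)"

lemma ptop_at: "p < 2 * m \<Longrightarrow> ptop L p = brow L p" "p < 2 * m \<Longrightarrow> ptop L (2 * m + p) = 3 + bcol L p"
  by (simp_all add: ptop_def joinw_def)

lemma TL_box:
  assumes "L \<in> TL" "p < 2 * m"
  shows "brow L p < 3" "bcol L p < n"
proof -
  have L: "length L = 3" "sum_list L = 2 * m" "\<And>i. i < 3 \<Longrightarrow> L ! i \<le> n" using assms(1) by (auto simp: TL_def)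
  show "brow L p < 3" using position_box(1)[of p L] assms(2) L by simp
  then show "bcol L p < n" using position_box(2)[of p L] assms(2) L(2) L(3)[of "brow L p"] by simp
qed

lemma ptop_words: "L \<in> TL \<Longrightarrow> ptop L \<in> Wd"
  using joinw_words[of "2 * m" "brow L" 3 "2 * m" "bcol L" n] TL_box by (simp add: ptop_def)

lemma ptop_pat: "L \<in> TL \<Longrightarrow> patm (ptop L)"
  using TL_box by (simp add: pat_def ptop_at)

lemma zs_ptop: "p < 2 * m \<Longrightarrow> zs (ptop L) p = (brow L p, bcol L p)"
  by (simp add: zs_def rgt_def ptop_at)

lemma zs_ptop_image:
  assumes "L \<in> TL"
  shows "zs (ptop L) ` {..<2 * m} = {(i, j). i < 3 \<and> j < L ! i}" "inj_on (zs (ptop L)) {..<2 * m}"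
proof -
  have L: "length L = 3" "sum_list L = 2 * m" using assms(1) by (auto simp: TL_def)
  show "zs (ptop L) ` {..<2 * m} = {(i, j). i < 3 \<and> j < L ! i}"
  proof
    show "zs (ptop L) ` {..<2 * m} \<subseteq> {(i, j). i < 3 \<and> j < L ! i}"
      using position_box[of _ L] L by (auto simp: zs_ptop)
    show "{(i, j). i < 3 \<and> j < L ! i} \<subseteq> zs (ptop L) ` {..<2 * m}"
    proof
      fix z assume "z \<in> {(i, j). i < 3 \<and> j < L ! i}"
      then obtain i j where z: "z = (i, j)" "i < length L" "j < L ! i" using L by auto
      obtain p where "p < sum_list L" "brow L p = i" "bcol L p = j" using box_position[OF z(2,3)] .
      then show "z \<in> zs (ptop L) ` {..<2 * m}" using z(1) L zs_ptop[of p L] by (auto simp: image_iff intro!: bexI[of _ p])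
    qed
  qed
  show "inj_on (zs (ptop L)) {..<2 * m}"
    using box_inj_on[of L] L by (auto simp: inj_on_def zs_ptop)
qed

text \<open>Words that list the same rows of psi differ by a permutation of the rows, hence by a
  sign.\<close>

lemma PQ_same_image:
  assumes "patm w" "patm v" "inj_on (zs w) {..<2 * m}" "inj_on (zs v) {..<2 * m}"
    and "zs w ` {..<2 * m} = zs v ` {..<2 * m}"
  shows "\<exists>k. k \<noteq> 0 \<and> PQ w = cscale k (PQ v)"
proof -
  obtain \<tau> where \<tau>: "\<tau> permutes {..<2 * m}" "\<And>p. p < 2 * m \<Longrightarrow> zs v (\<tau> p) = zs w p"
    using permutes_match[OF assms(3-5)] by blast
  have "w p = v (\<tau> p) \<and> w (2 * m + p) = v (2 * m + \<tau> p)" if p: "p < 2 * m" for p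
  proof -
    have "\<tau> p < 2 * m" using permutes_in_image[OF \<tau>(1)] p by simp
    then have "3 \<le> w (2 * m + p)" "3 \<le> v (2 * m + \<tau> p)" using assms(1,2) p by (auto simp: pat_def)
    then show ?thesis using \<tau>(2)[OF p] by (auto simp: zs_def rgt_def)
  qed
  then have "PQ w = cscale (of_int (sign \<tau>)) (PQ v)" by (rule PQ_alternating[OF \<tau>(1)])
  then show ?thesis by (intro exI[of _ "of_int (sign \<tau>)"]) (simp add: sign_def)
qed

definition yform :: "(nat \<Rightarrow> nat \<Rightarrow> nat \<Rightarrow> complex) \<Rightarrow> 'u \<Rightarrow> 'v \<Rightarrow> 'v \<Rightarrow> complex" where
  "yform Y u v w = (\<Sum>c<3. \<Sum>i<n. \<Sum>j<n. U.crd (2 - c) u * V.crd i v * V.crd j w * Y c i j)"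

lemma yform_space:
  assumes "\<And>c i j. Y c i j = Y c j i"
  shows "yform Y \<in> form_space sU sV"
  unfolding form_space_def
proof (intro CollectI conjI allI)
  fix u v w
  have "yform Y u w v = (\<Sum>c<3. \<Sum>j<n. \<Sum>i<n. U.crd (2 - c) u * V.crd i v * V.crd j w * Y c i j)"
    unfolding yform_def using assms by (intro sum.cong refl) (simp add: mult_ac)
  also have "\<dots> = yform Y u v w" unfolding yform_def by (intro sum.cong refl sum.swap)
  finally show "yform Y u v w = yform Y u w v" by simp
  show "Vector_Spaces.linear sU (*) (\<lambda>u. yform Y u v w)"
    unfolding Vector_Spaces.linear_iff yform_def
    by (simp add: U.vector_space_axioms vector_space_complex linear_add[OF U.linear_crd] linear_scale[OF U.linear_crd]
      distrib_right sum.distrib sum_distrib_left mult.assoc)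
  show "Vector_Spaces.linear sV (*) (\<lambda>v. yform Y u v w)"
    unfolding Vector_Spaces.linear_iff yform_def
    by (simp add: V.vector_space_axioms vector_space_complex linear_add[OF V.linear_crd] linear_scale[OF V.linear_crd]
      distrib_left distrib_right sum.distrib sum_distrib_left mult_ac)
qed

lemma Yf_yform:
  assumes "c < 3" "i < n" "j < n"
  shows "Yf (yform Y) c i j = Y c i j"
proof -
  have "Yf (yform Y) c i j = (\<Sum>c'<3. \<Sum>i'<n. \<Sum>j'<n. if j' = j then (if i' = i then (if c' = c then Y c i j else 0) else 0) else 0)"
    unfolding Yf_def yform_def
  proof (intro sum.cong refl)
    fix c' i' j' assume "c' \<in> {..<3 :: nat}" "i' \<in> {..<n}" "j' \<in> {..<n}"
    moreover have "U.crd (2 - c') (us ! (2 - c)) = (if c' = c then 1 else 0)" if "c' < 3" for c'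
      using U.crd_basis[of "2 - c" "2 - c'"] that assms(1) K3 by auto
    ultimately show "U.crd (2 - c') (us ! (2 - c)) * V.crd i' (vs ! i) * V.crd j' (vs ! j) * Y c' i' j' =
      (if j' = j then (if i' = i then (if c' = c then Y c i j else 0) else 0) else 0)"
      using assms by (auto simp: V.crd_basis)
  qed
  then show ?thesis using assms by simp
qed

text \<open>The Pfaffian is evaluated at the form with the matrices \<open>Ymatch\<close>, with the
  boxes listed in the order of the matching; by \<open>PQ_same_image\<close> this order costs only a
  scalar factor.\<close>

lemma PQ_ptop_nonzero:
  assumes "L \<in> TL"
  shows "PQ (ptop L) \<noteq> 0"
proof -
  have L: "length L = 3" "sum_list L = 2 * m" "\<And>i. i < 3 \<Longrightarrow> L ! i \<le> m" "\<And>i. i < 3 \<Longrightarrow> L ! i \<le> n" "sorted_wrt (\<ge>) L"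
    using assms by (auto simp: TL_def)
  \<comment> \<open>\<open>a\<close>, \<open>b\<close>, \<open>c\<close> count the pairs of a
    matching that avoid row 0, 1, 2 of the diagram: no pair lies inside one row, so row
    \<open>i\<close> meets exactly \<open>L ! i\<close> of the \<open>m\<close> pairs.\<close>
  define a where "a = m - L ! 0"
  define b where "b = m - L ! 1"
  define c where "c = m - L ! 2"
  have "L ! 0 \<ge> L ! 1" "L ! 1 \<ge> L ! 2" using L(1,5) by (auto simp: sorted_wrt_iff_nth_less)
  then have abc: "a \<le> b" "b \<le> c" by (auto simp: a_def b_def c_def)
  have sumL: "L ! 0 + L ! 1 + L ! 2 = 2 * m"
    using L(1,2) sum_list_sum_nth[of L] by (simp add: eval_nat_numeral)
  then have m: "a + b + c = m" "L ! 0 = b + c" "L ! 1 = a + c" "L ! 2 = a + b"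
    using L(3)[of 0] L(3)[of 1] L(3)[of 2] by (auto simp: a_def b_def c_def)
  have Leq: "L = [b + c, a + c, a + b]"
    using L(1) m by (intro nth_equalityI) (auto simp: less_Suc_eq eval_nat_numeral)
  let ?Z = "mpos a b c"
  let ?Y = "Ymatch a b c"
  define w where "w = joinw (2 * m) (2 * m) 3 (fst \<circ> ?Z) (snd \<circ> ?Z)"
  have Zin: "?Z p \<in> {(k, j). k < 3 \<and> j < L ! k}" if "p < 2 * m" for p
    using mpos_diagram[OF abc, of p] that m(1) Leq by simp
  have Z3: "fst (?Z p) < 3" "snd (?Z p) < n" if "p < 2 * m" for p
    using Zin[OF that] L(4)[of "fst (?Z p)"] by auto
  have w_at: "w p = fst (?Z p)" "w (2 * m + p) = 3 + snd (?Z p)" if "p < 2 * m" for p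
    using that by (simp_all add: w_def joinw_def)
  have pw: "patm w" using Z3 w_at by (simp add: pat_def)
  have zw: "zs w p = ?Z p" if "p < 2 * m" for p
    using w_at[OF that] by (simp add: zs_def rgt_def)
  have injZ: "inj_on ?Z {..<2 * m}" using mpos_inj[OF abc] m(1) by simp
  have injw: "inj_on (zs w) {..<2 * m}" using injZ zw by (simp add: inj_on_def)
  have im: "zs w ` {..<2 * m} = zs (ptop L) ` {..<2 * m}"
  proof (rule card_subset_eq)
    show "zs w ` {..<2 * m} \<subseteq> zs (ptop L) ` {..<2 * m}"
      unfolding zs_ptop_image(1)[OF assms]
    proof (rule image_subsetI)
      fix p assume "p \<in> {..<2 * m}"
      then show "zs w p \<in> {(i, j). i < 3 \<and> j < L ! i}" using Zin[of p] zw[of p] by (simp only: lessThan_iff)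
    qed
    show "card (zs w ` {..<2 * m}) = card (zs (ptop L) ` {..<2 * m})"
      using injw zs_ptop_image(2)[OF assms] by (simp add: card_image)
  qed simp
  have y: "yform ?Y \<in> form_space sU sV" by (rule yform_space) (rule Ymatch_sym)
  define A where "A = (\<lambda>p q. omy (Yf (yform ?Y)) (w p) (w (2 * m + p)) (w q) (w (2 * m + q)))"
  have A: "A p q = levY ?Y (?Z p) (?Z q)" if "p < 2 * m" "q < 2 * m" for p q
    using that Z3[OF that(1)] Z3[OF that(2)]
    by (simp add: A_def omy_def w_at levY_def Yf_yform cong: sum.cong_simp)
  have "(\<Sum>\<sigma> | \<sigma> permutes {..<2 * m}. of_int (sign \<sigma>) * (\<Prod>i<m. A (\<sigma> (2 * i)) (\<sigma> (2 * i + 1)))) \<noteq> 0"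
  proof (rule pair_sum_nonzero)
    show "A p q = - A q p" if "p < 2 * m" "q < 2 * m" for p q
    proof -
      have "levY ?Y z z' = - levY ?Y z' z" for z z'
        unfolding levY_def lev_antisym[of "fst z" "fst z'"] Ymatch_sym[of a b c _ "snd z" "snd z'"]
        by (simp add: sum_negf)
      then show ?thesis unfolding A[OF that] A[OF that(2,1)] .
    qed
    show "A (2 * i) (2 * i + 1) \<noteq> 0" if "i < m" for i
      using A[of "2 * i" "2 * i + 1"] that matching_nonzero[OF abc, of i] m(1) by (simp add: mpos_def)
    show "q = 2 * i + 1" if "i < m" "q < 2 * m" "A (2 * i) q \<noteq> 0" for i q
    proof -
      have "levY ?Y (pair1 a b i) (?Z q) \<noteq> 0" using A[of "2 * i" q] that by (simp add: mpos_def)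
      then have "?Z q = pair2 a b c i"
        using matching_unique[OF abc, of i "fst (?Z q)" "snd (?Z q)"] that Z3[OF that(2)] m(1) by simp
      then have "?Z q = ?Z (2 * i + 1)" by (simp add: mpos_def)
      then show ?thesis using injZ that unfolding inj_on_def by simp
    qed
  qed
  then have "pfw m (omy (Yf (yform ?Y))) w \<noteq> 0" by (simp add: pfw_def A_def)
  then have "PQ w (yform ?Y) \<noteq> 0" using y by (simp add: PQ_def)
  then have "PQ w \<noteq> 0" by auto
  moreover obtain k where "PQ w = cscale k (PQ (ptop L))"
    using PQ_same_image[OF pw ptop_pat[OF assms] injw zs_ptop_image(2)[OF assms] im] by blast
  ultimately show ?thesis by (auto simp: cscale_def fun_eq_iff)
qed

text \<open>The scalar \<open>s\<close> enters once for each of the \<open>2m\<close> block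
  positions of a word on which \<open>PQ\<close> does not vanish.\<close>

lemma thm3_scale:
  assumes s: "\<And>k l. k < 3 \<Longrightarrow> l < 3 \<Longrightarrow> cof3 (rev3 g) k l = s * E k l"
    and v: "\<And>k l. 3 \<le> k \<Longrightarrow> k < 3 + n \<Longrightarrow> 3 \<le> l \<Longrightarrow> l < 3 + n \<Longrightarrow> g k l = E k l"
    and E: "block_matrix (3 + n) 3 E"
  shows "lin Wd PQ (act (4 * m) (3 + n) (thm3 g) x) = cscale (s ^ (2 * m)) (lin Wd PQ (act (4 * m) (3 + n) E x))"
proof
  fix y
  have *: "(\<Prod>p<4 * m. thm3 g (v p) (w p)) * PQ v y = s ^ (2 * m) * ((\<Prod>p<4 * m. E (v p) (w p)) * PQ v y)"
    if v': "v \<in> Wd" and w: "w \<in> Wd" for v w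
  proof (cases "patm v")
    case False
    then have "PQ v = 0" using PQ_pat by blast
    then show ?thesis by simp
  next
    case True
    have E0: "E k l = 0" if "k < 3 + n" "l < 3 + n" "k < 3 \<longleftrightarrow> \<not> l < 3" for k l
      using E that by (auto simp: block_matrix_def blk_def)
    have 1: "thm3 g (v p) (w p) = s * E (v p) (w p)" if "p < 2 * m" for p
    proof -
      have "v p < 3" "w p < 3 + n" using True that words_less[OF w, of p] by (auto simp: pat_def)
      then show ?thesis using s E0[of "v p" "w p"] by (auto simp: thm3_def bmat_def)
    qed
    have 2: "thm3 g (v (2 * m + p)) (w (2 * m + p)) = E (v (2 * m + p)) (w (2 * m + p))" if "p < 2 * m" for p
    proof -
      have "3 \<le> v (2 * m + p)" "v (2 * m + p) < 3 + n" "w (2 * m + p) < 3 + n"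
        using True that words_less[OF w, of "2 * m + p"] words_less[OF v', of "2 * m + p"] by (auto simp: pat_def)
      then show ?thesis using v E0[of "v (2 * m + p)" "w (2 * m + p)"] by (auto simp: thm3_def bmat_def)
    qed
    have "(\<Prod>p<4 * m. thm3 g (v p) (w p)) = s ^ (2 * m) * (\<Prod>p<4 * m. E (v p) (w p))"
      unfolding four[symmetric] prod_split[of _ "2 * m" "2 * m"] by (simp add: 1 2 prod.distrib)
    then show ?thesis by simp
  qed
  have "x w * (\<Sum>v\<in>Wd. (\<Prod>p<4 * m. thm3 g (v p) (w p)) * PQ v y) =
      s ^ (2 * m) * (x w * (\<Sum>v\<in>Wd. (\<Prod>p<4 * m. E (v p) (w p)) * PQ v y))" if "w \<in> Wd" for w
  proof -
    have "(\<Sum>v\<in>Wd. (\<Prod>p<4 * m. thm3 g (v p) (w p)) * PQ v y) = s ^ (2 * m) * (\<Sum>v\<in>Wd. (\<Prod>p<4 * m. E (v p) (w p)) * PQ v y)"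
      unfolding sum_distrib_left by (rule sum.cong[OF refl]) (rule *[OF _ that])
    then show ?thesis by simp
  qed
  then show "lin Wd PQ (act (4 * m) (3 + n) (thm3 g) x) y = cscale (s ^ (2 * m)) (lin Wd PQ (act (4 * m) (3 + n) E x)) y"
    unfolding lin_act cscale_def sum_distrib_left[of "s ^ (2 * m)"] by (rule sum.cong[OF refl])
qed

text \<open>The group element is found by inverting the cofactor map on elementary matrices. It
  reproduces the given matrix up to a scalar, which is harmless for the invariance of
  subspaces.\<close>

lemma el_thm3:
  assumes "i < 3 + n" "j < 3 + n" "blk 3 i j" "i \<noteq> j \<or> z \<noteq> - 1"
  obtains g h k where "g \<in> carrier (GL sU)" "h \<in> carrier (GL sV)" "k \<noteq> 0"
    "\<And>x. lin Wd PQ (act (4 * m) (3 + n) (el z i j) x) = cscale k (poly_act (g, h) (lin Wd PQ x))"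
proof -
  have "\<exists>gh s. gh \<in> carrier (GL sU \<times>\<times> GL sV) \<and> s \<noteq> 0 \<and> det3 (rev3 (U.mat (fst gh))) \<noteq> 0 \<and>
    (\<forall>k<3. \<forall>l<3. cof3 (rev3 (gmat gh)) k l = s * el z i j k l) \<and>
    (\<forall>k l. 3 \<le> k \<longrightarrow> k < 3 + n \<longrightarrow> 3 \<le> l \<longrightarrow> l < 3 + n \<longrightarrow> gmat gh k l = el z i j k l)"
  proof (cases "i < 3")
    case False
    then have j: "\<not> j < 3" using assms(3) by (simp add: blk_def)
    obtain gh where gh: "gh \<in> carrier (GL sU \<times>\<times> GL sV)" "\<And>a b. a < K + n \<Longrightarrow> b < K + n \<Longrightarrow> gmat gh a b = el z i j a b"
      using el_gmat[of i j z] assms K3 by auto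
    have e: "gmat gh k l = (if k = l then 1 else 0)" if "k < 3" "l < 3" for k l
      using gh(2)[of k l] that K3 False by (auto simp: el_def)
    have "U.mat (fst gh) k l = (if k = l then 1 else 0)" if "k < 3" "l < 3" for k l
      using e[OF that] that K3 by (simp add: gmat_def bmat_def)
    then have "det3 (rev3 (U.mat (fst gh))) = 1" by (simp add: det3_def rev3_def)
    moreover have "cof3 (rev3 (gmat gh)) k l = 1 * el z i j k l" if "k < 3" "l < 3" for k l
    proof -
      have "el z i j k l = (if k = l then 1 else 0)" using that False by (auto simp: el_def)
      then show ?thesis using that unfolding less3
        by (elim disjE; simp only: cof3_entries rev3_def; simp add: e)
    qed
    ultimately show ?thesis using gh K3 by (intro exI[of _ gh] exI[of _ 1]) auto
  next
    case i3: True
    then have j3: "j < 3" using assms(3) by (simp add: blk_def)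
    \<comment> \<open>Cofactors exchange \<open>i\<close> and \<open>j\<close> and invert the
      matrix, and the reversal of the block letters sends \<open>i\<close> to
      \<open>2 - i\<close>.\<close>
    define z' where "z' = (if i = j then - z / (1 + z) else - z)"
    define i' where "i' = 2 - j"
    define j' where "j' = 2 - i"
    have nz: "i = j \<Longrightarrow> 1 + z \<noteq> 0" using assms(4) by (metis add.inverse_inverse add_eq_0_iff)
    have z': "i' \<noteq> j' \<or> z' \<noteq> - 1"
      using nz i3 j3 by (auto simp: i'_def j'_def z'_def field_simps)
    have ij': "i' < K + n" "j' < K + n" "blk K i' j'" using K3 by (auto simp: i'_def j'_def blk_def)
    obtain gh where gh: "gh \<in> carrier (GL sU \<times>\<times> GL sV)" "\<And>a b. a < K + n \<Longrightarrow> b < K + n \<Longrightarrow> gmat gh a b = el z' i' j' a b"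
      using el_gmat[OF ij' z'] by blast
    let ?s = "if i = j then 1 / (1 + z) else 1"
    have e: "gmat gh (2 - k) (2 - l) = el z' j i k l" if "k < 3" "l < 3" for k l
    proof -
      have "2 - k < K + n" "2 - l < K + n" using K3 by auto
      moreover have "2 - k = 2 - l \<longleftrightarrow> k = l" "2 - k = i' \<longleftrightarrow> k = j" "2 - l = j' \<longleftrightarrow> l = i"
        using that i3 j3 unfolding i'_def j'_def by arith+
      ultimately show ?thesis using gh(2) by (simp add: el_def)
    qed
    have R: "rev3 (gmat gh) k l = el z' j i k l" if "k < 3" "l < 3" for k l
      using e[OF that] by (simp add: rev3_def)
    have "U.mat (fst gh) (2 - k) (2 - l) = el z' j i k l" if "k < 3" "l < 3" for k l
    proof -
      have "2 - k < (3 :: nat)" "2 - l < (3 :: nat)" by auto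
      then show ?thesis using e[OF that] K3 by (simp add: gmat_def bmat_def)
    qed
    then have M: "rev3 (U.mat (fst gh)) k l = el z' j i k l" if "k < 3" "l < 3" for k l
      using that by (simp add: rev3_def)
    have "det3 (rev3 (U.mat (fst gh))) = (if i = j then 1 + z' else 1)"
      using det3_cong[of _ "el z' j i", OF M] det3_el[OF i3 j3, of z'] by simp
    moreover have "i = j \<Longrightarrow> 1 + z' = 1 / (1 + z)" using nz by (simp add: z'_def field_simps)
    ultimately have d: "det3 (rev3 (U.mat (fst gh))) \<noteq> 0" using nz by simp
    have C: "cof3 (rev3 (gmat gh)) k l = cof3 (el z' j i) k l" for k l
      by (rule cof3_cong) (rule R)
    have c: "cof3 (rev3 (gmat gh)) k l = ?s * el z i j k l" if kl: "k < 3" "l < 3" for k l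
    proof (cases "i = j")
      case True
      have "1 + z' = 1 / (1 + z)" "(1 + z') * (1 + z) = 1" using nz True by (simp_all add: z'_def field_simps)
      then show ?thesis using C[of k l] cof3_el_diag[OF i3 kl, of z' z] True by simp
    next
      case False
      then show ?thesis using C[of k l] cof3_el_offdiag[OF i3 j3 False kl, of z] by (simp add: z'_def)
    qed
    have "gmat gh k l = el z i j k l" if "3 \<le> k" "k < 3 + n" "3 \<le> l" "l < 3 + n" for k l
    proof -
      have "gmat gh k l = el z' i' j' k l" using gh(2) that K3 by simp
      moreover have "k \<noteq> i'" "k \<noteq> i" using that i3 by (auto simp: i'_def)
      ultimately show ?thesis by (simp add: el_def)
    qed
    moreover have "?s \<noteq> 0" using nz by simp
    ultimately show ?thesis using gh(1) d c by (intro exI[of _ gh] exI[of _ ?s]) blast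
  qed
  then obtain gh s where gh: "gh \<in> carrier (GL sU \<times>\<times> GL sV)" "s \<noteq> 0" "det3 (rev3 (U.mat (fst gh))) \<noteq> 0"
    "\<And>k l. k < 3 \<Longrightarrow> l < 3 \<Longrightarrow> cof3 (rev3 (gmat gh)) k l = s * el z i j k l"
    "\<And>k l. 3 \<le> k \<Longrightarrow> k < 3 + n \<Longrightarrow> 3 \<le> l \<Longrightarrow> l < 3 + n \<Longrightarrow> gmat gh k l = el z i j k l" by blast
  obtain g h where gh': "gh = (g, h)" "g \<in> carrier (GL sU)" "h \<in> carrier (GL sV)" using gh(1) by (cases gh) auto
  have bm: "block_matrix (3 + n) 3 (el z i j)" using assms(3) by (auto simp: block_matrix_def blk_def el_def)
  let ?D = "det3 (rev3 (U.mat g)) ^ m"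
  have "lin Wd PQ (act (4 * m) (3 + n) (el z i j) x) = cscale (?D / s ^ (2 * m)) (poly_act (g, h) (lin Wd PQ x))" for x
  proof -
    have "cscale ?D (poly_act (g, h) (lin Wd PQ x)) = cscale (s ^ (2 * m)) (lin Wd PQ (act (4 * m) (3 + n) (el z i j) x))"
      using PQ_act[OF gh'(2,3)] gh(4,5) gh'(1) bm thm3_scale[of "gmat gh" s "el z i j" x]
      by simp
    then have "?D * poly_act (g, h) (lin Wd PQ x) y = s ^ (2 * m) * lin Wd PQ (act (4 * m) (3 + n) (el z i j) x) y" for y
      by (simp add: cscale_def fun_eq_iff)
    then show ?thesis using gh(2) by (simp add: cscale_def fun_eq_iff field_simps)
  qed
  moreover have "?D / s ^ (2 * m) \<noteq> 0" using gh(2,3) gh'(1) by simp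
  ultimately show ?thesis using that gh'(2,3) by blast
qed

end

section \<open>Classification of the highest weight vectors of the Pfaffians\<close>

lemma kap_cong: "(\<And>i. i \<in> B \<Longrightarrow> c i = c' i) \<Longrightarrow> kap B c = kap B c'"
  unfolding kap_def by (intro arg_cong2[of _ _ _ _ "(-)"] sum.cong refl) (auto simp: max_def)

lemma lin_proportional:
  assumes "\<And>w. w \<in> A \<Longrightarrow> x w \<noteq> 0 \<Longrightarrow> \<exists>k. Q w = cscale k f"
  shows "\<exists>k. lin A Q x = cscale k f"
proof -
  obtain k where k: "\<And>w. w \<in> A \<Longrightarrow> x w \<noteq> 0 \<Longrightarrow> Q w = cscale (k w) f" using assms by metis
  have "lin A Q x = cscale (\<Sum>w\<in>A. x w * k w) f"
  proof
    fix z
    have "x w * Q w z = x w * k w * f z" if "w \<in> A" for w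
      using k[OF that] by (cases "x w = 0") (simp_all add: cscale_def)
    then have "lin A Q x z = (\<Sum>w\<in>A. x w * k w * f z)"
      unfolding lin_def by (rule sum.cong[OF refl])
    then show "lin A Q x z = cscale (\<Sum>w\<in>A. x w * k w) f z"
      by (simp add: cscale_def sum_distrib_right)
  qed
  then show ?thesis by blast
qed

context pf_space
begin

lemma PQ_inj_zs: "PQ w \<noteq> 0 \<Longrightarrow> inj_on (zs w) {..<2 * m}"
  using PQ_inj[of w] unfolding zs_def inj_on_def by blast

text \<open>In a diagram the places above a box in its column and left of it in its row are
  occupied. A changed letter therefore makes two rows of the submatrix equal.\<close>

lemma pf_top_fixed:
  assumes L: "L \<in> TL" and ij: "i < j" "j < 3 + n" "blk 3 i j"
  shows "lin Wd PQ (act (4 * m) (3 + n) (el z i j) (unitv (ptop L))) = PQ (ptop L)"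
proof (rule lin_act_el_top[OF ptop_words[OF L]])
  show "i \<noteq> j" using ij by simp
  fix w assume w: "w \<in> Wd" "w \<noteq> ptop L"
    and step: "\<And>p. p < 4 * m \<Longrightarrow> w p = ptop L p \<or> w p = i \<and> ptop L p = j"
  obtain p where p: "p < 4 * m" "w p \<noteq> ptop L p" using words_eqI[OF w(1) ptop_words[OF L]] w(2) by blast
  then have wp: "w p = i" "ptop L p = j" using step by blast+
  have sL: "sum_list L = 2 * m" "length L = 3" "sorted_wrt (\<ge>) L" using L by (auto simp: TL_def)
  show "PQ w = 0"
  proof (rule ccontr)
    assume nz: "PQ w \<noteq> 0"
    have dup: "q = r" if "q < 2 * m" "r < 2 * m" "w q = w r" "w (2 * m + q) = w (2 * m + r)" for q r
      using PQ_inj_zs[OF nz] that unfolding inj_on_def zs_def rgt_def by simp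
    show False
    proof (cases "p < 2 * m")
      case True
      have j: "j = brow L p" using wp(2) True by (simp add: ptop_at)
      obtain r where r: "r < 2 * m" "bcol L r = bcol L p" "brow L r = i"
        using box_column_left[OF sL(3), of p i] ij(1) j sL(1) True by auto
      have "w r = i" using step[of r] r by (auto simp: ptop_at)
      moreover have "3 > i" using ij(1) j TL_box(1)[OF L True] by simp
      then have "w (2 * m + r) = ptop L (2 * m + r)" "w (2 * m + p) = ptop L (2 * m + p)"
        using step[of "2 * m + r"] step[of "2 * m + p"] r True j TL_box(1)[OF L True] by (auto simp: ptop_at)
      then have "w (2 * m + r) = w (2 * m + p)" using r True by (simp add: ptop_at)
      ultimately have "r = p" using dup r True wp(1) by simp
      then show False using r(3) j ij(1) by simp
    next
      case False
      define q where "q = p - 2 * m"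
      have q: "q < 2 * m" "p = 2 * m + q" using False p(1) by (auto simp: q_def)
      have j: "j = 3 + bcol L q" using wp(2) q by (simp add: ptop_at)
      then have i3: "3 \<le> i" using ij(3) by (simp add: blk_def)
      have "i - 3 < L ! brow L q" using position_box(2)[of q L] q(1) sL(1) ij(1) j i3 by simp
      moreover have "brow L q < length L" using position_box(1)[of q L] q(1) sL(1) by simp
      ultimately obtain r where r: "r < 2 * m" "brow L r = brow L q" "bcol L r = i - 3"
        using box_position[of "brow L q" L "i - 3"] sL(1) by metis
      have "w (2 * m + r) = i" using step[of "2 * m + r"] r i3 by (auto simp: ptop_at)
      moreover have "w r = ptop L r" "w q = ptop L q"
      proof -
        have "ptop L r < 3" "ptop L q < 3" using TL_box(1)[OF L r(1)] TL_box(1)[OF L q(1)] r q by (simp_all add: ptop_at)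
        then have "ptop L r \<noteq> j" "ptop L q \<noteq> j" using j by simp_all
        then show "w r = ptop L r" "w q = ptop L q" using step[of r] step[of q] r(1) q(1) by auto
      qed
      then have "w r = w q" using r q by (simp add: ptop_at)
      ultimately have "r = q" using dup r q wp(1) by simp
      then show False using r(3) j ij(1) i3 by simp
    qed
  qed
qed

sublocale ppre: pre_quotient_rep "4 * m" "3 + n" 3 PQ "ptop ` TL"
proof
  fix i j :: nat and z :: complex and x
  assume *: "i < 3 + n" "j < 3 + n" "blk 3 i j" "i \<noteq> j \<or> z \<noteq> - 1" and x: "x \<in> ker Wd PQ"
  obtain g h k where "\<And>x. lin Wd PQ (act (4 * m) (3 + n) (el z i j) x) = cscale k (poly_act (g, h) (lin Wd PQ x))"
    using el_thm3[OF *] by metis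
  then show "lin Wd PQ (act (4 * m) (3 + n) (el z i j) x) = 0"
    using x by (auto simp: ker_def poly_act_def cscale_def fun_eq_iff)
next
  show "ptop ` TL \<subseteq> Wd" using ptop_words by blast
  show "\<And>t. t \<in> ptop ` TL \<Longrightarrow> PQ t \<noteq> 0" using PQ_ptop_nonzero by blast
  show "\<And>t i j z. t \<in> ptop ` TL \<Longrightarrow> i < j \<Longrightarrow> j < 3 + n \<Longrightarrow> blk 3 i j \<Longrightarrow>
      lin Wd PQ (act (4 * m) (3 + n) (el z i j) (unitv t)) = PQ t" using pf_top_fixed by blast
qed

text \<open>\<open>lin_PQ_Sw\<close> controls only the sum of the two Casimir operators, so only the
  sum of the eigenvalues is obtained.\<close>

lemma pf_kap:
  assumes x: "hwv (4 * m) (3 + n) 3 c x" "lin Wd PQ x \<noteq> 0"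
  shows "kap {..<3} c + kap {3..<3 + n} c = 0"
proof -
  have "Sw (4 * m) (3 + n) {..<3} x = cscale (of_int (kap {..<3} c)) x"
    by (rule hwv_Sw[OF x(1)]) (auto simp: blk_def)
  moreover have "Sw (4 * m) (3 + n) {3..<3 + n} x = cscale (of_int (kap {3..<3 + n} c)) x"
    by (rule hwv_Sw[OF x(1)]) (auto simp: blk_def)
  ultimately have "cscale (of_int (kap {..<3} c)) (lin Wd PQ x) + cscale (of_int (kap {3..<3 + n} c)) (lin Wd PQ x) = 0"
    using lin_PQ_Sw[of x] by (simp add: lin_scale)
  then have "(of_int (kap {..<3} c) + of_int (kap {3..<3 + n} c)) * lin Wd PQ x y = 0" for y
    by (simp add: cscale_def fun_eq_iff distrib_right)
  moreover obtain y where "lin Wd PQ x y \<noteq> 0" using x(2) by (auto simp: fun_eq_iff)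
  ultimately have "(of_int (kap {..<3} c) + of_int (kap {3..<3 + n} c) :: complex) = 0" by (metis mult_eq_0_iff)
  then show ?thesis by (metis of_int_add of_int_eq_0_iff)
qed

lemma rgt_less': "w \<in> Wd \<Longrightarrow> patm w \<Longrightarrow> p < 2 * m \<Longrightarrow> rgt (2 * m) 3 w p < n"
  using rgt_less[of w "2 * m" "2 * m" 3 n p] by simp

lemma cnt_pat':
  assumes "patm w"
  shows "i < 3 \<Longrightarrow> cnt (4 * m) w i = cnt (2 * m) w i" "cnt (4 * m) w (3 + i) = cnt (2 * m) (rgt (2 * m) 3 w) i"
  using cnt_pat[of "2 * m" "2 * m" 3 w] assms by simp_all

text \<open>The rows listed by \<open>w\<close> form a set with \<open>L ! i\<close> elements in
  block \<open>i\<close>, and pushing them to the left gives the diagram \<open>L\<close>. So the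
  index weight is dominated by the conjugate of \<open>L\<close>, and only the diagram itself
  attains it.\<close>

lemma pf_fill:
  assumes w: "w \<in> Wd" "PQ w \<noteq> 0" and L: "L \<in> TL" and eq: "\<And>i. i < 3 \<Longrightarrow> cnt (4 * m) w i = L ! i"
  shows "card {p\<in>{..<2 * m}. rgt (2 * m) 3 w p < k} \<le> card {p\<in>{..<2 * m}. bcol L p < k}"
    and "(\<And>k. card {p\<in>{..<2 * m}. rgt (2 * m) 3 w p < k} = card {p\<in>{..<2 * m}. bcol L p < k}) \<Longrightarrow>
      \<exists>k. k \<noteq> 0 \<and> PQ w = cscale k (PQ (ptop L))"
proof -
  let ?J = "zs w ` {..<2 * m}" and ?D = "zs (ptop L) ` {..<2 * m}"
  have pw: "patm w" using PQ_pat w(2) by blast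
  have iw: "inj_on (zs w) {..<2 * m}" using PQ_inj_zs w(2) by blast
  note D = zs_ptop_image[OF L]
  have fib: "card {j. (i, j) \<in> ?J} = card {j. (i, j) \<in> ?D}" for i
  proof (cases "i < 3")
    case True
    have "{j. (i, j) \<in> ?J} = rgt (2 * m) 3 w ` {p\<in>{..<2 * m}. w p = i}" by (auto simp: zs_def)
    moreover have "inj_on (rgt (2 * m) 3 w) {p\<in>{..<2 * m}. w p = i}"
      using iw unfolding inj_on_def zs_def by auto
    ultimately have "card {j. (i, j) \<in> ?J} = cnt (2 * m) w i" by (simp add: card_image cnt_def)
    also have "\<dots> = L ! i" using eq[OF True] cnt_pat'(1)[OF pw True] by simp
    finally show ?thesis unfolding D(1) using True by (simp add: lessThan_def[symmetric])
  next
    case False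
    then have "{j. (i, j) \<in> ?J} = {}" using pw by (auto simp: zs_def pat_def)
    moreover have "{j. (i, j) \<in> ?D} = {}" unfolding D(1) using False by auto
    ultimately show ?thesis by (simp only:)
  qed
  have left: "(x, i) \<in> ?D" if "(x, j) \<in> ?D" "i < j" for x i j using that unfolding D(1) by auto
  have cJ: "card {z\<in>?J. snd z < k} = card {p\<in>{..<2 * m}. rgt (2 * m) 3 w p < k}" for k
  proof -
    have "{z\<in>?J. snd z < k} = zs w ` {p\<in>{..<2 * m}. rgt (2 * m) 3 w p < k}" by (auto simp: zs_def)
    moreover have "inj_on (zs w) {p\<in>{..<2 * m}. rgt (2 * m) 3 w p < k}" using iw unfolding inj_on_def by auto
    ultimately show ?thesis by (simp add: card_image)
  qed
  have cD: "card {z\<in>?D. snd z < k} = card {p\<in>{..<2 * m}. bcol L p < k}" for k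
  proof -
    have "{z\<in>?D. snd z < k} = zs (ptop L) ` {p\<in>{..<2 * m}. bcol L p < k}" by (auto simp: zs_ptop)
    moreover have "inj_on (zs (ptop L)) {p\<in>{..<2 * m}. bcol L p < k}" using D(2) unfolding inj_on_def by auto
    ultimately show ?thesis by (simp add: card_image)
  qed
  have fin: "finite ?J" "finite ?D" by auto
  show "card {p\<in>{..<2 * m}. rgt (2 * m) 3 w p < k} \<le> card {p\<in>{..<2 * m}. bcol L p < k}"
  proof -
    have "card {z\<in>?J. snd z < k} \<le> card {z\<in>?D. snd z < k}" by (rule fill_dominance(1)[OF fin fib]) (rule left)
    then show ?thesis unfolding cJ cD .
  qed
  assume "\<And>k. card {p\<in>{..<2 * m}. rgt (2 * m) 3 w p < k} = card {p\<in>{..<2 * m}. bcol L p < k}"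
  then have eqk: "card {z\<in>?J. snd z < k} = card {z\<in>?D. snd z < k}" for k unfolding cJ cD by blast
  have "?J = ?D" by (rule fill_dominance(2)[OF fin fib]) (rule left, assumption+, rule eqk)
  then show "\<exists>k. k \<noteq> 0 \<and> PQ w = cscale k (PQ (ptop L))"
    by (rule PQ_same_image[OF pw ptop_pat[OF L] iw D(2)])
qed

lemma ptop_cnt:
  assumes "L \<in> TL"
  shows "i < 3 \<Longrightarrow> cnt (4 * m) (ptop L) i = L ! i" "cnt (4 * m) (ptop L) (3 + i) = cnt (2 * m) (bcol L) i"
proof -
  have L: "length L = 3" "sum_list L = 2 * m" using assms by (auto simp: TL_def)
  note c = cnt_pat'[OF ptop_pat[OF assms]]
  have "{p\<in>{..<2 * m}. ptop L p = i} = {p\<in>{..<2 * m}. brow L p = i}" by (auto simp: ptop_at)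
  then have "cnt (2 * m) (ptop L) i = part L i" using cnt_brow[of L i] L(2) by (simp add: cnt_def)
  then show "i < 3 \<Longrightarrow> cnt (4 * m) (ptop L) i = L ! i" using c(1) L(1) by (simp add: part_def)
  have "{p\<in>{..<2 * m}. rgt (2 * m) 3 (ptop L) p = i} = {p\<in>{..<2 * m}. bcol L p = i}" by (auto simp: ptop_at rgt_def)
  then show "cnt (4 * m) (ptop L) (3 + i) = cnt (2 * m) (bcol L) i" unfolding c(2) by (simp add: cnt_def)
qed

text \<open>The block weight of \<open>x\<close> is some \<open>L\<close> in \<open>TL\<close>. By
  \<open>pf_kap\<close>, applied to \<open>x\<close> and to the lift of \<open>ptop L\<close>, the
  two index weights have the same Casimir eigenvalue, and the dominance in \<open>pf_fill\<close>
  makes them equal. The equality case of \<open>pf_fill\<close> then makes all contributing words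
  multiples of \<open>ptop L\<close> under \<open>PQ\<close>.\<close>

lemma pf_hwv_top:
  assumes x: "hwv (4 * m) (3 + n) 3 c x" "lin Wd PQ x \<noteq> 0"
  shows "\<exists>L\<in>TL. \<exists>k. lin Wd PQ x = cscale k (PQ (ptop L))"
proof -
  obtain w where w: "w \<in> Wd" "x w \<noteq> 0" "PQ w \<noteq> 0"
  proof -
    obtain z where "lin Wd PQ x z \<noteq> 0" using x(2) by (auto simp: fun_eq_iff)
    then obtain w where "w \<in> Wd" "x w * PQ w z \<noteq> 0"
      unfolding lin_def by (rule sum.not_neutral_contains_not_neutral)
    moreover from this have "PQ w \<noteq> 0" "x w \<noteq> 0" by auto
    ultimately show ?thesis using that by blast
  qed
  have cw: "cnt (4 * m) v i = c i" if "x v \<noteq> 0" "i < 3 + n" for v i using x(1) that unfolding hwv_def by blast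
  have pw: "patm w" using PQ_pat w(3) by blast
  have c2: "c i = cnt (2 * m) w i" if "i < 3" for i
    using cw[OF w(2), of i] cnt_pat'(1)[OF pw that] that by simp
  define L where "L = [c 0, c 1, c 2]"
  have Lc: "L ! i = c i" if "i < 3" for i using that unfolding less3 L_def by auto
  have LT: "L \<in> TL"
    unfolding TL_def
  proof (intro CollectI conjI allI impI)
    show "length L = 3" by (simp add: L_def)
    have "c 1 \<le> c 0" "c 2 \<le> c 1" using hwv_decreasing[OF x(1), of 0 1] hwv_decreasing[OF x(1), of 1 2] by (auto simp: blk_def)
    then show "sorted_wrt (\<ge>) L" by (simp add: L_def)
    have "(\<Sum>i<3. c i) = (\<Sum>i<3. cnt (2 * m) w i)" using c2 by simp
    also have "\<dots> = card {p\<in>{..<2 * m}. w p < 3}" by (rule sum_cnt)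
    also have "{p\<in>{..<2 * m}. w p < 3} = {..<2 * m}" using pw by (auto simp: pat_def)
    finally show "sum_list L = 2 * m" by (simp add: L_def sum3)
    fix i :: nat assume i: "i < 3"
    show "L ! i \<le> m" using PQ_block[OF w(3), of i] c2[OF i] Lc[OF i] by simp
    have "inj_on (rgt (2 * m) 3 w) {p\<in>{..<2 * m}. w p = i}"
      using PQ_inj_zs[OF w(3)] unfolding inj_on_def zs_def by auto
    then have "card {p\<in>{..<2 * m}. w p = i} \<le> card {..<n}"
      using rgt_less'[OF w(1) pw] by (intro card_inj_on_le[of "rgt (2 * m) 3 w"]) auto
    then show "L ! i \<le> n" using c2[OF i] Lc[OF i] by (simp add: cnt_def)
  qed
  let ?t = "cnt (4 * m) (ptop L)"
  obtain p where p: "lin Wd PQ p = PQ (ptop L)" "hwv (4 * m) (3 + n) 3 ?t p"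
    using ppre.top_lift_hwv[of "ptop L"] LT by blast
  have p0: "lin Wd PQ p \<noteq> 0" using p(1) PQ_ptop_nonzero[OF LT] by simp
  have "kap {..<3} c = kap {..<3} ?t" by (rule kap_cong) (use ptop_cnt(1)[OF LT] Lc in simp)
  then have "kap {3..<3 + n} c = kap {3..<3 + n} ?t" using pf_kap[OF x] pf_kap[OF p(2) p0] by simp
  then have kapV: "kap {..<n} (\<lambda>i. c (3 + i)) = kap {..<n} (\<lambda>i. ?t (3 + i))" by (simp only: kap_shift)
  have decV: "d (3 + Suc i) \<le> d (3 + i)" if "hwv (4 * m) (3 + n) 3 d y" "Suc i < n" for d y i
    using hwv_decreasing[OF that(1), of "3 + i" "3 + Suc i"] that(2) by (simp add: blk_def)
  have eqL: "cnt (4 * m) v i = L ! i" if "x v \<noteq> 0" "i < 3" for v i using cw[OF that(1), of i] Lc that by simp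
  have cV: "c (3 + i) = cnt (2 * m) (rgt (2 * m) 3 v) i" if "x v \<noteq> 0" "patm v" "i < n" for v i
    using cw[OF that(1), of "3 + i"] cnt_pat'(2)[OF that(2)] that(3) by simp
  have V: "c (3 + i) = ?t (3 + i)" if "i < n" for i
  proof (rule casimir_weights[of n "\<lambda>i. c (3 + i)" "\<lambda>i. ?t (3 + i)", OF decV[OF x(1)] decV[OF p(2)] _ _ kapV that])
    fix k assume "k \<le> n"
    then have "(\<Sum>i<k. c (3 + i)) = card {p\<in>{..<2 * m}. rgt (2 * m) 3 w p < k}"
      "(\<Sum>i<k. ?t (3 + i)) = card {p\<in>{..<2 * m}. bcol L p < k}"
      unfolding sum_cnt[symmetric] using cV[OF w(2) pw] ptop_cnt(2)[OF LT] by (auto intro!: sum.cong)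
    then show "(\<Sum>i<k. c (3 + i)) \<le> (\<Sum>i<k. ?t (3 + i))"
      using pf_fill(1)[OF w(1,3) LT eqL[OF w(2)]] by simp
  next
    have "(\<Sum>i<n. c (3 + i)) = card {p\<in>{..<2 * m}. rgt (2 * m) 3 w p < n}"
      "(\<Sum>i<n. ?t (3 + i)) = card {p\<in>{..<2 * m}. bcol L p < n}"
      unfolding sum_cnt[symmetric] using cV[OF w(2) pw] ptop_cnt(2)[OF LT] by (auto intro!: sum.cong)
    moreover have "{p\<in>{..<2 * m}. rgt (2 * m) 3 w p < n} = {..<2 * m}" "{p\<in>{..<2 * m}. bcol L p < n} = {..<2 * m}"
      using rgt_less'[OF w(1) pw] TL_box(2)[OF LT] by auto
    ultimately show "(\<Sum>i<n. c (3 + i)) = (\<Sum>i<n. ?t (3 + i))" by simp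
  qed
  have "\<exists>k. PQ v = cscale k (PQ (ptop L))" if v: "v \<in> Wd" "x v \<noteq> 0" for v
  proof (cases "PQ v = 0")
    case True
    then show ?thesis by (intro exI[of _ 0]) (auto simp: cscale_def fun_eq_iff)
  next
    case False
    have pv: "patm v" using PQ_pat False by blast
    have "cnt (2 * m) (rgt (2 * m) 3 v) i = cnt (2 * m) (bcol L) i" for i
    proof (cases "i < n")
      case True
      then show ?thesis using V[OF True] cV[OF v(2) pv True] ptop_cnt(2)[OF LT, of i] by simp
    next
      case False
      then have "{p\<in>{..<2 * m}. rgt (2 * m) 3 v p = i} = {}" "{p\<in>{..<2 * m}. bcol L p = i} = {}"
        using rgt_less'[OF v(1) pv] TL_box(2)[OF LT] by auto
      then show ?thesis unfolding cnt_def by (simp only:)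
    qed
    then have "card {p\<in>{..<2 * m}. rgt (2 * m) 3 v p < k} = card {p\<in>{..<2 * m}. bcol L p < k}" for k
      unfolding sum_cnt[symmetric] by simp
    then show ?thesis using pf_fill(2)[OF v(1) False LT eqL[OF v(2)]] by blast
  qed
  then show ?thesis using lin_proportional[of Wd x PQ] LT by blast
qed

sublocale pf: quotient_rep "4 * m" "3 + n" 3 PQ "ptop ` TL"
proof
  fix c x assume x: "hwv (4 * m) (3 + n) 3 c x" "x \<in> orthc Wd (ker Wd PQ)"
  have "x \<in> supp_on Wd" "x \<noteq> 0" using x(1) unfolding hwv_def by blast+
  then have "lin Wd PQ x \<noteq> 0" using orthc_Int[of Wd x "ker Wd PQ"] x(2) by (auto simp: ker_def)
  then show "\<exists>t\<in>ptop ` TL. \<exists>k. lin Wd PQ x = cscale k (PQ t)" using pf_hwv_top[OF x(1)] by blast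
qed

section \<open>The generators of the ideal\<close>

text \<open>The row number in \<open>psi_matrix\<close> that position \<open>p\<close> stands for;
  the block letter is reversed back.\<close>

definition zidx :: "(nat \<Rightarrow> nat) \<Rightarrow> nat \<Rightarrow> nat" where
  "zidx w p = (2 - w p) * n + (w (2 * m + p) - 3)"

lemma div_block: "b < N \<Longrightarrow> (k * N + b) div N = k" "b < N \<Longrightarrow> (k * N + b) mod N = b" for b N k :: nat
  by simp_all

lemma psi_entry:
  assumes "a < 3" "b < n" "a' < 3" "b' < n"
  shows "psi_matrix us vs y ((2 - a) * n + b) ((2 - a') * n + b') = omy (Yf y) a (3 + b) a' (3 + b')"
proof -
  have div: "((2 - a) * n + b) div n = 2 - a" "((2 - a') * n + b') div n = 2 - a'"
    "((2 - a) * n + b) mod n = b" "((2 - a') * n + b') mod n = b'"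
    by (rule div_block; use assms in blast)+
  have om: "omy (Yf y) a (3 + b) a' (3 + b') = (\<Sum>c<3. lev a a' c * Yf y c b b')" using assms by (simp add: omy_def)
  show ?thesis
    unfolding psi_matrix_def Let_def div om
    using assms(1,3) unfolding less3
    by (elim disjE; simp only: sum3 lev_values; simp add: Yf_def)
qed

lemma PQ_eq:
  assumes w: "w \<in> Wd" "patm w"
  shows "PQ w y = (if y \<in> form_space sU sV then pfaffian m (\<lambda>i j. psi_matrix us vs y (zidx w i) (zidx w j)) else 0)"
proof -
  have "psi_matrix us vs y (zidx w p) (zidx w q) = omy (Yf y) (w p) (w (2 * m + p)) (w q) (w (2 * m + q))"
    if "p < 2 * m" "q < 2 * m" for p q
  proof -
    have "w p < 3" "w q < 3" "3 \<le> w (2 * m + p)" "3 \<le> w (2 * m + q)" using w(2) that by (auto simp: pat_def)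
    moreover have "w (2 * m + p) - 3 < n" "w (2 * m + q) - 3 < n"
      using rgt_less'[OF w that(1)] rgt_less'[OF w that(2)] by (auto simp: rgt_def)
    ultimately show ?thesis using psi_entry[of "w p" "w (2 * m + p) - 3" "w q" "w (2 * m + q) - 3" y]
      by (simp add: zidx_def)
  qed
  then have "pfaffian m (\<lambda>i j. psi_matrix us vs y (zidx w i) (zidx w j)) = pfw m (omy (Yf y)) w / (2 ^ m * fact m)"
    unfolding pfaffian_def pfw_def
  proof (intro arg_cong2[of _ _ _ _ "(/)"] sum.cong[OF refl] arg_cong2[of _ _ _ _ "(*)"] prod.cong[OF refl] refl, goal_cases)
    case (1 \<sigma> i)
    then have "\<sigma> (2 * i) < 2 * m" "\<sigma> (2 * i + 1) < 2 * m"
      using permutes_in_image[of \<sigma> "{..<2 * m}"] by auto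
    then show ?case using 1 by blast
  qed
  then show ?thesis by (simp add: PQ_def)
qed

text \<open>A word with \<open>PQ w \<noteq> 0\<close> lists distinct rows, and sorting them gives a
  principal Pfaffian up to sign. Conversely the sorted list of \<open>J\<close> is itself such a
  word.\<close>

lemma span_psi_pfaffians: "lin Wd PQ ` supp_on Wd = fun_space.span (psi_pfaffians sU sV us vs m)"
proof -
  have "fun_space.span (PQ ` Wd) = fun_space.span (psi_pfaffians sU sV us vs m)"
  proof
    show "fun_space.span (PQ ` Wd) \<subseteq> fun_space.span (psi_pfaffians sU sV us vs m)"
    proof (rule fun_space.span_minimal[OF _ fun_space.subspace_span], rule image_subsetI)
      fix w assume w: "w \<in> Wd"
      show "PQ w \<in> fun_space.span (psi_pfaffians sU sV us vs m)"
      proof (cases "PQ w = 0")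
        case True
        then show ?thesis by (simp only: fun_space.span_zero)
      next
        case False
        have pw: "patm w" using PQ_pat False by blast
        let ?J = "zidx w ` {..<2 * m}"
        have lt: "w p < 3" "w (2 * m + p) - 3 < n" if "p < 2 * m" for p
          using pw that rgt_less'[OF w pw that] by (auto simp: pat_def rgt_def)
        have dm: "zidx w p div n = 2 - w p" "zidx w p mod n = w (2 * m + p) - 3" if "p < 2 * m" for p
          unfolding zidx_def by (rule div_block; use lt(2)[OF that] in blast)+
        have injz: "inj_on (zidx w) {..<2 * m}"
        proof (rule inj_onI)
          fix p q assume pq: "p \<in> {..<2 * m}" "q \<in> {..<2 * m}" "zidx w p = zidx w q"
          then have "2 - w p = 2 - w q" "w (2 * m + p) - 3 = w (2 * m + q) - 3" using dm[of p] dm[of q] by auto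
          then have "zs w p = zs w q" using lt(1)[of p] lt(1)[of q] pq by (auto simp: zs_def rgt_def)
          then show "p = q" using PQ_inj_zs[OF False] pq unfolding inj_on_def by blast
        qed
        have J: "?J \<subseteq> {..<3 * n}" "card ?J = 2 * m"
        proof -
          show "?J \<subseteq> {..<3 * n}"
          proof (rule image_subsetI)
            fix p assume "p \<in> {..<2 * m}"
            then have "w (2 * m + p) - 3 < n" using lt by simp
            moreover have "(2 - w p) * n \<le> 2 * n" by (intro mult_le_mono1) simp
            ultimately have "(2 - w p) * n + (w (2 * m + p) - 3) < 2 * n + n" by (intro add_le_less_mono)
            then show "zidx w p \<in> {..<3 * n}" by (simp add: zidx_def)
          qed
          show "card ?J = 2 * m" using injz by (simp add: card_image)
        qed
        let ?s = "sorted_list_of_set ?J"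
        have len: "length ?s = 2 * m" using J(2) by simp
        have "(\<lambda>p. ?s ! p) ` {..<2 * m} = set ?s" using len by (auto simp: set_conv_nth)
        then have im: "zidx w ` {..<2 * m} = (\<lambda>p. ?s ! p) ` {..<2 * m}" by simp
        have injs: "inj_on (\<lambda>p. ?s ! p) {..<2 * m}" using len by (auto simp: inj_on_def nth_eq_iff_index_eq)
        obtain \<tau> where \<tau>: "\<tau> permutes {..<2 * m}" "\<And>p. p < 2 * m \<Longrightarrow> zidx w (\<tau> p) = ?s ! p"
          using permutes_match[OF injs injz im[symmetric]] by blast
        define v where "v = w \<circ> lift2 m \<tau>"
        have lift: "lift2 m \<tau> p = \<tau> p" "lift2 m \<tau> (2 * m + p) = 2 * m + \<tau> p" if "p < 2 * m" for p
          using that by (simp_all add: lift2_def)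
        have v: "v p = w (\<tau> p) \<and> v (2 * m + p) = w (2 * m + \<tau> p)" if "p < 2 * m" for p
          using lift[OF that] by (simp add: v_def)
        have PQv: "PQ v = cscale (of_int (sign \<tau>)) (PQ w)" by (rule PQ_alternating[OF \<tau>(1) v])
        have \<tau>lt: "\<tau> p < 2 * m" if "p < 2 * m" for p using permutes_in_image[OF \<tau>(1)] that by simp
        have pv: "patm v" using pw v \<tau>lt by (simp add: pat_def)
        have vW: "v \<in> Wd"
        proof -
          have "v p < 3 + n" if "p < 4 * m" for p
          proof (cases "p < 2 * m")
            case True
            then show ?thesis using v[OF True] \<tau>lt[OF True] words_less[OF w, of "\<tau> p"] by simp
          next
            case False
            then have "p - 2 * m < 2 * m" "p = 2 * m + (p - 2 * m)" using that by auto
            then show ?thesis using v[of "p - 2 * m"] \<tau>lt[of "p - 2 * m"] words_less[OF w, of "2 * m + \<tau> (p - 2 * m)"] by simp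
          qed
          moreover have "v p = undefined" if "\<not> p < 4 * m" for p
            using that w by (auto simp: v_def lift2_def words_def PiE_iff extensional_def)
          ultimately show ?thesis by (auto simp: words_def PiE_iff extensional_def)
        qed
        have zv: "zidx v p = ?s ! p" if "p < 2 * m" for p
          using \<tau>(2)[OF that] v[OF that] by (simp add: zidx_def)
        have "PQ v = (\<lambda>x. if x \<in> form_space sU sV then principal_pfaffian m (psi_matrix us vs x) ?J else 0)"
        proof
          fix x
          have "pfaffian m (\<lambda>i j. psi_matrix us vs x (zidx v i) (zidx v j)) = principal_pfaffian m (psi_matrix us vs x) ?J"
            unfolding principal_pfaffian_def pfaffian_def
          proof (intro arg_cong2[of _ _ _ _ "(/)"] sum.cong[OF refl] arg_cong2[of _ _ _ _ "(*)"] prod.cong[OF refl] refl, goal_cases)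
            case (1 \<sigma> i)
            then have "\<sigma> (2 * i) < 2 * m" "\<sigma> (2 * i + 1) < 2 * m"
              using permutes_in_image[of \<sigma> "{..<2 * m}"] by auto
            then show ?case by (simp add: zv)
          qed
          then show "PQ v x = (if x \<in> form_space sU sV then principal_pfaffian m (psi_matrix us vs x) ?J else 0)"
            by (simp add: PQ_eq[OF vW pv])
        qed
        then have "PQ v \<in> psi_pfaffians sU sV us vs m"
          unfolding psi_pfaffians_def using J by blast
        then have "cscale (of_int (sign \<tau>)) (PQ v) \<in> fun_space.span (psi_pfaffians sU sV us vs m)"
          by (intro fun_space.span_scale fun_space.span_base)
        moreover have "cscale (of_int (sign \<tau>)) (PQ v) = PQ w"
          unfolding PQv by (auto simp: cscale_def fun_eq_iff sign_of_int_sq)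
        ultimately show ?thesis by simp
      qed
    qed
    show "fun_space.span (psi_pfaffians sU sV us vs m) \<subseteq> fun_space.span (PQ ` Wd)"
    proof (rule fun_space.span_mono, rule subsetI)
      fix f assume "f \<in> psi_pfaffians sU sV us vs m"
      then obtain J where J: "J \<subseteq> {..<3 * n}" "card J = 2 * m"
        "f = (\<lambda>x. if x \<in> form_space sU sV then principal_pfaffian m (psi_matrix us vs x) J else 0)"
        unfolding psi_pfaffians_def by blast
      have finJ: "finite J" using J(1) finite_subset by blast
      let ?s = "sorted_list_of_set J"
      have len: "length ?s = 2 * m" using J(2) by simp
      have sJ: "?s ! p < 3 * n" if "p < 2 * m" for p
      proof -
        have "?s ! p \<in> set ?s" using that len by (intro nth_mem) simp
        then show ?thesis using J(1) finJ by auto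
      qed
      define w where "w = joinw (2 * m) (2 * m) 3 (\<lambda>p. 2 - ?s ! p div n) (\<lambda>p. ?s ! p mod n)"
      have dn: "?s ! p div n < 3" "?s ! p mod n < n" if "p < 2 * m" for p
      proof -
        have "n > 0" using sJ[OF that] by (cases n) auto
        then show "?s ! p div n < 3" "?s ! p mod n < n" using sJ[OF that] by (auto simp: less_mult_imp_div_less)
      qed
      have w: "w \<in> Wd" using joinw_words[of "2 * m" "\<lambda>p. 2 - ?s ! p div n" 3 "2 * m" "\<lambda>p. ?s ! p mod n" n] dn
        by (simp add: w_def)
      have pw: "patm w" unfolding w_def by (rule pat_joinw) simp
      have zw: "zidx w p = ?s ! p" if "p < 2 * m" for p
      proof -
        have "zidx w p = (2 - (2 - ?s ! p div n)) * n + ?s ! p mod n"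
          using that by (simp add: zidx_def w_def joinw_def)
        also have "2 - (2 - ?s ! p div n) = ?s ! p div n" using dn(1)[OF that] by simp
        finally show ?thesis by simp
      qed
      have "f = PQ w"
      proof
        fix x
        have "pfaffian m (\<lambda>i j. psi_matrix us vs x (zidx w i) (zidx w j)) = principal_pfaffian m (psi_matrix us vs x) J"
          unfolding principal_pfaffian_def pfaffian_def
        proof (intro arg_cong2[of _ _ _ _ "(/)"] sum.cong[OF refl] arg_cong2[of _ _ _ _ "(*)"] prod.cong[OF refl] refl, goal_cases)
          case (1 \<sigma> i)
          then have "\<sigma> (2 * i) < 2 * m" "\<sigma> (2 * i + 1) < 2 * m"
            using permutes_in_image[of \<sigma> "{..<2 * m}"] by auto
          then show ?case by (simp add: zw)
        qed
        then show "f x = PQ w x" by (simp add: J(3) PQ_eq[OF w pw])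
      qed
      then show "f \<in> PQ ` Wd" using w by blast
    qed
  qed
  then show ?thesis by (simp add: range_lin)
qed

end

section \<open>Matrix coefficients determine a representation\<close>

lemma linear_onD:
  assumes "linear_on R \<Phi>"
  shows "f \<in> R \<Longrightarrow> g \<in> R \<Longrightarrow> \<Phi> (f + g) = \<Phi> f + \<Phi> g" "f \<in> R \<Longrightarrow> \<Phi> (cscale c f) = cscale c (\<Phi> f)"
  using assms unfolding linear_on_def by blast+

lemma representationD:
  assumes "representation G \<rho> R"
  shows "group G" "fun_space.subspace R" "g \<in> carrier G \<Longrightarrow> linear_on R (\<rho> g)"
    "g \<in> carrier G \<Longrightarrow> f \<in> R \<Longrightarrow> \<rho> g f \<in> R" "f \<in> R \<Longrightarrow> \<rho> \<one>\<^bsub>G\<^esub> f = f"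
    "g \<in> carrier G \<Longrightarrow> h \<in> carrier G \<Longrightarrow> f \<in> R \<Longrightarrow> \<rho> (g \<otimes>\<^bsub>G\<^esub> h) f = \<rho> g (\<rho> h f)"
  using assms unfolding representation_def by blast+

text \<open>The isomorphism relates the vectors with equal matrix coefficients.\<close>

lemma isomorphic_if_coefficients_agree:
  fixes G (structure)
  assumes rep1: "representation G \<rho> R" and rep2: "representation G \<rho>' R'"
    and v: "\<And>i. i \<in> I \<Longrightarrow> v i \<in> R" and v': "\<And>i. i \<in> I \<Longrightarrow> v' i \<in> R'"
    and gen: "R \<subseteq> fun_space.span {\<rho> g (v i) | g i. g \<in> carrier G \<and> i \<in> I}"
    and gen': "R' \<subseteq> fun_space.span {\<rho>' g (v' i) | g i. g \<in> carrier G \<and> i \<in> I}"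
    and add: "\<And>i f g. i \<in> I \<Longrightarrow> f \<in> R \<Longrightarrow> g \<in> R \<Longrightarrow> \<alpha> i (f + g) = \<alpha> i f + (\<alpha> i g :: complex)"
    and scale: "\<And>i c f. i \<in> I \<Longrightarrow> f \<in> R \<Longrightarrow> \<alpha> i (cscale c f) = c * \<alpha> i f"
    and add': "\<And>i f g. i \<in> I \<Longrightarrow> f \<in> R' \<Longrightarrow> g \<in> R' \<Longrightarrow> \<beta> i (f + g) = \<beta> i f + (\<beta> i g :: complex)"
    and scale': "\<And>i c f. i \<in> I \<Longrightarrow> f \<in> R' \<Longrightarrow> \<beta> i (cscale c f) = c * \<beta> i f"
    and sep: "\<And>f. f \<in> R \<Longrightarrow> (\<And>g i. g \<in> carrier G \<Longrightarrow> i \<in> I \<Longrightarrow> \<alpha> i (\<rho> g f) = 0) \<Longrightarrow> f = 0"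
    and sep': "\<And>f. f \<in> R' \<Longrightarrow> (\<And>g i. g \<in> carrier G \<Longrightarrow> i \<in> I \<Longrightarrow> \<beta> i (\<rho>' g f) = 0) \<Longrightarrow> f = 0"
    and agree: "\<And>g i j. g \<in> carrier G \<Longrightarrow> i \<in> I \<Longrightarrow> j \<in> I \<Longrightarrow> \<alpha> i (\<rho> g (v j)) = \<beta> i (\<rho>' g (v' j))"
  shows "isomorphic_reps G \<rho> R \<rho>' R'"
proof -
  note r1 = representationD[OF rep1] and r2 = representationD[OF rep2]
  note l1 = linear_onD[OF r1(3)] and l2 = linear_onD[OF r2(3)]
  interpret group G by (rule r1(1))
  \<comment> \<open>The graph of the isomorphism. Generation by the orbits makes it total on both
    sides, and separation by the coefficients makes it single-valued and injective.\<close>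
  define rel where "rel = (\<lambda>f f'. f \<in> R \<and> f' \<in> R' \<and> (\<forall>g\<in>carrier G. \<forall>i\<in>I. \<alpha> i (\<rho> g f) = \<beta> i (\<rho>' g f')))"
  have relD: "f \<in> R" "f' \<in> R'" "g \<in> carrier G \<Longrightarrow> i \<in> I \<Longrightarrow> \<alpha> i (\<rho> g f) = \<beta> i (\<rho>' g f')" if "rel f f'" for f f' g i
    using that unfolding rel_def by blast+
  have rel_add: "rel (f + h) (f' + h')" if "rel f f'" "rel h h'" for f f' h h'
    unfolding rel_def
    using relD[OF that(1)] relD[OF that(2)] r1(4) r2(4)
    by (auto simp: l1(1) l2(1) add add' intro: fun_space.subspace_add[OF r1(2)] fun_space.subspace_add[OF r2(2)])
  have rel_scale: "rel (cscale c f) (cscale c f')" if "rel f f'" for c f f'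
    unfolding rel_def
    using relD[OF that] r1(4) r2(4)
    by (auto simp: l1(2) l2(2) scale scale' intro: fun_space.subspace_scale[OF r1(2)] fun_space.subspace_scale[OF r2(2)])
  have rel_act: "rel (\<rho> h f) (\<rho>' h f')" if "rel f f'" "h \<in> carrier G" for h f f'
    unfolding rel_def
  proof (intro conjI ballI)
    show "\<rho> h f \<in> R" "\<rho>' h f' \<in> R'" using r1(4) r2(4) relD[OF that(1)] that(2) by blast+
    fix g i assume g: "g \<in> carrier G" and i: "i \<in> I"
    have "\<alpha> i (\<rho> (g \<otimes> h) f) = \<beta> i (\<rho>' (g \<otimes> h) f')" using relD(3)[OF that(1)] g that(2) i by blast
    then show "\<alpha> i (\<rho> g (\<rho> h f)) = \<beta> i (\<rho>' g (\<rho>' h f'))"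
      using r1(6)[OF g that(2) relD(1)[OF that(1)]] r2(6)[OF g that(2) relD(2)[OF that(1)]] by simp
  qed
  have rel_v: "rel (v i) (v' i)" if "i \<in> I" for i
    unfolding rel_def using v v' agree that by blast
  have zero: "\<alpha> i 0 = 0" "\<beta> i 0 = 0" "\<rho> g 0 = 0" "\<rho>' g 0 = 0" if "i \<in> I" "g \<in> carrier G" for i g
    using scale[OF that(1) fun_space.subspace_0[OF r1(2)], of 0] scale'[OF that(1) fun_space.subspace_0[OF r2(2)], of 0]
      l1(2)[OF that(2) fun_space.subspace_0[OF r1(2)], of 0] l2(2)[OF that(2) fun_space.subspace_0[OF r2(2)], of 0]
    by simp_all
  have rel_diff: "rel (f - h) (f' - h')" if "rel f f'" "rel h h'" for f f' h h'
    using rel_add[OF that(1) rel_scale[OF that(2), of "- 1"]]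
    by simp
  have rel_0: "rel 0 0" unfolding rel_def using zero fun_space.subspace_0[OF r1(2)] fun_space.subspace_0[OF r2(2)] by auto
  have z2: "f' = 0" if "rel 0 f'" for f'
    using relD(3)[OF that] zero by (intro sep'[OF relD(2)[OF that]]) auto
  have z1: "f = 0" if "rel f 0" for f
    using relD(3)[OF that] zero by (intro sep[OF relD(1)[OF that]]) auto
  have sv: "f' = h'" if "rel f f'" "rel f h'" for f f' h'
    using z2[of "f' - h'"] rel_diff[OF that] by simp
  have inj: "f = h" if "rel f f'" "rel h f'" for f h f'
    using z1[of "f - h"] rel_diff[OF that] by simp
  have dom: "\<exists>f'. rel f f'" if "f \<in> R" for f
  proof -
    have "fun_space.subspace {f. \<exists>f'. rel f f'}"
      unfolding fun_space.subspace_def using rel_0 rel_add rel_scale by blast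
    then have "fun_space.span {\<rho> g (v i) | g i. g \<in> carrier G \<and> i \<in> I} \<subseteq> {f. \<exists>f'. rel f f'}"
      using rel_act[OF rel_v] by (intro fun_space.span_minimal) auto
    then show ?thesis using gen that by blast
  qed
  have ran: "\<exists>f. rel f f'" if "f' \<in> R'" for f'
  proof -
    have "fun_space.subspace {f'. \<exists>f. rel f f'}"
      unfolding fun_space.subspace_def using rel_0 rel_add rel_scale by blast
    then have "fun_space.span {\<rho>' g (v' i) | g i. g \<in> carrier G \<and> i \<in> I} \<subseteq> {f'. \<exists>f. rel f f'}"
      using rel_act[OF rel_v] by (intro fun_space.span_minimal) auto
    then show ?thesis using gen' that by blast
  qed
  obtain \<Phi> where \<Phi>: "\<And>f. f \<in> R \<Longrightarrow> rel f (\<Phi> f)" using dom by metis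
  have \<Phi>I: "\<Phi> f = f'" if "rel f f'" for f f' using sv \<Phi> relD(1)[OF that] that by blast
  show ?thesis
    unfolding isomorphic_reps_def
  proof (intro conjI exI[of _ \<Phi>] ballI)
    show "linear_on R \<Phi>"
      unfolding linear_on_def using \<Phi>I rel_add[OF \<Phi> \<Phi>] rel_scale[OF \<Phi>] by blast
    show "bij_betw \<Phi> R R'"
    proof (rule bij_betw_imageI)
      show "inj_on \<Phi> R" using inj \<Phi> by (intro inj_onI) metis
      show "\<Phi> ` R = R'" using relD(2)[OF \<Phi>] ran \<Phi>I relD(1) by (blast intro: sym)
    qed
    show "\<And>g f. g \<in> carrier G \<Longrightarrow> f \<in> R \<Longrightarrow> \<Phi> (\<rho> g f) = \<rho>' g (\<Phi> f)"
      using \<Phi>I rel_act[OF \<Phi>] by blast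
  qed (rule rep1, rule rep2)
qed

context quotient_rep
begin

text \<open>\<open>q\<close> is orthogonal to the kernel, so \<open>ip W x q\<close> depends only on
  the class of \<open>x\<close> and descends to the image of \<open>lin W Q\<close>.\<close>

lemma coefficient_functional:
  assumes "q \<in> orthc W (ker W Q)"
  obtains \<alpha> where "\<And>x. x \<in> supp_on W \<Longrightarrow> \<alpha> (lin W Q x) = ip W x q"
proof
  define s where "s = (\<lambda>f. SOME x. x \<in> supp_on W \<and> lin W Q x = f)"
  fix x assume x: "x \<in> supp_on W"
  then have s: "s (lin W Q x) \<in> supp_on W \<and> lin W Q (s (lin W Q x)) = lin W Q x"
    unfolding s_def using someI[of "\<lambda>y. y \<in> supp_on W \<and> lin W Q y = lin W Q x" x] by simp
  then have "s (lin W Q x) - x \<in> ker W Q"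
    using x fun_space.subspace_diff[OF subspace_supp_on, of "s (lin W Q x)" W x] by (simp add: ker_def lin_diff)
  then have "ip W (s (lin W Q x) - x) q = 0" using assms unfolding orthc_def by blast
  then show "(\<lambda>f. ip W (s f) q) (lin W Q x) = ip W x q" by (simp add: ip_simps)
qed

lemma subspace_vimage_lin:
  assumes "fun_space.subspace S"
  shows "fun_space.subspace {x \<in> supp_on W. lin W Q x \<in> S}"
  using assms subspace_supp_on[of W]
  by (auto simp: fun_space.subspace_def lin_add lin_scale lin_zero)

context
  fixes G :: "('g, 'b) monoid_scheme" and \<rho>
  assumes rep: "representation G \<rho> (lin W Q ` supp_on W)"
    and el_rep: "\<And>i j z. i < N \<Longrightarrow> j < N \<Longrightarrow> blk K i j \<Longrightarrow> i \<noteq> j \<or> z \<noteq> - 1 \<Longrightarrow>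
      \<exists>g\<in>carrier G. \<exists>k. \<forall>x. lin W Q (act d N (el z i j) x) = cscale k (\<rho> g (lin W Q x))"
begin

text \<open>A subspace contains the scalar multiples of its vectors; therefore \<open>el_rep\<close>
  has to match elementary matrices with elements of \<open>G\<close> only up to a factor, as is the
  case for the Pfaffians.\<close>

lemma inv_sub_vimage_lin:
  assumes "fun_space.subspace S" "\<And>g f. g \<in> carrier G \<Longrightarrow> f \<in> lin W Q ` supp_on W \<Longrightarrow> f \<in> S \<Longrightarrow> \<rho> g f \<in> S"
  shows "inv_sub d N K {x \<in> supp_on W. lin W Q x \<in> S}"
  unfolding inv_sub_def
proof (intro conjI allI impI ballI)
  show "fun_space.subspace {x \<in> supp_on W. lin W Q x \<in> S}" by (rule subspace_vimage_lin[OF assms(1)])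
  fix i j :: nat and z :: complex and x
  assume *: "i < N" "j < N" "blk K i j" "i \<noteq> j \<or> z \<noteq> - 1" and x: "x \<in> {x \<in> supp_on W. lin W Q x \<in> S}"
  obtain g k where g: "g \<in> carrier G" "lin W Q (act d N (el z i j) x) = cscale k (\<rho> g (lin W Q x))"
    using el_rep[OF *] by blast
  then have "lin W Q (act d N (el z i j) x) \<in> S"
    using assms(2)[OF g(1)] x fun_space.subspace_scale[OF assms(1)] by simp
  then show "act d N (el z i j) x \<in> {x \<in> supp_on W. lin W Q x \<in> S}" by (simp add: act_supp)
qed blast

text \<open>The preimage of the span of the orbits is invariant and contains the kernel and the
  tops, so \<open>generated_by_tops\<close> makes it everything.\<close>

lemma spanned_by_orbits:
  "lin W Q ` supp_on W \<subseteq> fun_space.span {\<rho> g (Q t) | g t. g \<in> carrier G \<and> t \<in> T}" (is "?R \<subseteq> fun_space.span ?X")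
proof -
  note r = representationD[OF rep]
  interpret group G by (rule r(1))
  have QR: "Q t \<in> ?R" if "t \<in> T" for t
    using lin_unitv[of W t Q] unitv_supp[of t W] that top_words by (metis finite_words imageI subsetD)
  have inv: "\<rho> g f \<in> fun_space.span ?X" if g: "g \<in> carrier G" and f: "f \<in> fun_space.span ?X" for g f
  proof -
    let ?S = "{f \<in> ?R. \<rho> g f \<in> fun_space.span ?X}"
    note l = linear_onD[OF r(3)[OF g]]
    have "fun_space.subspace ?S"
      unfolding fun_space.subspace_def
    proof (intro conjI ballI allI)
      have "\<rho> g 0 = 0" using l(2)[OF fun_space.subspace_0[OF r(2)], of 0] by simp
      then show "0 \<in> ?S" using fun_space.subspace_0[OF r(2)] fun_space.span_zero by simp
    qed (use l fun_space.subspace_add[OF r(2)] fun_space.subspace_scale[OF r(2)] in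
        \<open>auto simp: fun_space.span_add fun_space.span_scale\<close>)
    moreover have "?X \<subseteq> ?S"
    proof (rule subsetI)
      fix y assume "y \<in> ?X"
      then obtain h t where h: "h \<in> carrier G" "t \<in> T" "y = \<rho> h (Q t)" by blast
      have "\<rho> g y = \<rho> (g \<otimes>\<^bsub>G\<^esub> h) (Q t)" unfolding h(3) using r(6)[OF g h(1) QR[OF h(2)]] by simp
      then have "\<rho> g y \<in> ?X" using g h by blast
      then have "\<rho> g y \<in> fun_space.span ?X" by (rule fun_space.span_base)
      then show "y \<in> ?S" using r(4)[OF h(1) QR[OF h(2)]] h(3) by simp
    qed
    ultimately have "fun_space.span ?X \<subseteq> ?S" by (intro fun_space.span_minimal)
    then show ?thesis using f by blast
  qed
  have "{x \<in> supp_on W. lin W Q x \<in> fun_space.span ?X} = supp_on W"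
  proof (rule generated_by_tops)
    show "inv_sub d N K {x \<in> supp_on W. lin W Q x \<in> fun_space.span ?X}"
      by (rule inv_sub_vimage_lin[OF fun_space.subspace_span]) (rule inv)
    show "ker W Q \<subseteq> {x \<in> supp_on W. lin W Q x \<in> fun_space.span ?X}"
      using fun_space.span_zero by (auto simp: ker_def)
    fix t assume t: "t \<in> T"
    have "Q t = \<rho> \<one>\<^bsub>G\<^esub> (Q t)" using r(5)[OF QR[OF t]] by simp
    then have "Q t \<in> ?X" using t by blast
    then have "Q t \<in> fun_space.span ?X" by (rule fun_space.span_base)
    then show "unitv t \<in> {x \<in> supp_on W. lin W Q x \<in> fun_space.span ?X}"
      using t top_words lin_unitv[of W t Q] unitv_supp[of t W] by auto
  qed
  then show ?thesis by blast
qed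

text \<open>The vectors with vanishing coefficients form an invariant subspace. If it were nonzero,
  its preimage would contain a highest weight vector that is a nonzero multiple of some
  \<open>q t\<close>, and the coefficient of its image at the unit of \<open>G\<close> is not
  0.\<close>

lemma separated_by_coefficients:
  assumes q: "\<And>t. t \<in> T \<Longrightarrow> q t \<in> orthc W (ker W Q)" "\<And>t. t \<in> T \<Longrightarrow> lin W Q (q t) = cscale (\<kappa> t) (Q t)" "\<And>t. t \<in> T \<Longrightarrow> \<kappa> t \<noteq> 0"
    and \<alpha>: "\<And>t x. t \<in> T \<Longrightarrow> x \<in> supp_on W \<Longrightarrow> \<alpha> t (lin W Q x) = ip W x (q t)"
    and x: "x \<in> supp_on W" "\<And>g t. g \<in> carrier G \<Longrightarrow> t \<in> T \<Longrightarrow> \<alpha> t (\<rho> g (lin W Q x)) = 0"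
  shows "lin W Q x = 0"
proof -
  note r = representationD[OF rep]
  let ?R = "lin W Q ` supp_on W"
  interpret group G by (rule r(1))
  have \<alpha>l: "\<alpha> t (f + h) = \<alpha> t f + \<alpha> t h" "\<alpha> t (cscale c f) = c * \<alpha> t f" if t: "t \<in> T" and fh: "f \<in> ?R" "h \<in> ?R" for t f h c
  proof -
    obtain x y where xy: "x \<in> supp_on W" "y \<in> supp_on W" "f = lin W Q x" "h = lin W Q y" using fh by blast
    have "x + y \<in> supp_on W" "cscale c x \<in> supp_on W"
      using xy fun_space.subspace_add[OF subspace_supp_on] fun_space.subspace_scale[OF subspace_supp_on] by blast+
    then show "\<alpha> t (f + h) = \<alpha> t f + \<alpha> t h" "\<alpha> t (cscale c f) = c * \<alpha> t f"
      using \<alpha>[OF t] xy by (simp_all add: lin_add[symmetric] lin_scale[symmetric] ip_simps)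
  qed
  have R0: "0 \<in> ?R" by (rule fun_space.subspace_0[OF r(2)])
  define S where "S = {f \<in> ?R. \<forall>g\<in>carrier G. \<forall>t\<in>T. \<alpha> t (\<rho> g f) = 0}"
  have zero: "\<rho> g 0 = 0" "\<alpha> t 0 = 0" if "g \<in> carrier G" "t \<in> T" for g t
    using linear_onD(2)[OF r(3)[OF that(1)] R0, of 0] \<alpha>l(2)[OF that(2) R0 R0, of 0] by simp_all
  have S: "fun_space.subspace S"
    unfolding fun_space.subspace_def S_def
    using zero R0 r(4) \<alpha>l linear_onD[OF r(3)] fun_space.subspace_add[OF r(2)] fun_space.subspace_scale[OF r(2)]
    by auto
  let ?V = "{x \<in> supp_on W. lin W Q x \<in> S}"
  have V: "inv_sub d N K ?V"
  proof (rule inv_sub_vimage_lin[OF S])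
    fix g f assume g: "g \<in> carrier G" and f: "f \<in> ?R" "f \<in> S"
    have "\<alpha> t (\<rho> h (\<rho> g f)) = 0" if "h \<in> carrier G" "t \<in> T" for h t
    proof -
      have "\<alpha> t (\<rho> (h \<otimes>\<^bsub>G\<^esub> g) f) = 0" using f(2) that g unfolding S_def by blast
      then show ?thesis using r(6)[OF that(1) g f(1)] by simp
    qed
    then show "\<rho> g f \<in> S" unfolding S_def using r(4)[OF g f(1)] by blast
  qed
  have "?V \<inter> orthc W (ker W Q) \<subseteq> {0}"
  proof (rule ccontr)
    assume "\<not> ?V \<inter> orthc W (ker W Q) \<subseteq> {0}"
    then obtain y0 where "y0 \<in> ?V \<inter> orthc W (ker W Q)" "y0 \<noteq> 0" by blast
    then have "\<exists>y c. y \<in> ?V \<inter> orthc W (ker W Q) \<and> hwv d N K c y"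
      by (rule hwv_exists[OF inv_sub_Int[OF V inv_orthc[OF inv_ker]]])
    then obtain y c where "y \<in> ?V \<inter> orthc W (ker W Q)" "hwv d N K c y" by blast
    then have y: "y \<in> supp_on W" "lin W Q y \<in> S" "y \<in> orthc W (ker W Q)" "hwv d N K c y" by auto
    obtain t k where t: "t \<in> T" "k \<noteq> 0" "lin W Q y = cscale k (Q t)" by (rule hwv_orthc_ker[OF y(4,3)])
    have Q: "Q t = cscale (1 / \<kappa> t) (lin W Q (q t))" using q(2,3)[OF t(1)] by simp
    let ?y = "y - cscale (k / \<kappa> t) (q t)"
    have O: "?y \<in> orthc W (ker W Q)"
      using y(3) q(1)[OF t(1)] fun_space.subspace_diff[OF subspace_orthc] fun_space.subspace_scale[OF subspace_orthc] by blast
    moreover have "?y \<in> ker W Q"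
      using O orthc_supp t(3) Q by (auto simp: ker_def lin_diff lin_scale)
    ultimately have "?y = 0" using orthc_Int by blast
    then have yq: "y = cscale (k / \<kappa> t) (q t)" by simp
    have "\<alpha> t (\<rho> \<one>\<^bsub>G\<^esub> (lin W Q y)) = 0" using y(2) t(1) unfolding S_def by blast
    moreover have "\<rho> \<one>\<^bsub>G\<^esub> (lin W Q y) = lin W Q y" using r(5) y(1) by blast
    ultimately have "ip W y (q t) = 0" using \<alpha>[OF t(1) y(1)] by simp
    then have "ip W (q t) (q t) = 0" unfolding yq using t(2) q(3)[OF t(1)] by (simp add: ip_simps)
    then have "q t = 0" using ip_self_eq_0[of W "q t"] q(1)[OF t(1)] orthc_supp by blast
    then have "y = 0" unfolding yq by simp
    then show False using y(4) unfolding hwv_def by blast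
  qed
  moreover have "ker W Q \<subseteq> ?V" using fun_space.subspace_0[OF S] by (auto simp: ker_def)
  ultimately have "?V = ker W Q"
    using subspace_eq_if_no_complement[of W ?V "ker W Q"] inv_sub_subspace[OF V] subspace_ker by blast
  moreover have "x \<in> ?V" using x unfolding S_def by blast
  ultimately show ?thesis by (simp add: ker_def)
qed

lemma irreducible_if_one_top_rep:
  assumes "T = {t}"
  shows "irreducible_rep G \<rho> (lin W Q ` supp_on W)"
  unfolding irreducible_rep_def
proof (intro conjI allI impI)
  show "lin W Q ` supp_on W \<noteq> {0}"
    using top_nonzero[of t] lin_unitv[of W t Q] unitv_supp[of t W] top_words assms by (metis finite_words image_eqI insertI1 singletonD subsetD)
  fix R assume R: "R \<subseteq> lin W Q ` supp_on W" and rR: "representation G \<rho> R"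
  let ?V = "{x \<in> supp_on W. lin W Q x \<in> R}"
  have im: "lin W Q ` ?V = R" using R by auto
  have "inv_sub d N K ?V"
    by (rule inv_sub_vimage_lin) (use representationD[OF rR] in blast)+
  moreover have "ker W Q \<subseteq> ?V" using fun_space.subspace_0[OF representationD(2)[OF rR]] by (auto simp: ker_def)
  ultimately have "?V = ker W Q \<or> ?V = supp_on W" using irreducible_if_one_top[OF _ _ assms] by blast
  moreover have "lin W Q ` ker W Q = {0}"
    using fun_space.subspace_0[OF subspace_ker[of W Q]] by (auto simp: ker_def image_iff)
  ultimately show "R = {0} \<or> R = lin W Q ` supp_on W" using im by auto
qed (rule rep)

end

end

section \<open>The degree of the generators\<close>

lemma subspace_poly_part: "fun_space.subspace (poly_part sU sV d)"
  unfolding poly_part_def by (rule fun_space.subspace_span)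

lemma poly_part_homogeneous:
  assumes "f \<in> poly_part sU sV d" "x \<in> form_space sU sV"
    and "(\<lambda>u v w. t * x u v w) \<in> form_space sU sV"
  shows "f (\<lambda>u v w. t * x u v w) = t ^ d * f x"
proof -
  have "poly_part sU sV d \<subseteq> {f. f (\<lambda>u v w. t * x u v w) = t ^ d * f x}"
    unfolding poly_part_def
  proof (rule fun_space.span_minimal)
    have "(\<Prod>(u, v, w)\<leftarrow>ts. t * x u v w) = t ^ length ts * (\<Prod>(u, v, w)\<leftarrow>ts. x u v w)" for ts
      by (induction ts) (auto simp: mult_ac)
    then show "{(\<lambda>x. if x \<in> form_space sU sV then \<Prod>(u, v, w)\<leftarrow>ts. x u v w else 0) | ts. length ts = d}
        \<subseteq> {f. f (\<lambda>u v w. t * x u v w) = t ^ d * f x}"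
      using assms(2,3) by auto
    show "fun_space.subspace {f. f (\<lambda>u v w. t * x u v w) = t ^ d * f x}"
      by (auto simp: fun_space.subspace_def cscale_def algebra_simps)
  qed
  then show ?thesis using assms(1) by blast
qed

lemma poly_part_outside:
  assumes "f \<in> poly_part sU sV d" "x \<notin> form_space sU sV"
  shows "f x = 0"
proof -
  have "poly_part sU sV d \<subseteq> {f. f x = 0}"
    unfolding poly_part_def
    by (rule fun_space.span_minimal) (use assms(2) in \<open>auto simp: fun_space.subspace_def cscale_def\<close>)
  then show ?thesis using assms(1) by blast
qed

context pf_space
begin

lemma form_scale: "x \<in> form_space sU sV \<Longrightarrow> (\<lambda>u v w. t * x u v w) \<in> form_space sU sV"
  unfolding form_space_def Vector_Spaces.linear_iff by (auto simp: algebra_simps)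

text \<open>The factor \<open>c\<close> is 1, - 1 or 0, the last one on the diagonal blocks.\<close>

lemma psi_matrix_scale:
  "a < 3 * n \<Longrightarrow> b < 3 * n \<Longrightarrow> \<exists>c u v w. \<forall>x. psi_matrix us vs x a b = c * x u v w"
proof -
  assume "a < 3 * n" "b < 3 * n"
  then have "a div n < 3" "b div n < 3" by (auto simp: less_mult_imp_div_less)
  then show ?thesis
    unfolding less3 psi_matrix_def Let_def
    by (elim disjE; simp only: nth_Cons_0 nth_Cons_Suc One_nat_def numeral_2_eq_2;
      metis mult_zero_left mult_1_left mult_minus1)
qed

lemma psi_pfaffians_poly: "psi_pfaffians sU sV us vs m \<subseteq> poly_part sU sV m"
proof
  fix f assume "f \<in> psi_pfaffians sU sV us vs m"
  then obtain J where J: "J \<subseteq> {..<3 * n}" "card J = 2 * m"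
    "f = (\<lambda>x. if x \<in> form_space sU sV then principal_pfaffian m (psi_matrix us vs x) J else 0)"
    unfolding psi_pfaffians_def by blast
  let ?s = "sorted_list_of_set J"
  have "finite J" using J(1) finite_subset by blast
  then have s: "?s ! p < 3 * n" if "p < 2 * m" for p
    using nth_mem[of p ?s] J that by auto
  let ?P = "\<lambda>\<sigma> x. if x \<in> form_space sU sV then \<Prod>i<m. psi_matrix us vs x (?s ! \<sigma> (2 * i)) (?s ! \<sigma> (2 * i + 1)) else 0"
  have P: "?P \<sigma> \<in> poly_part sU sV m" if "\<sigma> permutes {..<2 * m}" for \<sigma>
  proof -
    have "\<exists>c u v w. \<forall>x. psi_matrix us vs x (?s ! \<sigma> (2 * i)) (?s ! \<sigma> (2 * i + 1)) = c * x u v w" if "i < m" for i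
      using permutes_in_image[OF \<open>\<sigma> permutes {..<2 * m}\<close>] that by (intro psi_matrix_scale s) auto
    then obtain c u v w where c: "\<And>i x. i < m \<Longrightarrow>
        psi_matrix us vs x (?s ! \<sigma> (2 * i)) (?s ! \<sigma> (2 * i + 1)) = c i * x (u i) (v i) (w i)"
      by metis
    let ?ts = "map (\<lambda>i. (u i, v i, w i)) [0..<m]"
    have "(\<Prod>(u, v, w)\<leftarrow>map (\<lambda>i. (u i, v i, w i)) [0..<k]. x u v w) = (\<Prod>i<k. x (u i) (v i) (w i) :: complex)" for x k
      by (induction k) simp_all
    moreover have "(\<Prod>i<m. psi_matrix us vs x (?s ! \<sigma> (2 * i)) (?s ! \<sigma> (2 * i + 1))) = (\<Prod>i<m. c i) * (\<Prod>i<m. x (u i) (v i) (w i))" for x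
      unfolding prod.distrib[symmetric] using c by (intro prod.cong) auto
    ultimately have "?P \<sigma> = cscale (\<Prod>i<m. c i) (\<lambda>x. if x \<in> form_space sU sV then \<Prod>(u, v, w)\<leftarrow>?ts. x u v w else 0)"
      by (simp add: cscale_def fun_eq_iff)
    moreover have "(\<lambda>x. if x \<in> form_space sU sV then \<Prod>(u, v, w)\<leftarrow>?ts. x u v w else 0) \<in> poly_part sU sV m"
      unfolding poly_part_def by (rule fun_space.span_base) (auto intro!: exI[of _ ?ts])
    ultimately show ?thesis using fun_space.subspace_scale[OF subspace_poly_part] by simp
  qed
  have "f = cscale (1 / (2 ^ m * fact m)) (\<Sum>\<sigma> | \<sigma> permutes {..<2 * m}. cscale (of_int (sign \<sigma>)) (?P \<sigma>))"
    by (simp add: J(3) fun_eq_iff cscale_def principal_pfaffian_def pfaffian_def sum_fun_apply)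
  then show "f \<in> poly_part sU sV m"
    using P by (auto intro!: fun_space.subspace_scale[OF subspace_poly_part] fun_space.subspace_sum[OF subspace_poly_part])
qed

text \<open>
  An element of the ideal and its component of degree \<open>m\<close> agree to first order when the argument
  is scaled by \<open>t \<rightarrow> 0\<close>.
\<close>

lemma kappa_ideal_degree_part:
  assumes "m = Suc r"
  shows "kappa_ideal sU sV us vs r \<inter> poly_part sU sV m = fun_space.span (psi_pfaffians sU sV us vs m)"
proof
  let ?F = "form_space sU sV" and ?P = "psi_pfaffians sU sV us vs m"
  have r: "r + 1 = m" using assms by simp
  have spanP: "fun_space.span ?P \<subseteq> poly_part sU sV m"
    by (rule fun_space.span_minimal[OF psi_pfaffians_poly subspace_poly_part])
  have "?P \<subseteq> kappa_ideal sU sV us vs r"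
  proof
    fix q assume q: "q \<in> ?P"
    let ?p = "\<lambda>x. if x \<in> ?F then 1 else 0 :: complex"
    have "?p = (\<lambda>x. if x \<in> ?F then \<Prod>(u, v, w)\<leftarrow>[]. x u v w else 0)" by (rule ext) simp
    then have "?p \<in> poly_part sU sV 0" unfolding poly_part_def by (intro fun_space.span_base) force
    then have "?p \<in> poly_ring sU sV" unfolding poly_ring_def by (intro fun_space.span_base) blast
    moreover have "?p * q = q" using poly_part_outside[of q sU sV m] q psi_pfaffians_poly by (auto simp: fun_eq_iff)
    ultimately show "q \<in> kappa_ideal sU sV us vs r"
      unfolding kappa_ideal_def r using q by (intro fun_space.span_base CollectI exI[of _ ?p] exI[of _ q]) simp
  qed
  then show "fun_space.span ?P \<subseteq> kappa_ideal sU sV us vs r \<inter> poly_part sU sV m"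
    using spanP fun_space.span_minimal[of ?P "kappa_ideal sU sV us vs r"] unfolding kappa_ideal_def
    by (simp add: fun_space.subspace_span)
  \<comment> \<open>The constant term \<open>c\<close> has to be the same for all forms
    \<open>x\<close>, since in \<open>CD\<close> it becomes the scalar in
    \<open>cscale c q\<close>.\<close>
  define C where "C = {p :: ('u \<Rightarrow> 'v \<Rightarrow> 'v \<Rightarrow> complex) \<Rightarrow> complex.
    \<exists>c. \<forall>x\<in>?F. \<exists>h. isCont h 0 \<and> (\<forall>t. p (\<lambda>u v w. t * x u v w) = c + t * h t)}"
  \<comment> \<open>The leading term \<open>g\<close> of order \<open>m\<close> is one element of
    the span, chosen before the form \<open>x\<close>; at the end it is shown to be the given
    element of degree \<open>m\<close>.\<close>
  define D where "D = {p :: ('u \<Rightarrow> 'v \<Rightarrow> 'v \<Rightarrow> complex) \<Rightarrow> complex.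
    \<exists>g\<in>fun_space.span ?P. \<forall>x\<in>?F. \<exists>h. isCont h 0 \<and> (\<forall>t. p (\<lambda>u v w. t * x u v w) = t ^ m * (g x + t * h t))}"
  have CD: "p * q \<in> D" if "p \<in> C" "q \<in> ?P" for p q
  proof -
    obtain c where c: "\<forall>x\<in>?F. \<exists>h. isCont h 0 \<and> (\<forall>t. p (\<lambda>u v w. t * x u v w) = c + t * h t)"
      using \<open>p \<in> C\<close> unfolding C_def by blast
    have "\<exists>h. isCont h 0 \<and> (\<forall>t. (p * q) (\<lambda>u v w. t * x u v w) = t ^ m * (cscale c q x + t * h t))" if x: "x \<in> ?F" for x
    proof -
      obtain h where h: "isCont h 0" "\<And>t. p (\<lambda>u v w. t * x u v w) = c + t * h t" using c x by blast
      have "(p * q) (\<lambda>u v w. t * x u v w) = t ^ m * (cscale c q x + t * (h t * q x))" for t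
        using poly_part_homogeneous[of q sU sV m x t] psi_pfaffians_poly \<open>q \<in> ?P\<close> x form_scale[OF x]
        by (auto simp: h(2) cscale_def algebra_simps)
      moreover have "isCont (\<lambda>t. h t * q x) 0" using h(1) by simp
      ultimately show ?thesis by blast
    qed
    moreover have "cscale c q \<in> fun_space.span ?P" using \<open>q \<in> ?P\<close> by (intro fun_space.span_scale fun_space.span_base)
    ultimately show ?thesis unfolding D_def by blast
  qed
  have C: "poly_ring sU sV \<subseteq> C"
    unfolding poly_ring_def
  proof (rule fun_space.span_minimal)
    show "(\<Union>d. poly_part sU sV d) \<subseteq> C"
    proof
      fix p assume "p \<in> (\<Union>d. poly_part sU sV d)"
      then obtain d where p: "p \<in> poly_part sU sV d" by blast
      have hom: "p (\<lambda>u v w. t * x u v w) = t ^ d * p x" if "x \<in> ?F" for x t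
        by (rule poly_part_homogeneous[OF p that form_scale[OF that]])
      show "p \<in> C"
      proof (cases d)
        case 0
        \<comment> \<open>In degree 0 the value at every form equals the value at the zero form,
          which serves as the common constant.\<close>
        have "(\<lambda>u v w. 0) \<in> ?F" using form_scale[of _ 0] unfolding form_space_def Vector_Spaces.linear_iff
          using U.vector_space_axioms V.vector_space_axioms vector_space_complex by auto
        then have "p x = p (\<lambda>u v w. 0)" if "x \<in> ?F" for x using hom[OF that, of 0] 0 by simp
        then have "\<forall>x\<in>?F. isCont (\<lambda>t :: complex. 0 :: complex) 0 \<and> (\<forall>t. p (\<lambda>u v w. t * x u v w) = p (\<lambda>u v w. 0) + t * 0)"
          using hom 0 by simp
        then show ?thesis unfolding C_def by blast
      next
        case (Suc e)
        have "isCont (\<lambda>t. t ^ e * p x) 0" for x by (intro continuous_intros)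
        moreover have "p (\<lambda>u v w. t * x u v w) = 0 + t * (t ^ e * p x)" if "x \<in> ?F" for x t
          using hom[OF that] Suc by simp
        ultimately show ?thesis unfolding C_def by blast
      qed
    qed
    show "fun_space.subspace C"
      unfolding fun_space.subspace_def
    proof (intro conjI ballI allI)
      have "\<forall>x\<in>?F. isCont (\<lambda>t :: complex. 0 :: complex) 0 \<and> (\<forall>t. (0 :: ('u \<Rightarrow> 'v \<Rightarrow> 'v \<Rightarrow> complex) \<Rightarrow> complex) (\<lambda>u v w. t * x u v w) = 0 + t * 0)"
        by simp
      then show "0 \<in> C" unfolding C_def by blast
    next
      fix p p' assume "p \<in> C" "p' \<in> C"
      then obtain c c' where c: "\<forall>x\<in>?F. \<exists>h. isCont h 0 \<and> (\<forall>t. p (\<lambda>u v w. t * x u v w) = c + t * h t)"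
        "\<forall>x\<in>?F. \<exists>h. isCont h 0 \<and> (\<forall>t. p' (\<lambda>u v w. t * x u v w) = c' + t * h t)"
        unfolding C_def by blast
      have "\<exists>h. isCont h 0 \<and> (\<forall>t. (p + p') (\<lambda>u v w. t * x u v w) = (c + c') + t * h t)" if xF: "x \<in> ?F" for x
      proof -
        obtain h h' where h: "isCont h 0" "isCont h' 0" "\<And>t. p (\<lambda>u v w. t * x u v w) = c + t * h t"
          "\<And>t. p' (\<lambda>u v w. t * x u v w) = c' + t * h' t" using c xF by blast
        then show ?thesis by (intro exI[of _ "\<lambda>t. h t + h' t"]) (auto simp: algebra_simps)
      qed
      then show "p + p' \<in> C" unfolding C_def by blast
    next
      fix k p assume "p \<in> C"
      then obtain c where c: "\<forall>x\<in>?F. \<exists>h. isCont h 0 \<and> (\<forall>t. p (\<lambda>u v w. t * x u v w) = c + t * h t)"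
        unfolding C_def by blast
      have "\<exists>h. isCont h 0 \<and> (\<forall>t. cscale k p (\<lambda>u v w. t * x u v w) = k * c + t * h t)" if xF: "x \<in> ?F" for x
      proof -
        obtain h where h: "isCont h 0" "\<And>t. p (\<lambda>u v w. t * x u v w) = c + t * h t" using c xF by blast
        then show ?thesis by (intro exI[of _ "\<lambda>t. k * h t"]) (auto simp: algebra_simps cscale_def)
      qed
      then show "cscale k p \<in> C" unfolding C_def by blast
    qed
  qed
  have D: "kappa_ideal sU sV us vs r \<subseteq> D"
    unfolding kappa_ideal_def r
  proof (rule fun_space.span_minimal)
    show "{p * q | p q. p \<in> poly_ring sU sV \<and> q \<in> ?P} \<subseteq> D" using CD C by blast
    show "fun_space.subspace D"
      unfolding fun_space.subspace_def
    proof (intro conjI ballI allI)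
      have "\<forall>x\<in>?F. isCont (\<lambda>t :: complex. 0 :: complex) 0 \<and> (\<forall>t. (0 :: ('u \<Rightarrow> 'v \<Rightarrow> 'v \<Rightarrow> complex) \<Rightarrow> complex) (\<lambda>u v w. t * x u v w) = t ^ m * (0 x + t * 0))"
        by simp
      then show "0 \<in> D" unfolding D_def using fun_space.span_zero by blast
    next
      fix p p' assume "p \<in> D" "p' \<in> D"
      then obtain c c' where cs: "c \<in> fun_space.span ?P" "c' \<in> fun_space.span ?P"
        and c: "\<forall>x\<in>?F. \<exists>h. isCont h 0 \<and> (\<forall>t. p (\<lambda>u v w. t * x u v w) = t ^ m * (c x + t * h t))"
        "\<forall>x\<in>?F. \<exists>h. isCont h 0 \<and> (\<forall>t. p' (\<lambda>u v w. t * x u v w) = t ^ m * (c' x + t * h t))"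
        unfolding D_def by blast
      have "\<exists>h. isCont h 0 \<and> (\<forall>t. (p + p') (\<lambda>u v w. t * x u v w) = t ^ m * ((c + c') x + t * h t))" if xF: "x \<in> ?F" for x
      proof -
        obtain h h' where h: "isCont h 0" "isCont h' 0" "\<And>t. p (\<lambda>u v w. t * x u v w) = t ^ m * (c x + t * h t)"
          "\<And>t. p' (\<lambda>u v w. t * x u v w) = t ^ m * (c' x + t * h' t)" using c xF by blast
        then show ?thesis by (intro exI[of _ "\<lambda>t. h t + h' t"]) (auto simp: algebra_simps)
      qed
      then show "p + p' \<in> D" unfolding D_def using fun_space.span_add[OF cs] by blast
    next
      fix k p assume "p \<in> D"
      then obtain c where cs: "c \<in> fun_space.span ?P"
        and c: "\<forall>x\<in>?F. \<exists>h. isCont h 0 \<and> (\<forall>t. p (\<lambda>u v w. t * x u v w) = t ^ m * (c x + t * h t))"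
        unfolding D_def by blast
      have "\<exists>h. isCont h 0 \<and> (\<forall>t. cscale k p (\<lambda>u v w. t * x u v w) = t ^ m * (cscale k c x + t * h t))" if xF: "x \<in> ?F" for x
      proof -
        obtain h where h: "isCont h 0" "\<And>t. p (\<lambda>u v w. t * x u v w) = t ^ m * (c x + t * h t)" using c xF by blast
        then show ?thesis by (intro exI[of _ "\<lambda>t. k * h t"]) (auto simp: algebra_simps cscale_def)
      qed
      then show "cscale k p \<in> D" unfolding D_def using fun_space.span_scale[OF cs] by blast
    qed
  qed
  show "kappa_ideal sU sV us vs r \<inter> poly_part sU sV m \<subseteq> fun_space.span ?P"
  proof
    fix f assume f: "f \<in> kappa_ideal sU sV us vs r \<inter> poly_part sU sV m"
    then obtain g where g: "g \<in> fun_space.span ?P"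
      "\<And>x. x \<in> ?F \<Longrightarrow> \<exists>h. isCont h 0 \<and> (\<forall>t. f (\<lambda>u v w. t * x u v w) = t ^ m * (g x + t * h t))"
      using D unfolding D_def by blast
    have "f x = g x" for x
    proof (cases "x \<in> ?F")
      case False
      then show ?thesis using poly_part_outside[of _ sU sV m x] f g(1) spanP by (metis IntD2 subsetD)
    next
      case True
      obtain h where h: "isCont h 0" "\<And>t. f (\<lambda>u v w. t * x u v w) = t ^ m * (g x + t * h t)" using g(2)[OF True] by blast
      have "g x + t * h t = f x" if "t \<noteq> 0" for t
        using h(2)[of t] poly_part_homogeneous[of f sU sV m x t] f True form_scale[OF True] that by auto
      then have "((\<lambda>t. g x + t * h t) \<longlongrightarrow> f x) (at 0)"
        by (intro tendsto_eventually) (auto simp: eventually_at_filter)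
      moreover have "isCont (\<lambda>t. g x + t * h t) 0" using h(1) by (intro continuous_intros)
      then have "((\<lambda>t. g x + t * h t) \<longlongrightarrow> g x) (at 0)" unfolding isCont_def by simp
      ultimately show ?thesis using LIM_unique by blast
    qed
    then have "f = g" by blast
    then show "f \<in> fun_space.span ?P" using g(1) by simp
  qed
qed

end

section \<open>Comparison of the matrix coefficients\<close>

context quotient_rep
begin

text \<open>\<open>p t\<close> is the lift of the top \<open>t\<close> orthogonal to the kernel, and
  \<open>q t\<close> is the multiple of it that makes their scalar product 1. This normalizes the
  coefficients of all representations alike.\<close>

lemma coefficient_data:
  obtains \<alpha> p q \<kappa> where
    "\<And>t. t \<in> T \<Longrightarrow> p t \<in> supp_on W" "\<And>t. t \<in> T \<Longrightarrow> lin W Q (p t) = Q t"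
    "\<And>t. t \<in> T \<Longrightarrow> q t \<in> orthc W (ker W Q)" "\<And>t. t \<in> T \<Longrightarrow> lin W Q (q t) = cscale (\<kappa> t) (Q t)"
    "\<And>t. t \<in> T \<Longrightarrow> \<kappa> t \<noteq> 0" "\<And>t. t \<in> T \<Longrightarrow> ip W (p t) (q t) = 1"
    "\<And>t x. t \<in> T \<Longrightarrow> x \<in> supp_on W \<Longrightarrow> \<alpha> t (lin W Q x) = ip W x (q t)"
    "\<And>t i j z. t \<in> T \<Longrightarrow> i < j \<Longrightarrow> j < N \<Longrightarrow> blk K i j \<Longrightarrow> act d N (el z i j) (p t) = p t"
    "\<And>t i j z. t \<in> T \<Longrightarrow> i < j \<Longrightarrow> j < N \<Longrightarrow> blk K i j \<Longrightarrow> act d N (el z i j) (q t) = q t"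
    "\<And>t w i. t \<in> T \<Longrightarrow> p t w \<noteq> 0 \<Longrightarrow> i < N \<Longrightarrow> cnt d w i = cnt d t i"
    "\<And>t w i. t \<in> T \<Longrightarrow> q t w \<noteq> 0 \<Longrightarrow> i < N \<Longrightarrow> cnt d w i = cnt d t i"
proof -
  define P where "P = (\<lambda>t p. p \<in> orthc W (ker W Q) \<and> lin W Q p = Q t \<and> ip W p p \<noteq> 0 \<and>
    (\<forall>i j z. i < j \<longrightarrow> j < N \<longrightarrow> blk K i j \<longrightarrow> act d N (el z i j) p = p) \<and>
    (\<forall>w i. p w \<noteq> 0 \<longrightarrow> i < N \<longrightarrow> cnt d w i = cnt d t i))"
  have "\<exists>p. P t p" if "t \<in> T" for t
    by (rule top_lift[OF that]) (unfold P_def, blast)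
  then obtain p where Pp: "\<And>t. t \<in> T \<Longrightarrow> P t (p t)" by metis
  have p: "p t \<in> orthc W (ker W Q)" "lin W Q (p t) = Q t" "ip W (p t) (p t) \<noteq> 0"
    "i < j \<Longrightarrow> j < N \<Longrightarrow> blk K i j \<Longrightarrow> act d N (el z i j) (p t) = p t"
    "p t w \<noteq> 0 \<Longrightarrow> i < N \<Longrightarrow> cnt d w i = cnt d t i" if "t \<in> T" for t i j z w
    using Pp[OF that] unfolding P_def by blast+
  define \<kappa> where "\<kappa> = (\<lambda>t. 1 / ip W (p t) (p t))"
  define q where "q = (\<lambda>t. cscale (\<kappa> t) (p t))"
  have q: "q t \<in> orthc W (ker W Q)" if "t \<in> T" for t
    unfolding q_def using fun_space.subspace_scale[OF subspace_orthc p(1)[OF that]] .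
  have k: "\<kappa> t \<noteq> 0" if "t \<in> T" for t using p(3)[OF that] by (simp add: \<kappa>_def)
  have "\<exists>a. \<forall>x\<in>supp_on W. a (lin W Q x) = ip W x (q t)" if "t \<in> T" for t
    using coefficient_functional[OF q[OF that]] by metis
  then obtain \<alpha> where \<alpha>: "\<And>t x. t \<in> T \<Longrightarrow> x \<in> supp_on W \<Longrightarrow> \<alpha> t (lin W Q x) = ip W x (q t)" by metis
  have ip1: "ip W (p t) (q t) = 1" if "t \<in> T" for t
  proof -
    have "cnj (ip W (p t) (p t)) = ip W (p t) (p t)" unfolding ip_self by simp
    then show ?thesis using p(3)[OF that] by (simp add: q_def \<kappa>_def ip_scale_right)
  qed
  have qw: "p t w \<noteq> 0" if "q t w \<noteq> 0" for t w using that by (auto simp: q_def cscale_def)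
  show ?thesis
  proof (rule that[of p q \<kappa> \<alpha>])
    show "\<And>t. t \<in> T \<Longrightarrow> p t \<in> supp_on W" using p(1) orthc_supp by blast
    show "\<And>t. t \<in> T \<Longrightarrow> lin W Q (q t) = cscale (\<kappa> t) (Q t)" by (simp add: q_def lin_scale p(2))
    show "\<And>t i j z. t \<in> T \<Longrightarrow> i < j \<Longrightarrow> j < N \<Longrightarrow> blk K i j \<Longrightarrow> act d N (el z i j) (q t) = q t"
      by (simp add: q_def act_scale p(4))
    show "\<And>t w i. t \<in> T \<Longrightarrow> q t w \<noteq> 0 \<Longrightarrow> i < N \<Longrightarrow> cnt d w i = cnt d t i" using p(5) qw by blast
  qed (fact p q k \<alpha> ip1)+
qed

end

lemma ip_act_expand:
  "ip (words d N) (act d N g x) y = (\<Sum>w\<in>words d N. (\<Sum>v\<in>words d N. (\<Prod>p<d. g (w p) (v p)) * x v) * cnj (y w))"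
  by (simp add: ip_def act_def)

lemma isCont_ip_act:
  assumes "\<And>a b. isCont (\<lambda>z. X z a b) (t :: complex)"
  shows "isCont (\<lambda>z. ip (words d N) (act d N (X z) x) y) t"
  unfolding ip_act_expand by (intro continuous_intros assms)

lemma act_diagonal:
  assumes g: "\<And>i j. i < N \<Longrightarrow> j < N \<Longrightarrow> i \<noteq> j \<Longrightarrow> g i j = 0" and w: "w \<in> words d N"
  shows "act d N g x w = (\<Prod>i<N. g i i ^ cnt d w i) * x w"
proof -
  have 0: "(\<Prod>p<d. g (w p) (v p)) = 0" if v: "v \<in> words d N" "v \<noteq> w" for v
  proof -
    obtain p where "p < d" "w p \<noteq> v p" using words_eqI[OF w v(1)] v(2) by metis
    then have "p \<in> {..<d}" "g (w p) (v p) = 0" using g words_less[OF w] words_less[OF v(1)] by auto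
    then show ?thesis by (intro prod_zero) auto
  qed
  have "(\<Sum>v\<in>words d N. (\<Prod>p<d. g (w p) (v p)) * x v) = (\<Sum>v\<in>words d N. if v = w then (\<Prod>p<d. g (w p) (w p)) * x w else 0)"
    by (rule sum.cong[OF refl]) (use 0 in auto)
  then have "act d N g x w = (\<Prod>p<d. g (w p) (w p)) * x w" using w by (simp add: act_def)
  also have "(\<Prod>p<d. g (w p) (w p)) = (\<Prod>i<N. \<Prod>p\<in>{p\<in>{..<d}. w p = i}. g (w p) (w p))"
    using words_less[OF w] by (intro prod.group[symmetric]) auto
  also have "\<dots> = (\<Prod>i<N. g i i ^ cnt d w i)"
    by (rule prod.cong[OF refl]) (simp add: cnt_def)
  finally show ?thesis .
qed

lemma ip_act_diagonal:
  assumes g: "\<And>i j. i < N \<Longrightarrow> j < N \<Longrightarrow> i \<noteq> j \<Longrightarrow> g i j = 0"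
    and x: "\<And>w i. x w \<noteq> 0 \<Longrightarrow> i < N \<Longrightarrow> cnt d w i = c i"
  shows "ip (words d N) (act d N g x) y = (\<Prod>i<N. g i i ^ c i) * ip (words d N) x y"
proof -
  have ad: "act d N g x w = (\<Prod>i<N. g i i ^ cnt d w i) * x w" if "w \<in> words d N" for w
    by (rule act_diagonal[OF _ that]) (rule g)
  have "act d N g x w * cnj (y w) = (\<Prod>i<N. g i i ^ c i) * (x w * cnj (y w))" if "w \<in> words d N" for w
  proof (cases "x w = 0")
    case True
    then show ?thesis using ad[OF that] by simp
  next
    case False
    have "(\<Prod>i<N. g i i ^ cnt d w i) = (\<Prod>i<N. g i i ^ c i)"
      by (rule prod.cong[OF refl]) (use x[OF False] in simp)
    then show ?thesis using ad[OF that] by simp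
  qed
  then show ?thesis unfolding ip_def sum_distrib_left by (intro sum.cong refl)
qed

lemma ip_different_weights:
  assumes x: "\<And>w. x w \<noteq> 0 \<Longrightarrow> cnt d w i = a" and y: "\<And>w. y w \<noteq> 0 \<Longrightarrow> cnt d w i = b" and "a \<noteq> b"
  shows "ip (words d N) x y = 0"
  unfolding ip_def
proof (rule sum.neutral, rule ballI)
  fix w
  have "x w = 0 \<or> y w = 0" using x[of w] y[of w] assms(3) by blast
  then show "x w * cnj (y w) = 0" by auto
qed

section \<open>The cofactor twist as a homomorphism of block matrices\<close>

lemma thm3_entries:
  "i < 3 \<Longrightarrow> j < 3 \<Longrightarrow> thm3 g i j = cof3 (rev3 g) i j"
  "3 \<le> i \<Longrightarrow> 3 \<le> j \<Longrightarrow> thm3 g i j = g i j"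
  "i < 3 \<Longrightarrow> 3 \<le> j \<Longrightarrow> thm3 g i j = 0" "3 \<le> i \<Longrightarrow> j < 3 \<Longrightarrow> thm3 g i j = 0"
  by (simp_all add: thm3_def bmat_def)

lemma mm_block:
  assumes "block_matrix (3 + N) 3 g" "block_matrix (3 + N) 3 h" "i < 3 + N" "j < 3 + N"
  shows "mm (3 + N) g h i j = (if i < 3 \<and> j < 3 then mm 3 g h i j
    else if 3 \<le> i \<and> 3 \<le> j then (\<Sum>k<N. g i (3 + k) * h (3 + k) j) else 0)"
proof -
  have b: "g a b = 0" "h a b = 0" if "a < 3 + N" "b < 3 + N" "\<not> (a < 3 \<longleftrightarrow> b < 3)" for a b
    using assms(1,2) that by (auto simp: block_matrix_def blk_def)
  show ?thesis
    unfolding mm_def sum_block[of _ 3 N]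
    using assms(3,4) b by (cases "i < 3"; cases "j < 3") (auto intro!: sum.neutral)
qed

lemma thm3_mult:
  assumes "block_matrix (3 + N) 3 g" "block_matrix (3 + N) 3 h" "i < 3 + N" "j < 3 + N"
  shows "thm3 (mm (3 + N) g h) i j = mm (3 + N) (thm3 g) (thm3 h) i j"
proof -
  have b: "block_matrix (3 + N) 3 (thm3 g)" "block_matrix (3 + N) 3 (thm3 h)"
    by (auto simp: block_matrix_def thm3_def bmat_def blk_def)
  consider "i < 3" "j < 3" | "3 \<le> i" "3 \<le> j" | "i < 3" "3 \<le> j" | "3 \<le> i" "j < 3" by linarith
  then show ?thesis
  proof cases
    case 1
    have "rev3 (mm (3 + N) g h) k l = mm 3 (rev3 g) (rev3 h) k l" if "k < 3" "l < 3" for k l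
    proof -
      have "2 - k < 3" "2 - l < 3" "2 - k < 3 + N" "2 - l < 3 + N" by simp_all
      then show ?thesis using mm_block[OF assms(1,2), of "2 - k" "2 - l"] by (simp add: rev3_def mm_def sum3)
    qed
    then have "cof3 (rev3 (mm (3 + N) g h)) i j = cof3 (mm 3 (rev3 g) (rev3 h)) i j" by (rule cof3_cong)
    also have "\<dots> = mm 3 (cof3 (rev3 g)) (cof3 (rev3 h)) i j" by (rule cof3_mult[OF 1])
    also have "\<dots> = mm 3 (thm3 g) (thm3 h) i j" using 1 by (simp add: mm_def thm3_entries)
    finally show ?thesis using mm_block[OF b assms(3,4)] 1 by (simp add: thm3_entries)
  next
    case 2
    then show ?thesis using mm_block[OF b assms(3,4)] mm_block[OF assms] by (simp add: thm3_entries)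
  qed (use mm_block[OF b assms(3,4)] in \<open>simp_all add: thm3_entries\<close>)
qed

lemma el_block: "blk K i j \<Longrightarrow> block_matrix N K (el z i j)"
  by (auto simp: block_matrix_def el_def blk_def)

text \<open>The transposition contained in the cofactors and the reversal of the block letters both
  exchange upper and lower triangular matrices; together they preserve the type.\<close>

lemma thm3_el:
  assumes "blk 3 i j" "i \<noteq> j"
  obtains z' i' j' where "\<And>a b. thm3 (el z i j) a b = el z' i' j' a b" "blk 3 i' j'"
    "i < j \<longleftrightarrow> i' < j'" "i' \<noteq> j'" "i < 3 + N \<Longrightarrow> j < 3 + N \<Longrightarrow> i' < 3 + N \<and> j' < 3 + N"
proof (cases "i < 3")
  case True
  then have ij: "i < 3" "j < 3" using assms(1) by (auto simp: blk_def)
  have "rev3 (el z i j) k l = el z (2 - i) (2 - j) k l" if "k < 3" "l < 3" for k l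
    using that ij unfolding rev3_def el_def less3 by (elim disjE; simp)
  then have c: "cof3 (rev3 (el z i j)) k l = cof3 (el z (2 - i) (2 - j)) k l" for k l by (rule cof3_cong)
  have ne: "2 - j \<noteq> 2 - i" using assms(2) ij by simp
  have "thm3 (el z i j) a b = el (- z) (2 - j) (2 - i) a b" for a b
  proof -
    consider "a < 3" "b < 3" | "3 \<le> a" "3 \<le> b" | "a < 3" "3 \<le> b" | "3 \<le> a" "b < 3" by linarith
    then show ?thesis
    proof cases
      case 1
      then show ?thesis using c[of a b] cof3_el_offdiag[of "2 - j" "2 - i" a b "- z"] ne by (simp add: thm3_entries)
    next
      case 2
      then have "a \<noteq> i" "a \<noteq> 2 - j" using ij by auto
      then show ?thesis using 2 by (simp add: thm3_entries el_def)
    next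
      case 3
      then have "b \<noteq> 2 - i" "a \<noteq> b" by auto
      then show ?thesis using 3 by (simp add: thm3_entries el_def)
    next
      case 4
      then have "a \<noteq> 2 - j" "a \<noteq> b" by auto
      then show ?thesis using 4 by (simp add: thm3_entries el_def)
    qed
  qed
  moreover have "i < j \<longleftrightarrow> 2 - j < 2 - i" "2 - j < 3 \<and> 2 - i < 3" using ij by arith+
  ultimately show ?thesis using that[of "- z" "2 - j" "2 - i"] ne by (simp add: blk_def)
next
  case False
  then have ij: "3 \<le> i" "3 \<le> j" using assms(1) by (auto simp: blk_def)
  have "rev3 (el z i j) k l = el 0 0 0 k l" if "k < 3" "l < 3" for k l
    using that ij unfolding rev3_def el_def less3 by (elim disjE; simp)
  then have c: "cof3 (rev3 (el z i j)) k l = cof3 (el 0 0 0) k l" for k l by (rule cof3_cong)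
  have "thm3 (el z i j) a b = el z i j a b" for a b
  proof -
    consider "a < 3" "b < 3" | "3 \<le> a" "3 \<le> b" | "a < 3" "3 \<le> b" | "3 \<le> a" "b < 3" by linarith
    then show ?thesis
    proof cases
      case 1
      then have "a \<noteq> i" using ij by auto
      moreover have "cof3 (el 0 0 0) a b = el 0 0 0 a b" using 1 cof3_el_diag[of 0 a b 0 0] by simp
      ultimately show ?thesis using c[of a b] 1 by (simp add: thm3_entries el_def)
    next
      case 2
      then show ?thesis by (simp add: thm3_entries)
    next
      case 3
      then show ?thesis using ij by (auto simp: thm3_entries el_def)
    next
      case 4
      then show ?thesis using ij by (auto simp: thm3_entries el_def)
    qed
  qed
  then show ?thesis using that[of z i j] assms by blast
qed

lemma det3_el_offdiag:
  assumes "blk 3 i j" "i \<noteq> j"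
  shows "det3 (el z i j) = 1"
proof (cases "i < 3")
  case True
  then show ?thesis using assms det3_el[of j i z] by (auto simp: blk_def)
next
  case False
  then have "det3 (el z i j) = det3 (el 0 0 0)" by (intro det3_cong) (auto simp: el_def)
  then show ?thesis using det3_el[of 0 0 0] by simp
qed

lemma det3_mm_block:
  assumes "block_matrix (3 + N) 3 g" "block_matrix (3 + N) 3 h"
  shows "det3 (mm (3 + N) g h) = det3 g * det3 h"
  unfolding det3_mult[symmetric] by (rule det3_cong) (simp add: mm_block[OF assms])

lemma isCont_thm3:
  assumes "\<And>a b. isCont (\<lambda>z. X z a b) (t :: complex)"
  shows "isCont (\<lambda>z. thm3 (X z) i j) t" "isCont (\<lambda>z. det3 (X z)) t"
proof -
  show "isCont (\<lambda>z. thm3 (X z) i j) t"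
  proof -
    consider "i < 3 \<and> j < 3" | "\<not> (i < 3 \<and> j < 3)" "3 \<le> i \<and> 3 \<le> j" | "\<not> (i < 3 \<and> j < 3)" "\<not> (3 \<le> i \<and> 3 \<le> j)" by blast
    then show ?thesis
    proof cases
      case 1
      show ?thesis unfolding thm3_def bmat_def cof3_def rev3_def if_P[OF 1] by (intro continuous_intros assms)
    next
      case 2
      show ?thesis unfolding thm3_def bmat_def if_not_P[OF 2(1)] if_P[OF 2(2)] by (intro assms)
    next
      case 3
      show ?thesis unfolding thm3_def bmat_def if_not_P[OF 3(1)] if_not_P[OF 3(2)] by (rule continuous_const)
    qed
  qed
  show "isCont (\<lambda>z. det3 (X z)) t" unfolding det3_def by (intro continuous_intros assms)
qed

text \<open>
  Both sides transform in the same way under unipotent matrices, so they agree everywhere once they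
  agree on the torus.
\<close>

lemma coefficients_agree:
  fixes p q p' q' :: "(nat \<Rightarrow> nat) \<Rightarrow> complex"
  assumes fixed: "\<And>i j z. i < j \<Longrightarrow> j < 3 + N \<Longrightarrow> blk 3 i j \<Longrightarrow> act d (3 + N) (el z i j) p = p"
    "\<And>i j z. i < j \<Longrightarrow> j < 3 + N \<Longrightarrow> blk 3 i j \<Longrightarrow> act d (3 + N) (el z i j) q = q"
    "\<And>i j z. i < j \<Longrightarrow> j < 3 + N \<Longrightarrow> blk 3 i j \<Longrightarrow> act d' (3 + N) (el z i j) p' = p'"
    "\<And>i j z. i < j \<Longrightarrow> j < 3 + N \<Longrightarrow> blk 3 i j \<Longrightarrow> act d' (3 + N) (el z i j) q' = q'"
    and torus: "\<And>g. (\<And>i j. i < 3 + N \<Longrightarrow> j < 3 + N \<Longrightarrow> i \<noteq> j \<Longrightarrow> g i j = 0) \<Longrightarrow>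
      ip (words d (3 + N)) (act d (3 + N) (thm3 g) p) q =
      s * det3 g ^ m * ip (words d' (3 + N)) (act d' (3 + N) g p') q'"
    and g: "block_matrix (3 + N) 3 g"
  shows "ip (words d (3 + N)) (act d (3 + N) (thm3 g) p) q =
    s * det3 g ^ m * ip (words d' (3 + N)) (act d' (3 + N) g p') q'"
proof -
  define A where "A = (\<lambda>X. ip (words d (3 + N)) (act d (3 + N) X p) q)"
  define B where "B = (\<lambda>X. ip (words d' (3 + N)) (act d' (3 + N) X p') q')"
  have A_cong: "A X = A Y" if "\<And>i j. i < 3 + N \<Longrightarrow> j < 3 + N \<Longrightarrow> X i j = Y i j" for X Y
    unfolding A_def using act_cong[of "3 + N" X Y, OF that] by simp
  have B_cong: "B X = B Y" if "\<And>i j. i < 3 + N \<Longrightarrow> j < 3 + N \<Longrightarrow> X i j = Y i j" for X Y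
    unfolding B_def using act_cong[of "3 + N" X Y, OF that] by simp
  \<comment> \<open>An elementary matrix on the left passes to \<open>q\<close> or \<open>q'\<close>
    as its adjoint, which is upper unipotent and fixes them.\<close>
  have A_low: "A (mm (3 + N) (el z i j) X) = A X" and B_low: "B (mm (3 + N) (el z i j) X) = B X"
    if "j < i" "i < 3 + N" "blk 3 i j" for i j z X
    using that fixed(2,4)[of j i] unfolding A_def B_def act_mm ip_act[of _ _ "el z i j"] adjm_el
    by (simp_all add: blk_sym)
  have A_up: "A (mm (3 + N) X (el z i j)) = A X" and B_up: "B (mm (3 + N) X (el z i j)) = B X"
    if "i < j" "j < 3 + N" "blk 3 i j" for i j z X
    using that fixed(1,3)[of i j] unfolding A_def B_def act_mm by simp_all
  have "A (thm3 g) - s * det3 g ^ m * B g = 0"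
  proof (rule block_function_vanishes[where N = "3 + N" and K = 3 and f = "\<lambda>g. A (thm3 g) - s * det3 g ^ m * B g"])
    fix g h :: "nat \<Rightarrow> nat \<Rightarrow> complex"
    assume gh: "\<And>i j. i < 3 + N \<Longrightarrow> j < 3 + N \<Longrightarrow> g i j = h i j"
    have "thm3 g i j = thm3 h i j" if "i < 3 + N" "j < 3 + N" for i j
    proof -
      have "cof3 (rev3 g) i j = cof3 (rev3 h) i j" by (rule cof3_cong) (simp add: rev3_def gh)
      then show ?thesis using gh that by (simp add: thm3_def bmat_def)
    qed
    then have "A (thm3 g) = A (thm3 h)" by (rule A_cong)
    moreover have "det3 g = det3 h" by (rule det3_cong) (simp add: gh)
    ultimately show "A (thm3 g) - s * det3 g ^ m * B g = A (thm3 h) - s * det3 h ^ m * B h"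
      using B_cong[of g h, OF gh] by simp
  next
    fix g i j and z :: complex
    assume g: "block_matrix (3 + N) 3 g" and ij: "j < i" "i < 3 + N" "blk 3 i j"
    obtain z' i' j' where el: "\<And>a b. thm3 (el z i j) a b = el z' i' j' a b" "blk 3 i' j'"
      "i < j \<longleftrightarrow> i' < j'" "i' \<noteq> j'" "i < 3 + N \<Longrightarrow> j < 3 + N \<Longrightarrow> i' < 3 + N \<and> j' < 3 + N"
      using thm3_el[of i j z N] ij by blast
    have e: "thm3 (el z i j) = el z' i' j'" using el(1) by blast
    have "A (thm3 (mm (3 + N) (el z i j) g)) = A (mm (3 + N) (el z' i' j') (thm3 g))"
      by (rule A_cong) (use thm3_mult[OF el_block[OF ij(3)] g] e in simp)
    also have "\<dots> = A (thm3 g)" using A_low[of j' i'] el ij by simp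
    finally show "A (thm3 (mm (3 + N) (el z i j) g)) - s * det3 (mm (3 + N) (el z i j) g) ^ m * B (mm (3 + N) (el z i j) g) =
        A (thm3 g) - s * det3 g ^ m * B g"
      using B_low[OF ij] det3_mm_block[OF el_block[OF ij(3)] g] det3_el_offdiag[OF ij(3)] ij(1) by simp
  next
    fix g i j and z :: complex
    assume g: "block_matrix (3 + N) 3 g" and ij: "i < j" "j < 3 + N" "blk 3 i j"
    obtain z' i' j' where el: "\<And>a b. thm3 (el z i j) a b = el z' i' j' a b" "blk 3 i' j'"
      "i < j \<longleftrightarrow> i' < j'" "i' \<noteq> j'" "i < 3 + N \<Longrightarrow> j < 3 + N \<Longrightarrow> i' < 3 + N \<and> j' < 3 + N"
      using thm3_el[of i j z N] ij by blast
    have e: "thm3 (el z i j) = el z' i' j'" using el(1) by blast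
    have "A (thm3 (mm (3 + N) g (el z i j))) = A (mm (3 + N) (thm3 g) (el z' i' j'))"
      by (rule A_cong) (use thm3_mult[OF g el_block[OF ij(3)]] e in simp)
    also have "\<dots> = A (thm3 g)" using A_up[of i' j'] el ij by simp
    finally show "A (thm3 (mm (3 + N) g (el z i j))) - s * det3 (mm (3 + N) g (el z i j)) ^ m * B (mm (3 + N) g (el z i j)) =
        A (thm3 g) - s * det3 g ^ m * B g"
      using B_up[OF ij] det3_mm_block[OF g el_block[OF ij(3)]] det3_el_offdiag[OF ij(3)] ij(1) by simp
  next
    fix g :: "nat \<Rightarrow> nat \<Rightarrow> complex" and k :: nat
    have iso: "isCont (\<lambda>z. g i j + (if i = k \<and> j = k then z else 0)) 0" for i j
      by (cases "i = k \<and> j = k") auto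
    show "isCont (\<lambda>z. A (thm3 (\<lambda>i j. g i j + (if i = k \<and> j = k then z else 0))) -
        s * det3 (\<lambda>i j. g i j + (if i = k \<and> j = k then z else 0)) ^ m *
        B (\<lambda>i j. g i j + (if i = k \<and> j = k then z else 0))) 0"
      unfolding A_def B_def 
      by (intro continuous_diff continuous_mult continuous_power continuous_const isCont_ip_act isCont_thm3 iso)
  next
    fix g :: "nat \<Rightarrow> nat \<Rightarrow> complex"
    assume "\<And>i j. i < 3 + N \<Longrightarrow> j < 3 + N \<Longrightarrow> i \<noteq> j \<Longrightarrow> g i j = 0"
    then show "A (thm3 g) - s * det3 g ^ m * B g = 0" using torus[of g] by (simp add: A_def B_def)
  qed (rule g)
  then show ?thesis by (simp add: A_def B_def)
qed

text \<open>The twist of a diagonal matrix has products of two diagonal entries in its first block.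
  Collecting the exponents of each \<open>g k k\<close> leaves the equations \<open>ac\<close>,
  which follow from \<open>a (2 - k) + c k = m\<close> and the total \<open>2 * m\<close>.\<close>

lemma torus_characters:
  fixes g :: "nat \<Rightarrow> nat \<Rightarrow> complex"
  assumes g: "\<And>i j. i < 3 + N \<Longrightarrow> j < 3 + N \<Longrightarrow> i \<noteq> j \<Longrightarrow> g i j = 0"
    and a: "\<And>k. k < 3 \<Longrightarrow> a (2 - k) + c k = m" "a 0 + a 1 + a 2 = 2 * m"
    and v: "\<And>k. k < N \<Longrightarrow> a (3 + k) = c (3 + k)"
  shows "(\<Prod>i<3 + N. thm3 g i i ^ a i) = det3 g ^ m * (\<Prod>i<3 + N. g i i ^ c i)"
proof -
  have g3: "g 0 1 = 0" "g 0 2 = 0" "g 1 0 = 0" "g 1 2 = 0" "g 2 0 = 0" "g 2 1 = 0" by (simp_all add: g)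
  have d: "det3 g = g 0 0 * g 1 1 * g 2 2" by (simp add: det3_def g3 g3[unfolded One_nat_def])
  have t: "thm3 g 0 0 = g 1 1 * g 0 0" "thm3 g 1 1 = g 0 0 * g 2 2" "thm3 g 2 2 = g 2 2 * g 1 1"
    by (simp_all only: thm3_entries cof3_entries) (simp_all add: thm3_entries cof3_entries cof3_entries[unfolded One_nat_def] rev3_def g3 g3[unfolded One_nat_def])
  have ac: "a 1 + a 0 = m + c 0" "a 0 + a 2 = m + c 1" "a 1 + a 2 = m + c 2" "a 2 + a 1 = m + c 2"
    using a(1)[of 0] a(1)[of 1] a(1)[of 2] a(2) by simp_all
  have "(\<Prod>i<3. thm3 g i i ^ a i) = thm3 g 0 0 ^ a 0 * thm3 g 1 1 ^ a 1 * thm3 g 2 2 ^ a 2"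
    by (simp add: eval_nat_numeral)
  also have "\<dots> = g 0 0 ^ (a 1 + a 0) * g 1 1 ^ (a 0 + a 2) * g 2 2 ^ (a 2 + a 1)"
    unfolding t by (simp add: power_mult_distrib power_add mult_ac)
  also have "\<dots> = det3 g ^ m * (g 0 0 ^ c 0 * g 1 1 ^ c 1 * g 2 2 ^ c 2)"
    unfolding ac d by (simp add: power_mult_distrib power_add mult_ac)
  also have "\<dots> = det3 g ^ m * (\<Prod>i<3. g i i ^ c i)" by (simp add: eval_nat_numeral)
  finally have 1: "(\<Prod>i<3. thm3 g i i ^ a i) = det3 g ^ m * (\<Prod>i<3. g i i ^ c i)" .
  have 2: "(\<Prod>k<N. thm3 g (3 + k) (3 + k) ^ a (3 + k)) = (\<Prod>k<N. g (3 + k) (3 + k) ^ c (3 + k))"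
    by (rule prod.cong[OF refl]) (simp add: thm3_entries v)
  show ?thesis unfolding prod_split 1 2 by (simp only: mult.assoc)
qed

section \<open>The partitions\<close>

lemma part_sorted: "sorted_wrt (\<ge>) \<pi> \<Longrightarrow> i \<le> j \<Longrightarrow> part \<pi> j \<le> part \<pi> i"
  by (cases "i = j") (auto simp: part_def sorted_wrt_iff_nth_less)

lemma sum_part: "length \<pi> \<le> k \<Longrightarrow> (\<Sum>i<k. part \<pi> i) = sum_list \<pi>"
proof -
  assume k: "length \<pi> \<le> k"
  have "(\<Sum>i<k. part \<pi> i) = (\<Sum>i<length \<pi>. part \<pi> i)"
    using k by (intro sum.mono_neutral_right) (auto simp: part_def)
  then show ?thesis by (simp add: part_def sum_list_sum_nth atLeast0LessThan)
qed

lemma eq_if_parts_eq: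
  assumes "0 \<notin> set \<pi>" "0 \<notin> set \<mu>" and eq: "\<And>i. part \<pi> i = part \<mu> i"
  shows "\<pi> = \<mu>"
proof -
  have pos: "i < length xs \<longleftrightarrow> part xs i > 0" if "0 \<notin> set xs" for xs i
    unfolding part_def by (cases "i < length xs") (use that nth_mem[of i xs] in \<open>metis gr0I\<close>, simp)
  have "i < length \<pi> \<longleftrightarrow> i < length \<mu>" for i using pos assms by simp
  then have len: "length \<pi> = length \<mu>" by (metis linorder_neqE_nat less_irrefl)
  show ?thesis
  proof (rule nth_equalityI[OF len])
    fix i assume "i < length \<pi>"
    then show "\<pi> ! i = \<mu> ! i" using eq[of i] len by (simp add: part_def)
  qed
qed

lemma complement3_sorted: "sorted_wrt (\<ge>) (complement3 m \<pi>)"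
proof -
  have "conj_part \<pi> j \<le> conj_part \<pi> i" if "i \<le> j" for i j
    unfolding conj_part_def
  proof (rule card_mono)
    show "finite {k. i < part \<pi> k}" by (rule finite_subset[of _ "{..<length \<pi>}"]) (auto simp: part_def split: if_splits)
  qed (use that in auto)
  then have "sorted_wrt (\<lambda>i j. 3 - conj_part \<pi> i \<le> 3 - conj_part \<pi> j) [0..<m]"
    unfolding sorted_wrt_iff_nth_less by (simp add: diff_le_mono2)
  then show ?thesis by (simp add: complement3_def sorted_wrt_rev sorted_wrt_map)
qed

text \<open>Read as a conjugate, \<open>complement3 m \<pi>\<close> belongs to the diagram with rows
  \<open>m - \<pi>\<^sub>3, m - \<pi>\<^sub>2, m - \<pi>\<^sub>1\<close>; in this form it meets the
  index weight of the Pfaffians.\<close>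

lemma part_complement3:
  assumes "length \<pi> \<le> 3"
  shows "part (complement3 m \<pi>) j = card {i. i < 3 \<and> j < m - part \<pi> i}"
proof (cases "j < m")
  case True
  have "{i. m - Suc j < part \<pi> i} \<subseteq> {..<3}" using assms by (auto simp: part_def split: if_splits)
  then have "card ({..<3} - {i. m - Suc j < part \<pi> i}) = 3 - conj_part \<pi> (m - Suc j)"
    unfolding conj_part_def by (subst card_Diff_subset) (auto intro: finite_subset)
  moreover have "{..<3} - {i. m - Suc j < part \<pi> i} = {i. i < 3 \<and> j < m - part \<pi> i}" using True by auto
  ultimately show ?thesis using True by (simp add: part_def complement3_def rev_nth)
next
  case False
  then have "{i. i < 3 \<and> j < m - part \<pi> i} = {}" by auto
  then show ?thesis using False by (simp only: card.empty) (simp add: part_def complement3_def)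
qed

lemma cnt_bcol: "cnt (sum_list L) (bcol L) j = card {i. i < length L \<and> j < L ! i}"
proof -
  have "brow L ` {p \<in> {..<sum_list L}. bcol L p = j} = {i. i < length L \<and> j < L ! i}"
  proof
    show "brow L ` {p \<in> {..<sum_list L}. bcol L p = j} \<subseteq> {i. i < length L \<and> j < L ! i}"
      using position_box[of _ L] by auto
    show "{i. i < length L \<and> j < L ! i} \<subseteq> brow L ` {p \<in> {..<sum_list L}. bcol L p = j}"
    proof
      fix i assume "i \<in> {i. i < length L \<and> j < L ! i}"
      then have i: "i < length L" "j < L ! i" by simp_all
      obtain p where "p < sum_list L" "brow L p = i" "bcol L p = j" by (rule box_position[OF i])
      then have "p \<in> {p \<in> {..<sum_list L}. bcol L p = j}" "i = brow L p" by simp_all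
      then show "i \<in> brow L ` {p \<in> {..<sum_list L}. bcol L p = j}" by (rule rev_image_eqI)
    qed
  qed
  moreover have "inj_on (brow L) {p \<in> {..<sum_list L}. bcol L p = j}"
  proof (rule inj_onI)
    fix p q assume "p \<in> {p \<in> {..<sum_list L}. bcol L p = j}" "q \<in> {p \<in> {..<sum_list L}. bcol L p = j}" "brow L p = brow L q"
    then have "p \<in> {..<sum_list L}" "q \<in> {..<sum_list L}" "(brow L p, bcol L p) = (brow L q, bcol L q)" by simp_all
    then show "p = q" using box_inj_on[of L] by (metis (no_types, lifting) inj_onD)
  qed
  then have "card (brow L ` {p \<in> {..<sum_list L}. bcol L p = j}) = card {p \<in> {..<sum_list L}. bcol L p = j}"
    by (rule card_image)
  ultimately show ?thesis unfolding cnt_def by simp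
qed

context schur_pair
begin

lemma cnt_stop: "i < K \<Longrightarrow> cnt (m + l) stop i = part \<pi> i" "cnt (m + l) stop (K + i) = part \<mu> i"
proof -
  note c = cnt_pat[OF stop_pat]
  have "{p \<in> {..<m}. stop p = i} = {p \<in> {..<m}. brow \<pi> p = i}" by (auto simp: stop_def joinw_def)
  then show "i < K \<Longrightarrow> cnt (m + l) stop i = part \<pi> i" using c(1) cnt_brow[of \<pi> i] by (simp add: cnt_def)
  have "{p \<in> {..<l}. rgt m K stop p = i} = {p \<in> {..<l}. brow \<mu> p = i}" by (auto simp: stop_def rgt_joinw)
  then show "cnt (m + l) stop (K + i) = part \<mu> i" unfolding c(2) using cnt_brow[of \<mu> i] by (simp add: cnt_def)
qed

end

section \<open>The representations\<close>

lemma linear_on_tensor_act: "linear_on W (tensor_act gh)"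
  by (cases gh) (auto simp: linear_on_def cscale_def fun_eq_iff tensor_act_def)

lemma linear_on_poly_act: "linear_on W (poly_act gh)"
  by (cases gh) (auto simp: linear_on_def cscale_def fun_eq_iff poly_act_def)

context two_spaces
begin

abbreviation "GG \<equiv> GL sU \<times>\<times> GL sV"

lemma group_GG: "group GG"
  by (intro DirProd_group group_GL U.vector_space_axioms V.vector_space_axioms)

lemma GG_simps: "a \<otimes>\<^bsub>GL sU\<^esub> a' = a \<circ> a'" "b \<otimes>\<^bsub>GL sV\<^esub> b' = b \<circ> b'" "\<one>\<^bsub>GL sU\<^esub> = id" "\<one>\<^bsub>GL sV\<^esub> = id" "\<one>\<^bsub>GG\<^esub> = (id, id)" "(g, h) \<otimes>\<^bsub>GG\<^esub> (g', h') = (g \<circ> g', h \<circ> h')"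
  by (simp_all add: DirProd_def GL_def)

lemma representation_tensor_act:
  assumes "fun_space.subspace W" "\<And>gh f. gh \<in> carrier GG \<Longrightarrow> f \<in> W \<Longrightarrow> tensor_act gh f \<in> W"
  shows "representation GG tensor_act W"
  unfolding representation_def
proof (intro conjI ballI)
  fix f assume "f \<in> W"
  show "tensor_act \<one>\<^bsub>GG\<^esub> f = f" by (auto simp: GG_simps tensor_act_def fun_eq_iff)
  fix gh gh' :: "('u \<Rightarrow> 'u) \<times> ('v \<Rightarrow> 'v)"
  show "tensor_act (gh \<otimes>\<^bsub>GG\<^esub> gh') f = tensor_act gh (tensor_act gh' f)"
    by (cases gh; cases gh') (auto simp: GG_simps tensor_act_def fun_eq_iff comp_def)
qed (use assms linear_on_tensor_act group_GG in auto)

lemma representation_poly_act: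
  assumes "fun_space.subspace W" "\<And>gh f. gh \<in> carrier GG \<Longrightarrow> f \<in> W \<Longrightarrow> poly_act gh f \<in> W"
  shows "representation GG poly_act W"
  unfolding representation_def
proof (intro conjI ballI)
  fix f assume "f \<in> W"
  show "poly_act \<one>\<^bsub>GG\<^esub> f = f" by (auto simp: GG_simps poly_act_def fun_eq_iff)
  fix gh gh' :: "('u \<Rightarrow> 'u) \<times> ('v \<Rightarrow> 'v)"
  show "poly_act (gh \<otimes>\<^bsub>GG\<^esub> gh') f = poly_act gh (poly_act gh' f)"
    by (cases gh; cases gh') (auto simp: GG_simps poly_act_def fun_eq_iff comp_def)
qed (use assms linear_on_poly_act group_GG in auto)

lemma gmat_block: "block_matrix N (length us) (gmat gh)"
  by (auto simp: block_matrix_def blk_def gmat_def bmat_def)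

end

lemma representation_direct_sum:
  fixes M :: "'i \<Rightarrow> ('x \<Rightarrow> complex) set" and G :: "('g, 'b) monoid_scheme"
  assumes "group G" and rep: "\<And>i. i \<in> I \<Longrightarrow> representation G \<rho> (M i)" and zero: "\<And>g. g \<in> carrier G \<Longrightarrow> \<rho> g 0 = 0"
  shows "representation G (direct_sum_act \<rho>) (direct_sum I M)"
proof -
  note r = representationD[OF rep]
  have F0: "(\<lambda>x. F (i, x)) = 0" if "F \<in> direct_sum I M" "i \<notin> I" for F i
    using that by (auto simp: direct_sum_def fun_eq_iff)
  have FM: "(\<lambda>x. F (i, x)) \<in> M i" if "F \<in> direct_sum I M" "i \<in> I" for F i
    using that by (auto simp: direct_sum_def)
  have slice: "(\<lambda>x. direct_sum_act \<rho> g F (i, x)) = \<rho> g (\<lambda>x. F (i, x))" for g F i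
    by (simp add: direct_sum_act_def)
  have add: "(\<lambda>x. (F + H) (i, x)) = (\<lambda>x. F (i, x)) + (\<lambda>x. H (i, x))"
    and scale: "(\<lambda>x. cscale c F (i, x)) = cscale c (\<lambda>x. F (i, x))" for F H :: "'i \<times> 'x \<Rightarrow> complex" and i c
    by (auto simp: fun_eq_iff cscale_def)
  have ext: "F = H" if "\<And>i. (\<lambda>x. F (i, x)) = (\<lambda>x. H (i, x))" for F H :: "'i \<times> 'x \<Rightarrow> complex"
    using that by (auto simp: fun_eq_iff)
  have mem: "F \<in> direct_sum I M" if "\<And>i. i \<in> I \<Longrightarrow> (\<lambda>x. F (i, x)) \<in> M i" "\<And>i. i \<notin> I \<Longrightarrow> (\<lambda>x. F (i, x)) = 0" for F
    using that by (auto simp: direct_sum_def fun_eq_iff)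
  show ?thesis
    unfolding representation_def
  proof (intro conjI ballI)
    show "group G" by fact
    show "fun_space.subspace (direct_sum I M)"
      unfolding fun_space.subspace_def
    proof (intro conjI ballI allI)
      have "(\<lambda>x. (0 :: 'i \<times> 'x \<Rightarrow> complex) (i, x)) = 0" for i by (auto simp: fun_eq_iff)
      then show "0 \<in> direct_sum I M" using fun_space.subspace_0[OF r(2)] by (intro mem) simp_all
      show "F + H \<in> direct_sum I M" if "F \<in> direct_sum I M" "H \<in> direct_sum I M" for F H
        by (rule mem) (simp_all only: add F0[OF that(1)] F0[OF that(2)] fun_space.subspace_add[OF r(2)] FM[OF that(1)] FM[OF that(2)] add_0_left not_False_eq_True)
      show "cscale c F \<in> direct_sum I M" if "F \<in> direct_sum I M" for F c
        by (rule mem) (simp_all only: scale F0[OF that] fun_space.subspace_scale[OF r(2)] FM[OF that] fun_space.scale_zero_right not_False_eq_True)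
    qed
  next
    fix g assume g: "g \<in> carrier G"
    show "linear_on (direct_sum I M) (direct_sum_act \<rho> g)"
      unfolding linear_on_def
    proof (intro conjI ballI allI)
      fix F H assume F: "F \<in> direct_sum I M" and H: "H \<in> direct_sum I M"
      show "direct_sum_act \<rho> g (F + H) = direct_sum_act \<rho> g F + direct_sum_act \<rho> g H"
      proof (rule ext)
        fix i show "(\<lambda>x. direct_sum_act \<rho> g (F + H) (i, x)) = (\<lambda>x. (direct_sum_act \<rho> g F + direct_sum_act \<rho> g H) (i, x))"
          unfolding add slice
          by (cases "i \<in> I") (simp_all only: linear_onD(1)[OF r(3)[OF _ g]] FM F H F0 zero[OF g] add_0_left not_False_eq_True)
      qed
    next
      fix c F assume F: "F \<in> direct_sum I M"
      show "direct_sum_act \<rho> g (cscale c F) = cscale c (direct_sum_act \<rho> g F)"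
      proof (rule ext)
        fix i show "(\<lambda>x. direct_sum_act \<rho> g (cscale c F) (i, x)) = (\<lambda>x. cscale c (direct_sum_act \<rho> g F) (i, x))"
          unfolding scale slice
          by (cases "i \<in> I") (simp_all only: linear_onD(2)[OF r(3)[OF _ g]] FM F F0 zero[OF g] fun_space.scale_zero_right not_False_eq_True)
      qed
    qed
    show "direct_sum_act \<rho> g ` direct_sum I M \<subseteq> direct_sum I M"
    proof (rule image_subsetI)
      fix F assume F: "F \<in> direct_sum I M"
      show "direct_sum_act \<rho> g F \<in> direct_sum I M"
        by (rule mem) (simp_all only: slice r(4)[OF _ g] FM F F0 zero[OF g] not_False_eq_True)
    qed
  next
    fix F assume F: "F \<in> direct_sum I M"
    interpret group G by fact
    show "direct_sum_act \<rho> \<one>\<^bsub>G\<^esub> F = F"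
    proof (rule ext)
      fix i show "(\<lambda>x. direct_sum_act \<rho> \<one>\<^bsub>G\<^esub> F (i, x)) = (\<lambda>x. F (i, x))"
        unfolding slice by (cases "i \<in> I") (simp_all only: r(5) FM F F0 zero one_closed not_False_eq_True)
    qed
  next
    fix g h F assume g: "g \<in> carrier G" "h \<in> carrier G" and F: "F \<in> direct_sum I M"
    interpret group G by fact
    show "direct_sum_act \<rho> (g \<otimes>\<^bsub>G\<^esub> h) F = direct_sum_act \<rho> g (direct_sum_act \<rho> h F)"
    proof (rule ext)
      fix i show "(\<lambda>x. direct_sum_act \<rho> (g \<otimes>\<^bsub>G\<^esub> h) F (i, x)) = (\<lambda>x. direct_sum_act \<rho> g (direct_sum_act \<rho> h F) (i, x))"
        unfolding slice by (cases "i \<in> I") (simp_all only: r(6)[OF _ g] FM F F0 zero g m_closed not_False_eq_True)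
    qed
  qed
qed

definition single :: "'i \<Rightarrow> ('x \<Rightarrow> complex) \<Rightarrow> 'i \<times> 'x \<Rightarrow> complex" where
  "single i f = (\<lambda>(j, x). if j = i then f x else 0)"

lemma single_apply: "(\<lambda>x. single i f (j, x)) = (if j = i then f else 0)"
  by (auto simp: single_def fun_eq_iff)

text \<open>A family has nonzero components only in \<open>D\<close>, so it is a finite sum of
  families with a single component, and each of these is generated within its own summand.\<close>

lemma direct_sum_spanned:
  fixes M :: "'i \<Rightarrow> ('x \<Rightarrow> complex) set" and G :: "('g, 'b) monoid_scheme"
  assumes "finite D" "D \<subseteq> I" and zero: "\<And>i. i \<in> I - D \<Longrightarrow> M i = {0}"
    and span: "\<And>i. i \<in> D \<Longrightarrow> M i \<subseteq> fun_space.span {\<rho> g (w i) | g. g \<in> carrier G}"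
    and \<rho>0: "\<And>g. g \<in> carrier G \<Longrightarrow> \<rho> g 0 = 0"
  shows "direct_sum I M \<subseteq> fun_space.span {direct_sum_act \<rho> g (single i (w i)) | g i. g \<in> carrier G \<and> i \<in> D}"
    (is "_ \<subseteq> fun_space.span ?X")
proof
  fix F assume F: "F \<in> direct_sum I M"
  have FM: "(\<lambda>x. F (i, x)) \<in> M i" if "i \<in> I" for i using F that by (auto simp: direct_sum_def)
  have F0: "F (i, x) = 0" if "i \<notin> D" for i x
  proof (cases "i \<in> I")
    case True
    then have "(\<lambda>x. F (i, x)) = 0" using FM[OF True] zero that by blast
    then show ?thesis by (simp add: fun_eq_iff)
  qed (use F in \<open>auto simp: direct_sum_def\<close>)
  have sp: "single i f \<in> fun_space.span ?X" if i: "i \<in> D" and f: "f \<in> M i" for i f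
  proof -
    have "fun_space.span {\<rho> g (w i) | g. g \<in> carrier G} \<subseteq> {f. single i f \<in> fun_space.span ?X}"
    proof (rule fun_space.span_minimal)
      have s: "single i (f + h) = single i f + single i h" "single i (cscale c f) = cscale c (single i f)" "single i 0 = 0"
        for f h :: "'x \<Rightarrow> complex" and c
        by (auto simp: single_def cscale_def fun_eq_iff)
      show "fun_space.subspace {f. single i f \<in> fun_space.span ?X}"
        by (auto simp: fun_space.subspace_def s fun_space.span_add fun_space.span_scale fun_space.span_zero)
      show "{\<rho> g (w i) | g. g \<in> carrier G} \<subseteq> {f. single i f \<in> fun_space.span ?X}"
      proof
        fix f assume "f \<in> {\<rho> g (w i) | g. g \<in> carrier G}"
        then obtain g where g: "g \<in> carrier G" "f = \<rho> g (w i)" by blast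
        have "single i f = direct_sum_act \<rho> g (single i (w i))"
          by (auto simp: fun_eq_iff direct_sum_act_def single_apply g(2) \<rho>0[OF g(1)]) (auto simp: single_def)
        then show "f \<in> {f. single i f \<in> fun_space.span ?X}" using g i by (auto intro: fun_space.span_base)
      qed
    qed
    then show ?thesis using span[OF i] f by blast
  qed
  have "F = (\<Sum>i\<in>D. single i (\<lambda>x. F (i, x)))"
  proof
    fix y :: "'i \<times> 'x" obtain i x where y: "y = (i, x)" by (cases y)
    have "(\<Sum>j\<in>D. single j (\<lambda>x. F (j, x)) y) = (\<Sum>j\<in>D. if j = i then F (i, x) else 0)"
      by (rule sum.cong[OF refl]) (auto simp: single_def y)
    then show "F y = (\<Sum>i\<in>D. single i (\<lambda>x. F (i, x))) y"
      using F0[of i x] assms(1) by (simp add: sum_fun_apply y)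
  qed
  then show "F \<in> fun_space.span ?X"
    using fun_space.span_sum[of D "\<lambda>i. single i (\<lambda>x. F (i, x))" ?X] sp FM assms(2) by auto
qed

lemma (in quotient_rep) functional_linear:
  assumes "\<And>x. x \<in> supp_on W \<Longrightarrow> \<alpha> (lin W Q x) = ip W x q" "f \<in> lin W Q ` supp_on W"
  shows "h \<in> lin W Q ` supp_on W \<Longrightarrow> \<alpha> (f + h) = \<alpha> f + (\<alpha> h :: complex)" "\<alpha> (cscale c f) = c * \<alpha> f"
proof -
  obtain x where x: "x \<in> supp_on W" "f = lin W Q x" using assms(2) by blast
  have "cscale c x \<in> supp_on W" by (rule fun_space.subspace_scale[OF subspace_supp_on x(1)])
  then show "\<alpha> (cscale c f) = c * \<alpha> f" using assms(1) x by (simp add: lin_scale[symmetric] ip_simps)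
  assume "h \<in> lin W Q ` supp_on W"
  then obtain y where y: "y \<in> supp_on W" "h = lin W Q y" by blast
  have "x + y \<in> supp_on W" by (rule fun_space.subspace_add[OF subspace_supp_on x(1) y(1)])
  then show "\<alpha> (f + h) = \<alpha> f + \<alpha> h" using assms(1) x y by (simp add: lin_add[symmetric] ip_simps)
qed

lemma subspace_range_lin: "finite A \<Longrightarrow> fun_space.subspace (lin A Q ` supp_on A)"
  by (simp add: range_lin fun_space.subspace_span)

lemma tensor_act_zero: "tensor_act gh 0 = 0"
  by (cases gh) (simp add: tensor_act_def fun_eq_iff)

lemma thm3_diagonal:
  assumes g: "\<And>i j. i < 3 + N \<Longrightarrow> j < 3 + N \<Longrightarrow> i \<noteq> j \<Longrightarrow> g i j = 0" and ij: "i < 3 + N" "j < 3 + N" "i \<noteq> j"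
  shows "thm3 g i j = 0"
proof -
  consider "i < 3" "j < 3" | "3 \<le> i" "3 \<le> j" | "i < 3" "3 \<le> j" | "3 \<le> i" "j < 3" by linarith
  then show ?thesis
  proof cases
    case 1
    have "rev3 g k l = 0" if "k < 3" "l < 3" "k \<noteq> l" for k l
      unfolding rev3_def by (rule g) (use that in auto)
    then have "rev3 g 0 1 = 0" "rev3 g 0 2 = 0" "rev3 g 1 0 = 0" "rev3 g 1 2 = 0" "rev3 g 2 0 = 0" "rev3 g 2 1 = 0"
      by simp_all
    note z = this this[unfolded One_nat_def]
    show ?thesis
      unfolding thm3_entries(1)[OF 1] using 1 ij(3) unfolding less3
      by (elim disjE; simp only: cof3_entries z; simp)
  qed (use g ij in \<open>simp_all add: thm3_entries\<close>)
qed

section \<open>The comparison of the Pfaffians with the direct sum\<close>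

context pf_space
begin

abbreviation "RP \<equiv> lin Wd PQ ` supp_on Wd"

lemma det3_GL:
  assumes "g \<in> carrier (GL sU)"
  shows "det3 (U.mat g) \<noteq> 0"
proof -
  interpret G: group "GL sU" by (rule group_GL[OF U.vector_space_axioms])
  obtain g' where "g \<otimes>\<^bsub>GL sU\<^esub> g' = \<one>\<^bsub>GL sU\<^esub>" using G.r_inv_ex[OF assms] by blast
  then have g': "g \<circ> g' = id" by (simp add: GL_def)
  have "det3 (U.mat g) * det3 (U.mat g') = det3 (U.mat (g \<circ> g'))"
    unfolding det3_mult[symmetric] using U.mat_comp[of g g'] assms
    by (intro det3_cong) (simp add: carrier_GL K3)
  also have "\<dots> = 1" unfolding g' det3_def by (simp add: mat_id(1) K3)
  finally show ?thesis by auto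
qed

lemma det3_gmat:
  assumes "gh \<in> carrier GG"
  shows "det3 (gmat gh) \<noteq> 0" "det3 (rev3 (U.mat (fst gh))) = det3 (gmat gh)"
proof -
  have "det3 (gmat gh) = det3 (U.mat (fst gh))" by (rule det3_cong) (simp add: gmat_def bmat_def K3)
  moreover have "det3 (rev3 (U.mat (fst gh))) = det3 (U.mat (fst gh))" by (simp add: det3_def rev3_def algebra_simps)
  moreover have "fst gh \<in> carrier (GL sU)" using assms by (cases gh) auto
  ultimately show "det3 (gmat gh) \<noteq> 0" "det3 (rev3 (U.mat (fst gh))) = det3 (gmat gh)" using det3_GL by simp_all
qed

text \<open>The determinant in \<open>PQ_act\<close> is nonzero on the group and can be divided out,
  which shows that the image of \<open>lin\<close> is invariant.\<close>

lemma poly_act_lin: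
  assumes "gh \<in> carrier GG"
  shows "poly_act gh (lin Wd PQ x) = lin Wd PQ (cscale (1 / det3 (gmat gh) ^ m) (act (4 * m) (3 + n) (thm3 (gmat gh)) x))"
proof -
  have gh: "fst gh \<in> carrier (GL sU)" "snd gh \<in> carrier (GL sV)" using assms by (cases gh; auto)+
  have "lin Wd PQ (act (4 * m) (3 + n) (thm3 (gmat gh)) x) = cscale (det3 (gmat gh) ^ m) (poly_act gh (lin Wd PQ x))"
    using PQ_act[OF gh, of x] det3_gmat(2)[OF assms] by simp
  then show ?thesis using det3_gmat(1)[OF assms] by (simp add: lin_scale)
qed

lemma representation_RP: "representation GG poly_act RP"
  by (rule representation_poly_act[OF subspace_range_lin[OF finite_words]])
    (auto simp: poly_act_lin intro!: imageI fun_space.subspace_scale[OF subspace_supp_on] act_supp)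

lemma el_poly_act:
  assumes "i < 3 + n" "j < 3 + n" "blk 3 i j" "i \<noteq> j \<or> z \<noteq> - 1"
  shows "\<exists>gh\<in>carrier GG. \<exists>k. \<forall>x. lin Wd PQ (act (4 * m) (3 + n) (el z i j) x) = cscale k (poly_act gh (lin Wd PQ x))"
proof -
  obtain g h k where g: "g \<in> carrier (GL sU)" "h \<in> carrier (GL sV)"
    "\<And>x. lin Wd PQ (act (4 * m) (3 + n) (el z i j) x) = cscale k (poly_act (g, h) (lin Wd PQ x))"
    using el_thm3[OF assms] by metis
  then have "(g, h) \<in> carrier GG" by simp
  then show ?thesis using g(3) by blast
qed

text \<open>The partitions of \<open>m\<close> with a nonzero summand. The truncated difference
  \<open>m - n\<close> is 0 when \<open>n \<ge> m\<close>, and the last condition is then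
  empty.\<close>

definition good :: "nat list set" where
  "good = {\<pi>. is_partition m \<pi> \<and> length \<pi> \<le> 3 \<and> m - n \<le> part \<pi> 2}"

text \<open>The block weight that belongs to \<open>\<pi>\<close>: complements to \<open>m\<close>
  in reverse order, as dictated by cofactors and the division by the \<open>m\<close>-th power of
  the determinant.\<close>

definition Lof :: "nat list \<Rightarrow> nat list" where
  "Lof \<pi> = [m - part \<pi> 2, m - part \<pi> 1, m - part \<pi> 0]"

lemma Lof_nth: "k < 3 \<Longrightarrow> Lof \<pi> ! k = m - part \<pi> (2 - k)"
  unfolding less3 by (auto simp: Lof_def)

lemma good_parts:
  assumes "\<pi> \<in> good"
  shows "part \<pi> 0 + part \<pi> 1 + part \<pi> 2 = m" "part \<pi> 1 \<le> part \<pi> 0" "part \<pi> 2 \<le> part \<pi> 1" "sorted_wrt (\<ge>) \<pi>"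
    "0 \<notin> set \<pi>" "length \<pi> \<le> 3" "m - n \<le> part \<pi> 2" "sum_list \<pi> = m"
proof -
  show s: "sorted_wrt (\<ge>) \<pi>" "0 \<notin> set \<pi>" "length \<pi> \<le> 3" "m - n \<le> part \<pi> 2" "sum_list \<pi> = m"
    using assms by (auto simp: good_def is_partition_def)
  show "part \<pi> 0 + part \<pi> 1 + part \<pi> 2 = m" using sum_part[OF s(3)] s(5) by (simp add: sum3)
  show "part \<pi> 1 \<le> part \<pi> 0" "part \<pi> 2 \<le> part \<pi> 1" using part_sorted[OF s(1)] by simp_all
qed

lemma Lof_TL:
  assumes "\<pi> \<in> good"
  shows "Lof \<pi> \<in> TL"
proof -
  note g = good_parts[OF assms]
  have "Lof \<pi> ! i \<le> m \<and> Lof \<pi> ! i \<le> n" if "i < 3" for i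
    using that g(1-3,7) unfolding less3 by (auto simp: Lof_def)
  then show ?thesis unfolding TL_def using g(1-3) by (auto simp: Lof_def)
qed

lemma Lof_inj:
  assumes "\<pi> \<in> good" "\<pi>' \<in> good" "Lof \<pi> = Lof \<pi>'"
  shows "\<pi> = \<pi>'"
proof (rule eq_if_parts_eq)
  note g = good_parts[OF assms(1)] and g' = good_parts[OF assms(2)]
  show "0 \<notin> set \<pi>" "0 \<notin> set \<pi>'" by (fact g(5) g'(5))+
  have "part \<pi> 0 = part \<pi>' 0" "part \<pi> 1 = part \<pi>' 1" "part \<pi> 2 = part \<pi>' 2"
    using assms(3) g(1) g'(1) unfolding Lof_def by auto
  then have 3: "part \<pi> i = part \<pi>' i" if "i < 3" for i using that unfolding less3 by auto
  show "part \<pi> i = part \<pi>' i" for i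
  proof (cases "i < 3")
    case False
    then show ?thesis using g(6) g'(6) by (simp add: part_def)
  qed (rule 3)
qed

lemma Lof_surj:
  assumes "m > 0" "L \<in> TL"
  shows "\<exists>\<pi>\<in>good. Lof \<pi> = L"
proof -
  obtain x y z where L: "L = [x, y, z]" using assms(2) by (auto simp: TL_def eval_nat_numeral length_Suc_conv)
  have "L ! 0 \<le> m \<and> L ! 0 \<le> n" "sum_list L = 2 * m" "sorted_wrt (\<ge>) L" using assms(2) by (auto simp: TL_def)
  then have xyz: "x + y + z = 2 * m" "y \<le> x" "z \<le> y" "x \<le> m" "x \<le> n" by (auto simp: L)
  define a where "a = m - z"
  define b where "b = m - y"
  define c where "c = m - x"
  have abc: "a + b + c = m" "b \<le> a" "c \<le> b" "m - n \<le> c" "x = m - c" "y = m - b" "z = m - a" "a > 0"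
    using xyz assms(1) by (auto simp: a_def b_def c_def)
  \<comment> \<open>The list stops at the last nonzero part. It is free of zeros also in the last
    case, since \<open>m > 0\<close> gives \<open>a > 0\<close>.\<close>
  define \<pi> where "\<pi> = (if c > 0 then [a, b, c] else if b > 0 then [a, b] else [a])"
  have "part \<pi> 0 = a" "part \<pi> 1 = b" "part \<pi> 2 = c" using abc by (auto simp: \<pi>_def part_def)
  then have "Lof \<pi> = L" "m - n \<le> part \<pi> 2" using abc by (simp_all add: Lof_def L)
  moreover have "is_partition m \<pi> \<and> length \<pi> \<le> 3" using abc by (auto simp: \<pi>_def is_partition_def)
  ultimately show ?thesis unfolding good_def by blast
qed

lemma finite_good: "finite good"
proof (rule finite_imageD)
  have "Lof ` good \<subseteq> {L. set L \<subseteq> {..m} \<and> length L = 3}" by (auto simp: Lof_def)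
  then show "finite (Lof ` good)" using finite_lists_length_eq[of "{..m}" 3] finite_subset by blast
  show "inj_on Lof good" using Lof_inj by (rule inj_onI)
qed

abbreviation "compl \<equiv> complement3 m"
abbreviation "Sm \<pi> \<equiv> tensor_prod (schur_functor sU \<pi>) (schur_functor sV (compl \<pi>))"

lemma part_compl_Lof:
  assumes "\<pi> \<in> good"
  shows "part (compl \<pi>) j = card {i. i < 3 \<and> j < Lof \<pi> ! i}"
proof -
  have im: "(\<lambda>i. 2 - i) ` {i. i < 3 \<and> j < m - part \<pi> i} = {i. i < 3 \<and> j < Lof \<pi> ! i}"
  proof
    show "{i. i < 3 \<and> j < Lof \<pi> ! i} \<subseteq> (\<lambda>i. 2 - i) ` {i. i < 3 \<and> j < m - part \<pi> i}"
    proof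
      fix i assume "i \<in> {i. i < 3 \<and> j < Lof \<pi> ! i}"
      then have "2 - i \<in> {i. i < 3 \<and> j < m - part \<pi> i}" "i = 2 - (2 - i)" by (auto simp: Lof_nth)
      then show "i \<in> (\<lambda>i. 2 - i) ` {i. i < 3 \<and> j < m - part \<pi> i}" by (rule rev_image_eqI)
    qed
  qed (auto simp: Lof_nth less3)
  have "inj_on (\<lambda>i. 2 - i) {i. i < 3 \<and> j < m - part \<pi> i}" by (rule inj_onI) auto
  then have "card ((\<lambda>i. 2 - i) ` {i. i < 3 \<and> j < m - part \<pi> i}) = card {i. i < 3 \<and> j < m - part \<pi> i}" by (rule card_image)
  then show ?thesis unfolding im part_complement3[OF good_parts(6)[OF assms]] by simp
qed

lemma schur_pair_good:
  assumes "\<pi> \<in> good"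
  shows "schur_pair sU us sV vs \<pi> (compl \<pi>)"
proof
  note g = good_parts[OF assms]
  show "sorted_wrt (\<ge>) \<pi>" "sorted_wrt (\<ge>) (compl \<pi>)" by (rule g(4), rule complement3_sorted)
  show "brow \<pi> p < K" if "p < sum_list \<pi>" for p using position_box(1)[OF that] g(6) K3 by simp
  show "brow (compl \<pi>) p < n" if "p < sum_list (compl \<pi>)" for p
  proof (rule ccontr)
    assume n: "\<not> brow (compl \<pi>) p < n"
    have "part (compl \<pi>) (brow (compl \<pi>) p) > 0" using position_box[OF that] by (simp add: part_def)
    then have "{i. i < 3 \<and> brow (compl \<pi>) p < Lof \<pi> ! i} \<noteq> {}"
      unfolding part_compl_Lof[OF assms] by (metis card.empty less_irrefl)
    moreover have "Lof \<pi> ! i \<le> n" if "i < 3" for i using Lof_TL[OF assms] that by (simp add: TL_def)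
    ultimately show False using n by force
  qed
qed

text \<open>A fourth part makes the first factor vanish. Otherwise
  \<open>part \<pi> 2 < m - n\<close>, so the complement has more than \<open>n\<close> nonzero
  parts and the second factor vanishes.\<close>

lemma Sm_zero:
  assumes "is_partition m \<pi>" "\<pi> \<notin> good"
  shows "Sm \<pi> = {0}"
proof -
  have \<pi>: "sorted_wrt (\<ge>) \<pi>" "0 \<notin> set \<pi>" using assms(1) by (auto simp: is_partition_def)
  have "schur_functor sU \<pi> = {0} \<or> schur_functor sV (compl \<pi>) = {0}"
  proof (cases "length \<pi> \<le> 3")
    case False
    then have "\<pi> ! 3 \<in> set \<pi>" by (intro nth_mem) simp
    then have "\<pi> ! 3 > 0" using \<pi>(2) by (metis gr0I)
    then show ?thesis using U.schur_functor_zero[OF \<pi>(1)] False K3 by simp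
  next
    case True
    then have "n < m - part \<pi> 2" using assms by (auto simp: good_def)
    then have "2 \<in> {i. i < 3 \<and> n < m - part \<pi> i}" by simp
    then have "{i. i < 3 \<and> n < m - part \<pi> i} \<noteq> {}" by blast
    moreover have "finite {i. i < 3 \<and> n < m - part \<pi> i}" by simp
    ultimately have "part (compl \<pi>) n > 0" unfolding part_complement3[OF True] card_gt_0_iff by blast
    then have "n < length (compl \<pi>)" "compl \<pi> ! n > 0" by (auto simp: part_def split: if_splits)
    then show ?thesis using V.schur_functor_zero[OF complement3_sorted] by blast
  qed
  then have "{(\<lambda>(x, y). a x * b y) | a b. a \<in> schur_functor sU \<pi> \<and> b \<in> schur_functor sV (compl \<pi>)} \<subseteq> {0}"
    by (auto simp: fun_eq_iff)
  then have "Sm \<pi> \<subseteq> {0}" unfolding tensor_prod_def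
    by (rule fun_space.span_minimal) (rule fun_space.subspace_single_0)
  moreover have "0 \<in> Sm \<pi>" unfolding tensor_prod_def by (rule fun_space.span_zero)
  ultimately show ?thesis by blast
qed

text \<open>All that the comparison needs from one summand. The word length \<open>d\<close> depends
  on \<open>\<pi>\<close>; bundling it with the rest permits choosing the data of all
  \<open>\<pi>\<close> at once.\<close>

definition schur_data where
  "schur_data \<pi> \<alpha> w p q d \<longleftrightarrow> w \<in> Sm \<pi> \<and>
    Sm \<pi> \<subseteq> fun_space.span {tensor_act g w | g. g \<in> carrier GG} \<and>
    (\<forall>f\<in>Sm \<pi>. \<forall>h\<in>Sm \<pi>. \<alpha> (f + h) = \<alpha> f + (\<alpha> h :: complex)) \<and> (\<forall>f\<in>Sm \<pi>. \<forall>c. \<alpha> (cscale c f) = c * \<alpha> f) \<and>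
    (\<forall>f\<in>Sm \<pi>. (\<forall>g\<in>carrier GG. \<alpha> (tensor_act g f) = 0) \<longrightarrow> f = 0) \<and>
    (\<forall>i j z. i < j \<longrightarrow> j < 3 + n \<longrightarrow> blk 3 i j \<longrightarrow> act d (3 + n) (el z i j) p = p \<and> act d (3 + n) (el z i j) q = q) \<and>
    (\<forall>x i. p x \<noteq> 0 \<longrightarrow> i < 3 + n \<longrightarrow> cnt d x i = (if i < 3 then part \<pi> i else part (compl \<pi>) (i - 3))) \<and>
    ip (words d (3 + n)) p q = 1 \<and>
    (\<forall>g\<in>carrier GG. \<alpha> (tensor_act g w) = ip (words d (3 + n)) (act d (3 + n) (gmat g) p) q)"

lemma schur_side:
  assumes "\<pi> \<in> good"
  shows "irreducible_rep GG tensor_act (Sm \<pi>)" "\<exists>\<alpha> w p q d. schur_data \<pi> \<alpha> w p q d"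
proof -
  interpret S: schur_pair sU us sV vs \<pi> "compl \<pi>" by (rule schur_pair_good[OF assms])
  let ?d = "sum_list \<pi> + sum_list (compl \<pi>)"
  let ?W = "words ?d (K + n)"
  have range: "lin ?W S.SQ ` supp_on ?W = Sm \<pi>" by (rule S.SQ_range)
  have rep: "representation GG tensor_act (lin ?W S.SQ ` supp_on ?W)"
    by (rule representation_tensor_act[OF subspace_range_lin[OF finite_words]]) (auto simp: S.SQ_act intro!: imageI act_supp)
  have el: "\<exists>g\<in>carrier GG. \<exists>k. \<forall>x. lin ?W S.SQ (act ?d (K + n) (el z i j) x) = cscale k (tensor_act g (lin ?W S.SQ x))"
    if ij: "i < K + n" "j < K + n" "blk K i j" "i \<noteq> j \<or> z \<noteq> - 1" for i j z
  proof -
    obtain gh where gh: "gh \<in> carrier GG" "\<And>a b. a < K + n \<Longrightarrow> b < K + n \<Longrightarrow> gmat gh a b = el z i j a b"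
      using el_gmat[OF ij] by blast
    have "act ?d (K + n) (el z i j) x = act ?d (K + n) (gmat gh) x" for x
      by (rule act_cong) (simp add: gh(2))
    then have "lin ?W S.SQ (act ?d (K + n) (el z i j) x) = cscale 1 (tensor_act gh (lin ?W S.SQ x))" for x
      using S.SQ_act[OF gh(1), of x] by simp
    then show ?thesis using gh(1) by blast
  qed
  show "irreducible_rep GG tensor_act (Sm \<pi>)"
    using S.irreducible_if_one_top_rep[OF rep el refl] unfolding range by blast
  obtain \<alpha> p q \<kappa> where c:
    "\<And>t. t \<in> {S.stop} \<Longrightarrow> p t \<in> supp_on ?W" "\<And>t. t \<in> {S.stop} \<Longrightarrow> lin ?W S.SQ (p t) = S.SQ t"
    "\<And>t. t \<in> {S.stop} \<Longrightarrow> q t \<in> orthc ?W (ker ?W S.SQ)" "\<And>t. t \<in> {S.stop} \<Longrightarrow> lin ?W S.SQ (q t) = cscale (\<kappa> t) (S.SQ t)"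
    "\<And>t. t \<in> {S.stop} \<Longrightarrow> \<kappa> t \<noteq> 0" "\<And>t. t \<in> {S.stop} \<Longrightarrow> ip ?W (p t) (q t) = 1"
    "\<And>t x. t \<in> {S.stop} \<Longrightarrow> x \<in> supp_on ?W \<Longrightarrow> \<alpha> t (lin ?W S.SQ x) = ip ?W x (q t)"
    "\<And>t i j z. t \<in> {S.stop} \<Longrightarrow> i < j \<Longrightarrow> j < K + n \<Longrightarrow> blk K i j \<Longrightarrow> act ?d (K + n) (el z i j) (p t) = p t"
    "\<And>t i j z. t \<in> {S.stop} \<Longrightarrow> i < j \<Longrightarrow> j < K + n \<Longrightarrow> blk K i j \<Longrightarrow> act ?d (K + n) (el z i j) (q t) = q t"
    "\<And>t w i. t \<in> {S.stop} \<Longrightarrow> p t w \<noteq> 0 \<Longrightarrow> i < K + n \<Longrightarrow> cnt ?d w i = cnt ?d t i"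
    by (rule S.coefficient_data) blast
  let ?t = S.stop
  have t: "?t \<in> {S.stop}" by simp
  have \<alpha>: "x \<in> supp_on ?W \<Longrightarrow> \<alpha> ?t (lin ?W S.SQ x) = ip ?W x (q ?t)" for x by (rule c(7)[OF t])
  have "schur_data \<pi> (\<alpha> ?t) (S.SQ ?t) (p ?t) (q ?t) ?d"
    unfolding schur_data_def
  proof (intro conjI ballI allI impI)
    show "S.SQ ?t \<in> Sm \<pi>" unfolding range[symmetric] c(2)[OF t, symmetric] using c(1)[OF t] by (rule imageI)
    show "Sm \<pi> \<subseteq> fun_space.span {tensor_act g (S.SQ ?t) | g. g \<in> carrier GG}"
      using S.spanned_by_orbits[OF rep el] unfolding range by simp
    show "\<alpha> ?t (f + h) = \<alpha> ?t f + \<alpha> ?t h" if "f \<in> Sm \<pi>" "h \<in> Sm \<pi>" for f h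
      using S.functional_linear(1)[of "\<alpha> ?t" "q ?t" f h] \<alpha> that unfolding range by blast
    show "\<alpha> ?t (cscale k f) = k * \<alpha> ?t f" if "f \<in> Sm \<pi>" for f k
      using S.functional_linear(2)[of "\<alpha> ?t" "q ?t" f k] \<alpha> that unfolding range by blast
    show "f = 0" if f: "f \<in> Sm \<pi>" and z: "\<forall>g\<in>carrier GG. \<alpha> ?t (tensor_act g f) = 0" for f
    proof -
      obtain x where x: "x \<in> supp_on ?W" "f = lin ?W S.SQ x" using f unfolding range[symmetric] by blast
      show ?thesis unfolding x(2)
        by (rule S.separated_by_coefficients[OF rep el c(3) c(4) c(5) c(7) x(1)]) (use z x(2) in auto)
    qed
    show "cnt ?d x i = (if i < 3 then part \<pi> i else part (compl \<pi>) (i - 3))" if "p ?t x \<noteq> 0" "i < 3 + n" for x i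
      using c(10)[OF t that(1), of i] that(2) S.cnt_stop(1)[of i] S.cnt_stop(2)[of "i - 3"] K3
      by (cases "i < 3") simp_all
    show "ip (words ?d (3 + n)) (p ?t) (q ?t) = 1" using c(6)[OF t] K3 by simp
    show "\<alpha> ?t (tensor_act g (S.SQ ?t)) = ip (words ?d (3 + n)) (act ?d (3 + n) (gmat g) (p ?t)) (q ?t)" if "g \<in> carrier GG" for g
      using S.SQ_act[OF that, of "p ?t"] c(2)[OF t] \<alpha>[OF act_supp] K3 by simp
  qed (use c(8,9)[OF t] K3 in auto)
  then show "\<exists>\<alpha> w p q d. schur_data \<pi> \<alpha> w p q d" by blast
qed

text \<open>The tops of both sides are indexed by \<open>good\<close>. Between different indices the
  matrix coefficients vanish, for the Pfaffians by their weights and for the direct sum by its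
  components. For equal indices they agree, because the factor \<open>det3 g ^ m\<close> cancels
  against the one in \<open>poly_act_lin\<close>.\<close>

lemma RP_isomorphic:
  assumes "m > 0"
  shows "isomorphic_reps GG poly_act RP (direct_sum_act tensor_act) (direct_sum {\<pi>. is_partition m \<pi>} Sm)"
proof -
  let ?I = "{\<pi>. is_partition m \<pi>}"
  obtain \<alpha> w p q d where "\<And>\<pi>. \<pi> \<in> good \<Longrightarrow> schur_data \<pi> (\<alpha> \<pi>) (w \<pi>) (p \<pi>) (q \<pi>) (d \<pi>)"
    using schur_side(2) by metis
  then have s: "w \<pi> \<in> Sm \<pi>" "Sm \<pi> \<subseteq> fun_space.span {tensor_act g (w \<pi>) | g. g \<in> carrier GG}"
    "f \<in> Sm \<pi> \<Longrightarrow> h \<in> Sm \<pi> \<Longrightarrow> \<alpha> \<pi> (f + h) = \<alpha> \<pi> f + \<alpha> \<pi> h" "f \<in> Sm \<pi> \<Longrightarrow> \<alpha> \<pi> (cscale c f) = c * \<alpha> \<pi> f"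
    "f \<in> Sm \<pi> \<Longrightarrow> (\<And>g. g \<in> carrier GG \<Longrightarrow> \<alpha> \<pi> (tensor_act g f) = 0) \<Longrightarrow> f = 0"
    "i < j \<Longrightarrow> j < 3 + n \<Longrightarrow> blk 3 i j \<Longrightarrow> act (d \<pi>) (3 + n) (el z i j) (p \<pi>) = p \<pi>"
    "i < j \<Longrightarrow> j < 3 + n \<Longrightarrow> blk 3 i j \<Longrightarrow> act (d \<pi>) (3 + n) (el z i j) (q \<pi>) = q \<pi>"
    "p \<pi> x \<noteq> 0 \<Longrightarrow> i < 3 + n \<Longrightarrow> cnt (d \<pi>) x i = (if i < 3 then part \<pi> i else part (compl \<pi>) (i - 3))"
    "ip (words (d \<pi>) (3 + n)) (p \<pi>) (q \<pi>) = 1"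
    "g \<in> carrier GG \<Longrightarrow> \<alpha> \<pi> (tensor_act g (w \<pi>)) = ip (words (d \<pi>) (3 + n)) (act (d \<pi>) (3 + n) (gmat g) (p \<pi>)) (q \<pi>)"
    if "\<pi> \<in> good" for \<pi> f h c i j z x g
    using that unfolding schur_data_def by blast+
  obtain \<beta> P Q \<kappa> where c:
    "\<And>t. t \<in> ptop ` TL \<Longrightarrow> P t \<in> supp_on Wd" "\<And>t. t \<in> ptop ` TL \<Longrightarrow> lin Wd PQ (P t) = PQ t"
    "\<And>t. t \<in> ptop ` TL \<Longrightarrow> Q t \<in> orthc Wd (ker Wd PQ)" "\<And>t. t \<in> ptop ` TL \<Longrightarrow> lin Wd PQ (Q t) = cscale (\<kappa> t) (PQ t)"
    "\<And>t. t \<in> ptop ` TL \<Longrightarrow> \<kappa> t \<noteq> 0" "\<And>t. t \<in> ptop ` TL \<Longrightarrow> ip Wd (P t) (Q t) = 1"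
    "\<And>t x. t \<in> ptop ` TL \<Longrightarrow> x \<in> supp_on Wd \<Longrightarrow> \<beta> t (lin Wd PQ x) = ip Wd x (Q t)"
    "\<And>t i j z. t \<in> ptop ` TL \<Longrightarrow> i < j \<Longrightarrow> j < 3 + n \<Longrightarrow> blk 3 i j \<Longrightarrow> act (4 * m) (3 + n) (el z i j) (P t) = P t"
    "\<And>t i j z. t \<in> ptop ` TL \<Longrightarrow> i < j \<Longrightarrow> j < 3 + n \<Longrightarrow> blk 3 i j \<Longrightarrow> act (4 * m) (3 + n) (el z i j) (Q t) = Q t"
    "\<And>t w i. t \<in> ptop ` TL \<Longrightarrow> P t w \<noteq> 0 \<Longrightarrow> i < 3 + n \<Longrightarrow> cnt (4 * m) w i = cnt (4 * m) t i"
    "\<And>t w i. t \<in> ptop ` TL \<Longrightarrow> Q t w \<noteq> 0 \<Longrightarrow> i < 3 + n \<Longrightarrow> cnt (4 * m) w i = cnt (4 * m) t i"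
    by (rule pf.coefficient_data) blast
  define t where "t = (\<lambda>\<pi>. ptop (Lof \<pi>))"
  have tT: "t \<pi> \<in> ptop ` TL" if "\<pi> \<in> good" for \<pi> unfolding t_def using Lof_TL[OF that] by blast
  have Tt: "\<exists>\<pi>\<in>good. t \<pi> = u" if "u \<in> ptop ` TL" for u using that Lof_surj[OF assms] unfolding t_def by blast
  have tcnt: "cnt (4 * m) (t \<pi>) k = m - part \<pi> (2 - k)" if "\<pi> \<in> good" "k < 3" for \<pi> k
    using ptop_cnt(1)[OF Lof_TL[OF that(1)] that(2)] Lof_nth[OF that(2)] by (simp add: t_def)
  have tcnt': "cnt (4 * m) (t \<pi>) (3 + k) = part (compl \<pi>) k" if "\<pi> \<in> good" for \<pi> k
  proof -
    have "sum_list (Lof \<pi>) = 2 * m" "length (Lof \<pi>) = 3" using Lof_TL[OF that] by (auto simp: TL_def)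
    then have "cnt (2 * m) (bcol (Lof \<pi>)) k = card {i. i < 3 \<and> k < Lof \<pi> ! i}" using cnt_bcol[of "Lof \<pi>" k] by simp
    then show ?thesis using ptop_cnt(2)[OF Lof_TL[OF that], of k] part_compl_Lof[OF that] by (simp add: t_def)
  qed
  \<comment> \<open>\<open>coefficients_agree\<close> reduces this to diagonal \<open>g\<close>,
    where both sides are the same character for \<open>i = j\<close>, and both are 0 for
    \<open>i \<noteq> j\<close> since the block weights differ.\<close>
  have coeff: "ip Wd (act (4 * m) (3 + n) (thm3 g) (P (t j))) (Q (t i)) =
      of_bool (i = j) * det3 g ^ m * ip (words (d i) (3 + n)) (act (d i) (3 + n) g (p i)) (q i)"
    if i: "i \<in> good" and j: "j \<in> good" and g: "block_matrix (3 + n) 3 g" for i j g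
  proof (rule coefficients_agree[OF _ _ _ _ _ g])
    fix g :: "nat \<Rightarrow> nat \<Rightarrow> complex"
    assume g: "\<And>i j. i < 3 + n \<Longrightarrow> j < 3 + n \<Longrightarrow> i \<noteq> j \<Longrightarrow> g i j = 0"
    have L: "ip Wd (act (4 * m) (3 + n) (thm3 g) (P (t j))) (Q (t i)) =
        (\<Prod>k<3 + n. thm3 g k k ^ cnt (4 * m) (t j) k) * ip Wd (P (t j)) (Q (t i))"
      by (rule ip_act_diagonal[OF thm3_diagonal[of n g, OF g] c(10)[OF tT[OF j]]])
    show "ip Wd (act (4 * m) (3 + n) (thm3 g) (P (t j))) (Q (t i)) =
      of_bool (i = j) * det3 g ^ m * ip (words (d i) (3 + n)) (act (d i) (3 + n) g (p i)) (q i)"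
    proof (cases "i = j")
      case True
      let ?c = "\<lambda>k. if k < 3 then part i k else part (compl i) (k - 3)"
      have R: "ip (words (d i) (3 + n)) (act (d i) (3 + n) g (p i)) (q i) = (\<Prod>k<3 + n. g k k ^ ?c k) * 1"
        unfolding s(9)[OF i, symmetric] by (rule ip_act_diagonal[OF g s(8)[OF i]])
      note gp = good_parts[OF i]
      have "(\<Prod>k<3 + n. thm3 g k k ^ cnt (4 * m) (t i) k) = det3 g ^ m * (\<Prod>k<3 + n. g k k ^ ?c k)"
      proof (rule torus_characters[OF g])
        show "cnt (4 * m) (t i) (2 - k) + ?c k = m" if "k < 3" for k
        proof -
          have "part i k \<le> m" using that gp(1) unfolding less3 by auto
          moreover have "2 - (2 - k) = k" using that by simp
          ultimately show ?thesis using tcnt[OF i, of "2 - k"] that by simp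
        qed
        show "cnt (4 * m) (t i) 0 + cnt (4 * m) (t i) 1 + cnt (4 * m) (t i) 2 = 2 * m"
          using tcnt[OF i, of 0] tcnt[OF i, of 1] tcnt[OF i, of 2] gp(1-3) by simp
        show "cnt (4 * m) (t i) (3 + k) = ?c (3 + k)" for k using tcnt'[OF i, of k] by simp
      qed
      then show ?thesis unfolding L R using True c(6)[OF tT[OF i]] by simp
    next
      case False
      have "length (Lof \<pi>) = 3" for \<pi> by (simp add: Lof_def)
      then obtain k where k: "k < 3" "Lof j ! k \<noteq> Lof i ! k"
        using Lof_inj[OF i j] nth_equalityI[of "Lof i" "Lof j"] False by metis
      then have ne: "cnt (4 * m) (t j) k \<noteq> cnt (4 * m) (t i) k" using tcnt[OF i k(1)] tcnt[OF j k(1)] by (simp add: Lof_nth)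
      have "ip Wd (P (t j)) (Q (t i)) = 0"
        by (rule ip_different_weights[OF c(10)[OF tT[OF j]] c(11)[OF tT[OF i]] ne]) (use k in simp_all)
      then show ?thesis unfolding L using False by simp
    qed
  qed (use c(8)[OF tT[OF j]] c(9)[OF tT[OF i]] s(6,7)[OF i] in auto)
  have RS: "representation GG (direct_sum_act tensor_act) (direct_sum ?I Sm)"
  proof (rule representation_direct_sum[OF group_GG])
    show "\<And>g. g \<in> carrier GG \<Longrightarrow> tensor_act g 0 = 0" by (rule tensor_act_zero)
    fix \<pi> assume "\<pi> \<in> ?I"
    then show "representation GG tensor_act (Sm \<pi>)"
    proof (cases "\<pi> \<in> good")
      case True
      then show ?thesis using schur_side(1) unfolding irreducible_rep_def by blast
    next
      case False
      then have "Sm \<pi> = {0}" using Sm_zero \<open>\<pi> \<in> ?I\<close> by blast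
      moreover have "representation GG tensor_act {0}"
        by (rule representation_tensor_act[OF fun_space.subspace_single_0]) (simp add: tensor_act_zero)
      ultimately show ?thesis by simp
    qed
  qed
  have slice: "(\<lambda>x. F (\<pi>, x)) \<in> Sm \<pi>" if "F \<in> direct_sum ?I Sm" "\<pi> \<in> good" for F \<pi>
    using that by (auto simp: direct_sum_def good_def)
  have act_slice: "(\<lambda>x. direct_sum_act tensor_act g F (\<pi>, x)) = tensor_act g (\<lambda>x. F (\<pi>, x))" for g F \<pi>
    by (simp add: direct_sum_act_def)
  show ?thesis
  proof (rule isomorphic_if_coefficients_agree[where I = good and v = "\<lambda>\<pi>. PQ (t \<pi>)" and v' = "\<lambda>\<pi>. single \<pi> (w \<pi>)"
        and \<alpha> = "\<lambda>\<pi>. \<beta> (t \<pi>)" and \<beta> = "\<lambda>\<pi> F. \<alpha> \<pi> (\<lambda>x. F (\<pi>, x))", OF representation_RP RS])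
    show "PQ (t \<pi>) \<in> RP" if "\<pi> \<in> good" for \<pi>
      unfolding c(2)[OF tT[OF that], symmetric] using c(1)[OF tT[OF that]] by (rule imageI)
    show "single \<pi> (w \<pi>) \<in> direct_sum ?I Sm" if "\<pi> \<in> good" for \<pi>
    proof -
      have "0 \<in> Sm \<rho>" for \<rho> unfolding tensor_prod_def by (rule fun_space.span_zero)
      then have "(if \<rho> = \<pi> then w \<pi> else 0) \<in> Sm \<rho>" for \<rho> using s(1)[OF that] by auto
      then have "(\<lambda>x. single \<pi> (w \<pi>) (\<rho>, x)) \<in> Sm \<rho>" for \<rho> unfolding single_apply .
      moreover have "single \<pi> (w \<pi>) (\<rho>, x) = 0" if "\<rho> \<notin> ?I" for \<rho> x
        using that \<open>\<pi> \<in> good\<close> by (auto simp: single_def good_def)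
      ultimately show ?thesis unfolding direct_sum_def by blast
    qed
    show "RP \<subseteq> fun_space.span {poly_act g (PQ (t i)) | g i. g \<in> carrier GG \<and> i \<in> good}"
    proof -
      have "{poly_act g (PQ u) | g u. g \<in> carrier GG \<and> u \<in> ptop ` TL} \<subseteq> {poly_act g (PQ (t i)) | g i. g \<in> carrier GG \<and> i \<in> good}"
      proof
        fix f assume "f \<in> {poly_act g (PQ u) | g u. g \<in> carrier GG \<and> u \<in> ptop ` TL}"
        then obtain g u where f: "f = poly_act g (PQ u)" "g \<in> carrier GG" "u \<in> ptop ` TL" by blast
        obtain i where "i \<in> good" "t i = u" using Tt[OF f(3)] by blast
        then show "f \<in> {poly_act g (PQ (t i)) | g i. g \<in> carrier GG \<and> i \<in> good}"
          using f(1,2) by blast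
      qed
      then have "fun_space.span {poly_act g (PQ u) | g u. g \<in> carrier GG \<and> u \<in> ptop ` TL} \<subseteq>
          fun_space.span {poly_act g (PQ (t i)) | g i. g \<in> carrier GG \<and> i \<in> good}" by (rule fun_space.span_mono)
      with pf.spanned_by_orbits[OF representation_RP el_poly_act] show ?thesis by (rule order_trans)
    qed
    show "direct_sum ?I Sm \<subseteq> fun_space.span {direct_sum_act tensor_act g (single i (w i)) | g i. g \<in> carrier GG \<and> i \<in> good}"
      by (rule direct_sum_spanned[OF finite_good]) (use Sm_zero s(2) tensor_act_zero in \<open>auto simp: good_def\<close>)
    show "\<beta> (t i) (f + h) = \<beta> (t i) f + \<beta> (t i) h" if "i \<in> good" "f \<in> RP" "h \<in> RP" for i f h
      by (rule pf.functional_linear(1)[OF c(7)[OF tT[OF that(1)]] that(2,3)])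
    show "\<beta> (t i) (cscale k f) = k * \<beta> (t i) f" if "i \<in> good" "f \<in> RP" for i f k
      by (rule pf.functional_linear(2)[OF c(7)[OF tT[OF that(1)]] that(2)])
    show "\<alpha> i (\<lambda>x. (F + H) (i, x)) = \<alpha> i (\<lambda>x. F (i, x)) + \<alpha> i (\<lambda>x. H (i, x))"
      if "i \<in> good" "F \<in> direct_sum ?I Sm" "H \<in> direct_sum ?I Sm" for i F H
      using s(3)[OF that(1) slice[OF that(2,1)] slice[OF that(3,1)]] by (simp add: plus_fun_def)
    show "\<alpha> i (\<lambda>x. cscale k F (i, x)) = k * \<alpha> i (\<lambda>x. F (i, x))" if "i \<in> good" "F \<in> direct_sum ?I Sm" for i F k
      using s(4)[OF that(1) slice[OF that(2,1)], of k] by (simp add: cscale_def)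
    show "f = 0" if f: "f \<in> RP" and z: "\<And>g i. g \<in> carrier GG \<Longrightarrow> i \<in> good \<Longrightarrow> \<beta> (t i) (poly_act g f) = 0" for f
    proof -
      obtain x where x: "x \<in> supp_on Wd" "f = lin Wd PQ x" using f by blast
      have "\<beta> u (poly_act g (lin Wd PQ x)) = 0" if "g \<in> carrier GG" "u \<in> ptop ` TL" for g u
        using Tt[OF that(2)] z[OF that(1)] x(2) by auto
      then show ?thesis unfolding x(2)
        by (intro pf.separated_by_coefficients[OF representation_RP el_poly_act c(3) c(4) c(5) c(7) x(1)])
    qed
    show "F = 0" if F: "F \<in> direct_sum ?I Sm"
      and z: "\<And>g i. g \<in> carrier GG \<Longrightarrow> i \<in> good \<Longrightarrow> \<alpha> i (\<lambda>x. direct_sum_act tensor_act g F (i, x)) = 0" for F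
    proof -
      have "(\<lambda>x. F (\<pi>, x)) = 0" for \<pi>
      proof (cases "\<pi> \<in> good")
        case True
        show ?thesis by (rule s(5)[OF True slice[OF F True]]) (use z[OF _ True] in \<open>simp add: act_slice\<close>)
      next
        case False
        then show ?thesis using F Sm_zero[OF _ False] by (cases "\<pi> \<in> ?I") (auto simp: direct_sum_def fun_eq_iff)
      qed
      then show ?thesis by (auto simp: fun_eq_iff)
    qed
    show "\<beta> (t i) (poly_act g (PQ (t j))) = \<alpha> i (\<lambda>x. direct_sum_act tensor_act g (single j (w j)) (i, x))"
      if g: "g \<in> carrier GG" and i: "i \<in> good" and j: "j \<in> good" for g i j
    proof -
      let ?D = "det3 (gmat g) ^ m" and ?ip = "ip (words (d i) (3 + n)) (act (d i) (3 + n) (gmat g) (p i)) (q i)"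
      note D = det3_gmat(1)[OF g]
      have b: "block_matrix (3 + n) 3 (gmat g)" using gmat_block[of "3 + n" g] K3 by simp
      have "\<beta> (t i) (poly_act g (PQ (t j))) = ip Wd (cscale (1 / ?D) (act (4 * m) (3 + n) (thm3 (gmat g)) (P (t j)))) (Q (t i))"
        unfolding c(2)[OF tT[OF j], symmetric] poly_act_lin[OF g]
        by (rule c(7)[OF tT[OF i] fun_space.subspace_scale[OF subspace_supp_on act_supp]])
      also have "\<dots> = of_bool (i = j) * ?ip" unfolding ip_scale_left coeff[OF i j b] using D by simp
      also have "\<dots> = \<alpha> i (\<lambda>x. direct_sum_act tensor_act g (single j (w j)) (i, x))"
      proof (cases "i = j")
        case True
        then show ?thesis using s(10)[OF i g] by (simp add: act_slice single_apply)
      next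
        case False
        have "\<alpha> i 0 = 0" using s(4)[OF i s(1)[OF i], of 0] by simp
        then show ?thesis using False by (simp add: act_slice single_apply tensor_act_zero)
      qed
      finally show ?thesis .
    qed
  qed
qed

end

theorem proposition3p8:
  fixes sU :: "complex \<Rightarrow> 'u::ab_group_add \<Rightarrow> 'u"
    and sV :: "complex \<Rightarrow> 'v::ab_group_add \<Rightarrow> 'v"
    and us :: "'u list" and vs :: "'v list"
    and n r :: nat
  assumes "vector_space sU" and "vector_space sV"
    and "is_basis sU us" and "length us = 3"
    and "is_basis sV vs" and "length vs = n"
    and "r \<ge> 1"
  shows "isomorphic_reps (GL sU \<times>\<times> GL sV)
           poly_act (kappa_ideal sU sV us vs r \<inter> poly_part sU sV (r + 1))
           (direct_sum_act tensor_act)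
           (direct_sum {\<pi>. is_partition (r + 1) \<pi>} (summand sU sV r))
       \<and> (\<forall>\<pi>. is_partition (r + 1) \<pi> \<longrightarrow> summand sU sV r \<pi> \<noteq> {0} \<longrightarrow>
            irreducible_rep (GL sU \<times>\<times> GL sV) tensor_act (summand sU sV r \<pi>))
       \<and> (\<forall>\<pi>. is_partition (r + 1) \<pi> \<longrightarrow> summand sU sV r \<pi> \<noteq> {0} \<longrightarrow>
            length \<pi> \<le> 3 \<and> part \<pi> 2 \<ge> r + 1 - n)"
proof -
  interpret P: pf_space sU us sV vs "r + 1"
    by (intro pf_space.intro two_spaces.intro based_space.intro based_space_axioms.intro pf_space_axioms.intro assms)
  have eq: "summand sU sV r = P.Sm" by (simp add: summand_def fun_eq_iff)
  have "kappa_ideal sU sV us vs r \<inter> poly_part sU sV (r + 1) = P.RP"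
    using P.kappa_ideal_degree_part[of r] P.span_psi_pfaffians by simp
  moreover have good: "\<pi> \<in> P.good" if "is_partition (r + 1) \<pi>" "P.Sm \<pi> \<noteq> {0}" for \<pi>
    using P.Sm_zero that by blast
  moreover have "length \<pi> \<le> 3 \<and> r + 1 - n \<le> part \<pi> 2" if "\<pi> \<in> P.good" for \<pi>
    using that assms(6) unfolding P.good_def by blast
  ultimately show ?thesis unfolding eq using P.RP_isomorphic P.schur_side(1) by auto
qed

end
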